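(* Let $Q$ be a commutative local ring, let $\bm{f}=f_1,\ldots,f_n$ and $\bm{f}'=f_1',\ldots,f_n'$ be Koszul-regular sequences in $Q$ of the same length $n$, let $I$ be an ideal of $Q$ containing all $f_i$ and all $f_i'$, and set $R=Q/I$. Let $M$ be an $R$-module such that $f_i-f_i'\in I\,\mathrm{ann}_Q(M)$ for each $1\le i\le n$. Then for each complex of $R$-modules $N$ the following hold: \begin{enumerate} \item $\mathsf{I}_{Q/(\bm{f})}^{M,N}(t)=\mathsf{I}_{Q/(\bm{f}')}^{M,N}(t)$, \item $\mathsf{P}^{Q/(\bm{f})}_{M,N}(t)=\mathsf{P}^{Q/(\bm{f}')}_{M,N}(t)$. \end{enumerate}
   Context: A sequence $\bm{f}=f_1,\ldots,f_n$ in $Q$ is Koszul-regular if the Koszul complex $E$ on $\bm{f}$ over $Q$ satisfies $H_0(E)=Q/(\bm{f})$ and $H_i(E)=0$ for $i\neq0$. For a local ring $S$, an $S$-module $M$ and a complex of $S$-modules $N$, let $\nu(-)$ denote the minimal number of generators of a module. The Bass series of $M$ and $N$ is $\mathsf{I}_S^{M,N}(t)=\sum_{i=0}^\infty\nu(\mathrm{Ext}_S^i(M,N))t^i$, and the Poincar\'e series of $M$ and $N$ is $\mathsf{P}^S_{M,N}(t)=\sum_{i=0}^\infty\nu(\mathrm{Tor}^S_i(M,N))t^i$. *)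

theory Defs
  imports
    "HOL-Library.Extended_Nat"
    "HOL-Library.FSet"
    "HOL-Computational_Algebra.Formal_Power_Series"
    "HOL-Algebra.QuotRing"
    "HOL-Algebra.Ideal_Product"
    "HOL-Algebra.Module"
begin

hide_const (open) Modules.module Multiset.mult

section \<open>Local rings and modules\<close>

definition local_ring :: "('q, 'z) ring_scheme \<Rightarrow> bool" where
  "local_ring Q \<longleftrightarrow> cring Q \<and> (\<exists>!P. maximalideal P Q)"

definition mod_hom ::
  "('s, 'z) ring_scheme \<Rightarrow> ('s, 'a) module \<Rightarrow> ('s, 'b) module \<Rightarrow> ('a \<Rightarrow> 'b) set" where
  "mod_hom S A B = {h \<in> carrier A \<rightarrow> carrier B.
     (\<forall>x\<in>carrier A. \<forall>y\<in>carrier A. h (x \<oplus>\<^bsub>A\<^esub> y) = h x \<oplus>\<^bsub>B\<^esub> h y) \<and>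
     (\<forall>s\<in>carrier S. \<forall>x\<in>carrier A. h (s \<odot>\<^bsub>A\<^esub> x) = s \<odot>\<^bsub>B\<^esub> h x)}"

definition mod_iso ::
  "('s, 'z) ring_scheme \<Rightarrow> ('s, 'a) module \<Rightarrow> ('s, 'b) module \<Rightarrow> bool" where
  "mod_iso S A B \<longleftrightarrow> (\<exists>h\<in>mod_hom S A B. bij_betw h (carrier A) (carrier B))"

text \<open>The type of modules extends that of rings; the ring multiplication and unit that come with
  it play no role for modules.\<close>

definition regular_module :: "('s, 'z) ring_scheme \<Rightarrow> ('s, 's) module" where
  "regular_module S = \<lparr>carrier = carrier S, mult = undefined, one = undefined,
     zero = \<zero>\<^bsub>S\<^esub>, add = (\<oplus>\<^bsub>S\<^esub>), smult = (\<otimes>\<^bsub>S\<^esub>)\<rparr>"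

definition restrict_scalars :: "('s \<Rightarrow> 't) \<Rightarrow> ('t, 'm) module \<Rightarrow> ('s, 'm) module" where
  "restrict_scalars h M = \<lparr>carrier = carrier M, mult = undefined, one = undefined,
     zero = \<zero>\<^bsub>M\<^esub>, add = (\<oplus>\<^bsub>M\<^esub>), smult = (\<lambda>s x. h s \<odot>\<^bsub>M\<^esub> x)\<rparr>"

definition quot_module :: "('s, 'm) module \<Rightarrow> 'm set \<Rightarrow> ('s, 'm set) module" where
  "quot_module M K = \<lparr>carrier = a_rcosets\<^bsub>M\<^esub> K, mult = undefined, one = undefined,
     zero = K, add = (<+>\<^bsub>M\<^esub>), smult = (\<lambda>s C. \<Union>c\<in>C. K +>\<^bsub>M\<^esub> (s \<odot>\<^bsub>M\<^esub> c))\<rparr>"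

definition mod_span :: "('s, 'z) ring_scheme \<Rightarrow> ('s, 'm) module \<Rightarrow> 'm set \<Rightarrow> 'm set" where
  "mod_span S M X = \<Inter>{H. submodule H S M \<and> X \<subseteq> H}"

text \<open>The minimal number of generators; the infimum over the empty set is \<open>\<infinity>\<close>, so this is
  \<open>\<infinity>\<close> for modules that are not finitely generated.\<close>

definition min_gens :: "('s, 'z) ring_scheme \<Rightarrow> ('s, 'm) module \<Rightarrow> enat" where
  "min_gens S M =
     Inf {enat (card X) | X. finite X \<and> X \<subseteq> carrier M \<and> mod_span S M X = carrier M}"

definition annihilator :: "('s, 'z) ring_scheme \<Rightarrow> ('s, 'm) module \<Rightarrow> 's set" where
  "annihilator S M = {s \<in> carrier S. \<forall>x\<in>carrier M. s \<odot>\<^bsub>M\<^esub> x = \<zero>\<^bsub>M\<^esub>}"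

text \<open>The free module on \<open>X\<close> consists of the finitely supported functions on \<open>X\<close>, extended by
  zero to the whole type.\<close>

definition free_module :: "('s, 'z) ring_scheme \<Rightarrow> 'x set \<Rightarrow> ('s, 'x \<Rightarrow> 's) module" where
  "free_module S X = \<lparr>
     carrier = {u. (\<forall>x\<in>X. u x \<in> carrier S) \<and> (\<forall>x. x \<notin> X \<longrightarrow> u x = \<zero>\<^bsub>S\<^esub>) \<and>
                   finite {x. u x \<noteq> \<zero>\<^bsub>S\<^esub>}},
     mult = undefined, one = undefined,
     zero = (\<lambda>_. \<zero>\<^bsub>S\<^esub>), add = (\<lambda>u v x. u x \<oplus>\<^bsub>S\<^esub> v x), smult = (\<lambda>s u x. s \<otimes>\<^bsub>S\<^esub> u x)\<rparr>"

definition basis_elt :: "('s, 'z) ring_scheme \<Rightarrow> 'x \<Rightarrow> 'x \<Rightarrow> 's" where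
  "basis_elt S a = (\<lambda>x. if x = a then \<one>\<^bsub>S\<^esub> else \<zero>\<^bsub>S\<^esub>)"

text \<open>The linear map from a free module to \<open>A\<close> that sends the basis element at \<open>x\<close> to \<open>g x\<close>.\<close>

definition lin_ext ::
  "('s, 'z) ring_scheme \<Rightarrow> ('s, 'a) module \<Rightarrow> ('x \<Rightarrow> 'a) \<Rightarrow> ('x \<Rightarrow> 's) \<Rightarrow> 'a" where
  "lin_ext S A g u = (\<Oplus>\<^bsub>A\<^esub> x\<in>{x. u x \<noteq> \<zero>\<^bsub>S\<^esub>}. u x \<odot>\<^bsub>A\<^esub> g x)"

definition direct_sum :: "('i \<Rightarrow> ('s, 'm) module) \<Rightarrow> ('s, 'i \<Rightarrow> 'm) module" where
  "direct_sum A = \<lparr>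
     carrier = {x. (\<forall>i. x i \<in> carrier (A i)) \<and> finite {i. x i \<noteq> \<zero>\<^bsub>A i\<^esub>}},
     mult = undefined, one = undefined,
     zero = (\<lambda>i. \<zero>\<^bsub>A i\<^esub>), add = (\<lambda>x y i. x i \<oplus>\<^bsub>A i\<^esub> y i),
     smult = (\<lambda>s x i. s \<odot>\<^bsub>A i\<^esub> x i)\<rparr>"

definition direct_prod :: "('i \<Rightarrow> ('s, 'm) module) \<Rightarrow> ('s, 'i \<Rightarrow> 'm) module" where
  "direct_prod A = \<lparr>
     carrier = {x. \<forall>i. x i \<in> carrier (A i)},
     mult = undefined, one = undefined,
     zero = (\<lambda>i. \<zero>\<^bsub>A i\<^esub>), add = (\<lambda>x y i. x i \<oplus>\<^bsub>A i\<^esub> y i),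
     smult = (\<lambda>s x i. s \<odot>\<^bsub>A i\<^esub> x i)\<rparr>"

text \<open>Linear maps are made extensional, so that equality in the Hom module is equality of maps on
  the carrier.\<close>

definition hom_module ::
  "('s, 'z) ring_scheme \<Rightarrow> ('s, 'a) module \<Rightarrow> ('s, 'b) module \<Rightarrow> ('s, 'a \<Rightarrow> 'b) module" where
  "hom_module S A B = \<lparr>
     carrier = mod_hom S A B \<inter> extensional (carrier A),
     mult = undefined, one = undefined,
     zero = (\<lambda>x\<in>carrier A. \<zero>\<^bsub>B\<^esub>), add = (\<lambda>g h. \<lambda>x\<in>carrier A. g x \<oplus>\<^bsub>B\<^esub> h x),
     smult = (\<lambda>s g. \<lambda>x\<in>carrier A. s \<odot>\<^bsub>B\<^esub> g x)\<rparr>"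

subsection \<open>Tensor products\<close>

definition bilinear_rels ::
  "('s, 'z) ring_scheme \<Rightarrow> ('s, 'a) module \<Rightarrow> ('s, 'b) module \<Rightarrow> ('a \<times> 'b \<Rightarrow> 's) set" where
  "bilinear_rels S A B =
    (let F = free_module S (carrier A \<times> carrier B); e = basis_elt S in
      {e (a \<oplus>\<^bsub>A\<^esub> a', b) \<ominus>\<^bsub>F\<^esub> (e (a, b) \<oplus>\<^bsub>F\<^esub> e (a', b)) | a a' b.
         a \<in> carrier A \<and> a' \<in> carrier A \<and> b \<in> carrier B} \<union>
      {e (a, b \<oplus>\<^bsub>B\<^esub> b') \<ominus>\<^bsub>F\<^esub> (e (a, b) \<oplus>\<^bsub>F\<^esub> e (a, b')) | a b b'.
         a \<in> carrier A \<and> b \<in> carrier B \<and> b' \<in> carrier B} \<union>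
      {e (s \<odot>\<^bsub>A\<^esub> a, b) \<ominus>\<^bsub>F\<^esub> s \<odot>\<^bsub>F\<^esub> e (a, b) | s a b.
         s \<in> carrier S \<and> a \<in> carrier A \<and> b \<in> carrier B} \<union>
      {e (a, s \<odot>\<^bsub>B\<^esub> b) \<ominus>\<^bsub>F\<^esub> s \<odot>\<^bsub>F\<^esub> e (a, b) | s a b.
         s \<in> carrier S \<and> a \<in> carrier A \<and> b \<in> carrier B})"

definition tensor_ker ::
  "('s, 'z) ring_scheme \<Rightarrow> ('s, 'a) module \<Rightarrow> ('s, 'b) module \<Rightarrow> ('a \<times> 'b \<Rightarrow> 's) set" where
  "tensor_ker S A B =
     mod_span S (free_module S (carrier A \<times> carrier B)) (bilinear_rels S A B)"

definition tensor_module ::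
  "('s, 'z) ring_scheme \<Rightarrow> ('s, 'a) module \<Rightarrow> ('s, 'b) module \<Rightarrow>
     ('s, ('a \<times> 'b \<Rightarrow> 's) set) module" where
  "tensor_module S A B =
     quot_module (free_module S (carrier A \<times> carrier B)) (tensor_ker S A B)"

definition pure_tensor ::
  "('s, 'z) ring_scheme \<Rightarrow> ('s, 'a) module \<Rightarrow> ('s, 'b) module \<Rightarrow> 'a \<Rightarrow> 'b \<Rightarrow>
     ('a \<times> 'b \<Rightarrow> 's) set" where
  "pure_tensor S A B a b =
     tensor_ker S A B +>\<^bsub>free_module S (carrier A \<times> carrier B)\<^esub> basis_elt S (a, b)"

text \<open>The map induced by \<open>g\<close> and \<open>h\<close> into the tensor product of \<open>A'\<close> and \<open>B'\<close>. All
  representatives \<open>u\<close> of a tensor \<open>t\<close> have the same image, and \<open>the_elem\<close> picks it.\<close>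

definition tensor_map ::
  "('s, 'z) ring_scheme \<Rightarrow> ('s, 'c) module \<Rightarrow> ('s, 'd) module \<Rightarrow> ('a \<Rightarrow> 'c) \<Rightarrow> ('b \<Rightarrow> 'd) \<Rightarrow>
     ('a \<times> 'b \<Rightarrow> 's) set \<Rightarrow> ('c \<times> 'd \<Rightarrow> 's) set" where
  "tensor_map S A' B' g h t = the_elem
     (lin_ext S (tensor_module S A' B') (\<lambda>(a, b). pure_tensor S A' B' (g a) (h b)) ` t)"

section \<open>Complexes\<close>

text \<open>Complexes are indexed by all integers, and the differentials \<open>cdiff C i\<close> lower the degree:
  they go from degree \<open>i\<close> to degree \<open>i - 1\<close>.\<close>

record ('s, 'm) cplx =
  cmod :: "int \<Rightarrow> ('s, 'm) module"
  cdiff :: "int \<Rightarrow> 'm \<Rightarrow> 'm"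

definition chain_complex :: "('s, 'z) ring_scheme \<Rightarrow> ('s, 'm) cplx \<Rightarrow> bool" where
  "chain_complex S C \<longleftrightarrow>
     (\<forall>i. module S (cmod C i)) \<and>
     (\<forall>i. cdiff C i \<in> mod_hom S (cmod C i) (cmod C (i - 1))) \<and>
     (\<forall>i. \<forall>x\<in>carrier (cmod C i). cdiff C (i - 1) (cdiff C i x) = \<zero>\<^bsub>cmod C (i - 2)\<^esub>)"

definition cycles :: "('s, 'm) cplx \<Rightarrow> int \<Rightarrow> 'm set" where
  "cycles C i = a_kernel (cmod C i) (cmod C (i - 1)) (cdiff C i)"

definition boundaries :: "('s, 'm) cplx \<Rightarrow> int \<Rightarrow> 'm set" where
  "boundaries C i = cdiff C (i + 1) ` carrier (cmod C (i + 1))"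

definition homology :: "('s, 'm) cplx \<Rightarrow> int \<Rightarrow> ('s, 'm set) module" where
  "homology C i = quot_module (cmod C i\<lparr>carrier := cycles C i\<rparr>) (boundaries C i)"

definition restrict_scalars_cplx :: "('s \<Rightarrow> 't) \<Rightarrow> ('t, 'm) cplx \<Rightarrow> ('s, 'm) cplx" where
  "restrict_scalars_cplx h C =
     \<lparr>cmod = (\<lambda>i. restrict_scalars h (cmod C i)), cdiff = cdiff C\<rparr>"

definition signed :: "('a, 'z) ring_scheme \<Rightarrow> int \<Rightarrow> 'a \<Rightarrow> 'a" where
  "signed A k x = (if even k then x else \<ominus>\<^bsub>A\<^esub> x)"

text \<open>An element of degree \<open>k\<close> of the Hom complex is a family of maps \<open>g p\<close> from degree \<open>p\<close>
  to degree \<open>p + k\<close>, and its differential is \<open>d g - (-1)\<^sup>k g d\<close>.\<close>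

definition hom_complex ::
  "('s, 'z) ring_scheme \<Rightarrow> ('s, 'a) cplx \<Rightarrow> ('s, 'b) cplx \<Rightarrow> ('s, int \<Rightarrow> 'a \<Rightarrow> 'b) cplx" where
  "hom_complex S A B = \<lparr>
     cmod = (\<lambda>k. direct_prod (\<lambda>p. hom_module S (cmod A p) (cmod B (p + k)))),
     cdiff = (\<lambda>k g p. \<lambda>x\<in>carrier (cmod A p).
       cdiff B (p + k) (g p x) \<ominus>\<^bsub>cmod B (p + k - 1)\<^esub>
       signed (cmod B (p + k - 1)) k (g (p - 1) (cdiff A p x)))\<rparr>"

text \<open>An element of degree \<open>k\<close> of the tensor product has components \<open>z p\<close> in the tensor product
  of \<open>cmod A p\<close> and \<open>cmod B (k - p)\<close>, and the differential sends \<open>a \<otimes> b\<close> to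
  \<open>d a \<otimes> b + (-1)\<^sup>p a \<otimes> d b\<close> for \<open>a\<close> in degree \<open>p\<close>.\<close>

definition tensor_complex ::
  "('s, 'z) ring_scheme \<Rightarrow> ('s, 'a) cplx \<Rightarrow> ('s, 'b) cplx \<Rightarrow>
     ('s, int \<Rightarrow> ('a \<times> 'b \<Rightarrow> 's) set) cplx" where
  "tensor_complex S A B = \<lparr>
     cmod = (\<lambda>k. direct_sum (\<lambda>p. tensor_module S (cmod A p) (cmod B (k - p)))),
     cdiff = (\<lambda>k z p. let T = tensor_module S (cmod A p) (cmod B (k - 1 - p)) in
       tensor_map S (cmod A p) (cmod B (k - 1 - p)) (cdiff A (p + 1)) id (z (p + 1)) \<oplus>\<^bsub>T\<^esub>
       signed T p
         (tensor_map S (cmod A p) (cmod B (k - 1 - p)) id (cdiff B (k - p)) (z p)))\<rparr>"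

subsection \<open>The Koszul complex\<close>

text \<open>The basis of degree \<open>k\<close> is given by the subsets of \<open>{1..n}\<close> with \<open>k\<close> elements:
  \<open>J = {j\<^sub>1 < \<dots> < j\<^sub>k}\<close> stands for \<open>e\<^bsub>j\<^sub>1\<^esub> \<and> \<dots> \<and> e\<^bsub>j\<^sub>k\<^esub>\<close>, which the
  differential sends to the sum of the \<open>(-1)\<^bsup>r - 1\<^esup> f j\<^sub>r\<close> times the basis element of
  \<open>J - {j\<^sub>r}\<close>. Below, this is spelled out for the coefficients.\<close>

definition koszul_complex ::
  "('q, 'z) ring_scheme \<Rightarrow> nat \<Rightarrow> (nat \<Rightarrow> 'q) \<Rightarrow> ('q, nat set \<Rightarrow> 'q) cplx" where
  "koszul_complex Q n f = \<lparr>
     cmod = (\<lambda>k. free_module Q {J. J \<subseteq> {1..n} \<and> int (card J) = k}),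
     cdiff = (\<lambda>k x J. \<Oplus>\<^bsub>Q\<^esub> j\<in>{1..n} - J.
       signed Q (int (card {i \<in> J. i < j})) (f j \<otimes>\<^bsub>Q\<^esub> x (insert j J)))\<rparr>"

definition quot_map :: "('q, 'z) ring_scheme \<Rightarrow> 'q set \<Rightarrow> 'q \<Rightarrow> 'q set" where
  "quot_map Q I = (\<lambda>q. I +>\<^bsub>Q\<^esub> q)"

definition seq_ideal :: "('q, 'z) ring_scheme \<Rightarrow> nat \<Rightarrow> (nat \<Rightarrow> 'q) \<Rightarrow> 'q set" where
  "seq_ideal Q n f = genideal Q (f ` {1..n})"

definition koszul_regular :: "('q, 'z) ring_scheme \<Rightarrow> nat \<Rightarrow> (nat \<Rightarrow> 'q) \<Rightarrow> bool" where
  "koszul_regular Q n f \<longleftrightarrow>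
     f \<in> {1..n} \<rightarrow> carrier Q \<and>
     mod_iso Q (homology (koszul_complex Q n f) 0)
       (restrict_scalars (quot_map Q (seq_ideal Q n f))
          (regular_module (Q Quot seq_ideal Q n f))) \<and>
     (\<forall>i. i \<noteq> 0 \<longrightarrow> carrier (homology (koszul_complex Q n f) i) =
       {\<zero>\<^bsub>homology (koszul_complex Q n f) i\<^esub>})"

subsection \<open>The canonical free resolution\<close>

text \<open>Degree \<open>0\<close> of the canonical free resolution of \<open>M\<close> is the free module on the elements of
  \<open>M\<close>, and degree \<open>n + 1\<close> is the free module on the cycles in degree \<open>n\<close> (in degree \<open>0\<close>: on
  the kernel of the augmentation). For all degrees to fit into one type, a cycle is encoded
  by the graph of its restriction to its support.\<close>

datatype ('s, 'm) res_gen = Elem 'm | Cyc "(('s, 'm) res_gen \<times> 's) fset"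

definition cyc_code ::
  "('s, 'z) ring_scheme \<Rightarrow> (('s, 'm) res_gen \<Rightarrow> 's) \<Rightarrow> ('s, 'm) res_gen" where
  "cyc_code S z = Cyc (Abs_fset {(x, z x) | x. z x \<noteq> \<zero>\<^bsub>S\<^esub>})"

definition augmentation ::
  "('s, 'z) ring_scheme \<Rightarrow> ('s, 'm) module \<Rightarrow> (('s, 'm) res_gen \<Rightarrow> 's) \<Rightarrow> 'm" where
  "augmentation S M = lin_ext S M (inv_into (carrier M) Elem)"

fun res_basis ::
    "('s, 'z) ring_scheme \<Rightarrow> ('s, 'm) module \<Rightarrow> nat \<Rightarrow> ('s, 'm) res_gen set"
  and res_cycles ::
    "('s, 'z) ring_scheme \<Rightarrow> ('s, 'm) module \<Rightarrow> nat \<Rightarrow> (('s, 'm) res_gen \<Rightarrow> 's) set"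
where
  "res_basis S M 0 = Elem ` carrier M"
| "res_basis S M (Suc n) = cyc_code S ` res_cycles S M n"
| "res_cycles S M 0 =
     a_kernel (free_module S (res_basis S M 0)) M (augmentation S M)"
| "res_cycles S M (Suc n) =
     a_kernel (free_module S (res_basis S M (Suc n))) (free_module S (res_basis S M n))
       (lin_ext S (free_module S (res_basis S M n)) (inv_into (res_cycles S M n) (cyc_code S)))"

definition free_resolution ::
  "('s, 'z) ring_scheme \<Rightarrow> ('s, 'm) module \<Rightarrow> ('s, ('s, 'm) res_gen \<Rightarrow> 's) cplx" where
  "free_resolution S M = \<lparr>
     cmod = (\<lambda>i. free_module S (if i < 0 then {} else res_basis S M (nat i))),
     cdiff = (\<lambda>i. if i \<le> 0 then (\<lambda>_ _. \<zero>\<^bsub>S\<^esub>) else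
       lin_ext S (free_module S (res_basis S M (nat (i - 1))))
         (inv_into (res_cycles S M (nat (i - 1))) (cyc_code S)))\<rparr>"

section \<open>The canonical free resolution is a resolution\<close>

text \<open>The lemmas \<open>free_resolution_complex\<close> and \<open>free_resolution_exact\<close> below show that the
  complex used to define Ext and Tor is a resolution by free modules.\<close>

lemma free_module_simps [simp]:
  "\<zero>\<^bsub>free_module S X\<^esub> = (\<lambda>_. \<zero>\<^bsub>S\<^esub>)"
  "u \<oplus>\<^bsub>free_module S X\<^esub> v = (\<lambda>x. u x \<oplus>\<^bsub>S\<^esub> v x)"
  "s \<odot>\<^bsub>free_module S X\<^esub> u = (\<lambda>x. s \<otimes>\<^bsub>S\<^esub> u x)"
  by (simp_all add: free_module_def)

lemma free_module_carrier:
  "u \<in> carrier (free_module S X) \<longleftrightarrow> (\<forall>x\<in>X. u x \<in> carrier S) \<and>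
     (\<forall>x. x \<notin> X \<longrightarrow> u x = \<zero>\<^bsub>S\<^esub>) \<and> finite {x. u x \<noteq> \<zero>\<^bsub>S\<^esub>}"
  by (simp add: free_module_def)

lemma free_module_coeff:
  assumes "cring S" "u \<in> carrier (free_module S X)"
  shows "u x \<in> carrier S"
proof -
  interpret cring S by fact
  show ?thesis using assms(2) by (cases "x \<in> X") (auto simp: free_module_carrier)
qed

lemma module_free_module:
  assumes "cring S"
  shows "module S (free_module S X)"
proof -
  interpret S: cring S by fact
  note c = free_module_coeff[OF assms, where X = X]
  show ?thesis
  proof (rule moduleI)
    show "abelian_group (free_module S X)"
    proof (rule abelian_groupI)
      fix u v assume u: "u \<in> carrier (free_module S X)" and v: "v \<in> carrier (free_module S X)"
      have "{x. u x \<oplus>\<^bsub>S\<^esub> v x \<noteq> \<zero>\<^bsub>S\<^esub>} \<subseteq> {x. u x \<noteq> \<zero>\<^bsub>S\<^esub>} \<union> {x. v x \<noteq> \<zero>\<^bsub>S\<^esub>}"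
        by auto
      then have "finite {x. u x \<oplus>\<^bsub>S\<^esub> v x \<noteq> \<zero>\<^bsub>S\<^esub>}"
        using u v by (auto simp: free_module_carrier elim: finite_subset)
      then show "u \<oplus>\<^bsub>free_module S X\<^esub> v \<in> carrier (free_module S X)"
        using u v by (auto simp: free_module_carrier)
    next
      fix u assume u: "u \<in> carrier (free_module S X)"
      show "\<exists>v\<in>carrier (free_module S X). v \<oplus>\<^bsub>free_module S X\<^esub> u = \<zero>\<^bsub>free_module S X\<^esub>"
      proof
        show "(\<lambda>x. \<ominus>\<^bsub>S\<^esub> u x) \<oplus>\<^bsub>free_module S X\<^esub> u = \<zero>\<^bsub>free_module S X\<^esub>"
          using c[OF u] by (simp add: S.l_neg)
        have "{x. \<ominus>\<^bsub>S\<^esub> u x \<noteq> \<zero>\<^bsub>S\<^esub>} \<subseteq> {x. u x \<noteq> \<zero>\<^bsub>S\<^esub>}" by auto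
        then have "finite {x. \<ominus>\<^bsub>S\<^esub> u x \<noteq> \<zero>\<^bsub>S\<^esub>}"
          using u by (auto simp: free_module_carrier elim: finite_subset)
        then show "(\<lambda>x. \<ominus>\<^bsub>S\<^esub> u x) \<in> carrier (free_module S X)"
          using u by (auto simp: free_module_carrier)
      qed
    qed (use c in \<open>auto simp: S.a_ac fun_eq_iff free_module_carrier[of "\<lambda>_. \<zero>\<^bsub>S\<^esub>"]\<close>)
  next
    fix s u assume s: "s \<in> carrier S" and u: "u \<in> carrier (free_module S X)"
    have "{x. s \<otimes>\<^bsub>S\<^esub> u x \<noteq> \<zero>\<^bsub>S\<^esub>} \<subseteq> {x. u x \<noteq> \<zero>\<^bsub>S\<^esub>}" using s by auto
    then have "finite {x. s \<otimes>\<^bsub>S\<^esub> u x \<noteq> \<zero>\<^bsub>S\<^esub>}"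
      using u by (auto simp: free_module_carrier elim: finite_subset)
    then show "s \<odot>\<^bsub>free_module S X\<^esub> u \<in> carrier (free_module S X)"
      using s u by (auto simp: free_module_carrier)
  qed (use c assms in \<open>auto simp: S.l_distr S.r_distr S.m_assoc\<close>)
qed

lemma lin_ext_eq:
  assumes "module S A" "u \<in> carrier (free_module S X)" "g \<in> X \<rightarrow> carrier A"
    and "finite F" "{x. u x \<noteq> \<zero>\<^bsub>S\<^esub>} \<subseteq> F" "F \<subseteq> X"
  shows "lin_ext S A g u = (\<Oplus>\<^bsub>A\<^esub> x\<in>F. u x \<odot>\<^bsub>A\<^esub> g x)"
proof -
  interpret A: module S A by fact
  note c = free_module_coeff[OF A.R.cring_axioms assms(2)]
  show ?thesis
    unfolding lin_ext_def
    by (rule A.M.add.finprod_mono_neutral_cong_left)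
       (use assms c in \<open>auto intro!: A.smult_closed A.smult_l_null\<close>)
qed

lemma lin_ext_hom:
  assumes "module S A" "g \<in> X \<rightarrow> carrier A"
  shows "lin_ext S A g \<in> mod_hom S (free_module S X) A"
proof -
  interpret A: module S A by fact
  interpret F: module S "free_module S X" by (rule module_free_module[OF A.R.cring_axioms])
  note c = free_module_coeff[OF A.R.cring_axioms]
  have fin: "finite {x. u x \<noteq> \<zero>\<^bsub>S\<^esub>}" "{x. u x \<noteq> \<zero>\<^bsub>S\<^esub>} \<subseteq> X"
    if "u \<in> carrier (free_module S X)" for u
    using that by (auto simp: free_module_carrier)
  have cl: "(\<Oplus>\<^bsub>A\<^esub> x\<in>T. u x \<odot>\<^bsub>A\<^esub> g x) \<in> carrier A" 
    if "u \<in> carrier (free_module S X)" "T \<subseteq> X" for u T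
    using that assms c[OF that(1)] by (intro A.M.finsum_closed) auto
  show ?thesis
    unfolding mod_hom_def
  proof (intro CollectI conjI ballI)
    show "lin_ext S A g \<in> carrier (free_module S X) \<rightarrow> carrier A"
      using cl fin by (auto simp: lin_ext_def)
  next
    fix u v assume u: "u \<in> carrier (free_module S X)" and v: "v \<in> carrier (free_module S X)"
    let ?T = "{x. u x \<noteq> \<zero>\<^bsub>S\<^esub>} \<union> {x. v x \<noteq> \<zero>\<^bsub>S\<^esub>}"
    have T: "finite ?T" "?T \<subseteq> X" using fin u v by auto
    have sub: "{x. (u \<oplus>\<^bsub>free_module S X\<^esub> v) x \<noteq> \<zero>\<^bsub>S\<^esub>} \<subseteq> ?T" by auto
    have "lin_ext S A g (u \<oplus>\<^bsub>free_module S X\<^esub> v) =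
        (\<Oplus>\<^bsub>A\<^esub> x\<in>?T. (u x \<oplus>\<^bsub>S\<^esub> v x) \<odot>\<^bsub>A\<^esub> g x)"
      using lin_ext_eq[OF assms(1) F.M.a_closed[OF u v] assms(2) T(1) sub T(2)] by simp
    also have "\<dots> = (\<Oplus>\<^bsub>A\<^esub> x\<in>?T. u x \<odot>\<^bsub>A\<^esub> g x \<oplus>\<^bsub>A\<^esub> v x \<odot>\<^bsub>A\<^esub> g x)"
      using assms T c[OF u] c[OF v]
      by (intro A.M.finsum_cong') (auto simp: Pi_iff subset_iff A.smult_l_distr)
    also have "\<dots> = (\<Oplus>\<^bsub>A\<^esub> x\<in>?T. u x \<odot>\<^bsub>A\<^esub> g x) \<oplus>\<^bsub>A\<^esub> (\<Oplus>\<^bsub>A\<^esub> x\<in>?T. v x \<odot>\<^bsub>A\<^esub> g x)"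
      using assms T c[OF u] c[OF v] by (intro A.M.finsum_addf) (auto simp: Pi_iff subset_iff)
    also have "\<dots> = lin_ext S A g u \<oplus>\<^bsub>A\<^esub> lin_ext S A g v"
      using lin_ext_eq[OF assms(1) u assms(2) T(1) _ T(2)]
        lin_ext_eq[OF assms(1) v assms(2) T(1) _ T(2)] by auto
    finally show "lin_ext S A g (u \<oplus>\<^bsub>free_module S X\<^esub> v) =
      lin_ext S A g u \<oplus>\<^bsub>A\<^esub> lin_ext S A g v" .
  next
    fix s u assume s: "s \<in> carrier S" and u: "u \<in> carrier (free_module S X)"
    let ?T = "{x. u x \<noteq> \<zero>\<^bsub>S\<^esub>}"
    have sub: "{x. (s \<odot>\<^bsub>free_module S X\<^esub> u) x \<noteq> \<zero>\<^bsub>S\<^esub>} \<subseteq> ?T" using s by auto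
    have "lin_ext S A g (s \<odot>\<^bsub>free_module S X\<^esub> u) =
        (\<Oplus>\<^bsub>A\<^esub> x\<in>?T. (s \<otimes>\<^bsub>S\<^esub> u x) \<odot>\<^bsub>A\<^esub> g x)"
      using lin_ext_eq[OF assms(1) F.smult_closed[OF s u] assms(2) fin(1)[OF u] sub fin(2)[OF u]]
      by simp
    also have "\<dots> = (\<Oplus>\<^bsub>A\<^esub> x\<in>?T. s \<odot>\<^bsub>A\<^esub> (u x \<odot>\<^bsub>A\<^esub> g x))"
      using assms s c[OF u] fin(2)[OF u]
      by (intro A.M.finsum_cong') (auto simp: Pi_iff subset_iff A.smult_assoc1)
    also have "\<dots> = s \<odot>\<^bsub>A\<^esub> lin_ext S A g u"
      unfolding lin_ext_def using assms s c[OF u] fin[OF u]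
      by (intro A.finsum_smult_ldistr[symmetric]) (auto simp: Pi_iff subset_iff)
    finally show "lin_ext S A g (s \<odot>\<^bsub>free_module S X\<^esub> u) = s \<odot>\<^bsub>A\<^esub> lin_ext S A g u" .
  qed
qed

lemma basis_elt_closed:
  assumes "cring S" "x \<in> X"
  shows "basis_elt S x \<in> carrier (free_module S X)"
proof -
  interpret cring S by fact
  have "{y. basis_elt S x y \<noteq> \<zero>\<^bsub>S\<^esub>} \<subseteq> {x}" by (auto simp: basis_elt_def)
  then have "finite {y. basis_elt S x y \<noteq> \<zero>\<^bsub>S\<^esub>}" by (rule finite_subset) simp
  then show ?thesis using assms(2) by (auto simp: free_module_carrier basis_elt_def)
qed

lemma lin_ext_basis_elt:
  assumes "module S A" "g \<in> X \<rightarrow> carrier A" "x \<in> X"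
  shows "lin_ext S A g (basis_elt S x) = g x"
proof -
  interpret A: module S A by fact
  have "lin_ext S A g (basis_elt S x) = (\<Oplus>\<^bsub>A\<^esub> y\<in>{x}. basis_elt S x y \<odot>\<^bsub>A\<^esub> g y)"
    by (rule lin_ext_eq[OF assms(1) basis_elt_closed[OF A.R.cring_axioms assms(3)] assms(2)])
       (use assms in \<open>auto simp: basis_elt_def\<close>)
  also have "\<dots> = g x"
    using funcset_mem[OF assms(2,3)] by (simp add: basis_elt_def A.M.finsum_insert)
  finally show ?thesis .
qed

lemma cyc_code_inj:
  assumes "finite {x. z x \<noteq> \<zero>\<^bsub>S\<^esub>}" "finite {x. w x \<noteq> \<zero>\<^bsub>S\<^esub>}" "cyc_code S z = cyc_code S w"
  shows "z = w"
proof -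
  have fin: "finite {(x, z x) | x. z x \<noteq> \<zero>\<^bsub>S\<^esub>}" "finite {(x, w x) | x. w x \<noteq> \<zero>\<^bsub>S\<^esub>}"
    using assms(1,2) by (auto simp: setcompr_eq_image)
  with assms(3) have eq: "{(x, z x) | x. z x \<noteq> \<zero>\<^bsub>S\<^esub>} = {(x, w x) | x. w x \<noteq> \<zero>\<^bsub>S\<^esub>}"
    by (simp add: cyc_code_def Abs_fset_inject)
  show ?thesis
  proof
    fix x
    have "(x, z x) \<in> {(x, z x) | x. z x \<noteq> \<zero>\<^bsub>S\<^esub>} \<longleftrightarrow> (x, z x) \<in> {(x, w x) | x. w x \<noteq> \<zero>\<^bsub>S\<^esub>}"
      "(x, w x) \<in> {(x, z x) | x. z x \<noteq> \<zero>\<^bsub>S\<^esub>} \<longleftrightarrow> (x, w x) \<in> {(x, w x) | x. w x \<noteq> \<zero>\<^bsub>S\<^esub>}"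
      unfolding eq by (rule refl)+
    then show "z x = w x" by auto
  qed
qed

lemma augmentation_hom:
  assumes "module S M"
  shows "augmentation S M \<in> mod_hom S (free_module S (res_basis S M 0)) M"
  unfolding augmentation_def
  by (rule lin_ext_hom[OF assms]) (auto simp: inj_on_def intro!: inv_into_into)

text \<open>The cycles of every degree lie in the free module of that degree, and the images of the
  basis elements under the next differential are exactly these cycles.\<close>

lemma res_cycles_subset: "res_cycles S M n \<subseteq> carrier (free_module S (res_basis S M n))"
  by (cases n) (auto simp: a_kernel_def kernel_def)

lemma res_cycles_decode:
  assumes "z \<in> res_cycles S M n"
  shows "inv_into (res_cycles S M n) (cyc_code S) (cyc_code S z) = z"
proof (rule inv_into_f_f[OF _ assms])
  show "inj_on (cyc_code S) (res_cycles S M n)"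
    using res_cycles_subset
    by (intro inj_onI cyc_code_inj) (auto simp: free_module_carrier subset_iff)
qed

lemma res_diff_hom:
  assumes "cring S"
  shows "lin_ext S (free_module S (res_basis S M n)) (inv_into (res_cycles S M n) (cyc_code S))
    \<in> mod_hom S (free_module S (res_basis S M (Suc n))) (free_module S (res_basis S M n))"
  by (rule lin_ext_hom[OF module_free_module[OF assms]])
     (use res_cycles_decode res_cycles_subset in \<open>fastforce\<close>)

lemma mod_hom_kernel_submodule:
  assumes "module S A" "module S B" "h \<in> mod_hom S A B"
  shows "submodule (a_kernel A B h) S A"
proof -
  interpret A: module S A by fact
  interpret B: module S B by fact
  have h1: "h x \<in> carrier B" if "x \<in> carrier A" for x
    using assms(3) that by (auto simp: mod_hom_def)
  have h2: "h (x \<oplus>\<^bsub>A\<^esub> y) = h x \<oplus>\<^bsub>B\<^esub> h y" if "x \<in> carrier A" "y \<in> carrier A" for x y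
    using assms(3) that by (auto simp: mod_hom_def)
  have h3: "h (s \<odot>\<^bsub>A\<^esub> x) = s \<odot>\<^bsub>B\<^esub> h x" if "s \<in> carrier S" "x \<in> carrier A" for s x
    using assms(3) that by (auto simp: mod_hom_def)
  have z: "h \<zero>\<^bsub>A\<^esub> = \<zero>\<^bsub>B\<^esub>"
    using h3[of "\<zero>\<^bsub>S\<^esub>" "\<zero>\<^bsub>A\<^esub>"] h1[of "\<zero>\<^bsub>A\<^esub>"] by simp
  have m: "h (\<ominus>\<^bsub>A\<^esub> x) = \<ominus>\<^bsub>B\<^esub> h x" if "x \<in> carrier A" for x
    using h3[of "\<ominus>\<^bsub>S\<^esub> \<one>\<^bsub>S\<^esub>" x] h1[of x] that
    by (simp add: A.smult_l_minus B.smult_l_minus)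
  show ?thesis
    by (rule A.submoduleI) (auto simp: a_kernel_def kernel_def h1 h2 h3 z m)
qed

text \<open>A submodule of the target that contains the images of the basis contains the image.\<close>

lemma lin_ext_in_submodule:
  assumes "module S A" "submodule H S A" "g \<in> X \<rightarrow> H" "u \<in> carrier (free_module S X)"
  shows "lin_ext S A g u \<in> H"
proof -
  interpret A: module S A by fact
  note H = A.submoduleE[OF assms(2)]
  have "(\<Oplus>\<^bsub>A\<^esub> x\<in>T. u x \<odot>\<^bsub>A\<^esub> g x) \<in> H" if "finite T" "T \<subseteq> X" for T
    using that
  proof (induction T)
    case empty
    from H(2) obtain z where z: "z \<in> H" by blast
    then have "z \<oplus>\<^bsub>A\<^esub> \<ominus>\<^bsub>A\<^esub> z \<in> H" by (intro H(5) H(3))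
    also have "z \<oplus>\<^bsub>A\<^esub> \<ominus>\<^bsub>A\<^esub> z = \<zero>\<^bsub>A\<^esub>" using z H(1) by (intro A.M.r_neg) auto
    finally show ?case by simp
  next
    case (insert x T)
    have "u y \<odot>\<^bsub>A\<^esub> g y \<in> H" if "y \<in> X" for y
      using that assms(3) H(4) free_module_coeff[OF A.R.cring_axioms assms(4)] by auto
    with insert H(1,5) show ?case
      by (subst A.M.finsum_insert) (auto simp: Pi_iff subset_iff)
  qed
  then show ?thesis unfolding lin_ext_def using assms(4)
    by (auto simp: free_module_carrier)
qed

lemma res_diff_image:
  assumes "module S M"
  shows "lin_ext S (free_module S (res_basis S M n)) (inv_into (res_cycles S M n) (cyc_code S))
    ` carrier (free_module S (res_basis S M (Suc n))) = res_cycles S M n"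
    (is "?d ` ?C = _")
proof
  interpret M: module S M by fact
  note mf = module_free_module[OF M.R.cring_axioms]
  have sub: "submodule (res_cycles S M n) S (free_module S (res_basis S M n))"
    using mod_hom_kernel_submodule[OF mf assms augmentation_hom[OF assms]]
      mod_hom_kernel_submodule[OF mf mf res_diff_hom[OF M.R.cring_axioms]]
    by (cases n) (simp_all del: res_basis.simps)
  show "?d ` ?C \<subseteq> res_cycles S M n"
    by (auto intro!: lin_ext_in_submodule[OF mf sub, where X = "res_basis S M (Suc n)"] simp: res_cycles_decode)
  show "res_cycles S M n \<subseteq> ?d ` ?C"
  proof
    fix z assume z: "z \<in> res_cycles S M n"
    have "?d (basis_elt S (cyc_code S z)) = inv_into (res_cycles S M n) (cyc_code S) (cyc_code S z)"
      by (rule lin_ext_basis_elt[OF mf, where X = "res_basis S M (Suc n)"])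
         (use z res_cycles_decode res_cycles_subset in fastforce)+
    also have "\<dots> = z" by (rule res_cycles_decode[OF z])
    finally show "z \<in> ?d ` ?C"
      using z basis_elt_closed[OF M.R.cring_axioms, of "cyc_code S z" "res_basis S M (Suc n)"]
      by (auto intro: rev_image_eqI)
  qed
qed

lemma free_resolution_complex:
  assumes "module S M"
  shows "chain_complex S (free_resolution S M)"
proof -
  interpret M: module S M by fact
  note mf = module_free_module[OF M.R.cring_axioms]
  show ?thesis
    unfolding chain_complex_def
  proof (intro conjI allI ballI)
    fix i :: int
    show "module S (cmod (free_resolution S M) i)"
      by (simp add: free_resolution_def mf)
    show "cdiff (free_resolution S M) i \<in>
        mod_hom S (cmod (free_resolution S M) i) (cmod (free_resolution S M) (i - 1))"
    proof (cases "i \<le> 0")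
      case True
      then show ?thesis
        by (auto simp: free_resolution_def mod_hom_def free_module_carrier)
    next
      case False
      define n where "n = nat (i - 1)"
      with False have "i = int (Suc n)" by simp
      then show ?thesis using res_diff_hom[OF M.R.cring_axioms, of M n]
        by (simp add: free_resolution_def nat_add_distrib del: res_basis.simps)
    qed
    fix u assume u: "u \<in> carrier (cmod (free_resolution S M) i)"
    show "cdiff (free_resolution S M) (i - 1) (cdiff (free_resolution S M) i u) =
        \<zero>\<^bsub>cmod (free_resolution S M) (i - 2)\<^esub>"
    proof (cases "i \<le> 1")
      case True
      then show ?thesis by (simp add: free_resolution_def)
    next
      case False
      define n where "n = nat (i - 2)"
      with False have n: "i = int (Suc (Suc n))" by simp
      have "cdiff (free_resolution S M) i u \<in> res_cycles S M (Suc n)"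
        using res_diff_image[OF assms, of "Suc n"] u
        by (auto simp: n free_resolution_def nat_add_distrib simp del: res_basis.simps res_cycles.simps)
      then show ?thesis
        by (simp add: n free_resolution_def a_kernel_def kernel_def nat_add_distrib del: res_basis.simps)
    qed
  qed
qed

lemma free_resolution_exact:
  fixes S :: "('a, 'b) ring_scheme" and M :: "('a, 'c) module"
  assumes "module S M"
  shows "i > 0 \<Longrightarrow> cycles (free_resolution S M) i = boundaries (free_resolution S M) i"
    and "a_kernel (cmod (free_resolution S M) 0) M (augmentation S M) =
      boundaries (free_resolution S M) 0"
    and "augmentation S M ` carrier (cmod (free_resolution S M) 0) = carrier M"
proof -
  interpret M: module S M by fact
  note mf = module_free_module[OF M.R.cring_axioms]
  show "cycles (free_resolution S M) i = boundaries (free_resolution S M) i" if "i > 0"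
  proof -
    define n where "n = nat (i - 1)"
    with that have n: "i = int (Suc n)" by simp
    show ?thesis using res_diff_image[OF assms, of "Suc n"]
      by (simp add: n cycles_def boundaries_def free_resolution_def nat_add_distrib
          del: res_basis.simps)
  qed
  show "a_kernel (cmod (free_resolution S M) 0) M (augmentation S M) =
      boundaries (free_resolution S M) 0"
    using res_diff_image[OF assms, of 0]
    by (simp add: boundaries_def free_resolution_def del: res_basis.simps)
  show "augmentation S M ` carrier (cmod (free_resolution S M) 0) = carrier M"
  proof
    show "augmentation S M ` carrier (cmod (free_resolution S M) 0) \<subseteq> carrier M"
      using augmentation_hom[OF assms] by (auto simp: mod_hom_def free_resolution_def)
    show "carrier M \<subseteq> augmentation S M ` carrier (cmod (free_resolution S M) 0)"
    proof
      fix m assume m: "m \<in> carrier M"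
      let ?e = "Elem m :: ('a, 'c) res_gen"
      have "augmentation S M (basis_elt S ?e) = inv_into (carrier M) Elem ?e"
        unfolding augmentation_def
        by (rule lin_ext_basis_elt[OF assms, where X = "res_basis S M 0"])
           (use m in \<open>auto simp: Pi_iff intro!: inv_into_into\<close>)
      also have "\<dots> = m" using m by (intro inv_into_f_f) (auto simp: inj_on_def)
      finally show "m \<in> augmentation S M ` carrier (cmod (free_resolution S M) 0)"
        using m basis_elt_closed[OF M.R.cring_axioms, of "Elem m" "Elem ` carrier M"]
        by (auto simp: free_resolution_def intro: rev_image_eqI)
    qed
  qed
qed

section \<open>Ext and Tor of a module and a complex, and their series\<close>

text \<open>Degree \<open>-i\<close> in the homological grading is cohomological degree \<open>i\<close>.\<close>

definition Ext_module ::
  "('s, 'z) ring_scheme \<Rightarrow> ('s, 'm) module \<Rightarrow> ('s, 'n) cplx \<Rightarrow> int \<Rightarrow>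
     ('s, (int \<Rightarrow> (('s, 'm) res_gen \<Rightarrow> 's) \<Rightarrow> 'n) set) module" where
  "Ext_module S M N i = homology (hom_complex S (free_resolution S M) N) (- i)"

definition Tor_module ::
  "('s, 'z) ring_scheme \<Rightarrow> ('s, 'm) module \<Rightarrow> ('s, 'n) cplx \<Rightarrow> int \<Rightarrow>
     ('s, (int \<Rightarrow> ((('s, 'm) res_gen \<Rightarrow> 's) \<times> 'n \<Rightarrow> 's) set) set) module" where
  "Tor_module S M N i = homology (tensor_complex S (free_resolution S M) N) i"

definition bass_series ::
  "('s, 'z) ring_scheme \<Rightarrow> ('s, 'm) module \<Rightarrow> ('s, 'n) cplx \<Rightarrow> enat fps" where
  "bass_series S M N = Abs_fps (\<lambda>i. min_gens S (Ext_module S M N (int i)))"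

definition poincare_series ::
  "('s, 'z) ring_scheme \<Rightarrow> ('s, 'm) module \<Rightarrow> ('s, 'n) cplx \<Rightarrow> enat fps" where
  "poincare_series S M N = Abs_fps (\<lambda>i. min_gens S (Tor_module S M N (int i)))"

section \<open>Quotients of a ring\<close>

text \<open>For an ideal \<open>J\<close> contained in \<open>I\<close>, the canonical map from \<open>Q Quot J\<close> to \<open>Q Quot I\<close>: the
  coset of \<open>q\<close> modulo \<open>J\<close> goes to \<open>I + (J + q) = I + q\<close>.\<close>

definition quot_quot_map :: "('q, 'z) ring_scheme \<Rightarrow> 'q set \<Rightarrow> 'q set \<Rightarrow> 'q set" where
  "quot_quot_map Q I = (\<lambda>C. I <+>\<^bsub>Q\<^esub> C)"

end

theory Submission
  imports Defs
begin

text \<open>Write \<open>f\<^sub>i - f'\<^sub>i\<close> as a combination, with coefficients in \<open>I\<close>, of finitely many elements of the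
  annihilator of \<open>M\<close>, and let \<open>c\<close> consist of the \<open>f'\<^sub>i\<close> and these elements. As all of \<open>c\<close> kills \<open>M\<close>,
  the module \<open>M\<close> has a semifree resolution \<open>L\<close> over the Koszul algebra on \<open>c\<close>. The change of exterior
  variables that turns \<open>f'\<^sub>i\<close> into \<open>f\<^sub>i\<close> is the identity modulo \<open>I\<close>; conjugating the differential of \<open>L\<close>
  with it gives a resolution of the same kind for \<open>f\<close>, with a differential congruent to the old one
  modulo \<open>I\<close>. Dividing \<open>L\<close> by \<open>f'\<close> and by the exterior variables of \<open>f'\<close> leaves a free resolution of
  \<open>M\<close> over \<open>Q/(f')\<close>, because the Koszul complex on \<open>f'\<close> is exact, and likewise for \<open>f\<close>. Modulo \<open>I\<close> these
  two free resolutions coincide, and for complexes of \<open>R\<close>-modules the Hom and tensor complexes depend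
  only on the reductions modulo \<open>I\<close>.\<close>

section \<open>Linear maps, quotients and generators\<close>

text \<open>The difference f_i - f'_i lies in I ann(M), not in I (f'), so a change of variables in
  the Koszul algebra on f' alone need not turn f'_i into f_i. This is why variables with boundaries
  in ann(M) are added. If f_i - f'_i is the sum of a_t c_t with a_t in I and c_t in ann(M), then e_i
  goes to e_i plus the sum of the a_t e_t. The Koszul algebra is never built. L consists of finitely
  supported functions on pairs of a generator and a set of indices, and the algebra is present
  through operators e_t with d e_t + e_t d = c_t. That the quotient of L is still a resolution comes
  from the acyclicity of the kernel of the division. It is proved along the filtration by the number
  of indices that belong to f'; on each layer the differential is the Koszul differential of f'. Ext
  and Tor are defined by one canonical resolution, which the comparison theorem trades for the
  quotient of L. Generators are counted over Q/(f), Q/(f') and R, so the counts are transferred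
  along maps that match scalars one at a time.\<close>

lemma mod_hom_closed: "h \<in> mod_hom S A B \<Longrightarrow> x \<in> carrier A \<Longrightarrow> h x \<in> carrier B"
  by (auto simp: mod_hom_def)

lemma mod_hom_add:
  "h \<in> mod_hom S A B \<Longrightarrow> x \<in> carrier A \<Longrightarrow> y \<in> carrier A \<Longrightarrow> h (x \<oplus>\<^bsub>A\<^esub> y) = h x \<oplus>\<^bsub>B\<^esub> h y"
  by (auto simp: mod_hom_def)

lemma mod_hom_smult:
  "h \<in> mod_hom S A B \<Longrightarrow> s \<in> carrier S \<Longrightarrow> x \<in> carrier A \<Longrightarrow> h (s \<odot>\<^bsub>A\<^esub> x) = s \<odot>\<^bsub>B\<^esub> h x"
  by (auto simp: mod_hom_def)

lemma mod_homI:
  assumes "\<And>x. x \<in> carrier A \<Longrightarrow> h x \<in> carrier B"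
    and "\<And>x y. x \<in> carrier A \<Longrightarrow> y \<in> carrier A \<Longrightarrow> h (x \<oplus>\<^bsub>A\<^esub> y) = h x \<oplus>\<^bsub>B\<^esub> h y"
    and "\<And>s x. s \<in> carrier S \<Longrightarrow> x \<in> carrier A \<Longrightarrow> h (s \<odot>\<^bsub>A\<^esub> x) = s \<odot>\<^bsub>B\<^esub> h x"
  shows "h \<in> mod_hom S A B"
  using assms by (auto simp: mod_hom_def)

lemma mod_hom_cong:
  assumes "module S A" "h \<in> mod_hom S A B" "\<And>x. x \<in> carrier A \<Longrightarrow> h x = g x"
  shows "g \<in> mod_hom S A B"
proof -
  interpret A: module S A by fact
  show ?thesis
  proof (rule mod_homI)
    show "g x \<in> carrier B" if "x \<in> carrier A" for x
      using mod_hom_closed[OF assms(2) that] assms(3)[OF that] by simp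
  qed (use assms(2) in \<open>simp_all add: assms(3)[symmetric] mod_hom_add mod_hom_smult\<close>)
qed

lemma mod_hom_zero:
  assumes "module S A" "module S B" "h \<in> mod_hom S A B"
  shows "h \<zero>\<^bsub>A\<^esub> = \<zero>\<^bsub>B\<^esub>"
proof -
  interpret A: module S A by fact
  interpret B: module S B by fact
  show ?thesis
    using mod_hom_smult[OF assms(3), of "\<zero>\<^bsub>S\<^esub>" "\<zero>\<^bsub>A\<^esub>"] mod_hom_closed[OF assms(3), of "\<zero>\<^bsub>A\<^esub>"]
    by simp
qed

lemma mod_hom_minus:
  assumes "module S A" "module S B" "h \<in> mod_hom S A B" "x \<in> carrier A"
  shows "h (\<ominus>\<^bsub>A\<^esub> x) = \<ominus>\<^bsub>B\<^esub> h x"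
proof -
  interpret A: module S A by fact
  interpret B: module S B by fact
  show ?thesis
    using mod_hom_smult[OF assms(3), of "\<ominus>\<^bsub>S\<^esub> \<one>\<^bsub>S\<^esub>" x] mod_hom_closed[OF assms(3,4)] assms(4)
    by (simp add: A.smult_l_minus B.smult_l_minus)
qed

lemma mod_hom_diff:
  assumes "module S A" "module S B" "h \<in> mod_hom S A B" "x \<in> carrier A" "y \<in> carrier A"
  shows "h (x \<ominus>\<^bsub>A\<^esub> y) = h x \<ominus>\<^bsub>B\<^esub> h y"
proof -
  interpret A: module S A by fact
  show ?thesis using assms by (simp add: a_minus_def mod_hom_add mod_hom_minus)
qed

lemma mod_hom_comp:
  "h \<in> mod_hom S A B \<Longrightarrow> g \<in> mod_hom S B C \<Longrightarrow> (\<lambda>x. g (h x)) \<in> mod_hom S A C"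
  by (auto simp: mod_hom_def Pi_iff)

lemma mod_hom_id: "(\<lambda>x. x) \<in> mod_hom S A A"
  by (auto simp: mod_hom_def)

lemma mod_hom_zero_map:
  assumes "module S B"
  shows "(\<lambda>_. \<zero>\<^bsub>B\<^esub>) \<in> mod_hom S A B"
proof -
  interpret B: module S B by fact
  show ?thesis by (auto intro!: mod_homI)
qed

lemma mod_hom_sum:
  assumes "module S B" "g \<in> mod_hom S A B" "h \<in> mod_hom S A B"
  shows "(\<lambda>x. g x \<oplus>\<^bsub>B\<^esub> h x) \<in> mod_hom S A B"
proof -
  interpret B: module S B by fact
  show ?thesis using assms(2,3)
    by (auto intro!: mod_homI simp: mod_hom_closed mod_hom_add mod_hom_smult B.smult_r_distr B.M.a_ac)
qed

lemma mod_hom_scale: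
  assumes "module S B" "h \<in> mod_hom S A B" "c \<in> carrier S"
  shows "(\<lambda>x. c \<odot>\<^bsub>B\<^esub> h x) \<in> mod_hom S A B"
proof -
  interpret B: module S B by fact
  show ?thesis using assms(2,3)
    by (auto intro!: mod_homI simp: mod_hom_closed mod_hom_add mod_hom_smult B.smult_r_distr
        B.smult_assoc1[symmetric] B.R.m_comm)
qed

lemma mod_hom_uminus:
  assumes "module S B" "h \<in> mod_hom S A B"
  shows "(\<lambda>x. \<ominus>\<^bsub>B\<^esub> h x) \<in> mod_hom S A B"
proof -
  interpret B: module S B by fact
  show ?thesis using assms(2)
    by (auto intro!: mod_homI simp: mod_hom_closed mod_hom_add mod_hom_smult B.M.minus_add
        B.smult_r_minus)
qed

lemma mod_hom_minusf:
  assumes "module S B" "g \<in> mod_hom S A B" "h \<in> mod_hom S A B"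
  shows "(\<lambda>x. g x \<ominus>\<^bsub>B\<^esub> h x) \<in> mod_hom S A B"
  unfolding a_minus_def by (intro mod_hom_sum mod_hom_uminus assms)

lemma mod_hom_signed:
  assumes "module S B" "h \<in> mod_hom S A B"
  shows "(\<lambda>x. signed B k (h x)) \<in> mod_hom S A B"
  using assms by (cases "even k") (auto simp: signed_def mod_hom_uminus)

lemma signed_closed: "abelian_group A \<Longrightarrow> x \<in> carrier A \<Longrightarrow> signed A k x \<in> carrier A"
  by (auto simp: signed_def abelian_group.a_inv_closed)

lemma signed_mod_hom:
  assumes "module S A" "module S B" "h \<in> mod_hom S A B" "x \<in> carrier A"
  shows "h (signed A k x) = signed B k (h x)"
  using assms by (auto simp: signed_def mod_hom_minus)

lemma submodule_zero:
  assumes "module S M" "submodule K S M" shows "\<zero>\<^bsub>M\<^esub> \<in> K"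
  using subgroup.one_closed[OF submodule.axioms(1)[OF assms(2)]] by simp

lemma submodule_diff:
  assumes "module S M" "submodule K S M" "x \<in> K" "y \<in> K" shows "x \<ominus>\<^bsub>M\<^esub> y \<in> K"
proof -
  interpret M: module S M by fact
  note M.submoduleE[OF assms(2)]
  then show ?thesis using assms by (simp add: a_minus_def)
qed

text \<open>Negatives are multiples by -1, so closure under scalars covers them.\<close>

lemma submodule_combine:
  assumes "module S M" "H \<subseteq> carrier M" "\<zero>\<^bsub>M\<^esub> \<in> H"
    and "\<And>x y. x \<in> H \<Longrightarrow> y \<in> H \<Longrightarrow> x \<oplus>\<^bsub>M\<^esub> y \<in> H"
    and "\<And>s x. s \<in> carrier S \<Longrightarrow> x \<in> H \<Longrightarrow> s \<odot>\<^bsub>M\<^esub> x \<in> H"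
  shows "submodule H S M"
proof -
  interpret M: module S M by fact
  have "\<ominus>\<^bsub>M\<^esub> x \<in> H" if "x \<in> H" for x
    using assms(5)[of "\<ominus>\<^bsub>S\<^esub> \<one>\<^bsub>S\<^esub>" x] that assms(2) by (auto simp: M.smult_l_minus subset_iff)
  with assms show ?thesis by (intro M.submoduleI) auto
qed

lemma mod_span_submodule:
  assumes "module S M" "X \<subseteq> carrier M"
  shows "submodule (mod_span S M X) S M" "X \<subseteq> mod_span S M X"
proof -
  interpret M: module S M by fact
  note E = M.submoduleE
  have c: "submodule (carrier M) S M" by (rule M.carrier_is_submodule)
  show "submodule (mod_span S M X) S M"
  proof (rule submodule_combine[OF assms(1)])
    show "mod_span S M X \<subseteq> carrier M" using c assms(2) by (auto simp: mod_span_def)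
    show "\<zero>\<^bsub>M\<^esub> \<in> mod_span S M X" using submodule_zero[OF assms(1)] by (auto simp: mod_span_def)
  qed (use E in \<open>auto simp: mod_span_def\<close>)
  show "X \<subseteq> mod_span S M X" by (auto simp: mod_span_def)
qed

lemma mod_span_least: "submodule H S M \<Longrightarrow> X \<subseteq> H \<Longrightarrow> mod_span S M X \<subseteq> H"
  by (auto simp: mod_span_def)

subsection \<open>Quotient modules\<close>

lemma a_r_coset_iff:
  assumes "module S M" "submodule K S M" "x \<in> carrier M"
  shows "y \<in> K +>\<^bsub>M\<^esub> x \<longleftrightarrow> y \<in> carrier M \<and> y \<ominus>\<^bsub>M\<^esub> x \<in> K"
proof -
  interpret M: module S M by fact
  note E = M.submoduleE[OF assms(2)]
  show ?thesis
  proof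
    assume "y \<in> K +>\<^bsub>M\<^esub> x"
    then obtain k where "k \<in> K" "y = k \<oplus>\<^bsub>M\<^esub> x" by (auto simp: a_r_coset_def')
    then show "y \<in> carrier M \<and> y \<ominus>\<^bsub>M\<^esub> x \<in> K"
      using E(1) assms(3) by (auto simp: a_minus_def M.M.a_assoc M.M.r_neg subset_iff)
  next
    assume y: "y \<in> carrier M \<and> y \<ominus>\<^bsub>M\<^esub> x \<in> K"
    then have "y = (y \<ominus>\<^bsub>M\<^esub> x) \<oplus>\<^bsub>M\<^esub> x"
      using assms(3) by (simp add: a_minus_def M.M.a_assoc M.M.l_neg)
    with y show "y \<in> K +>\<^bsub>M\<^esub> x" by (auto simp: a_r_coset_def')
  qed
qed

lemma a_r_coset_eq_iff:
  assumes "module S M" "submodule K S M" "x \<in> carrier M" "y \<in> carrier M"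
  shows "K +>\<^bsub>M\<^esub> x = K +>\<^bsub>M\<^esub> y \<longleftrightarrow> x \<ominus>\<^bsub>M\<^esub> y \<in> K"
proof -
  interpret M: module S M by fact
  note E = M.submoduleE[OF assms(2)]
  note iff = a_r_coset_iff[OF assms(1,2)]
  show ?thesis
  proof
    assume "K +>\<^bsub>M\<^esub> x = K +>\<^bsub>M\<^esub> y"
    moreover have "x \<in> K +>\<^bsub>M\<^esub> x"
      using assms submodule_zero[OF assms(1,2)] by (simp add: iff a_minus_def M.M.r_neg)
    ultimately show "x \<ominus>\<^bsub>M\<^esub> y \<in> K" using assms by (simp add: iff)
  next
    assume d: "x \<ominus>\<^bsub>M\<^esub> y \<in> K"
    have "z \<ominus>\<^bsub>M\<^esub> x \<in> K \<longleftrightarrow> z \<ominus>\<^bsub>M\<^esub> y \<in> K" if z: "z \<in> carrier M" for z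
    proof -
      have "z \<ominus>\<^bsub>M\<^esub> y = (z \<ominus>\<^bsub>M\<^esub> x) \<oplus>\<^bsub>M\<^esub> (x \<ominus>\<^bsub>M\<^esub> y)"
        using z assms by (simp add: a_minus_def M.M.a_assoc M.M.r_neg1)
      moreover have "(z \<ominus>\<^bsub>M\<^esub> y) \<oplus>\<^bsub>M\<^esub> \<ominus>\<^bsub>M\<^esub> (x \<ominus>\<^bsub>M\<^esub> y) = z \<ominus>\<^bsub>M\<^esub> x"
      proof -
        have "(z \<ominus>\<^bsub>M\<^esub> y) \<oplus>\<^bsub>M\<^esub> \<ominus>\<^bsub>M\<^esub> (x \<ominus>\<^bsub>M\<^esub> y) =
            (z \<oplus>\<^bsub>M\<^esub> \<ominus>\<^bsub>M\<^esub> x) \<oplus>\<^bsub>M\<^esub> (y \<oplus>\<^bsub>M\<^esub> \<ominus>\<^bsub>M\<^esub> y)"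
          using z assms by (simp add: a_minus_def M.M.minus_add M.M.a_ac)
        then show ?thesis using z assms by (simp add: a_minus_def M.M.r_neg)
      qed
      ultimately show ?thesis using d E by metis
    qed
    then show "K +>\<^bsub>M\<^esub> x = K +>\<^bsub>M\<^esub> y" using assms by (auto simp: iff)
  qed
qed

lemma quot_module_carrier: "carrier (quot_module M K) = (\<lambda>x. K +>\<^bsub>M\<^esub> x) ` carrier M"
  by (auto simp: quot_module_def A_RCOSETS_def' a_r_coset_def')

lemma quot_module_zero: "\<zero>\<^bsub>quot_module M K\<^esub> = K"
  by (simp add: quot_module_def)

lemma quot_module_zero':
  assumes "module S M" "submodule K S M"
  shows "K +>\<^bsub>M\<^esub> \<zero>\<^bsub>M\<^esub> = K"
proof -
  interpret M: module S M by fact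
  show ?thesis using M.submoduleE(1)[OF assms(2)] by (rule M.M.a_coset_add_zero)
qed

lemma quot_module_add:
  assumes "module S M" "submodule K S M" "x \<in> carrier M" "y \<in> carrier M"
  shows "(K +>\<^bsub>M\<^esub> x) \<oplus>\<^bsub>quot_module M K\<^esub> (K +>\<^bsub>M\<^esub> y) = K +>\<^bsub>M\<^esub> (x \<oplus>\<^bsub>M\<^esub> y)"
proof -
  interpret M: module S M by fact
  interpret K: abelian_subgroup K M
    by (rule abelian_subgroupI3[OF additive_subgroup.intro[OF submodule.axioms(1)[OF assms(2)]] M.M.abelian_group_axioms])
  show ?thesis using assms by (simp add: quot_module_def K.a_rcos_sum)
qed

lemma quot_module_smult:
  assumes "module S M" "submodule K S M" "x \<in> carrier M" "s \<in> carrier S"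
  shows "s \<odot>\<^bsub>quot_module M K\<^esub> (K +>\<^bsub>M\<^esub> x) = K +>\<^bsub>M\<^esub> (s \<odot>\<^bsub>M\<^esub> x)"
proof -
  interpret M: module S M by fact
  note E = M.submoduleE[OF assms(2)]
  note iff = a_r_coset_iff[OF assms(1,2)]
  \<comment> \<open>The scalar action on cosets is defined as a union over all representatives
    \<open>c\<close>. Every member of the union is the same coset, and the union is nonempty because
    \<open>x\<close> is a representative.\<close>
  have "K +>\<^bsub>M\<^esub> (s \<odot>\<^bsub>M\<^esub> c) = K +>\<^bsub>M\<^esub> (s \<odot>\<^bsub>M\<^esub> x)" if "c \<in> K +>\<^bsub>M\<^esub> x" for c
  proof -
    have c: "c \<in> carrier M" "c \<ominus>\<^bsub>M\<^esub> x \<in> K" using that assms by (auto simp: iff)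
    have "s \<odot>\<^bsub>M\<^esub> c \<ominus>\<^bsub>M\<^esub> s \<odot>\<^bsub>M\<^esub> x = s \<odot>\<^bsub>M\<^esub> (c \<ominus>\<^bsub>M\<^esub> x)"
      using c assms by (simp add: a_minus_def M.smult_r_distr M.smult_r_minus)
    with c E(4) assms show ?thesis by (subst a_r_coset_eq_iff[OF assms(1,2)]) auto
  qed
  then have "(\<Union>c\<in>K +>\<^bsub>M\<^esub> x. K +>\<^bsub>M\<^esub> (s \<odot>\<^bsub>M\<^esub> c)) = (\<Union>c\<in>K +>\<^bsub>M\<^esub> x. K +>\<^bsub>M\<^esub> (s \<odot>\<^bsub>M\<^esub> x))"
    by (rule SUP_cong[OF refl])
  also have "x \<in> K +>\<^bsub>M\<^esub> x"
    using assms submodule_zero[OF assms(1,2)] by (simp add: iff a_minus_def M.M.r_neg)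
  then have "(\<Union>c\<in>K +>\<^bsub>M\<^esub> x. K +>\<^bsub>M\<^esub> (s \<odot>\<^bsub>M\<^esub> x)) = K +>\<^bsub>M\<^esub> (s \<odot>\<^bsub>M\<^esub> x)"
    by blast
  finally show ?thesis by (simp add: quot_module_def)
qed

lemma quot_module_module:
  assumes "module S M" "submodule K S M"
  shows "module S (quot_module M K)"
proof -
  interpret M: module S M by fact
  note [simp] = quot_module_carrier quot_module_add[OF assms] quot_module_smult[OF assms]
  have z: "\<zero>\<^bsub>quot_module M K\<^esub> = K +>\<^bsub>M\<^esub> \<zero>\<^bsub>M\<^esub>"
    by (simp add: quot_module_zero quot_module_zero'[OF assms])
  show ?thesis
  proof (rule moduleI)
    show "abelian_group (quot_module M K)"
    proof (rule abelian_groupI)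
      fix X assume "X \<in> carrier (quot_module M K)"
      then obtain x where x: "x \<in> carrier M" "X = K +>\<^bsub>M\<^esub> x" by auto
      show "\<exists>Y\<in>carrier (quot_module M K). Y \<oplus>\<^bsub>quot_module M K\<^esub> X = \<zero>\<^bsub>quot_module M K\<^esub>"
        using x by (intro bexI[of _ "K +>\<^bsub>M\<^esub> (\<ominus>\<^bsub>M\<^esub> x)"]) (auto simp: z M.M.l_neg)
    qed (auto simp: z M.M.a_ac)
  qed (auto simp: M.R.cring_axioms M.smult_l_distr M.smult_r_distr M.smult_assoc1)
qed

lemma quot_module_hom:
  assumes "module S M" "submodule K S M"
  shows "(\<lambda>x. K +>\<^bsub>M\<^esub> x) \<in> mod_hom S M (quot_module M K)"
  by (rule mod_homI) (auto simp: quot_module_carrier quot_module_add[OF assms] quot_module_smult[OF assms])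

subsection \<open>Transfer of the number of generators\<close>

text \<open>In \<open>sc\<close> the scalar \<open>t\<close> is found for each \<open>s\<close>
  separately instead of being the value of a ring homomorphism. Two rings will be related by a
  surjection in one direction only, and in the other direction a scalar merely has some lift; this
  form covers both.\<close>

lemma submodule_vimage_semilinear:
  assumes "module S A" "module T B" "submodule H T B"
    and h: "\<And>x. x \<in> carrier A \<Longrightarrow> h x \<in> carrier B"
    and add: "\<And>x y. x \<in> carrier A \<Longrightarrow> y \<in> carrier A \<Longrightarrow> h (x \<oplus>\<^bsub>A\<^esub> y) = h x \<oplus>\<^bsub>B\<^esub> h y"
    and sc: "\<And>s. s \<in> carrier S \<Longrightarrow> \<exists>t\<in>carrier T. \<forall>x\<in>carrier A. h (s \<odot>\<^bsub>A\<^esub> x) = t \<odot>\<^bsub>B\<^esub> h x"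
  shows "submodule {x \<in> carrier A. h x \<in> H} S A"
proof -
  interpret A: module S A by fact
  interpret B: module T B by fact
  note E = B.submoduleE[OF assms(3)]
  have z: "h \<zero>\<^bsub>A\<^esub> = \<zero>\<^bsub>B\<^esub>"
    using add[of "\<zero>\<^bsub>A\<^esub>" "\<zero>\<^bsub>A\<^esub>"] h[of "\<zero>\<^bsub>A\<^esub>"] by (simp add: B.M.add.l_cancel_one)
  show ?thesis
  proof (rule submodule_combine[OF assms(1)])
    show "s \<odot>\<^bsub>A\<^esub> x \<in> {x \<in> carrier A. h x \<in> H}"
      if "s \<in> carrier S" "x \<in> {x \<in> carrier A. h x \<in> H}" for s x
      using sc[OF that(1)] that E(4) by fastforce
  qed (use z add E submodule_zero[OF assms(2,3)] in auto)
qed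

text \<open>The elements of \<open>A\<close> that go into the span of the images of \<open>X\<close>
  form a submodule that contains \<open>X\<close>, hence all of \<open>A\<close>; so images of
  generators generate. If \<open>A\<close> has no finite generating set, the right side is
  \<infinity>.\<close>

lemma min_gens_le_surj:
  assumes "module S A" "module T B"
    and h: "h ` carrier A = carrier B"
    and add: "\<And>x y. x \<in> carrier A \<Longrightarrow> y \<in> carrier A \<Longrightarrow> h (x \<oplus>\<^bsub>A\<^esub> y) = h x \<oplus>\<^bsub>B\<^esub> h y"
    and sc: "\<And>s. s \<in> carrier S \<Longrightarrow> \<exists>t\<in>carrier T. \<forall>x\<in>carrier A. h (s \<odot>\<^bsub>A\<^esub> x) = t \<odot>\<^bsub>B\<^esub> h x"
  shows "min_gens T B \<le> min_gens S A"
  unfolding min_gens_def[of S]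
proof (rule Inf_greatest, clarify)
  fix X assume X: "finite X" "X \<subseteq> carrier A" "mod_span S A X = carrier A"
  have hX: "h ` X \<subseteq> carrier B" using X(2) h by auto
  have "submodule {x \<in> carrier A. h x \<in> mod_span T B (h ` X)} S A"
    using mod_span_submodule(1)[OF assms(2) hX] h add sc
    by (intro submodule_vimage_semilinear[OF assms(1,2)]) auto
  from mod_span_least[OF this, of X] X mod_span_submodule(2)[OF assms(2) hX]
  have "h ` carrier A \<subseteq> mod_span T B (h ` X)" by auto
  moreover have "mod_span T B (h ` X) \<subseteq> carrier B"
    by (rule mod_span_least[OF module.carrier_is_submodule[OF assms(2)] hX])
  ultimately have "mod_span T B (h ` X) = carrier B" using h by auto
  with X(1) hX have "min_gens T B \<le> enat (card (h ` X))"
    unfolding min_gens_def by (intro Inf_lower) auto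
  also have "\<dots> \<le> enat (card X)" using X(1) by (simp add: card_image_le)
  finally show "min_gens T B \<le> enat (card X)" .
qed

text \<open>The bound for surjections applies to \<open>h\<close> and to its inverse;
  \<open>sc'\<close> matches the scalars for the inverse.\<close>

lemma min_gens_eq_bij:
  assumes "module S A" "module T B"
    and bij: "bij_betw h (carrier A) (carrier B)"
    and add: "\<And>x y. x \<in> carrier A \<Longrightarrow> y \<in> carrier A \<Longrightarrow> h (x \<oplus>\<^bsub>A\<^esub> y) = h x \<oplus>\<^bsub>B\<^esub> h y"
    and sc: "\<And>s. s \<in> carrier S \<Longrightarrow> \<exists>t\<in>carrier T. \<forall>x\<in>carrier A. h (s \<odot>\<^bsub>A\<^esub> x) = t \<odot>\<^bsub>B\<^esub> h x"
    and sc': "\<And>t. t \<in> carrier T \<Longrightarrow> \<exists>s\<in>carrier S. \<forall>x\<in>carrier A. h (s \<odot>\<^bsub>A\<^esub> x) = t \<odot>\<^bsub>B\<^esub> h x"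
  shows "min_gens S A = min_gens T B"
proof (rule antisym)
  interpret A: module S A by fact
  interpret B: module T B by fact
  let ?g = "inv_into (carrier A) h"
  have im: "h ` carrier A = carrier B" and inj: "inj_on h (carrier A)"
    using bij by (auto simp: bij_betw_def)
  show "min_gens T B \<le> min_gens S A"
    by (rule min_gens_le_surj[OF assms(1,2) im add sc])
  have g: "?g y \<in> carrier A" "h (?g y) = y" if "y \<in> carrier B" for y
    using that im by (auto intro: inv_into_into f_inv_into_f)
  have gh: "?g (h x) = x" if "x \<in> carrier A" for x using that inj by simp
  show "min_gens S A \<le> min_gens T B"
  proof (rule min_gens_le_surj[OF assms(2,1)])
    show "?g ` carrier B = carrier A"
      using im inj by (metis inv_into_image_cancel order_refl)
    show "?g (x \<oplus>\<^bsub>B\<^esub> y) = ?g x \<oplus>\<^bsub>A\<^esub> ?g y" if "x \<in> carrier B" "y \<in> carrier B" for x y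
      using gh[of "?g x \<oplus>\<^bsub>A\<^esub> ?g y"] that g add by simp
    show "\<exists>s\<in>carrier S. \<forall>x\<in>carrier B. ?g (t \<odot>\<^bsub>B\<^esub> x) = s \<odot>\<^bsub>A\<^esub> ?g x" if t: "t \<in> carrier T" for t
    proof -
      from sc'[OF t] obtain s where s: "s \<in> carrier S" "\<forall>x\<in>carrier A. h (s \<odot>\<^bsub>A\<^esub> x) = t \<odot>\<^bsub>B\<^esub> h x"
        by blast
      have "?g (t \<odot>\<^bsub>B\<^esub> x) = s \<odot>\<^bsub>A\<^esub> ?g x" if "x \<in> carrier B" for x
        using gh[of "s \<odot>\<^bsub>A\<^esub> ?g x"] s that g by simp
      with s show ?thesis by blast
    qed
  qed
qed

text \<open>By \<open>KL\<close> the induced map on cosets is well defined and injective.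
  Surjectivity is asked only modulo \<open>L\<close>, because a map of cycles will hit a given cycle
  only up to a boundary.\<close>

lemma min_gens_quot_eq:
  assumes "module S A" "module T B" "submodule K S A" "submodule L T B"
    and h: "\<And>x. x \<in> carrier A \<Longrightarrow> h x \<in> carrier B"
    and add: "\<And>x y. x \<in> carrier A \<Longrightarrow> y \<in> carrier A \<Longrightarrow> h (x \<oplus>\<^bsub>A\<^esub> y) = h x \<oplus>\<^bsub>B\<^esub> h y"
    and sc: "\<And>s. s \<in> carrier S \<Longrightarrow> \<exists>t\<in>carrier T. \<forall>x\<in>carrier A. h (s \<odot>\<^bsub>A\<^esub> x) = t \<odot>\<^bsub>B\<^esub> h x"
    and sc': "\<And>t. t \<in> carrier T \<Longrightarrow> \<exists>s\<in>carrier S. \<forall>x\<in>carrier A. h (s \<odot>\<^bsub>A\<^esub> x) = t \<odot>\<^bsub>B\<^esub> h x"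
    and KL: "\<And>x. x \<in> carrier A \<Longrightarrow> h x \<in> L \<longleftrightarrow> x \<in> K"
    and surj: "\<And>y. y \<in> carrier B \<Longrightarrow> \<exists>x\<in>carrier A. h x \<ominus>\<^bsub>B\<^esub> y \<in> L"
  shows "min_gens S (quot_module A K) = min_gens T (quot_module B L)"
proof -
  interpret A: module S A by fact
  interpret B: module T B by fact
  have hm: "h (\<ominus>\<^bsub>A\<^esub> x) = \<ominus>\<^bsub>B\<^esub> h x" if "x \<in> carrier A" for x
  proof -
    have z: "h \<zero>\<^bsub>A\<^esub> = \<zero>\<^bsub>B\<^esub>"
      using add[of "\<zero>\<^bsub>A\<^esub>" "\<zero>\<^bsub>A\<^esub>"] h[of "\<zero>\<^bsub>A\<^esub>"] by (simp add: B.M.add.l_cancel_one)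
    have "h (\<ominus>\<^bsub>A\<^esub> x) \<oplus>\<^bsub>B\<^esub> h x = \<zero>\<^bsub>B\<^esub>" using add[of "\<ominus>\<^bsub>A\<^esub> x" x] that z by (simp add: A.M.l_neg)
    then show ?thesis using that h by (intro B.M.minus_equality[symmetric]) auto
  qed
  have hd: "h (x \<ominus>\<^bsub>A\<^esub> y) = h x \<ominus>\<^bsub>B\<^esub> h y" if "x \<in> carrier A" "y \<in> carrier A" for x y
    using that add hm by (simp add: a_minus_def)
  have E: "L +>\<^bsub>B\<^esub> h x = L +>\<^bsub>B\<^esub> h y \<longleftrightarrow> K +>\<^bsub>A\<^esub> x = K +>\<^bsub>A\<^esub> y"
    if "x \<in> carrier A" "y \<in> carrier A" for x y
    using that h KL[of "x \<ominus>\<^bsub>A\<^esub> y"]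
    by (simp add: a_r_coset_eq_iff[OF assms(1,3)] a_r_coset_eq_iff[OF assms(2,4)] hd)
  \<comment> \<open>A representative of the coset is chosen; \<open>E\<close> shows that the value
    does not depend on it.\<close>
  define g where "g X = L +>\<^bsub>B\<^esub> h (SOME x. x \<in> carrier A \<and> X = K +>\<^bsub>A\<^esub> x)" for X
  have g: "g (K +>\<^bsub>A\<^esub> x) = L +>\<^bsub>B\<^esub> h x" if x: "x \<in> carrier A" for x
  proof -
    let ?y = "SOME y. y \<in> carrier A \<and> K +>\<^bsub>A\<^esub> x = K +>\<^bsub>A\<^esub> y"
    have "?y \<in> carrier A \<and> K +>\<^bsub>A\<^esub> x = K +>\<^bsub>A\<^esub> ?y" by (rule someI[of _ x]) (use x in auto)
    then show ?thesis using E[OF x, of ?y] by (simp add: g_def)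
  qed
  note [simp] = quot_module_carrier quot_module_add[OF assms(1,3)] quot_module_smult[OF assms(1,3)]
    quot_module_add[OF assms(2,4)] quot_module_smult[OF assms(2,4)]
  show ?thesis
  proof (rule min_gens_eq_bij[OF quot_module_module[OF assms(1,3)] quot_module_module[OF assms(2,4)], of g])
    have "inj_on g (carrier (quot_module A K))"
      by (rule inj_onI) (auto simp: g E)
    moreover have "L +>\<^bsub>B\<^esub> y \<in> g ` carrier (quot_module A K)" if y: "y \<in> carrier B" for y
    proof -
      from surj[OF y] obtain x where x: "x \<in> carrier A" "h x \<ominus>\<^bsub>B\<^esub> y \<in> L" by blast
      then have "g (K +>\<^bsub>A\<^esub> x) = L +>\<^bsub>B\<^esub> y" using y h
        by (simp add: g a_r_coset_eq_iff[OF assms(2,4)])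
      with x show ?thesis by (auto intro: rev_image_eqI)
    qed
    ultimately show "bij_betw g (carrier (quot_module A K)) (carrier (quot_module B L))"
      using h by (auto simp: bij_betw_def g)
    show "\<exists>t\<in>carrier T. \<forall>x\<in>carrier (quot_module A K).
        g (s \<odot>\<^bsub>quot_module A K\<^esub> x) = t \<odot>\<^bsub>quot_module B L\<^esub> g x" if "s \<in> carrier S" for s

    proof -
      from sc[OF that] obtain t where t: "t \<in> carrier T" "\<forall>x\<in>carrier A. h (s \<odot>\<^bsub>A\<^esub> x) = t \<odot>\<^bsub>B\<^esub> h x"
        by blast
      with that h show ?thesis by (intro bexI[of _ t]) (auto simp: g)
    qed
    show "\<exists>s\<in>carrier S. \<forall>x\<in>carrier (quot_module A K).
        g (s \<odot>\<^bsub>quot_module A K\<^esub> x) = t \<odot>\<^bsub>quot_module B L\<^esub> g x" if "t \<in> carrier T" for t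
    proof -
      from sc'[OF that] obtain s where s: "s \<in> carrier S" "\<forall>x\<in>carrier A. h (s \<odot>\<^bsub>A\<^esub> x) = t \<odot>\<^bsub>B\<^esub> h x"
        by blast
      with that h show ?thesis by (intro bexI[of _ s]) (auto simp: g)
    qed
  qed (use h add in \<open>auto simp: g\<close>)
qed

lemma (in abelian_group) minus_eq_zero_iff:
  assumes "x \<in> carrier G" "y \<in> carrier G"
  shows "x \<ominus> y = \<zero> \<longleftrightarrow> x = y"
  using assms minus_equality[of x "\<ominus> y"] by (auto simp: a_minus_def r_neg)

section \<open>Complexes and their homology\<close>

lemma chain_complexD:
  assumes "chain_complex S C"
  shows "module S (cmod C i)" "cdiff C i \<in> mod_hom S (cmod C i) (cmod C (i - 1))"
    "x \<in> carrier (cmod C i) \<Longrightarrow> cdiff C (i - 1) (cdiff C i x) = \<zero>\<^bsub>cmod C (i - 2)\<^esub>"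
  using assms by (auto simp: chain_complex_def)

lemma cycles_iff: "x \<in> cycles C i \<longleftrightarrow> x \<in> carrier (cmod C i) \<and> cdiff C i x = \<zero>\<^bsub>cmod C (i - 1)\<^esub>"
  by (auto simp: cycles_def a_kernel_def')

lemma boundaries_iff: "y \<in> boundaries C i \<longleftrightarrow> (\<exists>x\<in>carrier (cmod C (i + 1)). y = cdiff C (i + 1) x)"
  by (auto simp: boundaries_def)

lemma cycles_submodule:
  assumes "chain_complex S C"
  shows "submodule (cycles C i) S (cmod C i)"
  unfolding cycles_def using chain_complexD[OF assms] by (blast intro: mod_hom_kernel_submodule)

lemma boundaries_submodule:
  assumes "chain_complex S C"
  shows "submodule (boundaries C i) S (cmod C i)"
proof -
  note C = chain_complexD[OF assms]
  have d: "cdiff C (i + 1) \<in> mod_hom S (cmod C (i + 1)) (cmod C i)" using C(2)[of "i + 1"] by simp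
  interpret A: module S "cmod C (i + 1)" by (rule C(1))
  show ?thesis
  proof (rule submodule_combine[OF C(1)])
    show "boundaries C i \<subseteq> carrier (cmod C i)" using mod_hom_closed[OF d] by (auto simp: boundaries_iff)
    show "\<zero>\<^bsub>cmod C i\<^esub> \<in> boundaries C i"
      using mod_hom_zero[OF C(1) C(1) d] by (force simp: boundaries_iff)
    show "x \<oplus>\<^bsub>cmod C i\<^esub> y \<in> boundaries C i" if "x \<in> boundaries C i" "y \<in> boundaries C i" for x y
      using that mod_hom_add[OF d] by (auto simp: boundaries_iff) (metis A.M.a_closed)
    show "s \<odot>\<^bsub>cmod C i\<^esub> x \<in> boundaries C i" if "s \<in> carrier S" "x \<in> boundaries C i" for s x
      using that mod_hom_smult[OF d] by (auto simp: boundaries_iff) (metis A.smult_closed)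
  qed
qed

lemma boundaries_subset_cycles:
  assumes "chain_complex S C"
  shows "boundaries C i \<subseteq> cycles C i"
proof
  note C = chain_complexD[OF assms]
  fix y assume "y \<in> boundaries C i"
  then obtain x where x: "x \<in> carrier (cmod C (i + 1))" "y = cdiff C (i + 1) x"
    by (auto simp: boundaries_iff)
  show "y \<in> cycles C i"
    using mod_hom_closed[OF C(2) x(1)] C(3)[OF x(1)] by (simp add: cycles_iff x(2))
qed

text \<open>The additive inverse is described by a condition on the carrier, so it has to be shown
  that shrinking the carrier to a submodule leaves it unchanged.\<close>

lemma minus_restrict:
  assumes "module S M" "submodule H S M" "x \<in> H" "y \<in> H"
  shows "x \<ominus>\<^bsub>M\<lparr>carrier := H\<rparr>\<^esub> y = x \<ominus>\<^bsub>M\<^esub> y"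
proof -
  interpret M: module S M by fact
  have "a_inv (M\<lparr>carrier := H\<rparr>) y = a_inv M y"
    unfolding a_inv_def
    using group.m_inv_consistent[OF M.M.a_group submodule.axioms(1)[OF assms(2)] assms(4)] by simp
  then show ?thesis by (simp add: a_minus_def)
qed

lemma submodule_restrict:
  assumes "module S M" "submodule H S M" "submodule K S M" "K \<subseteq> H"
  shows "submodule K S (M\<lparr>carrier := H\<rparr>)"
proof -
  interpret M: module S M by fact
  note E = M.submoduleE[OF assms(3)]
  have "module S (M\<lparr>carrier := H\<rparr>)" by (rule submodule.submodule_is_module[OF assms(2,1)])
  then show ?thesis using E assms(4) submodule_zero[OF assms(1,3)]
    by (intro submodule_combine) auto
qed

text \<open>This is the form in which all comparisons of homology are made: one degree, maps given
  only on cycles, rings that may differ. The conditions \<open>inj\<close> and \<open>surj\<close>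
  are what a homotopy inverse provides.\<close>

lemma homology_min_gens_eq:
  assumes C: "chain_complex S C" and D: "chain_complex T D"
    and cyc: "\<And>x. x \<in> cycles C i \<Longrightarrow> h x \<in> cycles D j"
    and add: "\<And>x y. x \<in> cycles C i \<Longrightarrow> y \<in> cycles C i \<Longrightarrow> h (x \<oplus>\<^bsub>cmod C i\<^esub> y) = h x \<oplus>\<^bsub>cmod D j\<^esub> h y"
    and sc: "\<And>s. s \<in> carrier S \<Longrightarrow>
      \<exists>t\<in>carrier T. \<forall>x\<in>cycles C i. h (s \<odot>\<^bsub>cmod C i\<^esub> x) = t \<odot>\<^bsub>cmod D j\<^esub> h x"
    and sc': "\<And>t. t \<in> carrier T \<Longrightarrow>
      \<exists>s\<in>carrier S. \<forall>x\<in>cycles C i. h (s \<odot>\<^bsub>cmod C i\<^esub> x) = t \<odot>\<^bsub>cmod D j\<^esub> h x"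
    and bd: "\<And>x. x \<in> boundaries C i \<Longrightarrow> h x \<in> boundaries D j"
    and inj: "\<And>x. x \<in> cycles C i \<Longrightarrow> h x \<in> boundaries D j \<Longrightarrow> x \<in> boundaries C i"
    and surj: "\<And>y. y \<in> cycles D j \<Longrightarrow>
      \<exists>x\<in>cycles C i. \<exists>b\<in>boundaries D j. h x = y \<oplus>\<^bsub>cmod D j\<^esub> b"
  shows "min_gens S (homology C i) = min_gens T (homology D j)"
proof -
  note C' = chain_complexD(1)[OF C] cycles_submodule[OF C] boundaries_submodule[OF C]
    boundaries_subset_cycles[OF C]
  note D' = chain_complexD(1)[OF D] cycles_submodule[OF D] boundaries_submodule[OF D]
    boundaries_subset_cycles[OF D]
  show ?thesis
    unfolding homology_def
  proof (rule min_gens_quot_eq[where h = h])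
    show "module S (cmod C i\<lparr>carrier := cycles C i\<rparr>)" "module T (cmod D j\<lparr>carrier := cycles D j\<rparr>)"
      using C' D' by (blast intro: submodule.submodule_is_module)+
    show "submodule (boundaries C i) S (cmod C i\<lparr>carrier := cycles C i\<rparr>)"
      "submodule (boundaries D j) T (cmod D j\<lparr>carrier := cycles D j\<rparr>)"
      using C' D' by (blast intro: submodule_restrict)+
    fix y assume "y \<in> carrier (cmod D j\<lparr>carrier := cycles D j\<rparr>)"
    then have y: "y \<in> cycles D j" by simp
    from surj[OF this] obtain x b where x: "x \<in> cycles C i" "b \<in> boundaries D j"
      "h x = y \<oplus>\<^bsub>cmod D j\<^esub> b" by blast
    interpret M: module T "cmod D j" by (rule D')
    have "b \<in> carrier (cmod D j)" "y \<in> carrier (cmod D j)" using x(2) subsetD[OF D'(4)[of j]] y by (auto simp: cycles_iff)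
    moreover from this have "(y \<oplus>\<^bsub>cmod D j\<^esub> b) \<oplus>\<^bsub>cmod D j\<^esub> \<ominus>\<^bsub>cmod D j\<^esub> y =
        b \<oplus>\<^bsub>cmod D j\<^esub> (y \<oplus>\<^bsub>cmod D j\<^esub> \<ominus>\<^bsub>cmod D j\<^esub> y)"
      by (simp add: M.M.a_ac)
    ultimately have "h x \<ominus>\<^bsub>cmod D j\<^esub> y = b" by (simp add: x(3) a_minus_def M.M.r_neg)
    with x(1,2) show "\<exists>x\<in>carrier (cmod C i\<lparr>carrier := cycles C i\<rparr>).
        h x \<ominus>\<^bsub>cmod D j\<lparr>carrier := cycles D j\<rparr>\<^esub> y \<in> boundaries D j"
      using minus_restrict[OF D'(1,2) cyc y] by (intro bexI[of _ x]) auto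
  qed (use cyc add sc sc' bd inj in auto)
qed

section \<open>Free modules\<close>

text \<open>The induction runs over a finite set that contains the support, so that a coefficient
  that happens to vanish can be passed over.\<close>

lemma free_module_support_induct:
  assumes "cring S" "u \<in> carrier (free_module S X)"
    and zero: "P (\<lambda>_. \<zero>\<^bsub>S\<^esub>)"
    and step: "\<And>s x v. s \<in> carrier S \<Longrightarrow> x \<in> X \<Longrightarrow> v \<in> carrier (free_module S X) \<Longrightarrow> P v \<Longrightarrow>
      P (v \<oplus>\<^bsub>free_module S X\<^esub> s \<odot>\<^bsub>free_module S X\<^esub> basis_elt S x)"
  shows "P u"
proof -
  interpret cring S by fact
  have "P u" if "finite F" "{x. u x \<noteq> \<zero>\<^bsub>S\<^esub>} \<subseteq> F" "u \<in> carrier (free_module S X)" for F u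
    using that
  proof (induction F arbitrary: u)
    case empty
    then have "u = (\<lambda>_. \<zero>\<^bsub>S\<^esub>)" by auto
    then show ?case using zero by simp
  next
    case (insert x F)
    show ?case
    proof (cases "u x = \<zero>\<^bsub>S\<^esub>")
      case True
      then show ?thesis using insert by blast
    next
      case False
      then have x: "x \<in> X" using insert.prems(2) by (auto simp: free_module_carrier)
      let ?v = "u(x := \<zero>\<^bsub>S\<^esub>)"
      have "{y. ?v y \<noteq> \<zero>\<^bsub>S\<^esub>} \<subseteq> {y. u y \<noteq> \<zero>\<^bsub>S\<^esub>}" by auto
      moreover have "finite {y. u y \<noteq> \<zero>\<^bsub>S\<^esub>}"
        using insert.prems(2) by (simp add: free_module_carrier)
      ultimately have "finite {y. ?v y \<noteq> \<zero>\<^bsub>S\<^esub>}" by (rule finite_subset)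
      then have v: "?v \<in> carrier (free_module S X)"
        using insert.prems(2) by (simp add: free_module_carrier)
      have c: "u y \<in> carrier S" for y using free_module_coeff[OF assms(1) insert.prems(2)] .
      have eq: "?v \<oplus>\<^bsub>free_module S X\<^esub> u x \<odot>\<^bsub>free_module S X\<^esub> basis_elt S x = u"
        using c by (auto simp: basis_elt_def fun_eq_iff)
      have "P ?v" using insert.prems(1) by (intro insert.IH v) auto
      from step[OF c[of x] x v this] show ?thesis unfolding eq .
    qed
  qed
  then show ?thesis using assms(2) by (auto simp: free_module_carrier)
qed

lemma free_module_hom_eq:
  assumes "module S A" "g \<in> mod_hom S (free_module S X) A" "h \<in> mod_hom S (free_module S X) A"
    and eq: "\<And>x. x \<in> X \<Longrightarrow> g (basis_elt S x) = h (basis_elt S x)"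
    and "u \<in> carrier (free_module S X)"
  shows "g u = h u"
proof -
  interpret A: module S A by fact
  interpret F: module S "free_module S X" by (rule module_free_module[OF A.R.cring_axioms])
  note z = mod_hom_zero[OF F.module_axioms assms(1)]
  note b = basis_elt_closed[OF A.R.cring_axioms]
  show ?thesis
    using A.R.cring_axioms assms(5)
  proof (rule free_module_support_induct)
    show "g (\<lambda>_. \<zero>\<^bsub>S\<^esub>) = h (\<lambda>_. \<zero>\<^bsub>S\<^esub>)"
      using z[OF assms(2)] z[OF assms(3)] by simp
  next
    fix s x v
    assume "s \<in> carrier S" "x \<in> X" "v \<in> carrier (free_module S X)" "g v = h v"
    then show "g (v \<oplus>\<^bsub>free_module S X\<^esub> s \<odot>\<^bsub>free_module S X\<^esub> basis_elt S x) =
        h (v \<oplus>\<^bsub>free_module S X\<^esub> s \<odot>\<^bsub>free_module S X\<^esub> basis_elt S x)"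
      using assms(2,3) b[of x X] F.smult_closed[of s "basis_elt S x"]
      by (simp only: mod_hom_add mod_hom_smult eq)
  qed
qed

text \<open>Freeness as projectivity: for each basis element an image with the property
  \<open>P\<close> is picked separately. In the applications \<open>P\<close> says that the image
  lifts a given element along a differential or an augmentation.\<close>

lemma ex_free_module_hom:
  assumes "module S A" "\<And>x. x \<in> X \<Longrightarrow> \<exists>a. a \<in> carrier A \<and> P x a"
  obtains h where "h \<in> mod_hom S (free_module S X) A" "\<And>x. x \<in> X \<Longrightarrow> P x (h (basis_elt S x))"
proof -
  from assms(2) obtain g where g: "\<And>x. x \<in> X \<Longrightarrow> g x \<in> carrier A \<and> P x (g x)" by metis
  then have "g \<in> X \<rightarrow> carrier A" by auto
  from lin_ext_hom[OF assms(1) this] lin_ext_basis_elt[OF assms(1) this] g show ?thesis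
    by (intro that[of "lin_ext S A g"]) auto
qed

section \<open>Restriction of scalars\<close>

lemma restrict_scalars_simps [simp]:
  "carrier (restrict_scalars p M) = carrier M" "\<zero>\<^bsub>restrict_scalars p M\<^esub> = \<zero>\<^bsub>M\<^esub>"
  "x \<oplus>\<^bsub>restrict_scalars p M\<^esub> y = x \<oplus>\<^bsub>M\<^esub> y" "s \<odot>\<^bsub>restrict_scalars p M\<^esub> x = p s \<odot>\<^bsub>M\<^esub> x"
  by (simp_all add: restrict_scalars_def)

text \<open>Inverses depend only on carrier, zero and addition, and these are untouched by
  restriction of scalars.\<close>

lemma restrict_scalars_a_inv [simp]: "\<ominus>\<^bsub>restrict_scalars p M\<^esub> x = \<ominus>\<^bsub>M\<^esub> x"
  by (simp add: a_inv_def m_inv_def)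

lemma restrict_scalars_a_minus [simp]: "x \<ominus>\<^bsub>restrict_scalars p M\<^esub> y = x \<ominus>\<^bsub>M\<^esub> y"
  by (simp add: a_minus_def)

lemma restrict_scalars_signed [simp]: "signed (restrict_scalars p M) k x = signed M k x"
  by (simp add: signed_def)

lemma restrict_scalars_module:
  assumes "cring S" "p \<in> ring_hom S T" "module T M"
  shows "module S (restrict_scalars p M)"
proof -
  interpret S: cring S by fact
  interpret M: module T M by fact
  show ?thesis
    by (rule moduleI[OF assms(1)], rule abelian_groupI)
       (use ring_hom_closed[OF assms(2)] ring_hom_add[OF assms(2)] ring_hom_mult[OF assms(2)]
          ring_hom_one[OF assms(2)]
        in \<open>auto simp: M.smult_l_distr M.smult_r_distr M.smult_assoc1 M.M.a_ac
          intro!: bexI[of _ "\<ominus>\<^bsub>M\<^esub> x" for x] M.M.l_neg\<close>)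
qed

lemma restrict_scalars_hom:
  assumes "p \<in> ring_hom S T" "h \<in> mod_hom T A B"
  shows "h \<in> mod_hom S (restrict_scalars p A) (restrict_scalars p B)"
  using assms by (auto simp: mod_hom_def ring_hom_closed)

lemma restrict_scalars_hom_surj:
  assumes "p ` carrier S = carrier T" "h \<in> mod_hom S (restrict_scalars p A) (restrict_scalars p B)"
  shows "h \<in> mod_hom T A B"
  using assms by (auto simp: mod_hom_def) force

lemma restrict_scalars_cplx_simps [simp]:
  "cmod (restrict_scalars_cplx p C) i = restrict_scalars p (cmod C i)"
  "cdiff (restrict_scalars_cplx p C) = cdiff C"
  by (simp_all add: restrict_scalars_cplx_def)

lemma restrict_scalars_cplx_complex:
  assumes "cring S" "p \<in> ring_hom S T" "chain_complex T C"
  shows "chain_complex S (restrict_scalars_cplx p C)"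
  unfolding chain_complex_def
  using restrict_scalars_module[OF assms(1,2) chain_complexD(1)[OF assms(3)]]
    restrict_scalars_hom[OF assms(2) chain_complexD(2)[OF assms(3)]] chain_complexD(3)[OF assms(3)]
  by simp

text \<open>The value at \<open>y\<close> is \<open>h\<close> at an arbitrary preimage of
  \<open>y\<close>. Two preimages differ by an element of the kernel of \<open>r\<close>, which
  \<open>h\<close> kills.\<close>

lemma factor_through_surj:
  assumes "module S A" "module S B" "module S C" "r \<in> mod_hom S A B" "r ` carrier A = carrier B"
    and "h \<in> mod_hom S A C" "\<And>x. x \<in> carrier A \<Longrightarrow> r x = \<zero>\<^bsub>B\<^esub> \<Longrightarrow> h x = \<zero>\<^bsub>C\<^esub>"
  obtains g where "g \<in> mod_hom S B C" "\<And>x. x \<in> carrier A \<Longrightarrow> g (r x) = h x"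
proof -
  interpret A: module S A by fact
  interpret B: module S B by fact
  interpret C: module S C by fact
  define g where "g y = h (SOME x. x \<in> carrier A \<and> r x = y)" for y
  have g: "g (r x) = h x" if x: "x \<in> carrier A" for x
  proof -
    let ?z = "SOME z. z \<in> carrier A \<and> r z = r x"
    have z: "?z \<in> carrier A \<and> r ?z = r x" by (rule someI[of _ x]) (use x in auto)
    then have "r (?z \<ominus>\<^bsub>A\<^esub> x) = \<zero>\<^bsub>B\<^esub>"
      using x mod_hom_closed[OF assms(4)]
      by (simp add: mod_hom_diff[OF assms(1,2,4)] B.M.minus_eq_zero_iff)
    then have "h (?z \<ominus>\<^bsub>A\<^esub> x) = \<zero>\<^bsub>C\<^esub>" using z x assms(7) by simp
    then have "h ?z \<ominus>\<^bsub>C\<^esub> h x = \<zero>\<^bsub>C\<^esub>" using z x by (simp add: mod_hom_diff[OF assms(1,3,6)])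
    then show ?thesis using z x mod_hom_closed[OF assms(6)] by (simp add: g_def C.M.minus_eq_zero_iff)
  qed
  have "g \<in> mod_hom S B C"
  proof (rule mod_homI)
    show "g y \<in> carrier C" if "y \<in> carrier B" for y
      using that mod_hom_closed[OF assms(6)] unfolding assms(5)[symmetric] by (auto simp: g)
    show "g (x \<oplus>\<^bsub>B\<^esub> y) = g x \<oplus>\<^bsub>C\<^esub> g y" if "x \<in> carrier B" "y \<in> carrier B" for x y
      using that unfolding assms(5)[symmetric]
      by (auto simp: g mod_hom_add[OF assms(4), symmetric] mod_hom_add[OF assms(6)])
    show "g (s \<odot>\<^bsub>B\<^esub> x) = s \<odot>\<^bsub>C\<^esub> g x" if "s \<in> carrier S" "x \<in> carrier B" for s x
      using that unfolding assms(5)[symmetric]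
      by (auto simp: g mod_hom_smult[OF assms(4), symmetric] mod_hom_smult[OF assms(6)])
  qed
  then show ?thesis using g that by blast
qed

section \<open>Free resolutions\<close>

text \<open>The bases \<open>Y k\<close> belong to the data because maps out of the resolution are
  prescribed on them. The complex extends over all integers with empty bases below 0; in degree 0
  exactness is expressed by the augmentation \<open_eta>.\<close>

definition free_res ::
  "('s, 'z) ring_scheme \<Rightarrow> ('s, 'm) module \<Rightarrow> ('s, 'x \<Rightarrow> 's) cplx \<Rightarrow> (int \<Rightarrow> 'x set) \<Rightarrow>
     (('x \<Rightarrow> 's) \<Rightarrow> 'm) \<Rightarrow> bool" where
  "free_res S M C Y \<eta> \<longleftrightarrow> chain_complex S C \<and> (\<forall>k. cmod C k = free_module S (Y k)) \<and>
     (\<forall>k<0. Y k = {}) \<and> (\<forall>k>0. cycles C k \<subseteq> boundaries C k) \<and>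
     \<eta> \<in> mod_hom S (cmod C 0) M \<and> \<eta> ` carrier (cmod C 0) = carrier M \<and>
     (\<forall>x\<in>carrier (cmod C 0). \<eta> x = \<zero>\<^bsub>M\<^esub> \<longleftrightarrow> x \<in> boundaries C 0)"

lemma free_resD:
  assumes "free_res S M C Y \<eta>"
  shows "chain_complex S C" "cmod C k = free_module S (Y k)" "k < 0 \<Longrightarrow> Y k = {}"
    "k > 0 \<Longrightarrow> x \<in> cycles C k \<Longrightarrow> x \<in> boundaries C k"
    "\<eta> \<in> mod_hom S (cmod C 0) M" "\<eta> ` carrier (cmod C 0) = carrier M"
    "x \<in> carrier (cmod C 0) \<Longrightarrow> \<eta> x = \<zero>\<^bsub>M\<^esub> \<longleftrightarrow> x \<in> boundaries C 0"
  using assms by (auto simp: free_res_def)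

lemma free_resolution_free_res:
  assumes "module S M"
  shows "free_res S M (free_resolution S M)
    (\<lambda>i. if i < 0 then {} else res_basis S M (nat i)) (augmentation S M)"
proof -
  have c: "cmod (free_resolution S M) 0 = free_module S (res_basis S M 0)"
    by (simp add: free_resolution_def)
  show ?thesis
    unfolding free_res_def
    using free_resolution_complex[OF assms] free_resolution_exact(1)[OF assms]
      free_resolution_exact(2,3)[OF assms] augmentation_hom[OF assms]
    by (auto simp: c a_kernel_def' simp del: res_basis.simps) (auto simp: free_resolution_def)
qed

lemma free_res_negative:
  assumes "free_res S M C Y \<eta>" "k < 0" "x \<in> carrier (cmod C k)"
  shows "x = \<zero>\<^bsub>cmod C k\<^esub>"
  using assms(3) free_resD(2,3)[OF assms(1)] assms(2) by (auto simp: free_module_carrier)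

lemma free_res_hom_eq:
  assumes "free_res S M C Y \<eta>" "module S A" "g \<in> mod_hom S (cmod C k) A" "h \<in> mod_hom S (cmod C k) A"
    and "\<And>y. y \<in> Y k \<Longrightarrow> g (basis_elt S y) = h (basis_elt S y)" "x \<in> carrier (cmod C k)"
  shows "g x = h x"
  using free_module_hom_eq[of S A g "Y k" h x] assms(2-) by (simp add: free_resD(2)[OF assms(1)])

lemma free_res_ex_hom:
  assumes "free_res S M C Y \<eta>" "module S A" "\<And>y. y \<in> Y k \<Longrightarrow> \<exists>a. a \<in> carrier A \<and> P y a"
  obtains h where "h \<in> mod_hom S (cmod C k) A" "\<And>y. y \<in> Y k \<Longrightarrow> P y (h (basis_elt S y))"
  using ex_free_module_hom[of S A "Y k" P] assms(2-) by (auto simp: free_resD(2)[OF assms(1)])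

text \<open>The comparison theorem. A lift in degree n can be continued as soon as it sends
  boundaries to boundaries: the differential of a basis element of degree n + 1 is a boundary, so
  its image is one as well and has a preimage. The predicate \<open>P\<close> carries this invariant
  through the dependent choice. In degree 0 it holds because the augmentations detect boundaries, in
  positive degrees because cycles of the target are boundaries.\<close>

lemma free_res_chain_map:
  assumes C: "free_res S M C Y \<eta>" and D: "free_res S M D Y' \<eta>'" and "module S M"
  obtains \<phi> where "\<And>k. \<phi> k \<in> mod_hom S (cmod C k) (cmod D k)"
    "\<And>k x. x \<in> carrier (cmod C k) \<Longrightarrow> cdiff D k (\<phi> k x) = \<phi> (k - 1) (cdiff C k x)"
    "\<And>x. x \<in> carrier (cmod C 0) \<Longrightarrow> \<eta>' (\<phi> 0 x) = \<eta> x"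
proof -
  interpret M: module S M by fact
  note C' = free_resD[OF C] and D' = free_resD[OF D]
  note CC = chain_complexD[OF C'(1)] and DD = chain_complexD[OF D'(1)]
  have be: "basis_elt S y \<in> carrier (cmod C k)" if "y \<in> Y k" for y k
    using basis_elt_closed[OF M.R.cring_axioms that] by (simp add: C'(2))
  define P where "P n h \<longleftrightarrow> h \<in> mod_hom S (cmod C (int n)) (cmod D (int n)) \<and>
      (n = 0 \<longrightarrow> (\<forall>x\<in>carrier (cmod C 0). \<eta>' (h x) = \<eta> x)) \<and>
      (\<forall>x\<in>boundaries C (int n). h x \<in> boundaries D (int n))" for n h
  define R where "R n h h' \<longleftrightarrow> (\<forall>x\<in>carrier (cmod C (int (Suc n))).
      cdiff D (int (Suc n)) (h' x) = h (cdiff C (int (Suc n)) x))" for n h h'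
  have "\<exists>f. \<forall>n. P n (f n) \<and> R n (f n) (f (Suc n))"
  proof (rule dependent_nat_choice)
    have "\<exists>b. b \<in> carrier (cmod D 0) \<and> \<eta>' b = \<eta> (basis_elt S y)" if "y \<in> Y 0" for y
    proof -
      have "\<eta> (basis_elt S y) \<in> carrier M" using mod_hom_closed[OF C'(5) be[OF that]] .
      then show ?thesis unfolding D'(6)[symmetric] by force
    qed
    then obtain h where h: "h \<in> mod_hom S (cmod C 0) (cmod D 0)"
      "\<And>y. y \<in> Y 0 \<Longrightarrow> \<eta>' (h (basis_elt S y)) = \<eta> (basis_elt S y)"
      using free_res_ex_hom[OF C DD(1), of 0 0 "\<lambda>y b. \<eta>' b = \<eta> (basis_elt S y)"] by blast
    have eq: "\<eta>' (h x) = \<eta> x" if "x \<in> carrier (cmod C 0)" for x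
      by (rule free_res_hom_eq[OF C assms(3) mod_hom_comp[OF h(1) D'(5)] C'(5) h(2) that])
    moreover have "h x \<in> boundaries D 0" if "x \<in> boundaries C 0" for x
    proof -
      have x: "x \<in> carrier (cmod C 0)"
        using that boundaries_subset_cycles[OF C'(1), of 0] by (auto simp: cycles_iff)
      with that eq[OF x] C'(7) have "\<eta>' (h x) = \<zero>\<^bsub>M\<^esub>" by simp
      then show ?thesis using D'(7) mod_hom_closed[OF h(1)] x by simp
    qed
    ultimately show "\<exists>h. P 0 h" using h(1) by (auto simp: P_def)
  next
    fix h n assume h: "P n h"
    let ?k = "int (Suc n)"
    have k1: "?k - 1 = int n" by simp
    have dC: "cdiff C ?k \<in> mod_hom S (cmod C ?k) (cmod C (int n))" using CC(2)[of ?k] by simp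
    have dD: "cdiff D ?k \<in> mod_hom S (cmod D ?k) (cmod D (int n))" using DD(2)[of ?k] by simp
    have bd: "cdiff C ?k x \<in> boundaries C (int n)" if "x \<in> carrier (cmod C ?k)" for x
      using that by (auto simp: boundaries_iff add.commute)
    have "\<exists>b. b \<in> carrier (cmod D ?k) \<and> cdiff D ?k b = h (cdiff C ?k (basis_elt S y))" if "y \<in> Y ?k" for y
    proof -
      from bd[OF be[OF that]] h have "h (cdiff C ?k (basis_elt S y)) \<in> boundaries D (int n)"
        by (auto simp: P_def)
      then show ?thesis by (auto simp: boundaries_iff add.commute)
    qed
    then obtain h' where h': "h' \<in> mod_hom S (cmod C ?k) (cmod D ?k)"
      "\<And>y. y \<in> Y ?k \<Longrightarrow> cdiff D ?k (h' (basis_elt S y)) = h (cdiff C ?k (basis_elt S y))"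
      using free_res_ex_hom[OF C DD(1), of ?k ?k
          "\<lambda>y b. cdiff D ?k b = h (cdiff C ?k (basis_elt S y))"] by blast
    have hh: "h \<in> mod_hom S (cmod C (int n)) (cmod D (int n))" using h by (simp add: P_def)
    have eq: "cdiff D ?k (h' x) = h (cdiff C ?k x)" if "x \<in> carrier (cmod C ?k)" for x
      by (rule free_res_hom_eq[OF C DD(1) mod_hom_comp[OF h'(1) dD] mod_hom_comp[OF dC hh] h'(2) that])
    have "h' x \<in> boundaries D ?k" if x: "x \<in> boundaries C ?k" for x
    proof -
      have xc: "x \<in> carrier (cmod C ?k)" "cdiff C ?k x = \<zero>\<^bsub>cmod C (int n)\<^esub>"
        using x boundaries_subset_cycles[OF C'(1), of ?k] by (auto simp: cycles_iff)
      have "h' x \<in> cycles D ?k"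
        using eq[OF xc(1)] mod_hom_zero[OF CC(1) DD(1) hh] xc mod_hom_closed[OF h'(1)]
        by (simp add: cycles_iff)
      then show ?thesis using D'(4)[of ?k] by simp
    qed
    with h'(1) eq show "\<exists>h'. P (Suc n) h' \<and> R n h h'" unfolding P_def R_def by auto
  qed
  then obtain f where f: "\<And>n. P n (f n)" "\<And>n. R n (f n) (f (Suc n))" by blast
  \<comment> \<open>Negative degrees get the zero map. In degrees \<le> 0 both sides of the
    commutation rule land in a zero module.\<close>
  define \<phi> where "\<phi> k = (if k < 0 then (\<lambda>_. \<zero>\<^bsub>cmod D k\<^esub>) else f (nat k))" for k :: int
  show ?thesis
  proof (rule that[of \<phi>])
    show "\<phi> k \<in> mod_hom S (cmod C k) (cmod D k)" for k
      using f(1)[of "nat k"] mod_hom_zero_map[OF DD(1)] by (auto simp: \<phi>_def P_def)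
    show "\<eta>' (\<phi> 0 x) = \<eta> x" if "x \<in> carrier (cmod C 0)" for x
      using f(1)[of 0] that by (auto simp: \<phi>_def P_def)
    show "cdiff D k (\<phi> k x) = \<phi> (k - 1) (cdiff C k x)" if "x \<in> carrier (cmod C k)" for k x
    proof (cases "k \<le> 0")
      case True
      have "cdiff D k (\<phi> k x) \<in> carrier (cmod D (k - 1))"
        using \<open>\<phi> k \<in> _\<close> that mod_hom_closed DD(2) by metis
      then have "cdiff D k (\<phi> k x) = \<zero>\<^bsub>cmod D (k - 1)\<^esub>"
        using free_res_negative[OF D] True by simp
      then show ?thesis using True by (simp add: \<phi>_def)
    next
      case False
      then obtain n where "k = int (Suc n)" by (metis linorder_not_le zero_less_imp_eq_int gr0_conv_Suc)
      then show ?thesis using f(2)[of n] that by (simp add: R_def \<phi>_def nat_add_distrib)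
    qed
  qed
qed

text \<open>An endomorphism that covers the zero map of \<open>M\<close> is null homotopic. The
  invariant is that \<delta> agrees with d h on boundaries: then \<delta> - h d maps into the cycles
  of the next degree, which are boundaries, and the next component of the homotopy is a lift of
  it.\<close>

lemma free_res_null_homotopic:
  assumes C: "free_res S M C Y \<eta>" and M: "module S M"
    and \<delta>: "\<And>k. \<delta> k \<in> mod_hom S (cmod C k) (cmod C k)"
      "\<And>k x. x \<in> carrier (cmod C k) \<Longrightarrow> cdiff C k (\<delta> k x) = \<delta> (k - 1) (cdiff C k x)"
      "\<And>x. x \<in> carrier (cmod C 0) \<Longrightarrow> \<eta> (\<delta> 0 x) = \<zero>\<^bsub>M\<^esub>"
  obtains h where "\<And>k. h k \<in> mod_hom S (cmod C k) (cmod C (k + 1))"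
    "\<And>k x. x \<in> carrier (cmod C k) \<Longrightarrow>
      \<delta> k x = cdiff C (k + 1) (h k x) \<oplus>\<^bsub>cmod C k\<^esub> h (k - 1) (cdiff C k x)"
proof -
  interpret M: module S M by fact
  note C' = free_resD[OF C]
  note CC = chain_complexD[OF C'(1)]
  have be: "basis_elt S y \<in> carrier (cmod C k)" if "y \<in> Y k" for y k
    using basis_elt_closed[OF M.R.cring_axioms that] by (simp add: C'(2))
  have d1: "cdiff C (k + 1) \<in> mod_hom S (cmod C (k + 1)) (cmod C k)" for k
    using CC(2)[of "k + 1"] by simp
  define P where "P n h \<longleftrightarrow> h \<in> mod_hom S (cmod C (int n)) (cmod C (int n + 1)) \<and>
      (n = 0 \<longrightarrow> (\<forall>x\<in>carrier (cmod C 0). \<delta> 0 x = cdiff C 1 (h x))) \<and>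
      (\<forall>x\<in>boundaries C (int n). \<delta> (int n) x = cdiff C (int n + 1) (h x))" for n h
  define R where "R n h h' \<longleftrightarrow> (\<forall>x\<in>carrier (cmod C (int n + 1)).
      \<delta> (int n + 1) x = cdiff C (int n + 2) (h' x) \<oplus>\<^bsub>cmod C (int n + 1)\<^esub> h (cdiff C (int n + 1) x))" for n h h'
  have "\<exists>f. \<forall>n. P n (f n) \<and> R n (f n) (f (Suc n))"
  proof (rule dependent_nat_choice)
    have "\<exists>b. b \<in> carrier (cmod C 1) \<and> \<delta> 0 (basis_elt S y) = cdiff C 1 b" if "y \<in> Y 0" for y
      using \<delta>(3)[OF be[OF that]] C'(7)[OF mod_hom_closed[OF \<delta>(1) be[OF that]]]
      by (auto simp: boundaries_iff)
    then obtain h where h: "h \<in> mod_hom S (cmod C 0) (cmod C 1)"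
      "\<And>y. y \<in> Y 0 \<Longrightarrow> \<delta> 0 (basis_elt S y) = cdiff C 1 (h (basis_elt S y))"
      using free_res_ex_hom[OF C CC(1), of 0 1 "\<lambda>y b. \<delta> 0 (basis_elt S y) = cdiff C 1 b"] by blast
    have eq: "\<delta> 0 x = cdiff C 1 (h x)" if "x \<in> carrier (cmod C 0)" for x
      by (rule free_res_hom_eq[OF C CC(1) \<delta>(1) mod_hom_comp[OF h(1) d1[of 0, simplified]] h(2) that])
    moreover have "x \<in> carrier (cmod C 0)" if "x \<in> boundaries C 0" for x
      using that boundaries_subset_cycles[OF C'(1), of 0] by (auto simp: cycles_iff)
    ultimately show "\<exists>h. P 0 h" using h(1) by (auto simp: P_def)
  next
    fix h n assume h: "P n h"
    let ?k = "int n + 1"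
    interpret K: module S "cmod C ?k" by (rule CC(1))
    have hh: "h \<in> mod_hom S (cmod C (int n)) (cmod C ?k)" using h by (simp add: P_def)
    have dk: "cdiff C ?k \<in> mod_hom S (cmod C ?k) (cmod C (int n))" by (rule d1)
    have bd: "cdiff C ?k x \<in> boundaries C (int n)" if "x \<in> carrier (cmod C ?k)" for x
      using that by (auto simp: boundaries_iff)
    \<comment> \<open>The part of \<delta> that the next component of the homotopy has to account
      for.\<close>
    let ?g = "\<lambda>x. \<delta> ?k x \<ominus>\<^bsub>cmod C ?k\<^esub> h (cdiff C ?k x)"
    have g: "?g \<in> mod_hom S (cmod C ?k) (cmod C ?k)"
      by (rule mod_hom_minusf[OF CC(1) \<delta>(1) mod_hom_comp[OF dk hh]])
    have gb: "?g x \<in> boundaries C ?k" if x: "x \<in> carrier (cmod C ?k)" for x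
    proof -
      interpret N: module S "cmod C (int n)" by (rule CC(1))
      have "cdiff C ?k (?g x) = \<delta> (int n) (cdiff C ?k x) \<ominus>\<^bsub>cmod C (int n)\<^esub> cdiff C ?k (h (cdiff C ?k x))"
        using mod_hom_diff[OF CC(1) CC(1) dk] \<delta>(2)[OF x] mod_hom_closed[OF \<delta>(1) x]
          mod_hom_closed[OF mod_hom_comp[OF dk hh] x] by simp
      also have "\<dots> = \<zero>\<^bsub>cmod C (int n)\<^esub>"
      proof -
        have "\<delta> (int n) (cdiff C ?k x) = cdiff C ?k (h (cdiff C ?k x))"
          using h bd[OF x] by (simp add: P_def)
        then show ?thesis
          using mod_hom_closed[OF \<delta>(1)[of "int n"] mod_hom_closed[OF dk x]]
          by (simp add: N.M.minus_eq_zero_iff)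
      qed
      finally have "?g x \<in> cycles C ?k" using mod_hom_closed[OF g x] by (simp add: cycles_iff)
      then show ?thesis using C'(4)[of ?k] by simp
    qed
    have "\<exists>b. b \<in> carrier (cmod C (int n + 2)) \<and> ?g (basis_elt S y) = cdiff C (int n + 2) b"
      if "y \<in> Y ?k" for y
      using gb[OF be[OF that]] by (auto simp: boundaries_iff add.commute)
    then obtain h' where h': "h' \<in> mod_hom S (cmod C ?k) (cmod C (int n + 2))"
      "\<And>y. y \<in> Y ?k \<Longrightarrow> ?g (basis_elt S y) = cdiff C (int n + 2) (h' (basis_elt S y))"
      using free_res_ex_hom[OF C CC(1), of ?k "int n + 2"
          "\<lambda>y b. ?g (basis_elt S y) = cdiff C (int n + 2) b"] by blast
    have d2: "cdiff C (int n + 2) \<in> mod_hom S (cmod C (int n + 2)) (cmod C ?k)"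
      using d1[of ?k] by (simp add: add.commute)
    have eq: "?g x = cdiff C (int n + 2) (h' x)" if "x \<in> carrier (cmod C ?k)" for x
      by (rule free_res_hom_eq[OF C CC(1) g mod_hom_comp[OF h'(1) d2] h'(2) that])
    have R: "\<delta> ?k x = cdiff C (int n + 2) (h' x) \<oplus>\<^bsub>cmod C ?k\<^esub> h (cdiff C ?k x)"
      if "x \<in> carrier (cmod C ?k)" for x
      unfolding eq[OF that, symmetric]
      using mod_hom_closed[OF \<delta>(1) that] mod_hom_closed[OF mod_hom_comp[OF dk hh] that]
      by (simp add: a_minus_def K.M.a_assoc K.M.l_neg)
    have "\<delta> ?k x = cdiff C (int n + 2) (h' x)" if "x \<in> boundaries C ?k" for x
    proof -
      have x: "x \<in> carrier (cmod C ?k)" "cdiff C ?k x = \<zero>\<^bsub>cmod C (int n)\<^esub>"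
        using that boundaries_subset_cycles[OF C'(1), of ?k] by (auto simp: cycles_iff)
      show ?thesis
        using R[OF x(1)] mod_hom_zero[OF CC(1) CC(1) hh] x mod_hom_closed[OF mod_hom_comp[OF h'(1) d2]] by simp
    qed
    with h'(1) R show "\<exists>h'. P (Suc n) h' \<and> R n h h'"
      by (auto simp: P_def R_def add.commute intro!: exI[of _ h'])
  qed
  then obtain f where f: "\<And>n. P n (f n)" "\<And>n. R n (f n) (f (Suc n))" by blast
  define h where "h k = (if k < 0 then (\<lambda>_. \<zero>\<^bsub>cmod C (k + 1)\<^esub>) else f (nat k))" for k :: int
  show ?thesis
  proof (rule that[of h])
    show hk: "h k \<in> mod_hom S (cmod C k) (cmod C (k + 1))" for k
      using f(1)[of "nat k"] mod_hom_zero_map[OF CC(1)] by (auto simp: h_def P_def)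
    show "\<delta> k x = cdiff C (k + 1) (h k x) \<oplus>\<^bsub>cmod C k\<^esub> h (k - 1) (cdiff C k x)"
      if x: "x \<in> carrier (cmod C k)" for k x
    proof -
      interpret K: module S "cmod C k" by (rule CC(1))
      consider "k < 0" | "k = 0" | n where "k = int n + 1"
        by (metis linorder_less_linear zless_iff_Suc_zadd add.left_neutral int_Suc)
      then show ?thesis
      proof cases
        \<comment> \<open>Both sides lie in a zero module.\<close>
        case 1
        have "\<delta> k x \<in> carrier (cmod C k)"
          "cdiff C (k + 1) (h k x) \<oplus>\<^bsub>cmod C k\<^esub> h (k - 1) (cdiff C k x) \<in> carrier (cmod C k)"
          using mod_hom_closed[OF \<delta>(1) x] mod_hom_closed[OF mod_hom_comp[OF hk d1] x]
            mod_hom_closed[OF mod_hom_comp[OF CC(2) hk[of "k - 1"]] x] by auto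
        then show ?thesis using free_res_negative[OF C 1] by metis
      next
        case 2
        then show ?thesis
          using f(1)[of 0] x mod_hom_closed[OF mod_hom_comp[OF hk d1] x]
            K.M.r_zero by (auto simp: P_def h_def)
      next
        case (3 n)
        then show ?thesis using f(2)[of n] x by (simp add: R_def h_def nat_add_distrib add.commute)
      qed
    qed
  qed
qed

lemma signed_signed:
  assumes "abelian_group A" "x \<in> carrier A"
  shows "signed A k (signed A l x) = signed A (k + l) x"
  using assms by (auto simp: signed_def abelian_group.minus_minus)

lemma signed_add:
  assumes "abelian_group A" "x \<in> carrier A" "y \<in> carrier A"
  shows "signed A k (x \<oplus>\<^bsub>A\<^esub> y) = signed A k x \<oplus>\<^bsub>A\<^esub> signed A k y"
  using assms by (auto simp: signed_def abelian_group.minus_add)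

lemma signed_smult:
  assumes "module S A" "x \<in> carrier A" "s \<in> carrier S"
  shows "signed A k (s \<odot>\<^bsub>A\<^esub> x) = s \<odot>\<^bsub>A\<^esub> signed A k x"
  using assms by (auto simp: signed_def module.smult_r_minus)

section \<open>The Hom complex\<close>

lemma hom_module_iff:
  "g \<in> carrier (hom_module S A B) \<longleftrightarrow> g \<in> mod_hom S A B \<and> g \<in> extensional (carrier A)"
  by (simp add: hom_module_def)

lemma hom_module_simps [simp]:
  "\<zero>\<^bsub>hom_module S A B\<^esub> = (\<lambda>x\<in>carrier A. \<zero>\<^bsub>B\<^esub>)"
  "g \<oplus>\<^bsub>hom_module S A B\<^esub> h = (\<lambda>x\<in>carrier A. g x \<oplus>\<^bsub>B\<^esub> h x)"
  "s \<odot>\<^bsub>hom_module S A B\<^esub> g = (\<lambda>x\<in>carrier A. s \<odot>\<^bsub>B\<^esub> g x)"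
  by (simp_all add: hom_module_def)

lemma mod_hom_restrict:
  assumes "module S A" "h \<in> mod_hom S A B"
  shows "restrict h (carrier A) \<in> mod_hom S A B"
  by (rule mod_hom_cong[OF assms]) simp

lemma hom_module_restrict:
  "module S A \<Longrightarrow> h \<in> mod_hom S A B \<Longrightarrow> restrict h (carrier A) \<in> carrier (hom_module S A B)"
  by (simp add: hom_module_iff mod_hom_restrict)

lemma hom_module_module:
  assumes "module S A" "module S B"
  shows "module S (hom_module S A B)"
proof -
  interpret A: module S A by fact
  interpret B: module S B by fact
  note cl = hom_module_restrict[OF assms(1)]
  show ?thesis
  proof (rule moduleI[OF A.R.cring_axioms])
    show "abelian_group (hom_module S A B)"
    proof (rule abelian_groupI)
      fix g assume g: "g \<in> carrier (hom_module S A B)"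
      show "\<exists>h\<in>carrier (hom_module S A B). h \<oplus>\<^bsub>hom_module S A B\<^esub> g = \<zero>\<^bsub>hom_module S A B\<^esub>"
        using g mod_hom_uminus[OF assms(2), of g A]
        by (intro bexI[OF _ cl[of "\<lambda>x. \<ominus>\<^bsub>B\<^esub> g x"]])
          (auto simp: hom_module_iff mod_hom_closed B.M.l_neg cong: restrict_cong)
      show "\<zero>\<^bsub>hom_module S A B\<^esub> \<oplus>\<^bsub>hom_module S A B\<^esub> g = g"
        using g by (auto simp: hom_module_iff mod_hom_closed fun_eq_iff extensional_def)
      fix h assume h: "h \<in> carrier (hom_module S A B)"
      show "g \<oplus>\<^bsub>hom_module S A B\<^esub> h \<in> carrier (hom_module S A B)"
        using g h cl[OF mod_hom_sum[OF assms(2)]] by (simp add: hom_module_iff)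
      show "g \<oplus>\<^bsub>hom_module S A B\<^esub> h = h \<oplus>\<^bsub>hom_module S A B\<^esub> g"
        using g h by (auto simp: hom_module_iff mod_hom_closed B.M.a_comm cong: restrict_cong)
      fix f assume f: "f \<in> carrier (hom_module S A B)"
      show "g \<oplus>\<^bsub>hom_module S A B\<^esub> h \<oplus>\<^bsub>hom_module S A B\<^esub> f = g \<oplus>\<^bsub>hom_module S A B\<^esub> (h \<oplus>\<^bsub>hom_module S A B\<^esub> f)"
        using g h f by (auto simp: hom_module_iff mod_hom_closed B.M.a_assoc cong: restrict_cong)
    next
      show "\<zero>\<^bsub>hom_module S A B\<^esub> \<in> carrier (hom_module S A B)"
        using cl[OF mod_hom_zero_map[OF assms(2)]] by simp
    qed
    fix s assume s: "s \<in> carrier S"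
    fix g assume g: "g \<in> carrier (hom_module S A B)"
    show "s \<odot>\<^bsub>hom_module S A B\<^esub> g \<in> carrier (hom_module S A B)"
      using g cl[OF mod_hom_scale[OF assms(2) _ s]] by (simp add: hom_module_iff)
  qed (auto simp: hom_module_iff mod_hom_closed B.smult_l_distr B.smult_r_distr B.smult_assoc1
      fun_eq_iff restrict_def extensional_def)
qed

lemma direct_prod_simps [simp]:
  "x \<in> carrier (direct_prod A) \<longleftrightarrow> (\<forall>i. x i \<in> carrier (A i))"
  "\<zero>\<^bsub>direct_prod A\<^esub> = (\<lambda>i. \<zero>\<^bsub>A i\<^esub>)" "x \<oplus>\<^bsub>direct_prod A\<^esub> y = (\<lambda>i. x i \<oplus>\<^bsub>A i\<^esub> y i)"
  "s \<odot>\<^bsub>direct_prod A\<^esub> x = (\<lambda>i. s \<odot>\<^bsub>A i\<^esub> x i)"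
  by (simp_all add: direct_prod_def)

lemma direct_prod_module:
  assumes "\<And>i. module S (A i)"
  shows "module S (direct_prod A)"
proof -
  interpret A: module S "A i" for i by (rule assms)
  show ?thesis
  proof (rule moduleI[OF A.R.cring_axioms])
    show "abelian_group (direct_prod A)"
    proof (rule abelian_groupI)
      fix x assume "x \<in> carrier (direct_prod A)"
      then show "\<exists>y\<in>carrier (direct_prod A). y \<oplus>\<^bsub>direct_prod A\<^esub> x = \<zero>\<^bsub>direct_prod A\<^esub>"
        by (intro bexI[of _ "\<lambda>i. \<ominus>\<^bsub>A i\<^esub> x i"]) (auto simp: A.M.l_neg)
    qed (auto simp: A.M.a_ac)
  qed (auto simp: A.smult_l_distr A.smult_r_distr A.smult_assoc1)
qed

lemma hom_complex_cmod [simp]: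
  "cmod (hom_complex S A B) k = direct_prod (\<lambda>p. hom_module S (cmod A p) (cmod B (p + k)))"
  by (simp add: hom_complex_def)

lemma hom_complex_cdiff:
  "x \<in> carrier (cmod A p) \<Longrightarrow> cdiff (hom_complex S A B) k g p x =
     cdiff B (p + k) (g p x) \<ominus>\<^bsub>cmod B (p + k - 1)\<^esub>
     signed (cmod B (p + k - 1)) k (g (p - 1) (cdiff A p x))"
  by (simp add: hom_complex_def)

lemma hom_complex_cdiff_extensional:
  "cdiff (hom_complex S A B) k g p \<in> extensional (carrier (cmod A p))"
  by (simp add: hom_complex_def)

lemma hom_complex_eqI:
  assumes "\<And>p. g p \<in> extensional (carrier (cmod A p))" "\<And>p. h p \<in> extensional (carrier (cmod A p))"
    and "\<And>p x. x \<in> carrier (cmod A p) \<Longrightarrow> g p x = h p x"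
  shows "g = h"
  using assms by (intro ext[of g h] extensionalityI[where A = "carrier (cmod A p)" for p]) auto

lemma hom_complex_complex:
  assumes A: "chain_complex S A" and B: "chain_complex S B"
  shows "chain_complex S (hom_complex S A B)"
proof -
  note A' = chain_complexD[OF A] and B' = chain_complexD[OF B]
  let ?H = "hom_complex S A B"
  interpret B: module S "cmod B i" for i by (rule B')
  have mH: "module S (cmod ?H k)" for k
    by (simp add: direct_prod_module hom_module_module A' B')
  have gcl: "g p x \<in> carrier (cmod B (p + k))" "g p \<in> mod_hom S (cmod A p) (cmod B (p + k))"
    if "g \<in> carrier (cmod ?H k)" "x \<in> carrier (cmod A p)" for g k p x
    using that by (auto simp: hom_module_iff intro: mod_hom_closed)
  have gcl': "g (p - 1) \<in> mod_hom S (cmod A (p - 1)) (cmod B (p + k - 1))"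
    if "g \<in> carrier (cmod ?H k)" for g k p
  proof -
    have "p - 1 + k = p + k - 1" by simp
    then show ?thesis using that by (metis (no_types, lifting) hom_complex_cmod direct_prod_simps(1) hom_module_iff)
  qed
  have gd: "g (p - 1) (cdiff A p x) \<in> carrier (cmod B (p + k - 1))"
    if "g \<in> carrier (cmod ?H k)" "x \<in> carrier (cmod A p)" for g k p x
    using mod_hom_closed[OF gcl'[OF that(1)] mod_hom_closed[OF A'(2) that(2)]] .
  have dg: "cdiff B (p + k) (g p x) \<in> carrier (cmod B (p + k - 1))"
    if "g \<in> carrier (cmod ?H k)" "x \<in> carrier (cmod A p)" for g k p x
    using mod_hom_closed[OF B'(2) gcl(1)[OF that]] .
  have Dhom: "cdiff ?H k g p \<in> mod_hom S (cmod A p) (cmod B (p + k - 1))"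
    if g: "g \<in> carrier (cmod ?H k)" for g k p
  proof -
    have 1: "g p \<in> mod_hom S (cmod A p) (cmod B (p + k))" using g by (simp add: hom_module_iff)
    show ?thesis
      by (rule mod_hom_cong[OF A'(1) mod_hom_minusf[OF B'(1) mod_hom_comp[OF 1 B'(2)]
            mod_hom_signed[OF B'(1) mod_hom_comp[OF A'(2)[of p] gcl'[OF g, of p]], of k]]])
        (simp add: hom_complex_cdiff)
  qed
  have e: "p + (k - 1) = p + k - 1" "p - 1 + k = p + k - 1" for p k :: int by simp_all
  have Dcl: "cdiff ?H k g \<in> carrier (cmod ?H (k - 1))" if "g \<in> carrier (cmod ?H k)" for g k
    using Dhom[OF that] hom_complex_cdiff_extensional by (auto simp: hom_module_iff e)
  show ?thesis
    unfolding chain_complex_def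
  proof (intro conjI allI ballI mH)
    fix k
    show "cdiff ?H k \<in> mod_hom S (cmod ?H k) (cmod ?H (k - 1))"
    proof (rule mod_homI[OF Dcl])
      fix g h assume gh: "g \<in> carrier (cmod ?H k)" "h \<in> carrier (cmod ?H k)"
      interpret H: module S "cmod ?H k" by (rule mH)
      interpret H': module S "cmod ?H (k - 1)" by (rule mH)
      have sum: "g \<oplus>\<^bsub>cmod ?H k\<^esub> h \<in> carrier (cmod ?H k)"
        "cdiff ?H k g \<oplus>\<^bsub>cmod ?H (k - 1)\<^esub> cdiff ?H k h \<in> carrier (cmod ?H (k - 1))"
        using gh Dcl by blast+
      show "cdiff ?H k (g \<oplus>\<^bsub>cmod ?H k\<^esub> h) = cdiff ?H k g \<oplus>\<^bsub>cmod ?H (k - 1)\<^esub> cdiff ?H k h"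
      proof (rule hom_complex_eqI[OF hom_complex_cdiff_extensional])
        show "(cdiff ?H k g \<oplus>\<^bsub>cmod ?H (k - 1)\<^esub> cdiff ?H k h) p \<in> extensional (carrier (cmod A p))" for p
          by simp
        fix p x assume x: "x \<in> carrier (cmod A p)"
        note c = gd[OF gh(1) x] gd[OF gh(2) x] dg[OF gh(1) x] dg[OF gh(2) x]
        show "cdiff ?H k (g \<oplus>\<^bsub>cmod ?H k\<^esub> h) p x = (cdiff ?H k g \<oplus>\<^bsub>cmod ?H (k - 1)\<^esub> cdiff ?H k h) p x"
          using x c gcl(1)[OF gh(1) x] gcl(1)[OF gh(2) x] mod_hom_closed[OF A'(2) x]
          by (simp add: hom_complex_cdiff e mod_hom_add[OF B'(2)] signed_add[OF B.M.abelian_group_axioms]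
              a_minus_def B.M.minus_add B.M.a_ac signed_closed[OF B.M.abelian_group_axioms])
      qed
    next
      fix s g assume sg: "s \<in> carrier S" "g \<in> carrier (cmod ?H k)"
      show "cdiff ?H k (s \<odot>\<^bsub>cmod ?H k\<^esub> g) = s \<odot>\<^bsub>cmod ?H (k - 1)\<^esub> cdiff ?H k g"
      proof (rule hom_complex_eqI[OF hom_complex_cdiff_extensional])
        show "(s \<odot>\<^bsub>cmod ?H (k - 1)\<^esub> cdiff ?H k g) p \<in> extensional (carrier (cmod A p))" for p
          by simp
        fix p x assume x: "x \<in> carrier (cmod A p)"
        show "cdiff ?H k (s \<odot>\<^bsub>cmod ?H k\<^esub> g) p x = (s \<odot>\<^bsub>cmod ?H (k - 1)\<^esub> cdiff ?H k g) p x"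
          using x sg(1) gd[OF sg(2) x] dg[OF sg(2) x] gcl(1)[OF sg(2) x] mod_hom_closed[OF A'(2) x]
          by (simp add: hom_complex_cdiff e mod_hom_smult[OF B'(2)] signed_smult[OF B'(1)]
              a_minus_def B.smult_r_distr B.smult_r_minus signed_closed[OF B.M.abelian_group_axioms])
      qed
    qed
    fix g assume g: "g \<in> carrier (cmod ?H k)"
    show "cdiff ?H (k - 1) (cdiff ?H k g) = \<zero>\<^bsub>cmod ?H (k - 2)\<^esub>"
    proof (rule hom_complex_eqI[OF hom_complex_cdiff_extensional])
      show "\<zero>\<^bsub>cmod ?H (k - 2)\<^esub> p \<in> extensional (carrier (cmod A p))" for p by simp
      fix p x assume x: "x \<in> carrier (cmod A p)"
      let ?y = "cdiff A p x"
      have y: "?y \<in> carrier (cmod A (p - 1))" by (rule mod_hom_closed[OF A'(2) x])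
      let ?B = "cmod B (p + k - 2)"
      have [simp]: "p + k - 1 - 1 = p + k - 2" "p + (k - 2) = p + k - 2" "p - 1 + k = p + k - 1" by simp_all
      \<comment> \<open>The mixed term d g d. It arises twice, once from each summand of the outer
        differential, with signs belonging to k and to k - 1, and the two copies cancel.\<close>
      let ?z = "cdiff B (p + k - 1) (g (p - 1) ?y)"
      have dB: "cdiff B (p + k - 1) \<in> mod_hom S (cmod B (p + k - 1)) ?B"
        using B'(2)[of "p + k - 1"] by simp
      have z: "?z \<in> carrier ?B" by (rule mod_hom_closed[OF dB gd[OF g x]])
      have "g (p - 2) \<in> mod_hom S (cmod A (p - 2)) ?B"
        using gcl'[OF g, of "p - 1"] by (simp add: algebra_simps)
      then have "g (p - 2) (cdiff A (p - 1) ?y) = \<zero>\<^bsub>?B\<^esub>"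
        using A'(3)[OF x] mod_hom_zero[OF A'(1) B'(1)] by simp
      then have 1: "cdiff ?H k g (p - 1) ?y = ?z"
        using z by (simp add: hom_complex_cdiff[OF y] signed_def a_minus_def)
      have "cdiff ?H (k - 1) (cdiff ?H k g) p x =
          cdiff B (p + k - 1) (cdiff ?H k g p x) \<ominus>\<^bsub>?B\<^esub> signed ?B (k - 1) ?z"
        by (simp add: hom_complex_cdiff[OF x] 1 e)
      also have "cdiff B (p + k - 1) (cdiff ?H k g p x) = \<ominus>\<^bsub>?B\<^esub> signed ?B k ?z"
        using mod_hom_diff[OF B'(1) B'(1) dB dg[OF g x]] gd[OF g x] B'(3)[OF gcl(1)[OF g x]] z
          signed_mod_hom[OF B'(1) B'(1) dB]
        by (simp add: hom_complex_cdiff[OF x] signed_closed[OF B.M.abelian_group_axioms] a_minus_def)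
      also have "\<dots> \<ominus>\<^bsub>?B\<^esub> signed ?B (k - 1) ?z = \<zero>\<^bsub>?B\<^esub>"
        using z by (simp add: signed_def a_minus_def B.M.r_neg B.M.l_neg)
      finally show "cdiff ?H (k - 1) (cdiff ?H k g) p x = \<zero>\<^bsub>cmod ?H (k - 2)\<^esub> p x"
        using x by simp
    qed
  qed
qed

section \<open>Precomposition with chain maps and homotopies in the Hom complex\<close>

definition hom_pull ::
  "('s, 'a) cplx \<Rightarrow> (int \<Rightarrow> 'a \<Rightarrow> 'c) \<Rightarrow> (int \<Rightarrow> 'c \<Rightarrow> 'b) \<Rightarrow> int \<Rightarrow> 'a \<Rightarrow> 'b" where
  "hom_pull A \<phi> g = (\<lambda>p. \<lambda>x\<in>carrier (cmod A p). g p (\<phi> p x))"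

definition chain_map ::
  "('s, 'z) ring_scheme \<Rightarrow> ('s, 'a) cplx \<Rightarrow> ('s, 'b) cplx \<Rightarrow> (int \<Rightarrow> 'a \<Rightarrow> 'b) \<Rightarrow> bool" where
  "chain_map S A B \<phi> \<longleftrightarrow> (\<forall>k. \<phi> k \<in> mod_hom S (cmod A k) (cmod B k)) \<and>
     (\<forall>k. \<forall>x\<in>carrier (cmod A k). cdiff B k (\<phi> k x) = \<phi> (k - 1) (cdiff A k x))"

lemma chain_mapD:
  assumes "chain_map S A B \<phi>"
  shows "\<phi> k \<in> mod_hom S (cmod A k) (cmod B k)"
    "x \<in> carrier (cmod A k) \<Longrightarrow> \<phi> k x \<in> carrier (cmod B k)"
    "x \<in> carrier (cmod A k) \<Longrightarrow> cdiff B k (\<phi> k x) = \<phi> (k - 1) (cdiff A k x)"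
proof -
  show 1: "\<phi> k \<in> mod_hom S (cmod A k) (cmod B k)" using assms by (simp add: chain_map_def)
  show "\<phi> k x \<in> carrier (cmod B k)" if "x \<in> carrier (cmod A k)" using mod_hom_closed[OF 1 that] .
  show "cdiff B k (\<phi> k x) = \<phi> (k - 1) (cdiff A k x)" if "x \<in> carrier (cmod A k)"
    using assms that by (simp add: chain_map_def)
qed

lemma hom_pull_closed:
  assumes "chain_complex S A" "chain_map S A A' \<phi>" "g \<in> carrier (cmod (hom_complex S A' N) k)"
  shows "hom_pull A \<phi> g \<in> carrier (cmod (hom_complex S A N) k)"
  using assms
  by (auto simp: hom_pull_def chain_map_def hom_module_iff
      intro!: mod_hom_restrict chain_complexD(1) intro: mod_hom_comp)

lemma hom_pull_cdiff:
  assumes A: "chain_complex S A" and \<phi>: "chain_map S A A' \<phi>"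
  shows "cdiff (hom_complex S A N) k (hom_pull A \<phi> g) = hom_pull A \<phi> (cdiff (hom_complex S A' N) k g)"
proof (rule hom_complex_eqI[OF hom_complex_cdiff_extensional])
  show "hom_pull A \<phi> (cdiff (hom_complex S A' N) k g) p \<in> extensional (carrier (cmod A p))" for p
    by (simp add: hom_pull_def)
  fix p x assume x: "x \<in> carrier (cmod A p)"
  have y: "\<phi> p x \<in> carrier (cmod A' p)" by (rule chain_mapD(2)[OF \<phi> x])
  show "cdiff (hom_complex S A N) k (hom_pull A \<phi> g) p x =
      hom_pull A \<phi> (cdiff (hom_complex S A' N) k g) p x"
    using \<phi> x mod_hom_closed[OF chain_complexD(2)[OF A] x]
    by (simp add: hom_complex_cdiff[OF x] hom_pull_def hom_complex_cdiff[OF y] chain_map_def)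
qed

lemma hom_pull_cycles:
  assumes A: "chain_complex S A" and \<phi>: "chain_map S A A' \<phi>"
    and g: "g \<in> cycles (hom_complex S A' N) k"
  shows "hom_pull A \<phi> g \<in> cycles (hom_complex S A N) k"
proof -
  have [simp]: "p + (k - 1) = p + k - 1" for p by simp
  have "\<phi> p x \<in> carrier (cmod A' p)" if "x \<in> carrier (cmod A p)" for p x
    by (rule chain_mapD(2)[OF \<phi> that])
  then show ?thesis
  using g hom_pull_closed[OF A \<phi>, of g N k]
  by (auto simp: cycles_iff hom_pull_cdiff[OF A \<phi>] simp del: direct_prod_simps(1))
     (auto simp: hom_pull_def fun_eq_iff)
qed

lemma hom_pull_boundaries:
  assumes A: "chain_complex S A" and \<phi>: "chain_map S A A' \<phi>"
    and g: "g \<in> boundaries (hom_complex S A' N) k"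
  shows "hom_pull A \<phi> g \<in> boundaries (hom_complex S A N) k"
  using g hom_pull_closed[OF A \<phi>] hom_pull_cdiff[OF A \<phi>, symmetric]
  by (fastforce simp: boundaries_iff simp del: direct_prod_simps(1) hom_complex_cmod)

text \<open>If \<chi> = 1 + d h + h d and \<open>g\<close> is a cycle, then g \<chi> - g = g d h + g
  h d, and this is the boundary of the composite of \<open>g\<close> with \<open>h\<close>, up to
  sign.\<close>

lemma hom_pull_homotopy:
  assumes A: "chain_complex S A" and N: "chain_complex S N"
    and \<chi>: "\<And>k. \<chi> k \<in> mod_hom S (cmod A k) (cmod A k)"
    and h: "\<And>k. h k \<in> mod_hom S (cmod A k) (cmod A (k + 1))"
    and eq: "\<And>k x. x \<in> carrier (cmod A k) \<Longrightarrow>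
      \<chi> k x = x \<oplus>\<^bsub>cmod A k\<^esub> (cdiff A (k + 1) (h k x) \<oplus>\<^bsub>cmod A k\<^esub> h (k - 1) (cdiff A k x))"
    and g: "g \<in> cycles (hom_complex S A N) k"
  shows "\<exists>b\<in>boundaries (hom_complex S A N) k.
    hom_pull A \<chi> g = g \<oplus>\<^bsub>cmod (hom_complex S A N) k\<^esub> b"
proof -
  note A' = chain_complexD[OF A] and N' = chain_complexD[OF N]
  let ?H = "hom_complex S A N"
  interpret A: module S "cmod A i" for i by (rule A')
  interpret N: module S "cmod N i" for i by (rule N')
  have gH: "g \<in> carrier (cmod ?H k)" "cdiff ?H k g = \<zero>\<^bsub>cmod ?H (k - 1)\<^esub>"
    using g by (auto simp: cycles_iff)
  have gp: "g p \<in> mod_hom S (cmod A p) (cmod N (p + k))" for p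
    using gH(1) by (simp add: hom_module_iff)
  have gext: "g p \<in> extensional (carrier (cmod A p))" for p using gH(1) by (simp add: hom_module_iff)
  have gd: "cdiff N (p + k) (g p y) = signed (cmod N (p + k - 1)) k (g (p - 1) (cdiff A p y))"
    if y: "y \<in> carrier (cmod A p)" for p y
  proof -
    have [simp]: "p + (k - 1) = p + k - 1" "p - 1 + k = p + k - 1" by simp_all
    have "cdiff ?H k g p y = \<zero>\<^bsub>cmod N (p + k - 1)\<^esub>" using y by (simp add: gH(2))
    moreover have "g (p - 1) (cdiff A p y) \<in> carrier (cmod N (p + k - 1))"
      using mod_hom_closed[OF gp[of "p - 1"] mod_hom_closed[OF A'(2) y]] by simp
    ultimately show ?thesis
      using mod_hom_closed[OF mod_hom_comp[OF gp N'(2)] y]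
      by (simp add: hom_complex_cdiff[OF y] N.M.minus_eq_zero_iff signed_closed[OF N.M.abelian_group_axioms])
  qed
  \<comment> \<open>For a cycle of degree k, d g = (-1)^k g d. With the factor (-1)^k in
    \<open>w\<close> the term d w becomes g d h, and -(-1)^(k+1) w d becomes g h d.\<close>
  define w where "w p = (\<lambda>x\<in>carrier (cmod A p). signed (cmod N (p + k + 1)) k (g (p + 1) (h p x)))" for p
  have gp1: "g (p + 1) \<in> mod_hom S (cmod A (p + 1)) (cmod N (p + k + 1))" for p
    using gp[of "p + 1"] by (simp add: add.commute add.left_commute)
  have w: "w \<in> carrier (cmod ?H (k + 1))"
    using mod_hom_signed[OF N'(1) mod_hom_comp[OF h gp1]]
    by (auto simp: hom_module_iff w_def add.assoc[symmetric] intro!: mod_hom_restrict[OF A'(1)])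
  let ?b = "cdiff ?H (k + 1) w"
  have b: "?b p x = g p (cdiff A (p + 1) (h p x) \<oplus>\<^bsub>cmod A p\<^esub> h (p - 1) (cdiff A p x))"
    if x: "x \<in> carrier (cmod A p)" for p x
  proof -
    have dx: "cdiff A p x \<in> carrier (cmod A (p - 1))" by (rule mod_hom_closed[OF A'(2) x])
    have hx: "h p x \<in> carrier (cmod A (p + 1))" by (rule mod_hom_closed[OF h x])
    have hdx: "h (p - 1) (cdiff A p x) \<in> carrier (cmod A p)" using mod_hom_closed[OF h dx] by simp
    have dhx: "cdiff A (p + 1) (h p x) \<in> carrier (cmod A p)" using mod_hom_closed[OF A'(2) hx] by simp
    let ?N = "cmod N (p + k)"
    have [simp]: "p + (k + 1) = p + k + 1" "p - 1 + k + 1 = p + k" "p + 1 + k = p + k + 1" by simp_all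
    have dN: "cdiff N (p + k + 1) \<in> mod_hom S (cmod N (p + k + 1)) ?N"
      using N'(2)[of "p + k + 1"] by simp
    have w1: "cdiff N (p + k + 1) (w p x) = g p (cdiff A (p + 1) (h p x))"
      using x gd[OF hx] mod_hom_closed[OF gp1 hx] mod_hom_closed[OF gp dhx]
      by (simp add: w_def signed_mod_hom[OF N'(1) N'(1) dN] signed_signed[OF N.M.abelian_group_axioms])
         (simp add: signed_def)
    have w2: "w (p - 1) (cdiff A p x) = signed ?N k (g p (h (p - 1) (cdiff A p x)))"
      using dx by (simp add: w_def)
    show ?thesis
      using hdx dhx mod_hom_closed[OF gp hdx] mod_hom_closed[OF gp dhx]
      by (simp add: hom_complex_cdiff[OF x] w1 w2 mod_hom_add[OF gp] signed_def a_minus_def)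
  qed
  have "hom_pull A \<chi> g = g \<oplus>\<^bsub>cmod ?H k\<^esub> ?b"
  proof (rule hom_complex_eqI[of _ A])
    fix p x assume x: "x \<in> carrier (cmod A p)"
    have "cdiff A (p + 1) (h p x) \<in> carrier (cmod A p)"
      using mod_hom_closed[OF A'(2) mod_hom_closed[OF h x]] by simp
    moreover have "h (p - 1) (cdiff A p x) \<in> carrier (cmod A p)"
      using mod_hom_closed[OF h mod_hom_closed[OF A'(2) x]] by simp
    ultimately show "hom_pull A \<chi> g p x = (g \<oplus>\<^bsub>cmod ?H k\<^esub> ?b) p x"
      using x by (simp add: hom_pull_def eq[OF x] b[OF x] mod_hom_add[OF gp])
  qed (simp_all add: hom_pull_def)
  moreover have "?b \<in> boundaries ?H k" using w by (auto simp: boundaries_iff simp del: hom_complex_cmod)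
  ultimately show ?thesis by blast
qed

section \<open>Independence of the homology from the free resolution\<close>

lemma chain_map_comp:
  assumes "chain_map S A B \<phi>" "chain_map S B C \<psi>"
  shows "chain_map S A C (\<lambda>k x. \<psi> k (\<phi> k x))"
  unfolding chain_map_def
  using mod_hom_comp[OF chain_mapD(1)[OF assms(1)] chain_mapD(1)[OF assms(2)]]
    chain_mapD(2,3)[OF assms(1)] chain_mapD(3)[OF assms(2)]
  by simp

text \<open>Lift the identity of \<open>M\<close> in both directions. Each composite covers the
  identity, so its difference from the identity map covers zero and is null homotopic.\<close>

lemma free_res_comparison:
  assumes C: "free_res S M C Y \<eta>" and D: "free_res S M D Y' \<eta>'" and M: "module S M"
  obtains \<phi> \<psi> h h' where "chain_map S C D \<phi>" "chain_map S D C \<psi>"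
    "\<And>k. h k \<in> mod_hom S (cmod C k) (cmod C (k + 1))"
    "\<And>k x. x \<in> carrier (cmod C k) \<Longrightarrow> \<psi> k (\<phi> k x) =
      x \<oplus>\<^bsub>cmod C k\<^esub> (cdiff C (k + 1) (h k x) \<oplus>\<^bsub>cmod C k\<^esub> h (k - 1) (cdiff C k x))"
    "\<And>k. h' k \<in> mod_hom S (cmod D k) (cmod D (k + 1))"
    "\<And>k x. x \<in> carrier (cmod D k) \<Longrightarrow> \<phi> k (\<psi> k x) =
      x \<oplus>\<^bsub>cmod D k\<^esub> (cdiff D (k + 1) (h' k x) \<oplus>\<^bsub>cmod D k\<^esub> h' (k - 1) (cdiff D k x))"
proof -
  \<comment> \<open>Stated for an arbitrary resolution because it is applied to \<open>C\<close> and
    to \<open>D\<close>, whose bases have different types.\<close>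
  have null: "\<exists>h. (\<forall>k. h k \<in> mod_hom S (cmod C k) (cmod C (k + 1))) \<and>
      (\<forall>k. \<forall>x\<in>carrier (cmod C k). \<chi> k x =
        x \<oplus>\<^bsub>cmod C k\<^esub> (cdiff C (k + 1) (h k x) \<oplus>\<^bsub>cmod C k\<^esub> h (k - 1) (cdiff C k x)))"
    if C: "free_res S M C Y \<eta>" and \<chi>: "chain_map S C C \<chi>"
      and aug: "\<And>x. x \<in> carrier (cmod C 0) \<Longrightarrow> \<eta> (\<chi> 0 x) = \<eta> x"
    for C :: "('a, 'x \<Rightarrow> 'a) cplx" and Y and \<eta> :: "('x \<Rightarrow> 'a) \<Rightarrow> 'c" and \<chi>
  proof -
    note C' = free_resD[OF C]
    note CC = chain_complexD[OF C'(1)]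
    interpret C: module S "cmod C k" for k by (rule CC)
    interpret M: module S M by (rule M)
    have \<chi>1: "\<chi> k \<in> mod_hom S (cmod C k) (cmod C k)" for k using \<chi> by (simp add: chain_map_def)
    let ?\<delta> = "\<lambda>k x. \<chi> k x \<ominus>\<^bsub>cmod C k\<^esub> x"
    have \<delta>1: "?\<delta> k \<in> mod_hom S (cmod C k) (cmod C k)" for k
      by (rule mod_hom_minusf[OF CC(1) \<chi>1 mod_hom_id])
    obtain h where h: "\<And>k. h k \<in> mod_hom S (cmod C k) (cmod C (k + 1))"
      "\<And>k x. x \<in> carrier (cmod C k) \<Longrightarrow>
        ?\<delta> k x = cdiff C (k + 1) (h k x) \<oplus>\<^bsub>cmod C k\<^esub> h (k - 1) (cdiff C k x)"
    proof (rule free_res_null_homotopic[OF C M, of ?\<delta>])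
      show "cdiff C k (?\<delta> k x) = ?\<delta> (k - 1) (cdiff C k x)" if "x \<in> carrier (cmod C k)" for k x
        using \<chi> that mod_hom_closed[OF \<chi>1 that]
        by (simp add: mod_hom_diff[OF CC(1) CC(1) CC(2)] chain_map_def)
      show "\<eta> (?\<delta> 0 x) = \<zero>\<^bsub>M\<^esub>" if "x \<in> carrier (cmod C 0)" for x
        using that aug[OF that] mod_hom_closed[OF \<chi>1 that] mod_hom_closed[OF C'(5) that]
        by (simp add: mod_hom_diff[OF CC(1) M C'(5)] M.M.minus_eq_zero_iff)
    qed (use \<delta>1 in blast)+
    have "\<chi> k x = x \<oplus>\<^bsub>cmod C k\<^esub> ?\<delta> k x" if "x \<in> carrier (cmod C k)" for k x
      using that mod_hom_closed[OF \<chi>1 that] by (simp add: a_minus_def C.M.a_comm[of "\<chi> k x"] C.M.r_neg2)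
    then show ?thesis using h by (intro exI[of _ h]) simp
  qed
  obtain \<phi> where \<phi>: "chain_map S C D \<phi>" "\<And>x. x \<in> carrier (cmod C 0) \<Longrightarrow> \<eta>' (\<phi> 0 x) = \<eta> x"
    using free_res_chain_map[OF C D M] by (metis chain_map_def)
  obtain \<psi> where \<psi>: "chain_map S D C \<psi>" "\<And>x. x \<in> carrier (cmod D 0) \<Longrightarrow> \<eta> (\<psi> 0 x) = \<eta>' x"
    using free_res_chain_map[OF D C M] by (metis chain_map_def)
  have \<phi>0: "\<phi> 0 x \<in> carrier (cmod D 0)" if "x \<in> carrier (cmod C 0)" for x
    by (rule chain_mapD(2)[OF \<phi>(1) that])
  have \<psi>0: "\<psi> 0 x \<in> carrier (cmod C 0)" if "x \<in> carrier (cmod D 0)" for x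
    by (rule chain_mapD(2)[OF \<psi>(1) that])
  from null[OF C chain_map_comp[OF \<phi>(1) \<psi>(1)]] null[OF D chain_map_comp[OF \<psi>(1) \<phi>(1)]]
  show ?thesis using that[OF \<phi>(1) \<psi>(1)] \<phi> \<psi> \<phi>0 \<psi>0 by metis
qed

lemma hom_pull_comp:
  assumes "chain_map S A B \<phi>"
  shows "hom_pull A \<phi> (hom_pull B \<psi> g) = hom_pull A (\<lambda>k x. \<psi> k (\<phi> k x)) g"
proof -
  have "\<phi> p x \<in> carrier (cmod B p)" if "x \<in> carrier (cmod A p)" for p x
    by (rule chain_mapD(2)[OF assms that])
  then show ?thesis by (auto simp: hom_pull_def fun_eq_iff)
qed

text \<open>Pulling back along \<psi> is invertible up to boundaries, with inverse the pullback
  along \<phi>. Injectivity on homology uses the homotopy on \<open>C\<close>, surjectivity the one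
  on \<open>D\<close>.\<close>

lemma min_gens_Ext_eq:
  assumes C: "free_res S M C Y \<eta>" and D: "free_res S M D Y' \<eta>'" and M: "module S M"
    and N: "chain_complex S N"
  shows "min_gens S (homology (hom_complex S C N) i) = min_gens S (homology (hom_complex S D N) i)"
proof -
  note C' = free_resD[OF C] and D' = free_resD[OF D]
  obtain \<phi> \<psi> h h' where \<phi>: "chain_map S C D \<phi>" and \<psi>: "chain_map S D C \<psi>"
    and h: "\<And>k. h k \<in> mod_hom S (cmod C k) (cmod C (k + 1))"
      "\<And>k x. x \<in> carrier (cmod C k) \<Longrightarrow> \<psi> k (\<phi> k x) =
        x \<oplus>\<^bsub>cmod C k\<^esub> (cdiff C (k + 1) (h k x) \<oplus>\<^bsub>cmod C k\<^esub> h (k - 1) (cdiff C k x))"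
    and h': "\<And>k. h' k \<in> mod_hom S (cmod D k) (cmod D (k + 1))"
      "\<And>k x. x \<in> carrier (cmod D k) \<Longrightarrow> \<phi> k (\<psi> k x) =
        x \<oplus>\<^bsub>cmod D k\<^esub> (cdiff D (k + 1) (h' k x) \<oplus>\<^bsub>cmod D k\<^esub> h' (k - 1) (cdiff D k x))"
    using free_res_comparison[OF C D M] by metis
  let ?HC = "hom_complex S C N" and ?HD = "hom_complex S D N"
  have HC: "chain_complex S ?HC" and HD: "chain_complex S ?HD"
    using hom_complex_complex C'(1) D'(1) N by blast+
  have \<psi>\<phi>: "chain_map S C C (\<lambda>k x. \<psi> k (\<phi> k x))" and \<phi>\<psi>: "chain_map S D D (\<lambda>k x. \<phi> k (\<psi> k x))"
    using chain_map_comp \<phi> \<psi> by blast+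
  have \<psi>c: "\<psi> k x \<in> carrier (cmod C k)" if "x \<in> carrier (cmod D k)" for k x
    by (rule chain_mapD(2)[OF \<psi> that])
  show ?thesis
  proof (rule homology_min_gens_eq[OF HC HD, where h = "hom_pull D \<psi>"])
    fix g assume g: "g \<in> cycles ?HC i"
    show "hom_pull D \<psi> g \<in> cycles ?HD i" by (rule hom_pull_cycles[OF D'(1) \<psi> g])
    assume "hom_pull D \<psi> g \<in> boundaries ?HD i"
    then have b1: "hom_pull C \<phi> (hom_pull D \<psi> g) \<in> boundaries ?HC i"
      by (rule hom_pull_boundaries[OF C'(1) \<phi>])
    obtain b where b: "b \<in> boundaries ?HC i"
      "hom_pull C \<phi> (hom_pull D \<psi> g) = g \<oplus>\<^bsub>cmod ?HC i\<^esub> b"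
      using hom_pull_homotopy[OF C'(1) N _ h g] \<psi>\<phi>
      by (auto simp: hom_pull_comp[OF \<phi>] chain_map_def simp del: hom_complex_cmod)
    interpret H: module S "cmod ?HC i" by (rule chain_complexD(1)[OF HC])
    note E = H.submoduleE[OF boundaries_submodule[OF HC]]
    have "g = (g \<oplus>\<^bsub>cmod ?HC i\<^esub> b) \<oplus>\<^bsub>cmod ?HC i\<^esub> \<ominus>\<^bsub>cmod ?HC i\<^esub> b"
      using g b(1) E(1) by (auto simp: cycles_iff H.M.a_assoc H.M.r_neg simp del: hom_complex_cmod)
    then show "g \<in> boundaries ?HC i" using b b1 E(3,5) by metis
  next
    fix g assume g: "g \<in> cycles ?HD i"
    obtain b where "b \<in> boundaries ?HD i"
      "hom_pull D \<psi> (hom_pull C \<phi> g) = g \<oplus>\<^bsub>cmod ?HD i\<^esub> b"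
      using hom_pull_homotopy[OF D'(1) N _ h' g] \<phi>\<psi>
      by (auto simp: hom_pull_comp[OF \<psi>] chain_map_def simp del: hom_complex_cmod)
    then show "\<exists>x\<in>cycles ?HC i. \<exists>b\<in>boundaries ?HD i. hom_pull D \<psi> x = g \<oplus>\<^bsub>cmod ?HD i\<^esub> b"
      using hom_pull_cycles[OF C'(1) \<phi> g] by blast
  qed (use \<psi>c hom_pull_boundaries[OF D'(1) \<psi>] in \<open>auto simp: hom_pull_def fun_eq_iff intro!: bexI\<close>)
qed

section \<open>Tensor products\<close>

definition bilinear ::
  "('s, 'z) ring_scheme \<Rightarrow> ('s, 'a) module \<Rightarrow> ('s, 'b) module \<Rightarrow> ('s, 'c) module \<Rightarrow>
     ('a \<Rightarrow> 'b \<Rightarrow> 'c) \<Rightarrow> bool" where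
  "bilinear S A B T \<beta> \<longleftrightarrow> (\<forall>a\<in>carrier A. \<beta> a \<in> mod_hom S B T) \<and>
     (\<forall>b\<in>carrier B. (\<lambda>a. \<beta> a b) \<in> mod_hom S A T)"

lemma bilinearD:
  assumes "bilinear S A B T \<beta>"
  shows "a \<in> carrier A \<Longrightarrow> b \<in> carrier B \<Longrightarrow> \<beta> a b \<in> carrier T"
    "a \<in> carrier A \<Longrightarrow> a' \<in> carrier A \<Longrightarrow> b \<in> carrier B \<Longrightarrow> \<beta> (a \<oplus>\<^bsub>A\<^esub> a') b = \<beta> a b \<oplus>\<^bsub>T\<^esub> \<beta> a' b"
    "a \<in> carrier A \<Longrightarrow> b \<in> carrier B \<Longrightarrow> b' \<in> carrier B \<Longrightarrow> \<beta> a (b \<oplus>\<^bsub>B\<^esub> b') = \<beta> a b \<oplus>\<^bsub>T\<^esub> \<beta> a b'"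
    "s \<in> carrier S \<Longrightarrow> a \<in> carrier A \<Longrightarrow> b \<in> carrier B \<Longrightarrow> \<beta> (s \<odot>\<^bsub>A\<^esub> a) b = s \<odot>\<^bsub>T\<^esub> \<beta> a b"
    "s \<in> carrier S \<Longrightarrow> a \<in> carrier A \<Longrightarrow> b \<in> carrier B \<Longrightarrow> \<beta> a (s \<odot>\<^bsub>B\<^esub> b) = s \<odot>\<^bsub>T\<^esub> \<beta> a b"
  using assms by (auto simp: bilinear_def mod_hom_def)

lemma bilinearI:
  assumes "\<And>a b. a \<in> carrier A \<Longrightarrow> b \<in> carrier B \<Longrightarrow> \<beta> a b \<in> carrier T"
    "\<And>a a' b. a \<in> carrier A \<Longrightarrow> a' \<in> carrier A \<Longrightarrow> b \<in> carrier B \<Longrightarrow>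
      \<beta> (a \<oplus>\<^bsub>A\<^esub> a') b = \<beta> a b \<oplus>\<^bsub>T\<^esub> \<beta> a' b"
    "\<And>a b b'. a \<in> carrier A \<Longrightarrow> b \<in> carrier B \<Longrightarrow> b' \<in> carrier B \<Longrightarrow>
      \<beta> a (b \<oplus>\<^bsub>B\<^esub> b') = \<beta> a b \<oplus>\<^bsub>T\<^esub> \<beta> a b'"
    "\<And>s a b. s \<in> carrier S \<Longrightarrow> a \<in> carrier A \<Longrightarrow> b \<in> carrier B \<Longrightarrow> \<beta> (s \<odot>\<^bsub>A\<^esub> a) b = s \<odot>\<^bsub>T\<^esub> \<beta> a b"
    "\<And>s a b. s \<in> carrier S \<Longrightarrow> a \<in> carrier A \<Longrightarrow> b \<in> carrier B \<Longrightarrow> \<beta> a (s \<odot>\<^bsub>B\<^esub> b) = s \<odot>\<^bsub>T\<^esub> \<beta> a b"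
  shows "bilinear S A B T \<beta>"
  using assms by (auto simp: bilinear_def mod_hom_def)

definition tensor_lift ::
  "('s, 'z) ring_scheme \<Rightarrow> ('s, 'c) module \<Rightarrow> ('a \<Rightarrow> 'b \<Rightarrow> 'c) \<Rightarrow> ('a \<times> 'b \<Rightarrow> 's) set \<Rightarrow> 'c" where
  "tensor_lift S T \<beta> t = the_elem (lin_ext S T (\<lambda>(a, b). \<beta> a b) ` t)"

lemma tensor_map_eq_lift:
  "tensor_map S A' B' g h = tensor_lift S (tensor_module S A' B') (\<lambda>a b. pure_tensor S A' B' (g a) (h b))"
  by (simp add: tensor_map_def tensor_lift_def fun_eq_iff)

context
  fixes S :: "('s, 'z) ring_scheme" and A :: "('s, 'a) module" and B :: "('s, 'b) module"
  assumes A: "module S A" and B: "module S B"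
begin

interpretation A: module S A by (rule A)
interpretation B: module S B by (rule B)

private abbreviation (input) "F \<equiv> free_module S (carrier A \<times> carrier B)"

interpretation F: module S F by (rule module_free_module[OF A.R.cring_axioms])

lemma pair_basis_closed: "a \<in> carrier A \<Longrightarrow> b \<in> carrier B \<Longrightarrow> basis_elt S (a, b) \<in> carrier F"
  by (rule basis_elt_closed[OF A.R.cring_axioms]) simp

lemma bilinear_rels_subset: "bilinear_rels S A B \<subseteq> carrier F"
  unfolding bilinear_rels_def Let_def
  by (intro Un_least subsetI; elim CollectE exE conjE; hypsubst)
     (intro F.M.minus_closed F.M.a_closed F.smult_closed pair_basis_closed A.M.a_closed B.M.a_closed
       A.smult_closed B.smult_closed; assumption)+

lemma tensor_ker_submodule: "submodule (tensor_ker S A B) S F"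
  unfolding tensor_ker_def by (rule mod_span_submodule(1)[OF F.module_axioms bilinear_rels_subset])

lemma bilinear_rels_subset_ker: "bilinear_rels S A B \<subseteq> tensor_ker S A B"
  unfolding tensor_ker_def by (rule mod_span_submodule(2)[OF F.module_axioms bilinear_rels_subset])

lemma tensor_module_module: "module S (tensor_module S A B)"
  unfolding tensor_module_def by (rule quot_module_module[OF F.module_axioms tensor_ker_submodule])

lemma pure_tensor_bilinear: "bilinear S A B (tensor_module S A B) (pure_tensor S A B)"
proof -
  note q = quot_module_add[OF F.module_axioms tensor_ker_submodule]
    quot_module_smult[OF F.module_axioms tensor_ker_submodule]
  note eq = a_r_coset_eq_iff[OF F.module_axioms tensor_ker_submodule]
  note cl = pair_basis_closed F.M.a_closed F.smult_closed A.M.a_closed B.M.a_closed A.smult_closed B.smult_closed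
  have r: "x \<in> bilinear_rels S A B \<Longrightarrow> x \<in> tensor_ker S A B" for x
    using bilinear_rels_subset_ker by blast
  show ?thesis
  proof (rule bilinearI)
    fix a b assume ab: "a \<in> carrier A" "b \<in> carrier B"
    show "pure_tensor S A B a b \<in> carrier (tensor_module S A B)"
      using pair_basis_closed[OF ab] by (auto simp: pure_tensor_def tensor_module_def quot_module_carrier)
  next
    fix a a' b assume ab: "a \<in> carrier A" "a' \<in> carrier A" "b \<in> carrier B"
    have "basis_elt S (a \<oplus>\<^bsub>A\<^esub> a', b) \<ominus>\<^bsub>F\<^esub> (basis_elt S (a, b) \<oplus>\<^bsub>F\<^esub> basis_elt S (a', b)) \<in> tensor_ker S A B"
      by (rule r, unfold bilinear_rels_def Let_def, rule UnI1, rule UnI1, rule UnI1) (use ab in blast)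
    then show "pure_tensor S A B (a \<oplus>\<^bsub>A\<^esub> a') b =
        pure_tensor S A B a b \<oplus>\<^bsub>tensor_module S A B\<^esub> pure_tensor S A B a' b"
      using ab cl unfolding pure_tensor_def tensor_module_def by (simp only: q eq)
  next
    fix a b b' assume ab: "a \<in> carrier A" "b \<in> carrier B" "b' \<in> carrier B"
    have "basis_elt S (a, b \<oplus>\<^bsub>B\<^esub> b') \<ominus>\<^bsub>F\<^esub> (basis_elt S (a, b) \<oplus>\<^bsub>F\<^esub> basis_elt S (a, b')) \<in> tensor_ker S A B"
      by (rule r, unfold bilinear_rels_def Let_def, rule UnI1, rule UnI1, rule UnI2) (use ab in blast)
    then show "pure_tensor S A B a (b \<oplus>\<^bsub>B\<^esub> b') =
        pure_tensor S A B a b \<oplus>\<^bsub>tensor_module S A B\<^esub> pure_tensor S A B a b'"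
      using ab cl unfolding pure_tensor_def tensor_module_def by (simp only: q eq)
  next
    fix s a b assume ab: "s \<in> carrier S" "a \<in> carrier A" "b \<in> carrier B"
    have "basis_elt S (s \<odot>\<^bsub>A\<^esub> a, b) \<ominus>\<^bsub>F\<^esub> s \<odot>\<^bsub>F\<^esub> basis_elt S (a, b) \<in> tensor_ker S A B"
      by (rule r, unfold bilinear_rels_def Let_def, rule UnI1, rule UnI2) (use ab in blast)
    then show "pure_tensor S A B (s \<odot>\<^bsub>A\<^esub> a) b = s \<odot>\<^bsub>tensor_module S A B\<^esub> pure_tensor S A B a b"
      using ab cl unfolding pure_tensor_def tensor_module_def by (simp only: q eq)
    have "basis_elt S (a, s \<odot>\<^bsub>B\<^esub> b) \<ominus>\<^bsub>F\<^esub> s \<odot>\<^bsub>F\<^esub> basis_elt S (a, b) \<in> tensor_ker S A B"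
      by (rule r, unfold bilinear_rels_def Let_def, rule UnI2) (use ab in blast)
    then show "pure_tensor S A B a (s \<odot>\<^bsub>B\<^esub> b) = s \<odot>\<^bsub>tensor_module S A B\<^esub> pure_tensor S A B a b"
      using ab cl unfolding pure_tensor_def tensor_module_def by (simp only: q eq)
  qed
qed

text \<open>Composed with the projection from the free module on pairs, both maps become linear maps
  out of a free module, and its basis elements go to the pure tensors.\<close>

lemma tensor_hom_eq:
  assumes "module S T" "g \<in> mod_hom S (tensor_module S A B) T" "h \<in> mod_hom S (tensor_module S A B) T"
    and eq: "\<And>a b. a \<in> carrier A \<Longrightarrow> b \<in> carrier B \<Longrightarrow> g (pure_tensor S A B a b) = h (pure_tensor S A B a b)"
    and t: "t \<in> carrier (tensor_module S A B)"
  shows "g t = h t"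
proof -
  from t obtain u where u: "u \<in> carrier F" "t = tensor_ker S A B +>\<^bsub>F\<^esub> u"
    by (auto simp: tensor_module_def quot_module_carrier)
  note c = quot_module_hom[OF F.module_axioms tensor_ker_submodule, folded tensor_module_def]
  show ?thesis
    unfolding u(2)
    by (rule free_module_hom_eq[OF assms(1) mod_hom_comp[OF c assms(2)] mod_hom_comp[OF c assms(3)] _ u(1)])
       (use eq in \<open>auto simp: pure_tensor_def\<close>)
qed

text \<open>The linear extension of \<beta> kills the bilinear relations, hence is constant on each
  coset. The image of a coset is then a singleton, and \<open>the_elem\<close> extracts its
  element.\<close>

lemma tensor_lift:
  assumes T: "module S T" and \<beta>: "bilinear S A B T \<beta>"
  shows "tensor_lift S T \<beta> \<in> mod_hom S (tensor_module S A B) T"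
    and "a \<in> carrier A \<Longrightarrow> b \<in> carrier B \<Longrightarrow> tensor_lift S T \<beta> (pure_tensor S A B a b) = \<beta> a b"
proof -
  interpret T: module S T by (rule T)
  let ?l = "lin_ext S T (\<lambda>(a, b). \<beta> a b)"
  have \<beta>c: "(\<lambda>(a, b). \<beta> a b) \<in> carrier A \<times> carrier B \<rightarrow> carrier T" using bilinearD(1)[OF \<beta>] by auto
  have l: "?l \<in> mod_hom S F T" by (rule lin_ext_hom[OF T \<beta>c])
  have le: "?l (basis_elt S (a, b)) = \<beta> a b" if "a \<in> carrier A" "b \<in> carrier B" for a b
    using lin_ext_basis_elt[OF T \<beta>c, of "(a, b)"] that by simp
  note ld = mod_hom_diff[OF F.module_axioms T l]
  have "tensor_ker S A B \<subseteq> a_kernel F T ?l"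
    unfolding tensor_ker_def
  proof (rule mod_span_least[OF mod_hom_kernel_submodule[OF F.module_axioms T l]], rule subsetI)
    fix x assume x: "x \<in> bilinear_rels S A B"
    then have xF: "x \<in> carrier F" using bilinear_rels_subset by blast
    note cl = pair_basis_closed F.M.a_closed F.smult_closed A.M.a_closed B.M.a_closed A.smult_closed B.smult_closed
    note s = ld mod_hom_add[OF l] mod_hom_smult[OF l] le bilinearD[OF \<beta>]
    have "?l x = \<zero>\<^bsub>T\<^esub>"
      using x unfolding bilinear_rels_def Let_def Un_iff mem_Collect_eq
      by (elim disjE exE conjE; hypsubst)
         (simp only: s cl T.M.minus_eq_zero_iff T.M.a_closed T.smult_closed)+
    with xF show "x \<in> a_kernel F T ?l" by (simp add: a_kernel_def')
  qed
  then have ker: "?l x = \<zero>\<^bsub>T\<^esub>" if "x \<in> tensor_ker S A B" for x using that by (auto simp: a_kernel_def')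
  have L: "tensor_lift S T \<beta> (tensor_ker S A B +>\<^bsub>F\<^esub> u) = ?l u" if u: "u \<in> carrier F" for u
  proof -
    note iff = a_r_coset_iff[OF F.module_axioms tensor_ker_submodule u]
    have "?l v = ?l u" if "v \<in> tensor_ker S A B +>\<^bsub>F\<^esub> u" for v
      using that iff ker[of "v \<ominus>\<^bsub>F\<^esub> u"] ld u mod_hom_closed[OF l] by (auto simp only: T.M.minus_eq_zero_iff)
    then have "?l ` (tensor_ker S A B +>\<^bsub>F\<^esub> u) = (\<lambda>_. ?l u) ` (tensor_ker S A B +>\<^bsub>F\<^esub> u)"
      by (rule image_cong[OF refl])
    also have "u \<in> tensor_ker S A B +>\<^bsub>F\<^esub> u"
      using iff u submodule_zero[OF F.module_axioms tensor_ker_submodule] F.M.minus_eq_zero_iff by metis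
    then have "(\<lambda>_. ?l u) ` (tensor_ker S A B +>\<^bsub>F\<^esub> u) = {?l u}" by (rule image_constant)
    finally have "?l ` (tensor_ker S A B +>\<^bsub>F\<^esub> u) = {?l u}" .
    then show ?thesis by (simp add: tensor_lift_def)
  qed
  note q = quot_module_add[OF F.module_axioms tensor_ker_submodule]
    quot_module_smult[OF F.module_axioms tensor_ker_submodule]
  show "tensor_lift S T \<beta> \<in> mod_hom S (tensor_module S A B) T"
    unfolding tensor_module_def
  proof (rule mod_homI, unfold quot_module_carrier)
    show "tensor_lift S T \<beta> x \<in> carrier T" if "x \<in> (\<lambda>x. tensor_ker S A B +>\<^bsub>F\<^esub> x) ` carrier F" for x
      using that mod_hom_closed[OF l] by (auto simp only: L)
  next
    fix x y assume "x \<in> (\<lambda>x. tensor_ker S A B +>\<^bsub>F\<^esub> x) ` carrier F" "y \<in> (\<lambda>x. tensor_ker S A B +>\<^bsub>F\<^esub> x) ` carrier F"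
    then obtain u v where uv: "u \<in> carrier F" "v \<in> carrier F" "x = tensor_ker S A B +>\<^bsub>F\<^esub> u"
      "y = tensor_ker S A B +>\<^bsub>F\<^esub> v" by blast
    show "tensor_lift S T \<beta> (x \<oplus>\<^bsub>quot_module F (tensor_ker S A B)\<^esub> y) = tensor_lift S T \<beta> x \<oplus>\<^bsub>T\<^esub> tensor_lift S T \<beta> y"
      using uv(1,2) F.M.a_closed[OF uv(1,2)] unfolding uv(3,4)
      by (simp only: q L mod_hom_add[OF l])
  next
    fix s x assume s: "s \<in> carrier S" and "x \<in> (\<lambda>x. tensor_ker S A B +>\<^bsub>F\<^esub> x) ` carrier F"
    then obtain u where u: "u \<in> carrier F" "x = tensor_ker S A B +>\<^bsub>F\<^esub> u" by blast
    show "tensor_lift S T \<beta> (s \<odot>\<^bsub>quot_module F (tensor_ker S A B)\<^esub> x) = s \<odot>\<^bsub>T\<^esub> tensor_lift S T \<beta> x"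
      using s u(1) F.smult_closed[OF s u(1)] unfolding u(2) by (simp only: q L mod_hom_smult[OF l])
  qed
  show "tensor_lift S T \<beta> (pure_tensor S A B a b) = \<beta> a b" if "a \<in> carrier A" "b \<in> carrier B"
    using L[OF pair_basis_closed[OF that]] le[OF that] by (simp add: pure_tensor_def)
qed

end

lemma tensor_map:
  assumes "module S A" "module S B" "module S A'" "module S B'"
    and g: "g \<in> mod_hom S A A'" and h: "h \<in> mod_hom S B B'"
  shows "tensor_map S A' B' g h \<in> mod_hom S (tensor_module S A B) (tensor_module S A' B')"
    and "a \<in> carrier A \<Longrightarrow> b \<in> carrier B \<Longrightarrow>
      tensor_map S A' B' g h (pure_tensor S A B a b) = pure_tensor S A' B' (g a) (h b)"
proof -
  note p = bilinearD[OF pure_tensor_bilinear[OF assms(3,4)]]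
  have \<beta>: "bilinear S A B (tensor_module S A' B') (\<lambda>a b. pure_tensor S A' B' (g a) (h b))"
    by (rule bilinearI)
       (simp_all add: p mod_hom_closed[OF g] mod_hom_closed[OF h] mod_hom_add[OF g] mod_hom_add[OF h]
         mod_hom_smult[OF g] mod_hom_smult[OF h])
  show "tensor_map S A' B' g h \<in> mod_hom S (tensor_module S A B) (tensor_module S A' B')"
    "a \<in> carrier A \<Longrightarrow> b \<in> carrier B \<Longrightarrow>
      tensor_map S A' B' g h (pure_tensor S A B a b) = pure_tensor S A' B' (g a) (h b)"
    unfolding tensor_map_eq_lift
    using tensor_lift[OF assms(1,2) tensor_module_module[OF assms(3,4)] \<beta>] by blast+
qed

lemma pure_tensor_zero:
  assumes "module S A" "module S B"
  shows "b \<in> carrier B \<Longrightarrow> pure_tensor S A B \<zero>\<^bsub>A\<^esub> b = \<zero>\<^bsub>tensor_module S A B\<^esub>"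
    "a \<in> carrier A \<Longrightarrow> pure_tensor S A B a \<zero>\<^bsub>B\<^esub> = \<zero>\<^bsub>tensor_module S A B\<^esub>"
proof -
  note p = pure_tensor_bilinear[OF assms, unfolded bilinear_def]
  note t = tensor_module_module[OF assms]
  show "b \<in> carrier B \<Longrightarrow> pure_tensor S A B \<zero>\<^bsub>A\<^esub> b = \<zero>\<^bsub>tensor_module S A B\<^esub>"
    using p mod_hom_zero[OF assms(1) t, of "\<lambda>a. pure_tensor S A B a b"] by blast
  show "a \<in> carrier A \<Longrightarrow> pure_tensor S A B a \<zero>\<^bsub>B\<^esub> = \<zero>\<^bsub>tensor_module S A B\<^esub>"
    using p mod_hom_zero[OF assms(2) t, of "pure_tensor S A B a"] by blast
qed

text \<open>This and the following rules for induced maps hold because they hold on pure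
  tensors.\<close>

lemma tensor_map_comp:
  assumes m: "module S A" "module S B" "module S A'" "module S B'" "module S A''" "module S B''"
    and g: "g \<in> mod_hom S A A'" and h: "h \<in> mod_hom S B B'"
    and g': "g' \<in> mod_hom S A' A''" and h': "h' \<in> mod_hom S B' B''"
    and t: "t \<in> carrier (tensor_module S A B)"
  shows "tensor_map S A'' B'' g' h' (tensor_map S A' B' g h t) =
    tensor_map S A'' B'' (\<lambda>x. g' (g x)) (\<lambda>x. h' (h x)) t"
  by (rule tensor_hom_eq[OF m(1,2) tensor_module_module[OF m(5,6)]
        mod_hom_comp[OF tensor_map(1)[OF m(1-4) g h] tensor_map(1)[OF m(3-6) g' h']]
        tensor_map(1)[OF m(1,2,5,6) mod_hom_comp[OF g g'] mod_hom_comp[OF h h']] _ t])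
     (simp add: tensor_map(2)[OF m(1-4) g h] tensor_map(2)[OF m(3-6) g' h'] mod_hom_closed[OF g]
       mod_hom_closed[OF h] tensor_map(2)[OF m(1,2,5,6) mod_hom_comp[OF g g'] mod_hom_comp[OF h h']])

lemma tensor_map_cong:
  assumes m: "module S A" "module S B" "module S A'" "module S B'"
    and g: "g \<in> mod_hom S A A'" and h: "h \<in> mod_hom S B B'"
    and eq: "\<And>x. x \<in> carrier A \<Longrightarrow> g x = g' x" "\<And>x. x \<in> carrier B \<Longrightarrow> h x = h' x"
    and t: "t \<in> carrier (tensor_module S A B)"
  shows "tensor_map S A' B' g h t = tensor_map S A' B' g' h' t"
  using tensor_hom_eq[OF m(1,2) tensor_module_module[OF m(3,4)] tensor_map(1)[OF m g h]
      tensor_map(1)[OF m mod_hom_cong[OF m(1) g eq(1)] mod_hom_cong[OF m(2) h eq(2)]] _ t]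
    tensor_map(2)[OF m g h]
    tensor_map(2)[OF m mod_hom_cong[OF m(1) g eq(1)] mod_hom_cong[OF m(2) h eq(2)]] eq
  by simp

lemma tensor_map_id:
  assumes m: "module S A" "module S B" and t: "t \<in> carrier (tensor_module S A B)"
  shows "tensor_map S A B (\<lambda>x. x) (\<lambda>x. x) t = t"
  by (rule tensor_hom_eq[OF m tensor_module_module[OF m] tensor_map(1)[OF m m mod_hom_id mod_hom_id]
        mod_hom_id _ t])
     (simp add: tensor_map(2)[OF m m mod_hom_id mod_hom_id])

lemma tensor_map_zero:
  assumes m: "module S A" "module S B" "module S A'" "module S B'"
    and t: "t \<in> carrier (tensor_module S A B)"
  shows "h \<in> mod_hom S B B' \<Longrightarrow> tensor_map S A' B' (\<lambda>_. \<zero>\<^bsub>A'\<^esub>) h t = \<zero>\<^bsub>tensor_module S A' B'\<^esub>"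
    "g \<in> mod_hom S A A' \<Longrightarrow> tensor_map S A' B' g (\<lambda>_. \<zero>\<^bsub>B'\<^esub>) t = \<zero>\<^bsub>tensor_module S A' B'\<^esub>"
proof -
  note T = tensor_module_module[OF m(3,4)]
  assume h: "h \<in> mod_hom S B B'"
  note z = mod_hom_zero_map[OF m(3), of A]
  show "tensor_map S A' B' (\<lambda>_. \<zero>\<^bsub>A'\<^esub>) h t = \<zero>\<^bsub>tensor_module S A' B'\<^esub>"
    by (rule tensor_hom_eq[OF m(1,2) T tensor_map(1)[OF m z h] mod_hom_zero_map[OF T] _ t])
       (simp add: tensor_map(2)[OF m z h] pure_tensor_zero[OF m(3,4)] mod_hom_closed[OF h])
next
  note T = tensor_module_module[OF m(3,4)]
  assume g: "g \<in> mod_hom S A A'"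
  note z = mod_hom_zero_map[OF m(4), of B]
  show "tensor_map S A' B' g (\<lambda>_. \<zero>\<^bsub>B'\<^esub>) t = \<zero>\<^bsub>tensor_module S A' B'\<^esub>"
    by (rule tensor_hom_eq[OF m(1,2) T tensor_map(1)[OF m g z] mod_hom_zero_map[OF T] _ t])
       (simp add: tensor_map(2)[OF m g z] pure_tensor_zero[OF m(3,4)] mod_hom_closed[OF g])
qed

lemma tensor_map_add_left:
  assumes m: "module S A" "module S B" "module S A'" "module S B'"
    and g: "g \<in> mod_hom S A A'" and g': "g' \<in> mod_hom S A A'" and h: "h \<in> mod_hom S B B'"
    and t: "t \<in> carrier (tensor_module S A B)"
  shows "tensor_map S A' B' (\<lambda>x. g x \<oplus>\<^bsub>A'\<^esub> g' x) h t =
    tensor_map S A' B' g h t \<oplus>\<^bsub>tensor_module S A' B'\<^esub> tensor_map S A' B' g' h t"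
proof -
  note T = tensor_module_module[OF m(3,4)]
  note gg = mod_hom_sum[OF m(3) g g']
  show ?thesis
    by (rule tensor_hom_eq[OF m(1,2) T tensor_map(1)[OF m gg h]
          mod_hom_sum[OF T tensor_map(1)[OF m g h] tensor_map(1)[OF m g' h]] _ t])
       (simp add: tensor_map(2)[OF m gg h] tensor_map(2)[OF m g h] tensor_map(2)[OF m g' h]
         bilinearD[OF pure_tensor_bilinear[OF m(3,4)]] mod_hom_closed[OF g] mod_hom_closed[OF g'] mod_hom_closed[OF h])
qed

section \<open>The tensor product of complexes\<close>

lemma direct_sum_simps [simp]:
  "x \<in> carrier (direct_sum A) \<longleftrightarrow> (\<forall>i. x i \<in> carrier (A i)) \<and> finite {i. x i \<noteq> \<zero>\<^bsub>A i\<^esub>}"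
  "\<zero>\<^bsub>direct_sum A\<^esub> = (\<lambda>i. \<zero>\<^bsub>A i\<^esub>)" "x \<oplus>\<^bsub>direct_sum A\<^esub> y = (\<lambda>i. x i \<oplus>\<^bsub>A i\<^esub> y i)"
  "s \<odot>\<^bsub>direct_sum A\<^esub> x = (\<lambda>i. s \<odot>\<^bsub>A i\<^esub> x i)"
  by (simp_all add: direct_sum_def)

lemma direct_sum_module:
  assumes "\<And>i. module S (A i)"
  shows "module S (direct_sum A)"
proof -
  interpret A: module S "A i" for i by (rule assms)
  have 1: "finite {i. x i \<oplus>\<^bsub>A i\<^esub> y i \<noteq> \<zero>\<^bsub>A i\<^esub>}"
    if "finite {i. x i \<noteq> \<zero>\<^bsub>A i\<^esub>}" "finite {i. y i \<noteq> \<zero>\<^bsub>A i\<^esub>}" for x y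
    by (rule finite_subset[OF _ finite_UnI[OF that]]) auto
  have 2: "finite {i. s \<odot>\<^bsub>A i\<^esub> x i \<noteq> \<zero>\<^bsub>A i\<^esub>}"
    if "finite {i. x i \<noteq> \<zero>\<^bsub>A i\<^esub>}" "s \<in> carrier S" for x s
    by (rule finite_subset[OF _ that(1)]) (use that(2) in auto)
  have 3: "finite {i. \<ominus>\<^bsub>A i\<^esub> x i \<noteq> \<zero>\<^bsub>A i\<^esub>}" if "finite {i. x i \<noteq> \<zero>\<^bsub>A i\<^esub>}" for x
    by (rule finite_subset[OF _ that]) auto
  show ?thesis
  proof (rule moduleI[OF A.R.cring_axioms])
    show "abelian_group (direct_sum A)"
    proof (rule abelian_groupI)
      fix x assume "x \<in> carrier (direct_sum A)"
      then show "\<exists>y\<in>carrier (direct_sum A). y \<oplus>\<^bsub>direct_sum A\<^esub> x = \<zero>\<^bsub>direct_sum A\<^esub>"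
        by (intro bexI[of _ "\<lambda>i. \<ominus>\<^bsub>A i\<^esub> x i"]) (auto simp: A.M.l_neg 3)
    qed (auto simp: A.M.a_ac 1)
  qed (auto simp: A.smult_l_distr A.smult_r_distr A.smult_assoc1 2)
qed

lemma tensor_complex_cmod [simp]:
  "cmod (tensor_complex S A B) k = direct_sum (\<lambda>p. tensor_module S (cmod A p) (cmod B (k - p)))"
  by (simp add: tensor_complex_def)

lemma tensor_complex_cdiff:
  "cdiff (tensor_complex S A B) k z p =
     tensor_map S (cmod A p) (cmod B (k - 1 - p)) (cdiff A (p + 1)) (\<lambda>x. x) (z (p + 1))
     \<oplus>\<^bsub>tensor_module S (cmod A p) (cmod B (k - 1 - p))\<^esub>
     signed (tensor_module S (cmod A p) (cmod B (k - 1 - p))) p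
       (tensor_map S (cmod A p) (cmod B (k - 1 - p)) (\<lambda>x. x) (cdiff B (k - p)) (z p))"
  by (simp add: tensor_complex_def Let_def id_def)

definition tensor_push ::
  "('s, 'z) ring_scheme \<Rightarrow> ('s, 'c) cplx \<Rightarrow> ('s, 'b) cplx \<Rightarrow> (int \<Rightarrow> 'a \<Rightarrow> 'c) \<Rightarrow> int \<Rightarrow>
     (int \<Rightarrow> ('a \<times> 'b \<Rightarrow> 's) set) \<Rightarrow> int \<Rightarrow> ('c \<times> 'b \<Rightarrow> 's) set" where
  "tensor_push S A' B \<phi> k z p = tensor_map S (cmod A' p) (cmod B (k - p)) (\<phi> p) (\<lambda>x. x) (z p)"

context
  fixes S :: "('s, 'z) ring_scheme" and A :: "('s, 'a) cplx" and B :: "('s, 'b) cplx"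
  assumes A: "chain_complex S A" and B: "chain_complex S B"
begin

private abbreviation (input) "T p q \<equiv> tensor_module S (cmod A p) (cmod B q)"
private abbreviation (input) "H \<equiv> tensor_complex S A B"

lemma tensor_complex_T: "module S (T p q)"
  by (rule tensor_module_module[OF chain_complexD(1)[OF A] chain_complexD(1)[OF B]])

lemma tensor_complex_cdiff_left:
  "tensor_map S (cmod A p) (cmod B (k - 1 - p)) (cdiff A (p + 1)) (\<lambda>x. x)
     \<in> mod_hom S (T (p + 1) (k - (p + 1))) (T p (k - 1 - p))"
proof -
  have "k - (p + 1) = k - 1 - p" by simp
  moreover have "cdiff A (p + 1) \<in> mod_hom S (cmod A (p + 1)) (cmod A p)"
    using chain_complexD(2)[OF A, of "p + 1"] by simp
  ultimately show ?thesis
    using tensor_map(1)[OF chain_complexD(1)[OF A] chain_complexD(1)[OF B] chain_complexD(1)[OF A]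
        chain_complexD(1)[OF B] _ mod_hom_id] by metis
qed

lemma tensor_complex_cdiff_right:
  "tensor_map S (cmod A p) (cmod B (k - 1 - p)) (\<lambda>x. x) (cdiff B (k - p))
     \<in> mod_hom S (T p (k - p)) (T p (k - 1 - p))"
proof -
  have "k - p - 1 = k - 1 - p" by simp
  then have "cdiff B (k - p) \<in> mod_hom S (cmod B (k - p)) (cmod B (k - 1 - p))"
    using chain_complexD(2)[OF B, of "k - p"] by (simp only:)
  then show ?thesis
    by (rule tensor_map(1)[OF chain_complexD(1)[OF A] chain_complexD(1)[OF B] chain_complexD(1)[OF A]
        chain_complexD(1)[OF B] mod_hom_id])
qed

lemma tensor_complex_cdiff_closed:
  assumes "z \<in> carrier (cmod H k)"
  shows "cdiff H k z \<in> carrier (cmod H (k - 1))"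
proof -
  interpret T: module S "T p q" for p q by (rule tensor_complex_T)
  note l = tensor_complex_cdiff_left and r = tensor_complex_cdiff_right
  have z: "z p \<in> carrier (T p (k - p))" for p using assms by simp
  have "cdiff H k z p \<in> carrier (T p (k - 1 - p))" for p
    using mod_hom_closed[OF l z[of "p + 1"]] mod_hom_closed[OF r z[of p]]
    by (simp add: tensor_complex_cdiff signed_closed[OF T.M.abelian_group_axioms])
  \<comment> \<open>Component p of the image involves only the components p and p + 1 of
    \<open>z\<close>, so the support stays finite.\<close>
  moreover have "finite {p. cdiff H k z p \<noteq> \<zero>\<^bsub>T p (k - 1 - p)\<^esub>}"
  proof (rule finite_subset)
    show "{p. cdiff H k z p \<noteq> \<zero>\<^bsub>T p (k - 1 - p)\<^esub>} \<subseteq>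
        (\<lambda>p. p - 1) ` {p. z p \<noteq> \<zero>\<^bsub>T p (k - p)\<^esub>} \<union> {p. z p \<noteq> \<zero>\<^bsub>T p (k - p)\<^esub>}"
    proof
      fix p assume p: "p \<in> {p. cdiff H k z p \<noteq> \<zero>\<^bsub>T p (k - 1 - p)\<^esub>}"
      have "z (p + 1) \<noteq> \<zero>\<^bsub>T (p + 1) (k - (p + 1))\<^esub> \<or> z p \<noteq> \<zero>\<^bsub>T p (k - p)\<^esub>"
      proof (rule ccontr)
        assume "\<not> ?thesis"
        then have "cdiff H k z p = \<zero>\<^bsub>T p (k - 1 - p)\<^esub>"
          using mod_hom_zero[OF tensor_complex_T tensor_complex_T l, of p k]
            mod_hom_zero[OF tensor_complex_T tensor_complex_T r, of p k]
          by (simp add: tensor_complex_cdiff signed_def)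
        with p show False by simp
      qed
      then show "p \<in> (\<lambda>p. p - 1) ` {p. z p \<noteq> \<zero>\<^bsub>T p (k - p)\<^esub>} \<union> {p. z p \<noteq> \<zero>\<^bsub>T p (k - p)\<^esub>}"
        by (auto intro!: image_eqI[of _ _ "p + 1"])
    qed
    show "finite ((\<lambda>p. p - 1) ` {p. z p \<noteq> \<zero>\<^bsub>T p (k - p)\<^esub>} \<union> {p. z p \<noteq> \<zero>\<^bsub>T p (k - p)\<^esub>})"
      using assms by simp
  qed
  ultimately show ?thesis by simp
qed

lemma tensor_complex_complex: "chain_complex S H"
  unfolding chain_complex_def
proof (intro conjI allI ballI)
  interpret T: module S "T p q" for p q by (rule tensor_complex_T)
  note l = tensor_complex_cdiff_left and r = tensor_complex_cdiff_right
  note s = signed_closed[OF T.M.abelian_group_axioms]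
  note A' = chain_complexD[OF A] and B' = chain_complexD[OF B]
  fix k
  show "module S (cmod H k)" by (simp add: direct_sum_module tensor_complex_T)
  show "cdiff H k \<in> mod_hom S (cmod H k) (cmod H (k - 1))"
  proof (rule mod_homI[OF tensor_complex_cdiff_closed])
    fix z w assume zw: "z \<in> carrier (cmod H k)" "w \<in> carrier (cmod H k)"
    then have c: "z p \<in> carrier (T p (k - p))" "w p \<in> carrier (T p (k - p))" for p by simp_all
    show "cdiff H k (z \<oplus>\<^bsub>cmod H k\<^esub> w) = cdiff H k z \<oplus>\<^bsub>cmod H (k - 1)\<^esub> cdiff H k w"
    proof
      fix p
      show "cdiff H k (z \<oplus>\<^bsub>cmod H k\<^esub> w) p = (cdiff H k z \<oplus>\<^bsub>cmod H (k - 1)\<^esub> cdiff H k w) p"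
        using mod_hom_closed[OF l c(1)[of "p + 1"]] mod_hom_closed[OF r c(1)[of p]]
          mod_hom_closed[OF l c(2)[of "p + 1"]] mod_hom_closed[OF r c(2)[of p]]
        by (simp add: tensor_complex_cdiff mod_hom_add[OF l c] mod_hom_add[OF r c]
            signed_add[OF T.M.abelian_group_axioms] s T.M.a_ac)
    qed
  next
    fix x z assume x: "x \<in> carrier S" and "z \<in> carrier (cmod H k)"
    then have c: "z p \<in> carrier (T p (k - p))" for p by simp
    show "cdiff H k (x \<odot>\<^bsub>cmod H k\<^esub> z) = x \<odot>\<^bsub>cmod H (k - 1)\<^esub> cdiff H k z"
    proof
      fix p
      show "cdiff H k (x \<odot>\<^bsub>cmod H k\<^esub> z) p = (x \<odot>\<^bsub>cmod H (k - 1)\<^esub> cdiff H k z) p"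
        using mod_hom_closed[OF l c[of "p + 1"]] mod_hom_closed[OF r c[of p]] x
        by (simp add: tensor_complex_cdiff mod_hom_smult[OF l x c] mod_hom_smult[OF r x c]
            signed_smult[OF tensor_complex_T] s T.smult_r_distr)
    qed
  qed
  fix z assume z: "z \<in> carrier (cmod H k)"
  then have c: "z p \<in> carrier (T p (k - p))" for p by simp
  show "cdiff H (k - 1) (cdiff H k z) = \<zero>\<^bsub>cmod H (k - 2)\<^esub>"
  proof
    fix p
    let ?T = "T p (k - 2 - p)"
    have i [simp]: "k - 1 - 1 - p = k - 2 - p" "k - 1 - p - 1 = k - 2 - p" "k - 1 - (p + 1) = k - 2 - p"
      "k - (p + 1) = k - 1 - p" "p + 1 + 1 = p + 2" "p + 2 - 1 = p + 1" "k - (p + 2) = k - 2 - p" by simp_all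
    have j: "k - p - 1 = k - 1 - p" "k - p - 2 = k - 2 - p" by simp_all
    have dA1: "cdiff A (p + 1) \<in> mod_hom S (cmod A (p + 1)) (cmod A p)" using A'(2)[of "p + 1"] by simp
    have dA2: "cdiff A (p + 2) \<in> mod_hom S (cmod A (p + 2)) (cmod A (p + 1))" using A'(2)[of "p + 2"] by simp
    have dB1: "cdiff B (k - 1 - p) \<in> mod_hom S (cmod B (k - 1 - p)) (cmod B (k - 2 - p))"
      using B'(2)[of "k - 1 - p"] by simp
    have dB2: "cdiff B (k - p) \<in> mod_hom S (cmod B (k - p)) (cmod B (k - 1 - p))"
      using B'(2)[of "k - p"] by (simp only: j)
    have AA: "cdiff A (p + 1) (cdiff A (p + 2) x) = \<zero>\<^bsub>cmod A p\<^esub>" if "x \<in> carrier (cmod A (p + 2))" for x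
      using A'(3)[OF that] by simp
    have BB: "cdiff B (k - 1 - p) (cdiff B (k - p) x) = \<zero>\<^bsub>cmod B (k - 2 - p)\<^esub>"
      if "x \<in> carrier (cmod B (k - p))" for x
      using B'(3)[OF that] by (simp only: j)
    define a where "a = tensor_map S (cmod A (p + 1)) (cmod B (k - 2 - p)) (cdiff A (p + 2)) (\<lambda>x. x) (z (p + 2))"
    define b where "b = tensor_map S (cmod A (p + 1)) (cmod B (k - 2 - p)) (\<lambda>x. x) (cdiff B (k - 1 - p)) (z (p + 1))"
    define c' where "c' = tensor_map S (cmod A p) (cmod B (k - 1 - p)) (cdiff A (p + 1)) (\<lambda>x. x) (z (p + 1))"
    define d where "d = tensor_map S (cmod A p) (cmod B (k - 1 - p)) (\<lambda>x. x) (cdiff B (k - p)) (z p)"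
    \<comment> \<open>The image of \<open>z (p + 1)\<close> under the tensor product of the two
      differentials. Among the four terms of the squared differential, two vanish because a
      differential is applied twice to one factor; the other two are \<open>m\<close> with sign
      (-1)^(p+1) and \<open>m\<close> with sign (-1)^p.\<close>
    define m where "m = tensor_map S (cmod A p) (cmod B (k - 2 - p)) (cdiff A (p + 1)) (cdiff B (k - 1 - p)) (z (p + 1))"
    have z2: "z (p + 2) \<in> carrier (T (p + 2) (k - 2 - p))" using c[of "p + 2"] by simp
    have z1: "z (p + 1) \<in> carrier (T (p + 1) (k - 1 - p))" using c[of "p + 1"] by simp
    have ac: "a \<in> carrier (T (p + 1) (k - 2 - p))"
      unfolding a_def by (rule mod_hom_closed[OF tensor_map(1)[OF A'(1) B'(1) A'(1) B'(1) dA2 mod_hom_id] z2])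
    have bc: "b \<in> carrier (T (p + 1) (k - 2 - p))"
      unfolding b_def by (rule mod_hom_closed[OF tensor_map(1)[OF A'(1) B'(1) A'(1) B'(1) mod_hom_id dB1] z1])
    have cc: "c' \<in> carrier (T p (k - 1 - p))"
      unfolding c'_def by (rule mod_hom_closed[OF tensor_map(1)[OF A'(1) B'(1) A'(1) B'(1) dA1 mod_hom_id] z1])
    have dc: "d \<in> carrier (T p (k - 1 - p))"
      unfolding d_def by (rule mod_hom_closed[OF tensor_map(1)[OF A'(1) B'(1) A'(1) B'(1) mod_hom_id dB2] c])
    have mc: "m \<in> carrier ?T"
      unfolding m_def by (rule mod_hom_closed[OF tensor_map(1)[OF A'(1) B'(1) A'(1) B'(1) dA1 dB1] z1])
    let ?L = "tensor_map S (cmod A p) (cmod B (k - 2 - p)) (cdiff A (p + 1)) (\<lambda>x. x)"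
    let ?R = "tensor_map S (cmod A p) (cmod B (k - 2 - p)) (\<lambda>x. x) (cdiff B (k - 1 - p))"
    have L: "?L \<in> mod_hom S (T (p + 1) (k - 2 - p)) ?T"
      by (rule tensor_map(1)[OF A'(1) B'(1) A'(1) B'(1) dA1 mod_hom_id])
    have R: "?R \<in> mod_hom S (T p (k - 1 - p)) ?T"
      by (rule tensor_map(1)[OF A'(1) B'(1) A'(1) B'(1) mod_hom_id dB1])
    have La: "?L a = \<zero>\<^bsub>?T\<^esub>"
      using tensor_map_comp[OF A'(1) B'(1) A'(1) B'(1) A'(1) B'(1) dA2 mod_hom_id dA1 mod_hom_id z2]
        tensor_map_cong[OF A'(1) B'(1) A'(1) B'(1) mod_hom_comp[OF dA2 dA1] mod_hom_id AA refl z2]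
        tensor_map_zero(1)[OF A'(1) B'(1) A'(1) B'(1) z2 mod_hom_id]
      by (simp add: a_def)
    have Lb: "?L b = m"
      using tensor_map_comp[OF A'(1) B'(1) A'(1) B'(1) A'(1) B'(1) mod_hom_id dB1 dA1 mod_hom_id z1]
      by (simp add: b_def m_def)
    have Rc: "?R c' = m"
      using tensor_map_comp[OF A'(1) B'(1) A'(1) B'(1) A'(1) B'(1) dA1 mod_hom_id mod_hom_id dB1 z1]
      by (simp add: c'_def m_def)
    have Rd: "?R d = \<zero>\<^bsub>?T\<^esub>"
      using tensor_map_comp[OF A'(1) B'(1) A'(1) B'(1) A'(1) B'(1) mod_hom_id dB2 mod_hom_id dB1 c]
        tensor_map_cong[OF A'(1) B'(1) A'(1) B'(1) mod_hom_id mod_hom_comp[OF dB2 dB1] refl BB c]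
        tensor_map_zero(2)[OF A'(1) B'(1) A'(1) B'(1) c mod_hom_id]
      by (simp add: d_def)
    have D1: "cdiff H k z (p + 1) = a \<oplus>\<^bsub>T (p + 1) (k - 2 - p)\<^esub> signed (T (p + 1) (k - 2 - p)) (p + 1) b"
      by (simp add: tensor_complex_cdiff a_def b_def)
    have D0: "cdiff H k z p = c' \<oplus>\<^bsub>T p (k - 1 - p)\<^esub> signed (T p (k - 1 - p)) p d"
      by (simp add: tensor_complex_cdiff c'_def d_def)
    have "cdiff H (k - 1) (cdiff H k z) p = ?L (cdiff H k z (p + 1)) \<oplus>\<^bsub>?T\<^esub> signed ?T p (?R (cdiff H k z p))"
      by (simp add: tensor_complex_cdiff[of S A B "k - 1"])
    also have "?L (cdiff H k z (p + 1)) = signed ?T (p + 1) m"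
      unfolding D1 using ac bc mc s[OF bc]
      by (simp add: mod_hom_add[OF L] signed_mod_hom[OF tensor_complex_T tensor_complex_T L] La Lb s)
    also have "?R (cdiff H k z p) = m"
      unfolding D0 using cc dc mc s[OF dc]
      by (simp add: mod_hom_add[OF R] signed_mod_hom[OF tensor_complex_T tensor_complex_T R] Rc Rd)
         (simp add: signed_def)
    also have "signed ?T (p + 1) m \<oplus>\<^bsub>?T\<^esub> signed ?T p m = \<zero>\<^bsub>?T\<^esub>"
      using mc by (simp add: signed_def T.M.l_neg T.M.r_neg)
    finally show "cdiff H (k - 1) (cdiff H k z) p = \<zero>\<^bsub>cmod H (k - 2)\<^esub> p" by simp
  qed
qed

end

section \<open>Functoriality of the tensor complex in its first factor\<close>

context
  fixes S :: "('s, 'z) ring_scheme" and A :: "('s, 'a) cplx" and A' :: "('s, 'c) cplx" and B :: "('s, 'b) cplx"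
    and \<phi> :: "int \<Rightarrow> 'a \<Rightarrow> 'c"
  assumes A: "chain_complex S A" and A': "chain_complex S A'" and B: "chain_complex S B"
    and \<phi>: "chain_map S A A' \<phi>"
begin

private abbreviation (input) "push k \<equiv> tensor_push S A' B \<phi> k"
private lemmas mA = chain_complexD(1)[OF A] and mA' = chain_complexD(1)[OF A'] and mB = chain_complexD(1)[OF B]

lemma tensor_push_component:
  "tensor_map S (cmod A' p) (cmod B q) (\<phi> p) (\<lambda>x. x)
    \<in> mod_hom S (tensor_module S (cmod A p) (cmod B q)) (tensor_module S (cmod A' p) (cmod B q))"
  by (rule tensor_map(1)[OF mA mB mA' mB chain_mapD(1)[OF \<phi>] mod_hom_id])

lemma tensor_push_hom: "push k \<in> mod_hom S (cmod (tensor_complex S A B) k) (cmod (tensor_complex S A' B) k)"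
proof (rule mod_homI)
  note c = tensor_push_component
  fix z assume z: "z \<in> carrier (cmod (tensor_complex S A B) k)"
  then have "{p. push k z p \<noteq> \<zero>\<^bsub>tensor_module S (cmod A' p) (cmod B (k - p))\<^esub>} \<subseteq>
      {p. z p \<noteq> \<zero>\<^bsub>tensor_module S (cmod A p) (cmod B (k - p))\<^esub>}"
    using mod_hom_zero[OF tensor_module_module[OF mA mB] tensor_module_module[OF mA' mB] c]
    by (auto simp: tensor_push_def)
  with z show "push k z \<in> carrier (cmod (tensor_complex S A' B) k)"
    by (auto simp: tensor_push_def mod_hom_closed[OF c] intro: finite_subset)
  {
    fix w assume "w \<in> carrier (cmod (tensor_complex S A B) k)"
    with z show "push k (z \<oplus>\<^bsub>cmod (tensor_complex S A B) k\<^esub> w) =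
        push k z \<oplus>\<^bsub>cmod (tensor_complex S A' B) k\<^esub> push k w"
      by (simp add: tensor_push_def mod_hom_add[OF c] fun_eq_iff)
  next
    fix s assume "s \<in> carrier S"
    with z show "push k (s \<odot>\<^bsub>cmod (tensor_complex S A B) k\<^esub> z) =
        s \<odot>\<^bsub>cmod (tensor_complex S A' B) k\<^esub> push k z"
      by (simp add: tensor_push_def mod_hom_smult[OF c] fun_eq_iff)
  }
qed

lemma tensor_push_cdiff:
  assumes z: "z \<in> carrier (cmod (tensor_complex S A B) k)"
  shows "cdiff (tensor_complex S A' B) k (push k z) = push (k - 1) (cdiff (tensor_complex S A B) k z)"
proof
  fix p
  have i [simp]: "k - (p + 1) = k - 1 - p" by simp
  have j: "k - p - 1 = k - 1 - p" by simp
  have zp: "z p \<in> carrier (tensor_module S (cmod A p) (cmod B (k - p)))" for p using z by simp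
  have z1: "z (p + 1) \<in> carrier (tensor_module S (cmod A (p + 1)) (cmod B (k - 1 - p)))"
    using zp[of "p + 1"] by simp
  let ?T = "tensor_module S (cmod A p) (cmod B (k - 1 - p))"
  let ?T' = "tensor_module S (cmod A' p) (cmod B (k - 1 - p))"
  have T: "module S ?T" and T': "module S ?T'"
    by (rule tensor_module_module[OF mA mB], rule tensor_module_module[OF mA' mB])
  interpret T: module S ?T by (rule T)
  have dA: "cdiff A (p + 1) \<in> mod_hom S (cmod A (p + 1)) (cmod A p)"
    using chain_complexD(2)[OF A, of "p + 1"] by simp
  have dA': "cdiff A' (p + 1) \<in> mod_hom S (cmod A' (p + 1)) (cmod A' p)"
    using chain_complexD(2)[OF A', of "p + 1"] by simp
  have dB: "cdiff B (k - p) \<in> mod_hom S (cmod B (k - p)) (cmod B (k - 1 - p))"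
    using chain_complexD(2)[OF B, of "k - p"] by (simp only: j)
  note f = chain_mapD(1)[OF \<phi>]
  let ?l = "tensor_map S (cmod A p) (cmod B (k - 1 - p)) (cdiff A (p + 1)) (\<lambda>x. x) (z (p + 1))"
  let ?r = "tensor_map S (cmod A p) (cmod B (k - 1 - p)) (\<lambda>x. x) (cdiff B (k - p)) (z p)"
  let ?\<phi> = "tensor_map S (cmod A' p) (cmod B (k - 1 - p)) (\<phi> p) (\<lambda>x. x)"
  have lc: "?l \<in> carrier ?T" by (rule mod_hom_closed[OF tensor_map(1)[OF mA mB mA mB dA mod_hom_id] z1])
  have rc: "?r \<in> carrier ?T" by (rule mod_hom_closed[OF tensor_map(1)[OF mA mB mA mB mod_hom_id dB] zp])
  have 1: "?\<phi> ?l = tensor_map S (cmod A' p) (cmod B (k - 1 - p)) (cdiff A' (p + 1)) (\<lambda>x. x) (push k z (p + 1))"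
    using tensor_map_comp[OF mA mB mA mB mA' mB dA mod_hom_id f mod_hom_id z1]
      tensor_map_comp[OF mA mB mA' mB mA' mB f mod_hom_id dA' mod_hom_id z1]
      tensor_map_cong[OF mA mB mA' mB mod_hom_comp[OF dA f] mod_hom_id _ refl z1,
        of "\<lambda>x. cdiff A' (p + 1) (\<phi> (p + 1) x)"] chain_mapD(3)[OF \<phi>, of _ "p + 1"]
    by (simp add: tensor_push_def)
  have 2: "?\<phi> ?r = tensor_map S (cmod A' p) (cmod B (k - 1 - p)) (\<lambda>x. x) (cdiff B (k - p)) (push k z p)"
    using tensor_map_comp[OF mA mB mA mB mA' mB mod_hom_id dB f mod_hom_id zp]
      tensor_map_comp[OF mA mB mA' mB mA' mB f mod_hom_id mod_hom_id dB zp]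
    by (simp add: tensor_push_def)
  have "push (k - 1) (cdiff (tensor_complex S A B) k z) p = ?\<phi> (?l \<oplus>\<^bsub>?T\<^esub> signed ?T p ?r)"
    by (simp add: tensor_push_def tensor_complex_cdiff)
  also have "\<dots> = ?\<phi> ?l \<oplus>\<^bsub>?T'\<^esub> signed ?T' p (?\<phi> ?r)"
    using lc rc by (simp add: mod_hom_add[OF tensor_push_component] signed_closed[OF T.M.abelian_group_axioms]
      signed_mod_hom[OF T T' tensor_push_component])
  finally show "cdiff (tensor_complex S A' B) k (push k z) p = push (k - 1) (cdiff (tensor_complex S A B) k z) p"
    by (simp add: tensor_complex_cdiff 1 2)
qed

lemma tensor_push_cycles:
  assumes "z \<in> cycles (tensor_complex S A B) k"
  shows "push k z \<in> cycles (tensor_complex S A' B) k"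
proof -
  have z: "z \<in> carrier (cmod (tensor_complex S A B) k)"
    "cdiff (tensor_complex S A B) k z = \<zero>\<^bsub>cmod (tensor_complex S A B) (k - 1)\<^esub>"
    using assms by (auto simp: cycles_iff)
  note tc = tensor_complex_complex[OF A B] tensor_complex_complex[OF A' B]
  show ?thesis
    using mod_hom_closed[OF tensor_push_hom z(1)] tensor_push_cdiff[OF z(1)]
      mod_hom_zero[OF chain_complexD(1)[OF tc(1)] chain_complexD(1)[OF tc(2)] tensor_push_hom, of "k - 1"]
    unfolding z(2) cycles_iff by simp
qed

lemma tensor_push_boundaries:
  assumes "z \<in> boundaries (tensor_complex S A B) k"
  shows "push k z \<in> boundaries (tensor_complex S A' B) k"
proof -
  obtain w where w: "w \<in> carrier (cmod (tensor_complex S A B) (k + 1))"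
    "z = cdiff (tensor_complex S A B) (k + 1) w" using assms by (auto simp only: boundaries_iff)
  then show ?thesis
    using mod_hom_closed[OF tensor_push_hom w(1)] tensor_push_cdiff[OF w(1)]
    unfolding boundaries_iff by (intro bexI[of _ "push (k + 1) w"]) simp_all
qed

end

lemma tensor_push_comp:
  assumes A: "chain_complex S A" and A': "chain_complex S A'" and A'': "chain_complex S A''"
    and B: "chain_complex S B" and \<phi>: "chain_map S A A' \<phi>" and \<psi>: "chain_map S A' A'' \<psi>"
    and z: "z \<in> carrier (cmod (tensor_complex S A B) k)"
  shows "tensor_push S A'' B \<psi> k (tensor_push S A' B \<phi> k z) =
    tensor_push S A'' B (\<lambda>k x. \<psi> k (\<phi> k x)) k z"
  unfolding tensor_push_def
  using tensor_map_comp[OF chain_complexD(1)[OF A] chain_complexD(1)[OF B] chain_complexD(1)[OF A']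
      chain_complexD(1)[OF B] chain_complexD(1)[OF A''] chain_complexD(1)[OF B] chain_mapD(1)[OF \<phi>]
      mod_hom_id chain_mapD(1)[OF \<psi>] mod_hom_id] z
  by auto

text \<open>The boundary is that of the image of \<open>z\<close> under h \<otimes> 1. Its
  differential has the terms (d h) \<otimes> 1 and h \<otimes> d; on a cycle the latter can be
  rewritten as (h d) \<otimes> 1.\<close>

lemma tensor_push_homotopy:
  assumes A: "chain_complex S A" and B: "chain_complex S B"
    and \<chi>: "\<And>k. \<chi> k \<in> mod_hom S (cmod A k) (cmod A k)"
    and h: "\<And>k. h k \<in> mod_hom S (cmod A k) (cmod A (k + 1))"
    and eq: "\<And>k x. x \<in> carrier (cmod A k) \<Longrightarrow>
      \<chi> k x = x \<oplus>\<^bsub>cmod A k\<^esub> (cdiff A (k + 1) (h k x) \<oplus>\<^bsub>cmod A k\<^esub> h (k - 1) (cdiff A k x))"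
    and z: "z \<in> cycles (tensor_complex S A B) k"
  shows "\<exists>b\<in>boundaries (tensor_complex S A B) k.
    tensor_push S A B \<chi> k z = z \<oplus>\<^bsub>cmod (tensor_complex S A B) k\<^esub> b"
proof -
  let ?H = "tensor_complex S A B"
  note mA = chain_complexD(1)[OF A] and mB = chain_complexD(1)[OF B]
  note A' = chain_complexD[OF A] and B' = chain_complexD[OF B]
  let ?T = "\<lambda>p q. tensor_module S (cmod A p) (cmod B q)"
  have T: "module S (?T p q)" for p q by (rule tensor_module_module[OF mA mB])
  interpret T: module S "?T p q" for p q by (rule T)
  note sc = signed_closed[OF T.M.abelian_group_axioms]
  have zc: "z \<in> carrier (cmod ?H k)" "cdiff ?H k z = \<zero>\<^bsub>cmod ?H (k - 1)\<^esub>"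
    using z by (auto simp: cycles_iff)
  have zp: "z p \<in> carrier (?T p (k - p))" for p using zc(1) by simp
  have h1: "h (p - 1) \<in> mod_hom S (cmod A (p - 1)) (cmod A p)" for p using h[of "p - 1"] by simp
  have i: "k - (p - 1) = k + 1 - p" "k + 1 - 1 - p = k - p" "k + 1 - (p + 1) = k - p" "p + 1 - 1 = p" "k + 1 - p - 1 = k - p"
    "k - 1 - (p - 1) = k - p" "p - 1 + 1 = p" for p by simp_all
  define w where "w p = tensor_map S (cmod A p) (cmod B (k + 1 - p)) (h (p - 1)) (\<lambda>x. x) (z (p - 1))" for p
  have zp1: "z (p - 1) \<in> carrier (?T (p - 1) (k + 1 - p))" for p using zp[of "p - 1"] by (simp only: i)
  note hm = tensor_map(1)[OF mA mB mA mB h1 mod_hom_id]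
  have wp: "w p \<in> carrier (?T p (k + 1 - p))" for p
    unfolding w_def by (rule mod_hom_closed[OF hm zp1])
  have "finite {p. w p \<noteq> \<zero>\<^bsub>?T p (k + 1 - p)\<^esub>}"
  proof (rule finite_subset)
    show "{p. w p \<noteq> \<zero>\<^bsub>?T p (k + 1 - p)\<^esub>} \<subseteq> (\<lambda>p. p + 1) ` {p. z p \<noteq> \<zero>\<^bsub>?T p (k - p)\<^esub>}"
    proof
      fix p assume p: "p \<in> {p. w p \<noteq> \<zero>\<^bsub>?T p (k + 1 - p)\<^esub>}"
      have "z (p - 1) \<noteq> \<zero>\<^bsub>?T (p - 1) (k - (p - 1))\<^esub>"
        using p mod_hom_zero[OF T T hm] by (auto simp: w_def i)
      then show "p \<in> (\<lambda>p. p + 1) ` {p. z p \<noteq> \<zero>\<^bsub>?T p (k - p)\<^esub>}"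
        by (intro image_eqI[of _ _ "p - 1"]) auto
    qed
  qed (use zc(1) in simp)
  with wp have w: "w \<in> carrier (cmod ?H (k + 1))" by simp
  let ?b = "cdiff ?H (k + 1) w"
  have "tensor_push S A B \<chi> k z = z \<oplus>\<^bsub>cmod ?H k\<^esub> ?b"
  proof
    fix p
    have dA: "cdiff A (p + 1) \<in> mod_hom S (cmod A (p + 1)) (cmod A p)" using A'(2)[of "p + 1"] by simp
    have dB: "cdiff B (k + 1 - p) \<in> mod_hom S (cmod B (k + 1 - p)) (cmod B (k - p))"
      using B'(2)[of "k + 1 - p"] by (simp only: i)
    let ?M = "\<lambda>g h. tensor_map S (cmod A p) (cmod B (k - p)) g h"
    let ?P = "?T p (k - p)"
    define a where "a = ?M (\<lambda>x. cdiff A (p + 1) (h p x)) (\<lambda>x. x) (z p)"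
    define b where "b = ?M (\<lambda>x. h (p - 1) (cdiff A p x)) (\<lambda>x. x) (z p)"
    define c where "c = ?M (h (p - 1)) (cdiff B (k + 1 - p)) (z (p - 1))"
    have dh: "(\<lambda>x. cdiff A (p + 1) (h p x)) \<in> mod_hom S (cmod A p) (cmod A p)" by (rule mod_hom_comp[OF h dA])
    have hd: "(\<lambda>x. h (p - 1) (cdiff A p x)) \<in> mod_hom S (cmod A p) (cmod A p)" by (rule mod_hom_comp[OF A'(2) h1])
    have ac: "a \<in> carrier ?P" unfolding a_def by (rule mod_hom_closed[OF tensor_map(1)[OF mA mB mA mB dh mod_hom_id] zp])
    have bc: "b \<in> carrier ?P" unfolding b_def by (rule mod_hom_closed[OF tensor_map(1)[OF mA mB mA mB hd mod_hom_id] zp])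
    have cc: "c \<in> carrier ?P" unfolding c_def by (rule mod_hom_closed[OF tensor_map(1)[OF mA mB mA mB h1 dB] zp1])
    have b1: "?M (cdiff A (p + 1)) (\<lambda>x. x) (w (p + 1)) = a"
      using tensor_map_comp[OF mA mB mA mB mA mB h mod_hom_id dA mod_hom_id zp] by (simp add: w_def a_def i)
    have b2: "?M (\<lambda>x. x) (cdiff B (k + 1 - p)) (w p) = c"
      using tensor_map_comp[OF mA mB mA mB mA mB h1 mod_hom_id mod_hom_id dB zp1] by (simp add: w_def c_def)
    have bp: "?b p = a \<oplus>\<^bsub>?P\<^esub> signed ?P p c"
      by (simp add: tensor_complex_cdiff i b1 b2)
    \<comment> \<open>The cycle condition for \<open>z\<close> in position p - 1, pushed forward
      along h \<otimes> 1. It turns the term h \<otimes> d, with its sign, into (h d) \<otimes>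
      1.\<close>
    have cz: "b \<oplus>\<^bsub>?P\<^esub> signed ?P (p - 1) c = \<zero>\<^bsub>?P\<^esub>"
    proof -
      let ?Q = "?T (p - 1) (k - p)"
      let ?h = "?M (h (p - 1)) (\<lambda>x. x)"
      have hh: "?h \<in> mod_hom S ?Q ?P" by (rule hm)
      let ?l = "tensor_map S (cmod A (p - 1)) (cmod B (k - p)) (cdiff A p) (\<lambda>x. x) (z p)"
      let ?r = "tensor_map S (cmod A (p - 1)) (cmod B (k - p)) (\<lambda>x. x) (cdiff B (k + 1 - p)) (z (p - 1))"
      have lc: "?l \<in> carrier ?Q" by (rule mod_hom_closed[OF tensor_map(1)[OF mA mB mA mB A'(2) mod_hom_id] zp])
      have rc: "?r \<in> carrier ?Q" by (rule mod_hom_closed[OF tensor_map(1)[OF mA mB mA mB mod_hom_id dB] zp1])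
      have "cdiff ?H k z (p - 1) = \<zero>\<^bsub>?Q\<^esub>" by (simp add: zc(2) i)
      then have e: "?l \<oplus>\<^bsub>?Q\<^esub> signed ?Q (p - 1) ?r = \<zero>\<^bsub>?Q\<^esub>" by (simp add: tensor_complex_cdiff i)
      have l: "?h ?l = b"
        using tensor_map_comp[OF mA mB mA mB mA mB A'(2) mod_hom_id h1 mod_hom_id zp] by (simp add: b_def)
      have r: "?h ?r = c"
        using tensor_map_comp[OF mA mB mA mB mA mB mod_hom_id dB h1 mod_hom_id zp1] by (simp add: c_def)
      have "?h (?l \<oplus>\<^bsub>?Q\<^esub> signed ?Q (p - 1) ?r) = b \<oplus>\<^bsub>?P\<^esub> signed ?P (p - 1) c"
        using lc rc by (simp add: mod_hom_add[OF hh] sc signed_mod_hom[OF T T hh] l r)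
      then show ?thesis unfolding e using mod_hom_zero[OF T T hh] by simp
    qed
    have "signed ?P p c = b"
    proof -
      have e: "signed ?P (p - 1) c = \<ominus>\<^bsub>?P\<^esub> signed ?P p c" using cc by (simp add: signed_def)
      have "b \<ominus>\<^bsub>?P\<^esub> signed ?P p c = \<zero>\<^bsub>?P\<^esub>" using cz unfolding e by (simp add: a_minus_def)
      then show ?thesis using bc sc[OF cc] by (simp add: T.M.minus_eq_zero_iff)
    qed
    then have bp': "?b p = a \<oplus>\<^bsub>?P\<^esub> b" by (simp add: bp)
    have "tensor_push S A B \<chi> k z p = ?M (\<lambda>x. x \<oplus>\<^bsub>cmod A p\<^esub>
        (cdiff A (p + 1) (h p x) \<oplus>\<^bsub>cmod A p\<^esub> h (p - 1) (cdiff A p x))) (\<lambda>x. x) (z p)"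
      unfolding tensor_push_def by (rule tensor_map_cong[OF mA mB mA mB \<chi> mod_hom_id eq refl zp])
    also have "\<dots> = z p \<oplus>\<^bsub>?P\<^esub> (a \<oplus>\<^bsub>?P\<^esub> b)"
      using tensor_map_add_left[OF mA mB mA mB mod_hom_id mod_hom_sum[OF mA dh hd] mod_hom_id zp]
        tensor_map_add_left[OF mA mB mA mB dh hd mod_hom_id zp]
      by (simp add: tensor_map_id[OF mA mB zp] a_def b_def)
    finally show "tensor_push S A B \<chi> k z p = (z \<oplus>\<^bsub>cmod ?H k\<^esub> ?b) p" by (simp add: bp')
  qed
  moreover have "?b \<in> boundaries ?H k" using w by (auto simp only: boundaries_iff)
  ultimately show ?thesis by blast
qed

text \<open>As for Ext, but covariantly: the map is induced by \<phi>, its inverse up to boundaries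
  by \<psi>.\<close>

lemma min_gens_Tor_eq:
  assumes C: "free_res S M C Y \<eta>" and D: "free_res S M D Y' \<eta>'" and M: "module S M"
    and N: "chain_complex S N"
  shows "min_gens S (homology (tensor_complex S C N) i) = min_gens S (homology (tensor_complex S D N) i)"
proof -
  note C' = free_resD[OF C] and D' = free_resD[OF D]
  obtain \<phi> \<psi> h h' where \<phi>: "chain_map S C D \<phi>" and \<psi>: "chain_map S D C \<psi>"
    and h: "\<And>k. h k \<in> mod_hom S (cmod C k) (cmod C (k + 1))"
      "\<And>k x. x \<in> carrier (cmod C k) \<Longrightarrow> \<psi> k (\<phi> k x) =
        x \<oplus>\<^bsub>cmod C k\<^esub> (cdiff C (k + 1) (h k x) \<oplus>\<^bsub>cmod C k\<^esub> h (k - 1) (cdiff C k x))"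
    and h': "\<And>k. h' k \<in> mod_hom S (cmod D k) (cmod D (k + 1))"
      "\<And>k x. x \<in> carrier (cmod D k) \<Longrightarrow> \<phi> k (\<psi> k x) =
        x \<oplus>\<^bsub>cmod D k\<^esub> (cdiff D (k + 1) (h' k x) \<oplus>\<^bsub>cmod D k\<^esub> h' (k - 1) (cdiff D k x))"
    using free_res_comparison[OF C D M] by metis
  let ?HC = "tensor_complex S C N" and ?HD = "tensor_complex S D N"
  have HC: "chain_complex S ?HC" and HD: "chain_complex S ?HD"
    using tensor_complex_complex C'(1) D'(1) N by blast+
  have \<psi>\<phi>: "chain_map S C C (\<lambda>k x. \<psi> k (\<phi> k x))" and \<phi>\<psi>: "chain_map S D D (\<lambda>k x. \<phi> k (\<psi> k x))"
    using chain_map_comp \<phi> \<psi> by blast+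
  note ph = tensor_push_hom[OF C'(1) D'(1) N \<phi>]
  show ?thesis
  proof (rule homology_min_gens_eq[OF HC HD, where h = "tensor_push S D N \<phi> i"])
    fix g assume g: "g \<in> cycles ?HC i"
    then have gc: "g \<in> carrier (cmod ?HC i)" by (simp only: cycles_iff)
    show "tensor_push S D N \<phi> i g \<in> cycles ?HD i" by (rule tensor_push_cycles[OF C'(1) D'(1) N \<phi> g])
    assume "tensor_push S D N \<phi> i g \<in> boundaries ?HD i"
    then have b1: "tensor_push S C N \<psi> i (tensor_push S D N \<phi> i g) \<in> boundaries ?HC i"
      by (rule tensor_push_boundaries[OF D'(1) C'(1) N \<psi>])
    obtain b where b: "b \<in> boundaries ?HC i"
      "tensor_push S C N \<psi> i (tensor_push S D N \<phi> i g) = g \<oplus>\<^bsub>cmod ?HC i\<^esub> b"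
      unfolding tensor_push_comp[OF C'(1) D'(1) C'(1) N \<phi> \<psi> gc]
      using tensor_push_homotopy[OF C'(1) N chain_mapD(1)[OF \<psi>\<phi>] h g] by blast
    interpret H: module S "cmod ?HC i" by (rule chain_complexD(1)[OF HC])
    note E = H.submoduleE[OF boundaries_submodule[OF HC]]
    have "b \<in> carrier (cmod ?HC i)" using b(1) E(1) by blast
    then have "g = (g \<oplus>\<^bsub>cmod ?HC i\<^esub> b) \<oplus>\<^bsub>cmod ?HC i\<^esub> \<ominus>\<^bsub>cmod ?HC i\<^esub> b"
      using gc by (simp only: H.M.a_assoc H.M.r_neg H.M.a_inv_closed H.M.r_zero)
    then show "g \<in> boundaries ?HC i" using b b1 E(3,5) by metis
  next
    fix g assume g: "g \<in> cycles ?HD i"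
    then have gc: "g \<in> carrier (cmod ?HD i)" by (simp only: cycles_iff)
    obtain b where "b \<in> boundaries ?HD i"
      "tensor_push S D N \<phi> i (tensor_push S C N \<psi> i g) = g \<oplus>\<^bsub>cmod ?HD i\<^esub> b"
      unfolding tensor_push_comp[OF D'(1) C'(1) D'(1) N \<psi> \<phi> gc]
      using tensor_push_homotopy[OF D'(1) N chain_mapD(1)[OF \<phi>\<psi>] h' g] by blast
    then show "\<exists>x\<in>cycles ?HC i. \<exists>b\<in>boundaries ?HD i. tensor_push S D N \<phi> i x = g \<oplus>\<^bsub>cmod ?HD i\<^esub> b"
      using tensor_push_cycles[OF D'(1) C'(1) N \<psi> g] by blast
  next
    show "\<exists>t\<in>carrier S. \<forall>x\<in>cycles ?HC i. tensor_push S D N \<phi> i (s \<odot>\<^bsub>cmod ?HC i\<^esub> x) =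
        t \<odot>\<^bsub>cmod ?HD i\<^esub> tensor_push S D N \<phi> i x" if "s \<in> carrier S" for s
      using mod_hom_smult[OF ph that] that by (intro bexI[OF _ that] ballI) (simp only: cycles_iff)
    show "\<exists>s\<in>carrier S. \<forall>x\<in>cycles ?HC i. tensor_push S D N \<phi> i (s \<odot>\<^bsub>cmod ?HC i\<^esub> x) =
        t \<odot>\<^bsub>cmod ?HD i\<^esub> tensor_push S D N \<phi> i x" if "t \<in> carrier S" for t
      using mod_hom_smult[OF ph that] that by (intro bexI[OF _ that] ballI) (simp only: cycles_iff)
    show "tensor_push S D N \<phi> i (x \<oplus>\<^bsub>cmod ?HC i\<^esub> y) = tensor_push S D N \<phi> i x \<oplus>\<^bsub>cmod ?HD i\<^esub> tensor_push S D N \<phi> i y"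
      if "x \<in> cycles ?HC i" "y \<in> cycles ?HC i" for x y
      using that mod_hom_add[OF ph] by (simp only: cycles_iff)
  qed (rule tensor_push_boundaries[OF C'(1) D'(1) N \<phi>])
qed

section \<open>Base change along a surjection of rings\<close>

text \<open>Used for complexes over two rings that become isomorphic once scalars are matched along
  a surjection.\<close>

lemma homology_min_gens_eq_iso:
  assumes C: "chain_complex S C" and D: "chain_complex TX D"
    and bij: "\<And>k. bij_betw (h k) (carrier (cmod C k)) (carrier (cmod D k))"
    and add: "\<And>k x y. x \<in> carrier (cmod C k) \<Longrightarrow> y \<in> carrier (cmod C k) \<Longrightarrow>
      h k (x \<oplus>\<^bsub>cmod C k\<^esub> y) = h k x \<oplus>\<^bsub>cmod D k\<^esub> h k y"
    and sc: "\<And>s. s \<in> carrier S \<Longrightarrow>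
      \<exists>t\<in>carrier TX. \<forall>x\<in>carrier (cmod C i). h i (s \<odot>\<^bsub>cmod C i\<^esub> x) = t \<odot>\<^bsub>cmod D i\<^esub> h i x"
    and sc': "\<And>t. t \<in> carrier TX \<Longrightarrow>
      \<exists>s\<in>carrier S. \<forall>x\<in>carrier (cmod C i). h i (s \<odot>\<^bsub>cmod C i\<^esub> x) = t \<odot>\<^bsub>cmod D i\<^esub> h i x"
    and d: "\<And>k x. x \<in> carrier (cmod C k) \<Longrightarrow> cdiff D k (h k x) = h (k - 1) (cdiff C k x)"
  shows "min_gens S (homology C i) = min_gens TX (homology D i)"
proof -
  note C' = chain_complexD[OF C] and D' = chain_complexD[OF D]
  interpret C: module S "cmod C k" for k by (rule C')
  interpret D: module TX "cmod D k" for k by (rule D')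
  have hc: "h k x \<in> carrier (cmod D k)" if "x \<in> carrier (cmod C k)" for k x
    using bij that by (auto simp: bij_betw_def)
  have inj: "x = y" if "h k x = h k y" "x \<in> carrier (cmod C k)" "y \<in> carrier (cmod C k)" for k x y
    using bij that by (auto simp: bij_betw_def inj_on_def)
  have surj: "\<exists>x\<in>carrier (cmod C k). h k x = y" if "y \<in> carrier (cmod D k)" for k y
    using bij[of k] that unfolding bij_betw_def by (metis imageE)
  have z: "h k \<zero>\<^bsub>cmod C k\<^esub> = \<zero>\<^bsub>cmod D k\<^esub>" for k
    using add[of "\<zero>\<^bsub>cmod C k\<^esub>" k "\<zero>\<^bsub>cmod C k\<^esub>"] hc[of "\<zero>\<^bsub>cmod C k\<^esub>" k]
    by (simp add: D.M.add.l_cancel_one)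
  have dC: "cdiff C k x \<in> carrier (cmod C (k - 1))" if "x \<in> carrier (cmod C k)" for k x
    using mod_hom_closed[OF C'(2) that] .
  have cyc: "h i x \<in> cycles D i \<longleftrightarrow> x \<in> cycles C i" if "x \<in> carrier (cmod C i)" for x
  proof -
    have "h (i - 1) (cdiff C i x) = h (i - 1) \<zero>\<^bsub>cmod C (i - 1)\<^esub> \<longleftrightarrow> cdiff C i x = \<zero>\<^bsub>cmod C (i - 1)\<^esub>"
      using inj[OF _ dC[OF that] C.M.zero_closed] by metis
    then show ?thesis using that hc[OF that] by (simp add: cycles_iff d[OF that] z)
  qed
  have bd: "h i x \<in> boundaries D i \<longleftrightarrow> x \<in> boundaries C i" if x: "x \<in> carrier (cmod C i)" for x
  proof
    assume "h i x \<in> boundaries D i"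
    then obtain w where w: "w \<in> carrier (cmod D (i + 1))" "h i x = cdiff D (i + 1) w"
      by (auto simp: boundaries_iff)
    obtain v where v: "v \<in> carrier (cmod C (i + 1))" "h (i + 1) v = w" using surj[OF w(1)] by blast
    have "h i x = h i (cdiff C (i + 1) v)" using d[OF v(1)] w v by simp
    then have "x = cdiff C (i + 1) v" by (rule inj[OF _ x]) (use dC[OF v(1)] in simp)
    then show "x \<in> boundaries C i" using v by (auto simp: boundaries_iff)
  next
    assume "x \<in> boundaries C i"
    then obtain v where v: "v \<in> carrier (cmod C (i + 1))" "x = cdiff C (i + 1) v"
      by (auto simp: boundaries_iff)
    then have "h i x = cdiff D (i + 1) (h (i + 1) v)" using d[OF v(1)] by simp
    then show "h i x \<in> boundaries D i" using hc[OF v(1)] by (auto simp: boundaries_iff)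
  qed
  show ?thesis
  proof (rule homology_min_gens_eq[OF C D, where h = "h i"])
    fix y assume y: "y \<in> cycles D i"
    then obtain x where x: "x \<in> carrier (cmod C i)" "h i x = y" using surj by (auto simp: cycles_iff)
    then show "\<exists>x\<in>cycles C i. \<exists>b\<in>boundaries D i. h i x = y \<oplus>\<^bsub>cmod D i\<^esub> b"
      using y cyc submodule_zero[OF D'(1) boundaries_submodule[OF D]]
      by (intro bexI[of _ x] bexI[of _ "\<zero>\<^bsub>cmod D i\<^esub>"]) (auto simp: cycles_iff)
  next
    fix x assume "x \<in> boundaries C i"
    moreover from this have "x \<in> carrier (cmod C i)"
      using boundaries_subset_cycles[OF C, of i] by (auto simp: cycles_iff)
    ultimately show "h i x \<in> boundaries D i" using bd by blast
  next
    show "\<exists>t\<in>carrier TX. \<forall>x\<in>cycles C i. h i (s \<odot>\<^bsub>cmod C i\<^esub> x) = t \<odot>\<^bsub>cmod D i\<^esub> h i x"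
      if "s \<in> carrier S" for s using sc[OF that] by (meson cycles_iff)
    show "\<exists>s\<in>carrier S. \<forall>x\<in>cycles C i. h i (s \<odot>\<^bsub>cmod C i\<^esub> x) = t \<odot>\<^bsub>cmod D i\<^esub> h i x"
      if "t \<in> carrier TX" for t using sc'[OF that] by (meson cycles_iff)
  qed (use cyc bd add in \<open>auto simp: cycles_iff\<close>)
qed

subsection \<open>Tensor products with free modules\<close>

text \<open>The direct sum of copies of \<open>N\<close> indexed by \<open>X\<close>. Outside
  \<open>X\<close> the summand is the zero module, so that elements are functions on the whole type,
  as for free modules.\<close>

definition finsupp_module :: "('s, 'n) module \<Rightarrow> 'x set \<Rightarrow> ('s, 'x \<Rightarrow> 'n) module" where
  "finsupp_module N X = direct_sum (\<lambda>x. N\<lparr>carrier := if x \<in> X then carrier N else {\<zero>\<^bsub>N\<^esub>}\<rparr>)"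

lemma finsupp_module_iff:
  "v \<in> carrier (finsupp_module N X) \<longleftrightarrow> (\<forall>x\<in>X. v x \<in> carrier N) \<and> (\<forall>x. x \<notin> X \<longrightarrow> v x = \<zero>\<^bsub>N\<^esub>) \<and>
     finite {x. v x \<noteq> \<zero>\<^bsub>N\<^esub>}"
  by (auto simp: finsupp_module_def split: if_splits)

lemma finsupp_module_simps [simp]:
  "\<zero>\<^bsub>finsupp_module N X\<^esub> = (\<lambda>_. \<zero>\<^bsub>N\<^esub>)" "v \<oplus>\<^bsub>finsupp_module N X\<^esub> w = (\<lambda>x. v x \<oplus>\<^bsub>N\<^esub> w x)"
  "s \<odot>\<^bsub>finsupp_module N X\<^esub> v = (\<lambda>x. s \<odot>\<^bsub>N\<^esub> v x)"
  by (simp_all add: finsupp_module_def)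

text \<open>The isomorphism between the tensor product of a free module with \<open>N\<close> and
  the direct sum of copies of \<open>N\<close>. It makes the tensor product comparable over
  different rings, because its target mentions the ring only through the action.\<close>

definition tensor_eval :: "('s, 'z) ring_scheme \<Rightarrow> ('s, 'n) module \<Rightarrow> 'x set \<Rightarrow> (('x \<Rightarrow> 's) \<times> 'n \<Rightarrow> 's) set \<Rightarrow> 'x \<Rightarrow> 'n" where
  "tensor_eval S N X = tensor_lift S (finsupp_module N X) (\<lambda>u n x. u x \<odot>\<^bsub>N\<^esub> n)"

context
  fixes S :: "('s, 'z) ring_scheme" and N :: "('s, 'n) module" and X :: "'x set"
  assumes N: "module S N"
begin

interpretation N: module S N by (rule N)

private abbreviation (input) "FX \<equiv> free_module S X"
private abbreviation (input) "V \<equiv> finsupp_module N X"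
private abbreviation (input) "TX \<equiv> tensor_module S FX N"

private lemma FX: "module S FX" by (rule module_free_module[OF N.R.cring_axioms])

private lemma TX: "module S TX" by (rule tensor_module_module[OF FX N])

interpretation TX: module S TX by (rule TX)

lemma finsupp_module_module: "module S V"
  unfolding finsupp_module_def
proof (rule direct_sum_module)
  fix x
  have "submodule {\<zero>\<^bsub>N\<^esub>} S N" by (rule submodule_combine[OF N]) auto
  then have "submodule (if x \<in> X then carrier N else {\<zero>\<^bsub>N\<^esub>}) S N"
    using N.carrier_is_submodule by simp
  then show "module S (N\<lparr>carrier := if x \<in> X then carrier N else {\<zero>\<^bsub>N\<^esub>}\<rparr>)"
    by (rule submodule.submodule_is_module[OF _ N])
qed

lemma finsupp_coeff: "v \<in> carrier V \<Longrightarrow> v x \<in> carrier N"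
  by (cases "x \<in> X") (auto simp: finsupp_module_iff)

lemma tensor_eval_bilinear: "bilinear S FX N V (\<lambda>u n x. u x \<odot>\<^bsub>N\<^esub> n)"
proof (rule bilinearI)
  note c = free_module_coeff[OF N.R.cring_axioms]
  fix u n assume u: "u \<in> carrier FX" and n: "n \<in> carrier N"
  have "{x. u x \<odot>\<^bsub>N\<^esub> n \<noteq> \<zero>\<^bsub>N\<^esub>} \<subseteq> {x. u x \<noteq> \<zero>\<^bsub>S\<^esub>}" using n by auto
  with u n show "(\<lambda>x. u x \<odot>\<^bsub>N\<^esub> n) \<in> carrier V"
    by (auto simp: finsupp_module_iff free_module_carrier c[OF u] intro: finite_subset)
qed (simp_all add: free_module_coeff[OF N.R.cring_axioms] N.smult_l_distr N.smult_r_distr N.smult_assoc1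
    fun_eq_iff, metis N.R.m_comm N.smult_assoc1 free_module_coeff[OF N.R.cring_axioms])

lemma tensor_eval_hom: "tensor_eval S N X \<in> mod_hom S TX V"
  unfolding tensor_eval_def by (rule tensor_lift(1)[OF FX N finsupp_module_module tensor_eval_bilinear])

lemma tensor_eval_pure:
  "u \<in> carrier FX \<Longrightarrow> n \<in> carrier N \<Longrightarrow> tensor_eval S N X (pure_tensor S FX N u n) = (\<lambda>x. u x \<odot>\<^bsub>N\<^esub> n)"
  unfolding tensor_eval_def by (rule tensor_lift(2)[OF FX N finsupp_module_module tensor_eval_bilinear])

text \<open>The inverse of \<open>tensor_eval\<close>: the sum of the tensors of the basis elements
  with the components of \<open>v\<close>.\<close>

private definition "collect v = (\<Oplus>\<^bsub>TX\<^esub> x\<in>{x. v x \<noteq> \<zero>\<^bsub>N\<^esub>}. pure_tensor S FX N (basis_elt S x) (v x))"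

private lemma pure_basis_closed: "x \<in> X \<Longrightarrow> n \<in> carrier N \<Longrightarrow> pure_tensor S FX N (basis_elt S x) n \<in> carrier TX"
  by (rule bilinearD(1)[OF pure_tensor_bilinear[OF FX N] basis_elt_closed[OF N.R.cring_axioms]])

private lemma collect_eq:
  assumes "v \<in> carrier V" "finite G" "{x. v x \<noteq> \<zero>\<^bsub>N\<^esub>} \<subseteq> G" "G \<subseteq> X"
  shows "collect v = (\<Oplus>\<^bsub>TX\<^esub> x\<in>G. pure_tensor S FX N (basis_elt S x) (v x))"
  unfolding collect_def
proof (rule TX.M.add.finprod_mono_neutral_cong_left[OF assms(2,3)])
  show "pure_tensor S FX N (basis_elt S x) (v x) = \<zero>\<^bsub>TX\<^esub>" if "x \<in> G - {x. v x \<noteq> \<zero>\<^bsub>N\<^esub>}" for x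
  proof -
    have "x \<in> X" "v x = \<zero>\<^bsub>N\<^esub>" using assms(4) that by auto
    then show ?thesis by (simp add: pure_tensor_zero(2)[OF FX N] basis_elt_closed[OF N.R.cring_axioms])
  qed
  show "(\<lambda>x. pure_tensor S FX N (basis_elt S x) (v x)) \<in> G \<rightarrow> carrier TX"
    using assms(4) pure_basis_closed finsupp_coeff[OF assms(1)] by auto
qed simp

private lemma collect_hom: "collect \<in> mod_hom S V TX"
proof (rule mod_homI)
  note b = bilinearD[OF pure_tensor_bilinear[OF FX N]] and e = basis_elt_closed[OF N.R.cring_axioms]
  have fin: "finite {x. v x \<noteq> \<zero>\<^bsub>N\<^esub>}" "{x. v x \<noteq> \<zero>\<^bsub>N\<^esub>} \<subseteq> X" if "v \<in> carrier V" for v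
    using that by (auto simp: finsupp_module_iff)
  interpret V: module S V by (rule finsupp_module_module)
  fix v assume v: "v \<in> carrier V"
  show "collect v \<in> carrier TX"
    unfolding collect_def using fin(2)[OF v] pure_basis_closed finsupp_coeff[OF v]
    by (intro TX.M.finsum_closed) blast
  {
    fix w assume w: "w \<in> carrier V"
    let ?G = "{x. v x \<noteq> \<zero>\<^bsub>N\<^esub>} \<union> {x. w x \<noteq> \<zero>\<^bsub>N\<^esub>}"
    have G: "finite ?G" "?G \<subseteq> X" using fin[OF v] fin[OF w] by auto
    have "collect (v \<oplus>\<^bsub>V\<^esub> w) = (\<Oplus>\<^bsub>TX\<^esub> x\<in>?G. pure_tensor S FX N (basis_elt S x) ((v \<oplus>\<^bsub>V\<^esub> w) x))"
      by (rule collect_eq[OF V.M.a_closed[OF v w] G(1) _ G(2)]) auto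
    also have "\<dots> = (\<Oplus>\<^bsub>TX\<^esub> x\<in>?G. pure_tensor S FX N (basis_elt S x) (v x) \<oplus>\<^bsub>TX\<^esub> pure_tensor S FX N (basis_elt S x) (w x))"
      using G(2) b(3)[OF e] b(1)[OF e] finsupp_coeff[OF v] finsupp_coeff[OF w]
      by (intro TX.M.finsum_cong') (auto simp: Pi_iff subset_iff)
    also have "\<dots> = collect v \<oplus>\<^bsub>TX\<^esub> collect w"
      using G(2) pure_basis_closed finsupp_coeff[OF v] finsupp_coeff[OF w]
        collect_eq[OF v G(1) _ G(2)] collect_eq[OF w G(1) _ G(2)]
      by (subst TX.M.finsum_addf) (auto simp: Pi_iff subset_iff)
    finally show "collect (v \<oplus>\<^bsub>V\<^esub> w) = collect v \<oplus>\<^bsub>TX\<^esub> collect w" .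
  next
    fix s assume s: "s \<in> carrier S"
    let ?G = "{x. v x \<noteq> \<zero>\<^bsub>N\<^esub>}"
    have "collect (s \<odot>\<^bsub>V\<^esub> v) = (\<Oplus>\<^bsub>TX\<^esub> x\<in>?G. pure_tensor S FX N (basis_elt S x) ((s \<odot>\<^bsub>V\<^esub> v) x))"
      by (rule collect_eq[OF V.smult_closed[OF s v] fin(1)[OF v] _ fin(2)[OF v]]) (use s in auto)
    also have "\<dots> = (\<Oplus>\<^bsub>TX\<^esub> x\<in>?G. s \<odot>\<^bsub>TX\<^esub> pure_tensor S FX N (basis_elt S x) (v x))"
      using s fin(2)[OF v] b(5)[OF s e] b(1)[OF e] finsupp_coeff[OF v]
      by (intro TX.M.finsum_cong') (auto simp: Pi_iff subset_iff)
    also have "\<dots> = s \<odot>\<^bsub>TX\<^esub> collect v"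
      unfolding collect_def using s fin[OF v] pure_basis_closed finsupp_coeff[OF v]
      by (intro TX.finsum_smult_ldistr[symmetric]) (auto simp: Pi_iff subset_iff)
    finally show "collect (s \<odot>\<^bsub>V\<^esub> v) = s \<odot>\<^bsub>TX\<^esub> collect v" .
  }
qed

private lemma collect_single:
  assumes "x \<in> X" "n \<in> carrier N"
  shows "collect (\<lambda>y. basis_elt S x y \<odot>\<^bsub>N\<^esub> n) = pure_tensor S FX N (basis_elt S x) n"
proof -
  let ?v = "\<lambda>y. basis_elt S x y \<odot>\<^bsub>N\<^esub> n"
  have "?v \<in> carrier V"
    by (rule bilinearD(1)[OF tensor_eval_bilinear basis_elt_closed[OF N.R.cring_axioms assms(1)] assms(2)])
  then have "collect ?v = (\<Oplus>\<^bsub>TX\<^esub> y\<in>{x}. pure_tensor S FX N (basis_elt S y) (?v y))"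
    by (rule collect_eq) (use assms in \<open>auto simp: basis_elt_def split: if_splits\<close>)
  also have "\<dots> = pure_tensor S FX N (basis_elt S x) (?v x)"
    using pure_basis_closed[OF assms(1), of "?v x"] assms(2)
    by (subst TX.M.finsum_insert) (auto simp: basis_elt_def)
  finally show ?thesis using assms by (simp add: basis_elt_def)
qed

text \<open>\<open>collect\<close> is a left inverse. This is checked on pure tensors, and there, by
  linearity in the free factor, on basis elements.\<close>

lemma tensor_eval_inj: "inj_on (tensor_eval S N X) (carrier TX)"
proof (rule inj_on_inverseI[where g = collect])
  fix t assume t: "t \<in> carrier TX"
  show "collect (tensor_eval S N X t) = t"
  proof (rule tensor_hom_eq[OF FX N TX mod_hom_comp[OF tensor_eval_hom collect_hom] mod_hom_id _ t])
    fix u n assume u: "u \<in> carrier FX" and n: "n \<in> carrier N"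
    have "(\<lambda>u. collect (\<lambda>x. u x \<odot>\<^bsub>N\<^esub> n)) \<in> mod_hom S FX TX"
      using tensor_eval_bilinear n by (intro mod_hom_comp[OF _ collect_hom]) (auto simp: bilinear_def)
    moreover have "(\<lambda>u. pure_tensor S FX N u n) \<in> mod_hom S FX TX"
      using pure_tensor_bilinear[OF FX N] n by (auto simp: bilinear_def)
    ultimately have "collect (\<lambda>x. u x \<odot>\<^bsub>N\<^esub> n) = pure_tensor S FX N u n"
      by (rule free_module_hom_eq[OF TX _ _ _ u]) (rule collect_single[OF _ n])
    then show "collect (tensor_eval S N X (pure_tensor S FX N u n)) = pure_tensor S FX N u n"
      by (simp add: tensor_eval_pure[OF u n])
  qed
qed

lemma tensor_eval_surj: "tensor_eval S N X ` carrier TX = carrier V"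
proof
  note b = bilinearD[OF pure_tensor_bilinear[OF FX N]] and e = basis_elt_closed[OF N.R.cring_axioms]
  show "tensor_eval S N X ` carrier TX \<subseteq> carrier V" using mod_hom_closed[OF tensor_eval_hom] by blast
  have "v \<in> tensor_eval S N X ` carrier TX"
    if "finite G" "{x. v x \<noteq> \<zero>\<^bsub>N\<^esub>} \<subseteq> G" "v \<in> carrier V" for G v
    using that
  proof (induction G arbitrary: v)
    case empty
    then have "v = \<zero>\<^bsub>V\<^esub>" by auto
    then show ?case
      using mod_hom_zero[OF TX finsupp_module_module tensor_eval_hom] TX.M.zero_closed by (metis imageI)
  next
    case (insert x G)
    show ?case
    proof (cases "v x = \<zero>\<^bsub>N\<^esub>")
      case True
      then show ?thesis using insert by blast
    next
      case False
      then have x: "x \<in> X" using insert.prems(2) by (auto simp: finsupp_module_iff)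
      let ?w = "v(x := \<zero>\<^bsub>N\<^esub>)"
      have "finite {y. ?w y \<noteq> \<zero>\<^bsub>N\<^esub>}"
        by (rule finite_subset[of _ "{y. v y \<noteq> \<zero>\<^bsub>N\<^esub>}"]) (use insert.prems(2) in \<open>auto simp: finsupp_module_iff\<close>)
      then have "?w \<in> carrier V" using insert.prems(2) by (auto simp: finsupp_module_iff)
      moreover have "{y. ?w y \<noteq> \<zero>\<^bsub>N\<^esub>} \<subseteq> G" using insert.prems(1) by auto
      ultimately have "?w \<in> tensor_eval S N X ` carrier TX" by (rule insert.IH[rotated])
      then obtain t where t: "t \<in> carrier TX" "?w = tensor_eval S N X t" by blast
      have vx: "v x \<in> carrier N" by (rule finsupp_coeff[OF insert.prems(2)])
      let ?p = "pure_tensor S FX N (basis_elt S x) (v x)"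
      have p: "?p \<in> carrier TX" by (rule b(1)[OF e[OF x] vx])
      have "tensor_eval S N X (t \<oplus>\<^bsub>TX\<^esub> ?p) = (\<lambda>y. ?w y \<oplus>\<^bsub>N\<^esub> basis_elt S x y \<odot>\<^bsub>N\<^esub> v x)"
        unfolding mod_hom_add[OF tensor_eval_hom t(1) p] t(2)[symmetric] tensor_eval_pure[OF e[OF x] vx] by simp
      also have "\<dots> = v"
        using finsupp_coeff[OF insert.prems(2)] by (auto simp: basis_elt_def fun_eq_iff)
      finally have "tensor_eval S N X (t \<oplus>\<^bsub>TX\<^esub> ?p) = v" .
      then show ?thesis using t(1) p by (metis TX.M.a_closed imageI)
    qed
  qed
  then show "carrier V \<subseteq> tensor_eval S N X ` carrier TX" by (auto simp: finsupp_module_iff)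
qed

end

subsection \<open>Reduction of complexes of free modules\<close>

definition reduce :: "('s \<Rightarrow> 't) \<Rightarrow> ('x \<Rightarrow> 's) \<Rightarrow> 'x \<Rightarrow> 't" where
  "reduce p u = (\<lambda>x. p (u x))"

lemma ring_hom_zero':
  assumes "cring S" "cring T" "p \<in> ring_hom S T"
  shows "p \<zero>\<^bsub>S\<^esub> = \<zero>\<^bsub>T\<^esub>"
  using ring_hom_zero[OF assms(3)] assms(1,2) by (simp add: cring.axioms(1))

context
  fixes S :: "('s, 'z) ring_scheme" and T :: "('t, 'y) ring_scheme" and p :: "'s \<Rightarrow> 't"
  assumes S: "cring S" and T: "cring T" and p: "p \<in> ring_hom S T" and p_surj: "p ` carrier S = carrier T"
begin

interpretation S: cring S by (rule S)
interpretation T: cring T by (rule T)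

lemma reduce_hom: "reduce p \<in> mod_hom S (free_module S X) (restrict_scalars p (free_module T X))"
proof (rule mod_homI)
  note c = free_module_coeff[OF S] and z = ring_hom_zero'[OF S T p]
  fix u assume u: "u \<in> carrier (free_module S X)"
  have "{x. p (u x) \<noteq> \<zero>\<^bsub>T\<^esub>} \<subseteq> {x. u x \<noteq> \<zero>\<^bsub>S\<^esub>}" using z by auto
  with u show "reduce p u \<in> carrier (restrict_scalars p (free_module T X))"
    by (auto simp: free_module_carrier reduce_def z ring_hom_closed[OF p c[OF u]] intro: finite_subset)
  show "reduce p (u \<oplus>\<^bsub>free_module S X\<^esub> v) = reduce p u \<oplus>\<^bsub>restrict_scalars p (free_module T X)\<^esub> reduce p v"
    if "v \<in> carrier (free_module S X)" for v
    using c[OF u] c[OF that] by (simp add: reduce_def ring_hom_add[OF p])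
  show "reduce p (s \<odot>\<^bsub>free_module S X\<^esub> u) = s \<odot>\<^bsub>restrict_scalars p (free_module T X)\<^esub> reduce p u"
    if "s \<in> carrier S" for s
    using c[OF u] that by (simp add: reduce_def ring_hom_mult[OF p])
qed

lemma reduce_basis_elt: "reduce p (basis_elt S x) = basis_elt T x"
  by (auto simp: reduce_def basis_elt_def ring_hom_one[OF p] ring_hom_zero'[OF S T p])

lemma reduce_surj: "reduce p ` carrier (free_module S X) = carrier (free_module T X)"
proof
  show "reduce p ` carrier (free_module S X) \<subseteq> carrier (free_module T X)"
    using mod_hom_closed[OF reduce_hom] by fastforce
  show "carrier (free_module T X) \<subseteq> reduce p ` carrier (free_module S X)"
  proof
    fix v assume v: "v \<in> carrier (free_module T X)"
    \<comment> \<open>The coefficient zero must be lifted to zero, or the lifted function could have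
      infinite support.\<close>
    have "\<exists>s. s \<in> carrier S \<and> p s = v x \<and> (v x = \<zero>\<^bsub>T\<^esub> \<longrightarrow> s = \<zero>\<^bsub>S\<^esub>)" for x
    proof (cases "v x = \<zero>\<^bsub>T\<^esub>")
      case True
      then show ?thesis using ring_hom_zero'[OF S T p] by auto
    next
      case False
      have "v x \<in> p ` carrier S" unfolding p_surj by (rule free_module_coeff[OF T v])
      with False show ?thesis by force
    qed
    then obtain u where u: "\<And>x. u x \<in> carrier S" "\<And>x. p (u x) = v x"
      "\<And>x. v x = \<zero>\<^bsub>T\<^esub> \<Longrightarrow> u x = \<zero>\<^bsub>S\<^esub>" by metis
    have "{x. u x \<noteq> \<zero>\<^bsub>S\<^esub>} \<subseteq> {x. v x \<noteq> \<zero>\<^bsub>T\<^esub>}" using u(3) by auto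
    then have "u \<in> carrier (free_module S X)"
      using v u by (auto simp: free_module_carrier intro: finite_subset)
    moreover have "reduce p u = v" using u(2) by (auto simp: reduce_def)
    ultimately show "v \<in> reduce p ` carrier (free_module S X)" by blast
  qed
qed

text \<open>From \<open>S\<close> to \<open>T\<close> the partner of a scalar is its image under
  \<open>p\<close>; from \<open>T\<close> to \<open>S\<close> it is any preimage.\<close>

private lemma smult_exchange:
  assumes "\<And>s. s \<in> carrier S \<Longrightarrow> P s (p s)"
  shows "s \<in> carrier S \<Longrightarrow> \<exists>t\<in>carrier T. P s t" "t \<in> carrier T \<Longrightarrow> \<exists>s\<in>carrier S. P s t"
  using assms ring_hom_closed[OF p] p_surj by (blast, metis imageE)

context
  fixes G :: "('s, 'x \<Rightarrow> 's) cplx" and G' :: "('t, 'x \<Rightarrow> 't) cplx" and X :: "int \<Rightarrow> 'x set"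
    and N :: "('t, 'n) cplx"
  assumes G: "chain_complex S G" and GX: "\<And>k. cmod G k = free_module S (X k)"
    and G': "chain_complex T G'" and GX': "\<And>k. cmod G' k = free_module T (X k)"
    and red: "\<And>k u. u \<in> carrier (cmod G k) \<Longrightarrow> cdiff G' k (reduce p u) = reduce p (cdiff G k u)"
    and N: "chain_complex T N"
begin

private abbreviation (input) "N' \<equiv> restrict_scalars_cplx p N"

private lemma N': "chain_complex S N'" by (rule restrict_scalars_cplx_complex[OF S p N])

private lemma red_hom: "reduce p \<in> mod_hom S (cmod G k) (restrict_scalars p (cmod G' k))"
  unfolding GX GX' by (rule reduce_hom)

private lemma red_chain_map: "chain_map S G (restrict_scalars_cplx p G') (\<lambda>_. reduce p)"
  unfolding chain_map_def using red_hom red by simp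

text \<open>Precomposition with the reduction is bijective: a linear map out of a free module is
  given by arbitrary values on the basis, and \<open>G k\<close> and \<open>G' k\<close> have the
  same basis.\<close>

lemma min_gens_hom_base_change:
  "min_gens T (homology (hom_complex T G' N) i) = min_gens S (homology (hom_complex S G N') i)"
proof -
  \<comment> \<open>\<open>?K\<close> consists of the same families of maps as \<open>?H\<close>,
    regarded as linear over \<open>S\<close>; the two notions agree because \<open>p\<close> is
    onto. This puts both sides over one ring, where precomposition has been studied.\<close>
  let ?H = "hom_complex T G' N" and ?K = "hom_complex S (restrict_scalars_cplx p G') N'"
  let ?L = "hom_complex S G N'"
  have car: "carrier (cmod ?H k) = carrier (cmod ?K k)" for k
    using restrict_scalars_hom[OF p] restrict_scalars_hom_surj[OF p_surj]
    by (auto simp: hom_module_iff) blast+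
  have cd: "cdiff ?H k g = cdiff ?K k g" for k g
    by (rule hom_complex_eqI[of _ G'])
       (auto simp: hom_complex_cdiff hom_complex_def)
  have rs: "reduce p ` carrier (cmod G k) = carrier (cmod G' k)" for k
    unfolding GX GX' by (rule reduce_surj)
  have rc: "reduce p u \<in> carrier (cmod G' k)" if "u \<in> carrier (cmod G k)" for u k using rs that by blast
  let ?h = "\<lambda>_. hom_pull G (\<lambda>_. reduce p)"
  show ?thesis
  proof (rule homology_min_gens_eq_iso[where h = ?h, OF hom_complex_complex[OF G' N] hom_complex_complex[OF G N']])
    fix k
    show "bij_betw (hom_pull G (\<lambda>_. reduce p)) (carrier (cmod ?H k)) (carrier (cmod ?L k))"
    proof (rule bij_betw_imageI)
      show "inj_on (hom_pull G (\<lambda>_. reduce p)) (carrier (cmod ?H k))"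
      proof (rule inj_onI)
        fix g h assume g: "g \<in> carrier (cmod ?H k)" and h: "h \<in> carrier (cmod ?H k)"
          and eq: "hom_pull G (\<lambda>_. reduce p) g = hom_pull G (\<lambda>_. reduce p) h"
        show "g = h"
        proof (rule hom_complex_eqI[of _ G'])
          fix q y assume "y \<in> carrier (cmod G' q)"
          then obtain x where x: "x \<in> carrier (cmod G q)" "y = reduce p x" using rs by blast
          show "g q y = h q y" using fun_cong[OF fun_cong[OF eq, of q], of x] x by (simp add: hom_pull_def)
        qed (use g h in \<open>auto simp: hom_module_iff\<close>)
      qed
      show "hom_pull G (\<lambda>_. reduce p) ` carrier (cmod ?H k) = carrier (cmod ?L k)"
      proof
        show "hom_pull G (\<lambda>_. reduce p) ` carrier (cmod ?H k) \<subseteq> carrier (cmod ?L k)"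
          using hom_pull_closed[OF G red_chain_map] unfolding car by blast
        show "carrier (cmod ?L k) \<subseteq> hom_pull G (\<lambda>_. reduce p) ` carrier (cmod ?H k)"
        proof
          fix g assume g: "g \<in> carrier (cmod ?L k)"
          then have gq: "g q \<in> mod_hom S (cmod G q) (restrict_scalars p (cmod N (q + k)))" for q
            by (simp add: hom_module_iff)
          \<comment> \<open>The preimage of \<open>g\<close> is prescribed on the common basis by
            the values of \<open>g\<close>.\<close>
          have "\<exists>h. h \<in> mod_hom T (cmod G' q) (cmod N (q + k)) \<and>
              (\<forall>x\<in>X q. h (basis_elt T x) = g q (basis_elt S x))" for q
          proof -
            have "\<exists>a. a \<in> carrier (cmod N (q + k)) \<and> a = g q (basis_elt S x)" if "x \<in> X q" for x
              using mod_hom_closed[OF gq, of "basis_elt S x" q] basis_elt_closed[OF S that] by (simp add: GX)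
            then show ?thesis
              unfolding GX' using ex_free_module_hom[OF chain_complexD(1)[OF N], of "X q" "q + k"
                  "\<lambda>x a. a = g q (basis_elt S x)"] by metis
          qed
          then obtain h where h: "\<And>q. h q \<in> mod_hom T (cmod G' q) (cmod N (q + k))"
            "\<And>q x. x \<in> X q \<Longrightarrow> h q (basis_elt T x) = g q (basis_elt S x)" by metis
          define h' where "h' q = restrict (h q) (carrier (cmod G' q))" for q
          have h': "h' \<in> carrier (cmod ?H k)"
            using hom_module_restrict[OF chain_complexD(1)[OF G'] h(1)] by (simp add: h'_def)
          have "h q (reduce p u) = g q u" if u: "u \<in> carrier (cmod G q)" for q u
          proof -
            have "(\<lambda>u. h q (reduce p u)) \<in> mod_hom S (cmod G q) (restrict_scalars p (cmod N (q + k)))"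
              by (rule mod_hom_comp[OF red_hom restrict_scalars_hom[OF p h(1)]])
            from free_module_hom_eq[OF restrict_scalars_module[OF S p chain_complexD(1)[OF N]]
                this[unfolded GX] gq[unfolded GX] _ u[unfolded GX]]
            show ?thesis by (simp add: reduce_basis_elt h(2))
          qed
          then have "hom_pull G (\<lambda>_. reduce p) h' = g"
            using g rc by (intro hom_complex_eqI[of _ G]) (auto simp: hom_pull_def h'_def hom_module_iff)
          with h' show "g \<in> hom_pull G (\<lambda>_. reduce p) ` carrier (cmod ?H k)" by blast
        qed
      qed
    qed
    show "hom_pull G (\<lambda>_. reduce p) (g \<oplus>\<^bsub>cmod ?H k\<^esub> h) =
        hom_pull G (\<lambda>_. reduce p) g \<oplus>\<^bsub>cmod ?L k\<^esub> hom_pull G (\<lambda>_. reduce p) h" for g h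
      using rc by (auto simp: hom_pull_def fun_eq_iff)
    show "cdiff ?L k (hom_pull G (\<lambda>_. reduce p) g) = hom_pull G (\<lambda>_. reduce p) (cdiff ?H k g)" for g
      unfolding cd by (rule hom_pull_cdiff[OF G red_chain_map])
  next
    have eq: "hom_pull G (\<lambda>_. reduce p) (p s \<odot>\<^bsub>cmod ?H i\<^esub> g) = s \<odot>\<^bsub>cmod ?L i\<^esub> hom_pull G (\<lambda>_. reduce p) g" for s g
      using rc by (auto simp: hom_pull_def fun_eq_iff)
    show "\<exists>t\<in>carrier S. \<forall>x\<in>carrier (cmod ?H i). hom_pull G (\<lambda>_. reduce p) (s \<odot>\<^bsub>cmod ?H i\<^esub> x) =
        t \<odot>\<^bsub>cmod ?L i\<^esub> hom_pull G (\<lambda>_. reduce p) x" if "s \<in> carrier T" for s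
      by (rule smult_exchange(2)[OF _ that]) (use eq in blast)
    show "\<exists>s\<in>carrier T. \<forall>x\<in>carrier (cmod ?H i). hom_pull G (\<lambda>_. reduce p) (s \<odot>\<^bsub>cmod ?H i\<^esub> x) =
        t \<odot>\<^bsub>cmod ?L i\<^esub> hom_pull G (\<lambda>_. reduce p) x" if "t \<in> carrier S" for t
      by (rule smult_exchange(1)[OF _ that]) (use eq in blast)
  qed
qed

section \<open>The natural map from the tensor product over \<open>S\<close> to the one over
  \<open>T\<close>\<close>

private abbreviation (input) "rho a b \<equiv>
  tensor_lift S (restrict_scalars p (tensor_module T (cmod G' a) (cmod N b)))
    (\<lambda>u n. pure_tensor T (cmod G' a) (cmod N b) (reduce p u) n)"

private lemma mG: "module S (cmod G k)" and mG': "module T (cmod G' k)" and mN: "module T (cmod N k)"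
  and mN': "module S (restrict_scalars p (cmod N k))"
  by (rule chain_complexD(1)[OF G], rule chain_complexD(1)[OF G'], rule chain_complexD(1)[OF N],
      rule restrict_scalars_module[OF S p chain_complexD(1)[OF N]])

private lemma mTR: "module S (restrict_scalars p (tensor_module T (cmod G' a) (cmod N b)))"
  by (rule restrict_scalars_module[OF S p tensor_module_module[OF mG' mN]])

private lemma rho:
  shows "rho a b \<in> mod_hom S (tensor_module S (cmod G a) (restrict_scalars p (cmod N b)))
    (restrict_scalars p (tensor_module T (cmod G' a) (cmod N b)))"
  and "u \<in> carrier (cmod G a) \<Longrightarrow> n \<in> carrier (cmod N b) \<Longrightarrow>
    rho a b (pure_tensor S (cmod G a) (restrict_scalars p (cmod N b)) u n) =
    pure_tensor T (cmod G' a) (cmod N b) (reduce p u) n"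
proof -
  note b = bilinearD[OF pure_tensor_bilinear[OF mG' mN]]
  have rc: "reduce p u \<in> carrier (cmod G' k)" if "u \<in> carrier (cmod G k)" for u k
    using mod_hom_closed[OF red_hom that] by simp
  have "bilinear S (cmod G a) (restrict_scalars p (cmod N b)) (restrict_scalars p (tensor_module T (cmod G' a) (cmod N b)))
      (\<lambda>u n. pure_tensor T (cmod G' a) (cmod N b) (reduce p u) n)"
    using mod_hom_add[OF red_hom] mod_hom_smult[OF red_hom] b rc ring_hom_closed[OF p]
    by (intro bilinearI) simp_all
  from tensor_lift[OF mG mN' mTR this]
  show "rho a b \<in> mod_hom S (tensor_module S (cmod G a) (restrict_scalars p (cmod N b)))
    (restrict_scalars p (tensor_module T (cmod G' a) (cmod N b)))"
    "u \<in> carrier (cmod G a) \<Longrightarrow> n \<in> carrier (cmod N b) \<Longrightarrow>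
    rho a b (pure_tensor S (cmod G a) (restrict_scalars p (cmod N b)) u n) =
    pure_tensor T (cmod G' a) (cmod N b) (reduce p u) n" by simp_all
qed

text \<open>Both sides are the module of finitely supported functions from the basis to \<open>N\<close>.\<close>

private lemma rho_bij: "bij_betw (rho a b) (carrier (tensor_module S (cmod G a) (restrict_scalars p (cmod N b))))
    (carrier (tensor_module T (cmod G' a) (cmod N b)))"
proof -
  let ?A = "tensor_module S (cmod G a) (restrict_scalars p (cmod N b))"
  let ?B = "tensor_module T (cmod G' a) (cmod N b)"
  let ?e = "tensor_eval S (restrict_scalars p (cmod N b)) (X a)"
  let ?f = "tensor_eval T (cmod N b) (X a)"
  let ?V = "finsupp_module (restrict_scalars p (cmod N b)) (X a)"
  let ?W = "finsupp_module (cmod N b) (X a)"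
  have VW: "carrier ?V = carrier ?W" by (auto simp: finsupp_module_iff)
  have mV: "module S ?V" by (rule finsupp_module_module[OF mN'])
  have e: "inj_on ?e (carrier ?A)" "?e ` carrier ?A = carrier ?V" "?e \<in> mod_hom S ?A ?V"
    unfolding GX by (rule tensor_eval_inj[OF mN'] tensor_eval_surj[OF mN'] tensor_eval_hom[OF mN'])+
  have f: "inj_on ?f (carrier ?B)" "?f ` carrier ?B = carrier ?W" "?f \<in> mod_hom T ?B ?W"
    unfolding GX' by (rule tensor_eval_inj[OF mN] tensor_eval_surj[OF mN] tensor_eval_hom[OF mN])+
  have f': "?f \<in> mod_hom S (restrict_scalars p ?B) ?V"
    using f(3) ring_hom_closed[OF p] by (auto simp: mod_hom_def VW)
  have eq: "?f (rho a b t) = ?e t" if t: "t \<in> carrier ?A" for t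
  proof (rule tensor_hom_eq[OF mG mN' mV mod_hom_comp[OF rho(1) f'] e(3) _ t])
    fix u n assume u: "u \<in> carrier (cmod G a)" and n: "n \<in> carrier (restrict_scalars p (cmod N b))"
    have "reduce p u \<in> carrier (cmod G' a)" using mod_hom_closed[OF red_hom u] by simp
    with u n show "?f (rho a b (pure_tensor S (cmod G a) (restrict_scalars p (cmod N b)) u n)) =
        ?e (pure_tensor S (cmod G a) (restrict_scalars p (cmod N b)) u n)"
      using tensor_eval_pure[OF mN, of "reduce p u" "X a" n] tensor_eval_pure[OF mN', of u "X a" n]
      by (simp add: rho(2)) (simp add: GX GX' reduce_def)
  qed
  have rc: "rho a b t \<in> carrier ?B" if "t \<in> carrier ?A" for t using mod_hom_closed[OF rho(1) that] by simp
  show ?thesis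
  proof (rule bij_betw_imageI)
    show "inj_on (rho a b) (carrier ?A)"
      using e(1) eq unfolding inj_on_def by metis
    have "y \<in> rho a b ` carrier ?A" if y: "y \<in> carrier ?B" for y
    proof -
      have "?f y \<in> carrier ?V" using f(2) y VW by blast
      then have "?f y \<in> ?e ` carrier ?A" unfolding e(2) .
      then obtain t where t: "t \<in> carrier ?A" "?f y = ?e t" by blast
      then have "?f y = ?f (rho a b t)" by (simp only: eq)
      then have "y = rho a b t" by (rule inj_onD[OF f(1) _ y rc[OF t(1)]])
      then show ?thesis using t(1) by blast
    qed
    then show "rho a b ` carrier ?A = carrier ?B" using rc by blast
  qed
qed

text \<open>The bijections \<open>rho\<close> of all bidegrees commute with both parts of the
  differential, as can be seen on pure tensors, and therefore form an isomorphism of the tensor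
  complexes.\<close>

lemma min_gens_tensor_base_change:
  "min_gens S (homology (tensor_complex S G N') i) = min_gens T (homology (tensor_complex T G' N) i)"
proof -
  let ?H = "tensor_complex S G N'" and ?K = "tensor_complex T G' N"
  let ?A = "\<lambda>a b. tensor_module S (cmod G a) (restrict_scalars p (cmod N b))"
  let ?B = "\<lambda>a b. tensor_module T (cmod G' a) (cmod N b)"
  define h where "h k z q = rho q (k - q) (z q)" for k :: int and z :: "int \<Rightarrow> (('x \<Rightarrow> 's) \<times> 'n \<Rightarrow> 's) set" and q :: int
  have mA: "module S (?A a b)" for a b by (rule tensor_module_module[OF mG mN'])
  have mB: "module T (?B a b)" for a b by (rule tensor_module_module[OF mG' mN])
  have rz: "rho a b t = \<zero>\<^bsub>?B a b\<^esub> \<longleftrightarrow> t = \<zero>\<^bsub>?A a b\<^esub>" if "t \<in> carrier (?A a b)" for a b t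
  proof -
    interpret A: module S "?A a b" by (rule mA)
    have "rho a b \<zero>\<^bsub>?A a b\<^esub> = \<zero>\<^bsub>?B a b\<^esub>" using mod_hom_zero[OF mA mTR rho(1)] by simp
    then show ?thesis
      using inj_on_eq_iff[OF bij_betw_imp_inj_on[OF rho_bij] that A.M.zero_closed] by simp
  qed
  have rc: "rho a b t \<in> carrier (?B a b)" if "t \<in> carrier (?A a b)" for a b t
    using mod_hom_closed[OF rho(1) that] by simp
  have hc: "h k z \<in> carrier (cmod ?K k)" if z: "z \<in> carrier (cmod ?H k)" for k z
  proof -
    have "{q. h k z q \<noteq> \<zero>\<^bsub>?B q (k - q)\<^esub>} = {q. z q \<noteq> \<zero>\<^bsub>?A q (k - q)\<^esub>}"
      using z rz by (simp add: h_def)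
    then show ?thesis using z rc by (simp add: h_def)
  qed
  show ?thesis
  proof (rule homology_min_gens_eq_iso[where h = h, OF tensor_complex_complex[OF G N'] tensor_complex_complex[OF G' N]])
    fix k
    show "bij_betw (h k) (carrier (cmod ?H k)) (carrier (cmod ?K k))"
    proof (rule bij_betw_imageI)
      show "inj_on (h k) (carrier (cmod ?H k))"
      proof (rule inj_onI, rule ext)
        fix z w q assume z: "z \<in> carrier (cmod ?H k)" and w: "w \<in> carrier (cmod ?H k)" and eq: "h k z = h k w"
        have "rho q (k - q) (z q) = rho q (k - q) (w q)" using fun_cong[OF eq, of q] by (simp add: h_def)
        then show "z q = w q"
          by (rule inj_onD[OF bij_betw_imp_inj_on[OF rho_bij]]) (use z w in simp_all)
      qed
      have "w \<in> h k ` carrier (cmod ?H k)" if w: "w \<in> carrier (cmod ?K k)" for w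
      proof -
        have "\<exists>t. t \<in> carrier (?A q (k - q)) \<and> rho q (k - q) t = w q" for q
        proof -
          have "w q \<in> rho q (k - q) ` carrier (?A q (k - q))"
            unfolding bij_betw_imp_surj_on[OF rho_bij] using w by simp
          then show ?thesis by (auto simp only: image_iff)
        qed
        then obtain z where z: "\<And>q. z q \<in> carrier (?A q (k - q))" "\<And>q. rho q (k - q) (z q) = w q" by metis
        have "{q. z q \<noteq> \<zero>\<^bsub>?A q (k - q)\<^esub>} = {q. w q \<noteq> \<zero>\<^bsub>?B q (k - q)\<^esub>}"
          using z(1) rz by (simp add: z(2)[symmetric])
        then have "z \<in> carrier (cmod ?H k)" using z(1) w by simp
        moreover have "h k z = w" using z(2) by (simp add: h_def fun_eq_iff)
        ultimately show ?thesis by blast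
      qed
      then show "h k ` carrier (cmod ?H k) = carrier (cmod ?K k)" using hc by blast
    qed
    show "h k (z \<oplus>\<^bsub>cmod ?H k\<^esub> w) = h k z \<oplus>\<^bsub>cmod ?K k\<^esub> h k w"
      if "z \<in> carrier (cmod ?H k)" "w \<in> carrier (cmod ?H k)" for z w
      using that mod_hom_add[OF rho(1)] by (simp add: h_def fun_eq_iff)
    fix z assume z: "z \<in> carrier (cmod ?H k)"
    show "cdiff ?K k (h k z) = h (k - 1) (cdiff ?H k z)"
    proof
      fix q
      let ?b = "k - 1 - q"
      have j: "k - (q + 1) = k - 1 - q" "k - q - 1 = k - 1 - q" by simp_all
      have zq: "z q \<in> carrier (?A q (k - q))" for q using z by simp
      have z1: "z (q + 1) \<in> carrier (?A (q + 1) ?b)" using zq[of "q + 1"] by (simp only: j)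
      have dG: "cdiff G (q + 1) \<in> mod_hom S (cmod G (q + 1)) (cmod G q)"
        using chain_complexD(2)[OF G, of "q + 1"] by simp
      have dG': "cdiff G' (q + 1) \<in> mod_hom T (cmod G' (q + 1)) (cmod G' q)"
        using chain_complexD(2)[OF G', of "q + 1"] by simp
      have dN: "cdiff N (k - q) \<in> mod_hom T (cmod N (k - q)) (cmod N ?b)"
        using chain_complexD(2)[OF N, of "k - q"] by (simp only: j)
      note dN' = restrict_scalars_hom[OF p dN]
      let ?l = "tensor_map S (cmod G q) (restrict_scalars p (cmod N ?b)) (cdiff G (q + 1)) (\<lambda>x. x)"
      let ?r = "tensor_map S (cmod G q) (restrict_scalars p (cmod N ?b)) (\<lambda>x. x) (cdiff N (k - q))"
      let ?l' = "tensor_map T (cmod G' q) (cmod N ?b) (cdiff G' (q + 1)) (\<lambda>x. x)"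
      let ?r' = "tensor_map T (cmod G' q) (cmod N ?b) (\<lambda>x. x) (cdiff N (k - q))"
      note l = tensor_map[OF mG mN' mG mN' dG mod_hom_id] and r = tensor_map[OF mG mN' mG mN' mod_hom_id dN']
      note l' = tensor_map[OF mG' mN mG' mN dG' mod_hom_id] and r' = tensor_map[OF mG' mN mG' mN mod_hom_id dN]
      have gc: "reduce p u \<in> carrier (cmod G' k)" if "u \<in> carrier (cmod G k)" for u k
        using mod_hom_closed[OF red_hom that] by simp
      have L: "?l' (rho (q + 1) ?b t) = rho q ?b (?l t)" if "t \<in> carrier (?A (q + 1) ?b)" for t
        by (rule tensor_hom_eq[OF mG mN' mTR mod_hom_comp[OF rho(1) restrict_scalars_hom[OF p l'(1)]]
              mod_hom_comp[OF l(1) rho(1)] _ that])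
           (simp add: rho(2) l(2) l'(2) gc red mod_hom_closed[OF dG])
      have R: "?r' (rho q (k - q) t) = rho q ?b (?r t)" if "t \<in> carrier (?A q (k - q))" for t
        by (rule tensor_hom_eq[OF mG mN' mTR mod_hom_comp[OF rho(1) restrict_scalars_hom[OF p r'(1)]]
              mod_hom_comp[OF r(1) rho(1)] _ that])
           (simp add: rho(2) r(2) r'(2) gc mod_hom_closed[OF dN])
      interpret A: module S "?A q ?b" by (rule mA)
      have lc: "?l (z (q + 1)) \<in> carrier (?A q ?b)" by (rule mod_hom_closed[OF l(1) z1])
      have rc': "?r (z q) \<in> carrier (?A q ?b)" by (rule mod_hom_closed[OF r(1) zq])
      have "h (k - 1) (cdiff ?H k z) q = rho q ?b (?l (z (q + 1)) \<oplus>\<^bsub>?A q ?b\<^esub> signed (?A q ?b) q (?r (z q)))"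
        by (simp add: h_def tensor_complex_cdiff)
      also have "\<dots> = rho q ?b (?l (z (q + 1))) \<oplus>\<^bsub>?B q ?b\<^esub> signed (?B q ?b) q (rho q ?b (?r (z q)))"
        using lc rc' signed_closed[OF A.M.abelian_group_axioms rc']
        by (simp add: mod_hom_add[OF rho(1)] signed_mod_hom[OF mA mTR rho(1)])
      also have "\<dots> = ?l' (rho (q + 1) ?b (z (q + 1))) \<oplus>\<^bsub>?B q ?b\<^esub> signed (?B q ?b) q (?r' (rho q (k - q) (z q)))"
        by (simp only: L[OF z1] R[OF zq])
      also have "\<dots> = cdiff ?K k (h k z) q"
        by (simp only: tensor_complex_cdiff h_def j)
      finally show "cdiff ?K k (h k z) q = h (k - 1) (cdiff ?H k z) q" by (rule sym)
    qed
  next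
    have eq: "h i (s \<odot>\<^bsub>cmod ?H i\<^esub> z) = p s \<odot>\<^bsub>cmod ?K i\<^esub> h i z"
      if "z \<in> carrier (cmod ?H i)" "s \<in> carrier S" for s z
      using that mod_hom_smult[OF rho(1)] by (simp add: h_def fun_eq_iff)
    show "\<exists>t\<in>carrier T. \<forall>x\<in>carrier (cmod ?H i). h i (s \<odot>\<^bsub>cmod ?H i\<^esub> x) = t \<odot>\<^bsub>cmod ?K i\<^esub> h i x"
      if "s \<in> carrier S" for s
      by (rule smult_exchange(1)[OF _ that]) (use eq in blast)
    show "\<exists>s\<in>carrier S. \<forall>x\<in>carrier (cmod ?H i). h i (s \<odot>\<^bsub>cmod ?H i\<^esub> x) = t \<odot>\<^bsub>cmod ?K i\<^esub> h i x"
      if "t \<in> carrier T" for t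
      by (rule smult_exchange(2)[OF _ that]) (use eq in blast)
  qed
qed

end

end

section \<open>Exterior multiplication and contraction\<close>

lemma (in abelian_group) minus_zero_right: "x \<in> carrier G \<Longrightarrow> x \<ominus> \<zero> = x"
  by (simp add: a_minus_def)

text \<open>The exponent of the sign that arises when e_t is moved from the front to its place among
  the factors indexed by \<open>J\<close>.\<close>

definition pos :: "nat set \<Rightarrow> nat \<Rightarrow> int" where
  "pos J t = int (card {i \<in> J. i < t})"

lemma pos_insert: "s \<notin> J \<Longrightarrow> pos (insert s J) t = pos J t + (if s < t then 1 else 0)"
proof -
  assume "s \<notin> J"
  moreover have "{i \<in> insert s J. i < t} = (if s < t then insert s {i \<in> J. i < t} else {i \<in> J. i < t})"
    by auto
  ultimately show ?thesis by (simp add: pos_def)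
qed

lemma pos_eq_0: "(\<And>i. i \<in> J \<Longrightarrow> t \<le> i) \<Longrightarrow> pos J t = 0"
  by (auto simp: pos_def card_eq_0_iff) (metis linorder_not_less)

context cring
begin

text \<open>A function \<open>u\<close> on pairs \<open>(x, J)\<close> stands for the sum of the \<open>u (x, J) e\<^sub>J x\<close>, where
  \<open>e\<^sub>J\<close> is the exterior product of the \<open>e\<^sub>j\<close> in increasing order. Then \<open>ext t\<close> is multiplication by
  \<open>e\<^sub>t\<close>, and \<open>contr t\<close> is the antiderivation with \<open>e\<^sub>t \<mapsto> 1\<close> that kills the other generators.\<close>

definition ext :: "nat \<Rightarrow> ('x \<times> nat set \<Rightarrow> 'a) \<Rightarrow> 'x \<times> nat set \<Rightarrow> 'a" where
  "ext t u = (\<lambda>(x, J). if t \<in> J then signed R (pos J t) (u (x, J - {t})) else \<zero>)"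

definition contr :: "nat \<Rightarrow> ('x \<times> nat set \<Rightarrow> 'a) \<Rightarrow> 'x \<times> nat set \<Rightarrow> 'a" where
  "contr t u = (\<lambda>(x, J). if t \<in> J then \<zero> else signed R (pos J t) (u (x, insert t J)))"

text \<open>One ungraded module holds all degrees, so that \<open>ext\<close>, \<open>contr\<close>
  and the differentials are single endomorphisms. Degrees reappear later as submodules
  \<open>FB (B k)\<close>.\<close>

abbreviation FU :: "nat set \<Rightarrow> ('a, 'x \<times> nat set \<Rightarrow> 'a) module" where
  "FU E \<equiv> free_module R (UNIV \<times> Pow E)"

lemma FU_module: "module R (FU E)"
  by (rule module_free_module[OF cring_axioms])

lemma FU_coeff: "u \<in> carrier (FU E) \<Longrightarrow> u b \<in> carrier R"
  by (rule free_module_coeff[OF cring_axioms])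

lemma FU_minus:
  assumes v: "v \<in> carrier (FU E)"
  shows "\<ominus>\<^bsub>FU E\<^esub> v = (\<lambda>b. \<ominus> v b)"
proof -
  interpret F: module R "FU E" by (rule FU_module)
  have "\<ominus>\<^bsub>FU E\<^esub> v = (\<ominus> \<one>) \<odot>\<^bsub>FU E\<^esub> v"
    using v F.smult_l_minus[of \<one> v] F.smult_one[OF v] by (simp del: free_module_simps F.smult_one)
  then show ?thesis using FU_coeff[OF v] by (simp add: l_minus)
qed

lemma FU_diff:
  assumes "v \<in> carrier (FU E)"
  shows "u \<ominus>\<^bsub>FU E\<^esub> v = (\<lambda>b. u b \<ominus> v b)"
  unfolding a_minus_def FU_minus[OF assms] by simp

lemma FU_support: "u \<in> carrier (FU E) \<Longrightarrow> \<not> J \<subseteq> E \<Longrightarrow> u (x, J) = \<zero>"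
  by (simp add: free_module_carrier)

lemma signed_zero [simp]: "signed R k \<zero> = \<zero>"
  by (simp add: signed_def)

lemma signed_closed' [simp]: "x \<in> carrier R \<Longrightarrow> signed R k x \<in> carrier R"
  by (simp add: signed_def)

lemma signed_mult: "x \<in> carrier R \<Longrightarrow> y \<in> carrier R \<Longrightarrow> signed R k (x \<otimes> y) = x \<otimes> signed R k y"
  by (simp add: signed_def r_minus)

lemma ext_hom:
  assumes t: "t \<in> E"
  shows "ext t \<in> mod_hom R (FU E) (FU E)"
proof (rule mod_homI)
  fix u assume u: "u \<in> carrier (FU E)"
  have "{b. ext t u b \<noteq> \<zero>} \<subseteq> (\<lambda>(x, J). (x, insert t J)) ` {b. u b \<noteq> \<zero>}"
  proof clarify
    fix x J assume "ext t u (x, J) \<noteq> \<zero>"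
    then have "t \<in> J" "u (x, J - {t}) \<noteq> \<zero>" by (auto simp: ext_def split: if_splits)
    then show "(x, J) \<in> (\<lambda>(x, J). (x, insert t J)) ` {b. u b \<noteq> \<zero>}"
      by (intro image_eqI[of _ _ "(x, J - {t})"]) auto
  qed
  then have "finite {b. ext t u b \<noteq> \<zero>}"
    using u finite_subset by (fastforce simp: free_module_carrier)
  moreover have "ext t u b \<in> carrier R" for b using FU_coeff[OF u] by (auto simp: ext_def split: prod.split)
  moreover have "ext t u b = \<zero>" if "b \<notin> UNIV \<times> Pow E" for b
  proof -
    obtain x J where b: "b = (x, J)" by (cases b)
    then have "\<not> J \<subseteq> E" using that by simp
    then have "\<not> J - {t} \<subseteq> E" using t by blast
    from FU_support[OF u this] show ?thesis by (simp add: ext_def b)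
  qed
  ultimately show "ext t u \<in> carrier (FU E)" by (simp add: free_module_carrier)
qed (auto simp: FU_coeff ext_def signed_add[OF abelian_group_axioms] signed_mult fun_eq_iff)

lemma contr_hom: "contr t \<in> mod_hom R (FU E) (FU E)"
proof (rule mod_homI)
  fix u assume u: "u \<in> carrier (FU E)"
  have "{b. contr t u b \<noteq> \<zero>} \<subseteq> (\<lambda>(x, J). (x, J - {t})) ` {b. u b \<noteq> \<zero>}"
  proof clarify
    fix x J assume "contr t u (x, J) \<noteq> \<zero>"
    then have "t \<notin> J" "u (x, insert t J) \<noteq> \<zero>" by (auto simp: contr_def split: if_splits)
    then show "(x, J) \<in> (\<lambda>(x, J). (x, J - {t})) ` {b. u b \<noteq> \<zero>}"
      by (intro image_eqI[of _ _ "(x, insert t J)"]) auto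
  qed
  then have "finite {b. contr t u b \<noteq> \<zero>}"
    using u finite_subset by (fastforce simp: free_module_carrier)
  moreover have "contr t u b \<in> carrier R" for b using FU_coeff[OF u] by (auto simp: contr_def split: prod.split)
  moreover have "contr t u b = \<zero>" if "b \<notin> UNIV \<times> Pow E" for b
  proof -
    obtain x J where b: "b = (x, J)" by (cases b)
    then have "\<not> J \<subseteq> E" using that by simp
    then have "\<not> insert t J \<subseteq> E" by blast
    from FU_support[OF u this] show ?thesis by (simp add: contr_def b)
  qed
  ultimately show "contr t u \<in> carrier (FU E)" by (simp add: free_module_carrier)
qed (auto simp: FU_coeff contr_def signed_add[OF abelian_group_axioms] signed_mult fun_eq_iff)

text \<open>The relations of the exterior algebra. For distinct indices, inserting the smaller one
  shifts the position of the larger by one, while the larger does not affect the smaller; so the two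
  orders of insertion differ by one sign.\<close>

lemma ext_ext:
  fixes u :: "'x \<times> nat set \<Rightarrow> 'a"
  assumes "u \<in> carrier (FU E)"
  shows "ext t (ext t u) = (\<lambda>_. \<zero>)"
    and "s \<noteq> t \<Longrightarrow> ext s (ext t u) = (\<lambda>b. \<ominus> ext t (ext s u) b)"
proof -
  show "ext t (ext t u) = (\<lambda>_. \<zero>)" by (auto simp: ext_def fun_eq_iff)
  assume st: "s \<noteq> t"
  show "ext s (ext t u) = (\<lambda>b. \<ominus> ext t (ext s u) b)"
  proof
    fix b :: "'x \<times> nat set"
    obtain x J where b: "b = (x, J)" by (cases b)
    show "ext s (ext t u) b = \<ominus> ext t (ext s u) b"
    proof (cases "s \<in> J \<and> t \<in> J")
      case True
      define K where "K = J - {s, t}"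
      have J: "J = insert s (insert t K)" "s \<notin> K" "t \<notin> K" using True by (auto simp: K_def)
      have 1: "J - {s} = insert t K" "J - {t} = insert s K" "insert t K - {t} = K" "insert s K - {s} = K"
        using J st by auto
      have 2: "pos J s = pos K s + (if t < s then 1 else 0)" "pos J t = pos K t + (if s < t then 1 else 0)"
        using J st by (simp_all add: pos_insert insert_commute[of s t])
      have 3: "pos (insert t K) t = pos K t" "pos (insert s K) s = pos K s"
        using J by (simp_all add: pos_insert)
      have "ext s (ext t u) b = signed R (pos J s + pos K t) (u (x, K))"
        using True st FU_coeff[OF assms]
        by (simp add: b ext_def 1 3 signed_signed[OF abelian_group_axioms])
      moreover have "ext t (ext s u) b = signed R (pos J t + pos K s) (u (x, K))"
        using True st FU_coeff[OF assms]
        by (simp add: b ext_def 1 3 signed_signed[OF abelian_group_axioms])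
      moreover have "odd (pos J s + pos K t) \<longleftrightarrow> even (pos J t + pos K s)"
        using st unfolding 2 by auto
      ultimately show ?thesis using FU_coeff[OF assms] by (auto simp: signed_def)
    next
      case False
      then show ?thesis by (auto simp: b ext_def)
    qed
  qed
qed

text \<open>The commutation rules of multiplication and contraction: e_t and its own contraction
  anticommute up to the identity, e_t and the contraction at another index anticommute.\<close>

lemma ext_contr:
  fixes u :: "'x \<times> nat set \<Rightarrow> 'a"
  assumes "u \<in> carrier (FU E)"
  shows "(\<lambda>b. ext t (contr t u) b \<oplus> contr t (ext t u) b) = u"
    and "s \<noteq> t \<Longrightarrow> contr s (ext t u) = (\<lambda>b. \<ominus> ext t (contr s u) b)"
proof -
  show "(\<lambda>b. ext t (contr t u) b \<oplus> contr t (ext t u) b) = u"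
  proof
    fix b :: "'x \<times> nat set"
    obtain x J where b: "b = (x, J)" by (cases b)
    show "ext t (contr t u) b \<oplus> contr t (ext t u) b = u b"
    proof (cases "t \<in> J")
      case True
      define K where "K = J - {t}"
      have J: "J = insert t K" "t \<notin> K" using True by (auto simp: K_def)
      then show ?thesis using FU_coeff[OF assms]
        by (simp add: b ext_def contr_def pos_insert signed_signed[OF abelian_group_axioms])
           (simp add: signed_def)
    next
      case False
      then show ?thesis using FU_coeff[OF assms]
        by (simp add: b ext_def contr_def pos_insert signed_signed[OF abelian_group_axioms])
           (simp add: signed_def)
    qed
  qed
  assume st: "s \<noteq> t"
  show "contr s (ext t u) = (\<lambda>b. \<ominus> ext t (contr s u) b)"
  proof
    fix b :: "'x \<times> nat set"
    obtain x J where b: "b = (x, J)" by (cases b)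
    show "contr s (ext t u) b = \<ominus> ext t (contr s u) b"
    proof (cases "s \<notin> J \<and> t \<in> J")
      case True
      define K where "K = J - {t}"
      have J: "J = insert t K" "t \<notin> K" "s \<notin> K" using True by (auto simp: K_def)
      have 1: "insert s (insert t K) - {t} = insert s K" "insert t K - {t} = K" using J st by auto
      have "contr s (ext t u) b = signed R (pos J s + pos (insert s J) t) (u (x, insert s K))"
        using True st FU_coeff[OF assms]
        by (simp add: b ext_def contr_def J(1) 1 signed_signed[OF abelian_group_axioms])
      moreover have "ext t (contr s u) b = signed R (pos J t + pos K s) (u (x, insert s K))"
        using True st FU_coeff[OF assms] J
        by (simp add: b ext_def contr_def 1 signed_signed[OF abelian_group_axioms])
      moreover have "pos J s = pos K s + (if t < s then 1 else 0)"
        "pos (insert s J) t = pos J t + (if s < t then 1 else 0)"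
        using J True by (simp_all add: pos_insert)
      moreover from this have "odd (pos J s + pos (insert s J) t) \<longleftrightarrow> even (pos J t + pos K s)"
        using st by auto
      ultimately show ?thesis using FU_coeff[OF assms] by (auto simp: signed_def)
    next
      case False
      then show ?thesis using st by (auto simp: b ext_def contr_def)
    qed
  qed
qed

lemma contr_contr:
  assumes "u \<in> carrier (FU E)"
  shows "contr t (contr t u) = (\<lambda>_. \<zero>)"
  by (auto simp: contr_def fun_eq_iff)

lemma ext_basis_elt:
  fixes x :: 'x
  shows "t \<in> J \<Longrightarrow> ext t (basis_elt R (x, J)) = (\<lambda>_. \<zero>)"
    and "t \<notin> J \<Longrightarrow> ext t (basis_elt R (x, J)) = (\<lambda>b. signed R (pos J t) (basis_elt R (x, insert t J) b))"
proof -
  show "t \<in> J \<Longrightarrow> ext t (basis_elt R (x, J)) = (\<lambda>_. \<zero>)"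
    by (auto simp: ext_def basis_elt_def fun_eq_iff)
  assume t: "t \<notin> J"
  show "ext t (basis_elt R (x, J)) = (\<lambda>b. signed R (pos J t) (basis_elt R (x, insert t J) b))"
  proof
    fix b :: "'x \<times> nat set"
    obtain y K where b: "b = (y, K)" by (cases b)
    show "ext t (basis_elt R (x, J)) b = signed R (pos J t) (basis_elt R (x, insert t J) b)"
    proof (cases "y = x \<and> K = insert t J")
      case True
      then have "K - {t} = J" "pos K t = pos J t" using t by (simp_all add: pos_insert)
      with True show ?thesis by (simp add: b ext_def basis_elt_def)
    next
      case False
      then have "t \<in> K \<Longrightarrow> (y, K - {t}) \<noteq> (x, J)" by blast
      with False show ?thesis by (auto simp: b ext_def basis_elt_def)
    qed
  qed
qed

section \<open>Semifree differentials over a Koszul algebra\<close>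

text \<open>For a generator x with prescribed boundary \<delta> x, the relation d e_t + e_t d = c_t
  leaves no choice: d (e_t y) = c_t y - e_t (d y). The recursion peels off the factors of e_J x in
  increasing order; \<open>koszul_diff\<close> extends the result linearly.\<close>

primrec semifree_diff ::
  "(nat \<Rightarrow> 'a) \<Rightarrow> ('x \<Rightarrow> 'x \<times> nat set \<Rightarrow> 'a) \<Rightarrow> 'x \<Rightarrow> nat list \<Rightarrow> 'x \<times> nat set \<Rightarrow> 'a" where
  "semifree_diff c \<delta> x [] = \<delta> x"
| "semifree_diff c \<delta> x (t # ts) =
     (\<lambda>b. c t \<otimes> basis_elt R (x, set ts) b \<ominus> ext t (semifree_diff c \<delta> x ts) b)"

definition koszul_diff ::
  "nat set \<Rightarrow> (nat \<Rightarrow> 'a) \<Rightarrow> ('x \<Rightarrow> 'x \<times> nat set \<Rightarrow> 'a) \<Rightarrow> ('x \<times> nat set \<Rightarrow> 'a) \<Rightarrow> 'x \<times> nat set \<Rightarrow> 'a" where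
  "koszul_diff E c \<delta> = lin_ext R (FU E) (\<lambda>(x, J). semifree_diff c \<delta> x (sorted_list_of_set J))"

context
  fixes E :: "nat set" and c :: "nat \<Rightarrow> 'a" and \<delta> :: "'x \<Rightarrow> 'x \<times> nat set \<Rightarrow> 'a"
  assumes E: "finite E" and c: "\<And>t. t \<in> E \<Longrightarrow> c t \<in> carrier R" and \<delta>: "\<And>x. \<delta> x \<in> carrier (FU E)"
begin

private abbreviation (input) "d \<equiv> koszul_diff E c \<delta>"
private abbreviation (input) "e x J \<equiv> basis_elt R (x, J)"

interpretation F: module R "FU E :: ('a, 'x \<times> nat set \<Rightarrow> 'a) module" by (rule FU_module)

lemma basis_FU: "J \<subseteq> E \<Longrightarrow> e x J \<in> carrier (FU E)"
  by (rule basis_elt_closed[OF cring_axioms]) auto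

lemma semifree_diff_closed: "set ts \<subseteq> E \<Longrightarrow> semifree_diff c \<delta> x ts \<in> carrier (FU E)"
proof (induction ts)
  case Nil
  then show ?case using \<delta> by simp
next
  case (Cons t ts)
  have v: "ext t (semifree_diff c \<delta> x ts) \<in> carrier (FU E)"
    using Cons by (intro mod_hom_closed[OF ext_hom]) auto
  have "c t \<odot>\<^bsub>FU E\<^esub> e x (set ts) \<ominus>\<^bsub>FU E\<^esub> ext t (semifree_diff c \<delta> x ts) \<in> carrier (FU E)"
    using Cons.prems c v basis_FU[of "set ts" x] by (intro F.M.minus_closed F.smult_closed) auto
  then show ?case using v by (simp add: FU_diff)
qed

lemma koszul_diff_hom: "d \<in> mod_hom R (FU E) (FU E)"
  unfolding koszul_diff_def
proof (rule lin_ext_hom[OF F.module_axioms], clarify)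
  fix x J assume J: "J \<subseteq> E"
  then have "finite J" using E by (rule finite_subset)
  with J show "semifree_diff c \<delta> x (sorted_list_of_set J) \<in> carrier (FU E)"
    by (intro semifree_diff_closed) auto
qed

lemma koszul_diff_basis:
  assumes "J \<subseteq> E"
  shows "d (e x J) = semifree_diff c \<delta> x (sorted_list_of_set J)"
proof -
  have "(\<lambda>(x, J). semifree_diff c \<delta> x (sorted_list_of_set J)) \<in> UNIV \<times> Pow E \<rightarrow> carrier (FU E)"
  proof clarify
    fix x J assume J: "J \<subseteq> E"
    then have "finite J" using E by (rule finite_subset)
    with J show "semifree_diff c \<delta> x (sorted_list_of_set J) \<in> carrier (FU E)"
      by (intro semifree_diff_closed) auto
  qed
  from lin_ext_basis_elt[OF F.module_axioms this, of "(x, J)"] assms show ?thesis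
    by (simp add: koszul_diff_def)
qed

lemma koszul_diff_empty: "d (e x {}) = \<delta> x"
  by (simp add: koszul_diff_basis)

text \<open>If \<open>t\<close> precedes all of \<open>K\<close>, it heads the sorted list of
  \<open>insert t K\<close> and \<open>ext t\<close> introduces no sign, so this is the recursion
  itself.\<close>

private lemma diff_step:
  assumes "insert t K \<subseteq> E" "\<forall>a\<in>K. t < a"
  shows "d (ext t (e x K)) = c t \<odot>\<^bsub>FU E\<^esub> e x K \<ominus>\<^bsub>FU E\<^esub> ext t (d (e x K))"
proof -
  have K: "finite K" "t \<notin> K" "K \<subseteq> E" using assms finite_subset[OF _ E] by auto
  have p: "pos K t = 0" using assms(2) by (intro pos_eq_0) (auto intro: less_imp_le)
  have "Min (insert t K) = t" using K assms(2) by (intro Min_eqI) (auto intro: less_imp_le)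
  then have "sorted_list_of_set (insert t K) = t # sorted_list_of_set K"
    using K sorted_list_of_set_nonempty[of "insert t K"] by simp
  then have "d (e x (insert t K)) = (\<lambda>b. c t \<otimes> e x K b \<ominus> ext t (d (e x K)) b)"
    using koszul_diff_basis[OF assms(1)] koszul_diff_basis[OF K(3)] K by simp
  moreover have "ext t (d (e x K)) \<in> carrier (FU E)"
    using assms(1) by (intro mod_hom_closed[OF ext_hom] mod_hom_closed[OF koszul_diff_hom] basis_FU) auto
  moreover have "ext t (e x K) = e x (insert t K)"
    using K ext_basis_elt(2)[of t K x] by (simp add: p signed_def)
  ultimately show ?thesis by (simp add: FU_diff)
qed

text \<open>The recursion yields the relation only for \<open>s\<close> below all indices of the
  basis element. For general \<open>s\<close> the index set is built up by new minima
  \<open>t\<close>, and \<open>s\<close> is compared with \<open>t\<close>. If \<open>s < t\<close>,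
  the recursion applies. If \<open>s = t\<close>, the first term vanishes and e_t d e_t reduces to
  c_t e_t. If \<open>t < s\<close>, the product is reordered as e_s e_t = - e_t e_s, then the
  recursion is used for \<open>t\<close> and the induction hypothesis for \<open>s\<close>.\<close>

lemma koszul_diff_ext:
  assumes s: "s \<in> E" and u: "u \<in> carrier (FU E)"
  shows "d (ext s u) \<oplus>\<^bsub>FU E\<^esub> ext s (d u) = c s \<odot>\<^bsub>FU E\<^esub> u"
proof -
  note dh = koszul_diff_hom
  note dc = mod_hom_closed[OF dh]
  have basis: "\<forall>s\<in>E. d (ext s (e x J)) \<oplus>\<^bsub>FU E\<^esub> ext s (d (e x J)) = c s \<odot>\<^bsub>FU E\<^esub> e x J"
    if "finite J" "J \<subseteq> E" for x J
    using that
  proof (induction J rule: finite_linorder_min_induct)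
    case empty
    show ?case
    proof
      fix s assume s: "s \<in> E"
      have "ext s (d (e x {})) \<in> carrier (FU E)" "c s \<odot>\<^bsub>FU E\<^esub> e x {} \<in> carrier (FU E)"
        by (rule mod_hom_closed[OF ext_hom[OF s] dc[OF basis_FU[OF empty_subsetI]]],
            rule F.smult_closed[OF c[OF s] basis_FU[OF empty_subsetI]])
      moreover have "d (ext s (e x {})) = c s \<odot>\<^bsub>FU E\<^esub> e x {} \<ominus>\<^bsub>FU E\<^esub> ext s (d (e x {}))"
        by (rule diff_step) (use s in auto)
      ultimately show "d (ext s (e x {})) \<oplus>\<^bsub>FU E\<^esub> ext s (d (e x {})) = c s \<odot>\<^bsub>FU E\<^esub> e x {}"
        by (simp only: a_minus_def F.M.a_assoc F.M.l_neg F.M.r_zero F.M.a_inv_closed)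
    qed
  next
    case (insert t K)
    have t: "t \<in> E" and K: "K \<subseteq> E" "t \<notin> K" using insert by auto
    let ?b = "e x K"
    let ?D = "d ?b"
    have b: "?b \<in> carrier (FU E)" by (rule basis_FU[OF K(1)])
    then have D: "?D \<in> carrier (FU E)" by (rule dc)
    note et = mod_hom_closed[OF ext_hom[OF t]]
    have IH: "d (ext s ?b) = c s \<odot>\<^bsub>FU E\<^esub> ?b \<ominus>\<^bsub>FU E\<^esub> ext s ?D" if s: "s \<in> E" for s
    proof -
      have e: "d (ext s ?b) \<oplus>\<^bsub>FU E\<^esub> ext s ?D = c s \<odot>\<^bsub>FU E\<^esub> ?b" using insert.IH K(1) s by blast
      show ?thesis
        unfolding e[symmetric] a_minus_def
        using dc[OF mod_hom_closed[OF ext_hom[OF s] b]] mod_hom_closed[OF ext_hom[OF s] D]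
        by (simp only: F.M.a_assoc F.M.r_neg F.M.r_zero F.M.a_inv_closed)
    qed
    have eb: "e x (insert t K) = ext t ?b"
    proof -
      have "pos K t = 0" using insert.hyps(2) by (intro pos_eq_0) (auto intro: less_imp_le)
      then show ?thesis using K ext_basis_elt(2)[of t K x] by (simp add: signed_def)
    qed
    have dt: "d (ext t ?b) = c t \<odot>\<^bsub>FU E\<^esub> ?b \<ominus>\<^bsub>FU E\<^esub> ext t ?D" by (rule IH[OF t])
    show ?case
      unfolding eb
    proof
      fix s assume s: "s \<in> E"
      note es = mod_hom_closed[OF ext_hom[OF s]]
      let ?p = "c t \<odot>\<^bsub>FU E\<^esub> ext s ?b" and ?q = "c s \<odot>\<^bsub>FU E\<^esub> ext t ?b"
      have pc: "?p \<in> carrier (FU E)" and qc: "?q \<in> carrier (FU E)"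
        by (rule F.smult_closed[OF c[OF t] es[OF b]], rule F.smult_closed[OF c[OF s] et[OF b]])
      consider "s < t" | "s = t" | "t < s" by linarith
      then show "d (ext s (ext t ?b)) \<oplus>\<^bsub>FU E\<^esub> ext s (d (ext t ?b)) = c s \<odot>\<^bsub>FU E\<^esub> ext t ?b"
      proof cases
        case 1
        have "\<forall>a\<in>insert t K. s < a" using 1 insert.hyps(2) by auto
        from diff_step[OF _ this, of x] have "d (ext s (ext t ?b)) = ?q \<ominus>\<^bsub>FU E\<^esub> ext s (d (ext t ?b))"
          using s t K(1) unfolding eb by simp
        moreover have "ext s (d (ext t ?b)) \<in> carrier (FU E)" by (intro es dc et b)
        ultimately show ?thesis using qc
          by (simp only: a_minus_def F.M.a_assoc F.M.l_neg F.M.r_zero F.M.a_inv_closed)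
      next
        case 2
        have "ext s (ext t ?b) = \<zero>\<^bsub>FU E\<^esub>" "ext t (ext t ?D) = \<zero>\<^bsub>FU E\<^esub>"
          using ext_ext(1)[OF b] ext_ext(1)[OF D] 2 by simp_all
        moreover have "ext t (c t \<odot>\<^bsub>FU E\<^esub> ?b \<ominus>\<^bsub>FU E\<^esub> ext t ?D) = ?q \<ominus>\<^bsub>FU E\<^esub> ext t (ext t ?D)"
          using mod_hom_diff[OF F.module_axioms F.module_axioms ext_hom[OF t] F.smult_closed[OF c[OF t] b] et[OF D]]
            mod_hom_smult[OF ext_hom[OF t] c[OF t] b] 2 by metis
        moreover have "?q \<ominus>\<^bsub>FU E\<^esub> \<zero>\<^bsub>FU E\<^esub> = ?q"
          using qc by (rule F.M.minus_zero_right)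
        ultimately show ?thesis
          using mod_hom_zero[OF F.module_axioms F.module_axioms dh] qc 2
          by (simp only: dt F.M.l_zero)
      next
        case 3
        let ?r = "ext t (ext s ?D)"
        have rc: "?r \<in> carrier (FU E)" by (intro et es D)
        \<comment> \<open>The recursion for \<open>t\<close>, applied to the product of e_s with the
          basis element. That product is zero if \<open>s\<close> is in \<open>K\<close>, and
          otherwise a signed basis element whose indices all exceed \<open>t\<close>.\<close>
        have "d (ext t (ext s ?b)) = ?p \<ominus>\<^bsub>FU E\<^esub> ext t (d (ext s ?b))"
        proof (cases "s \<in> K")
          case True
          then have z: "ext s ?b = \<zero>\<^bsub>FU E\<^esub>" using ext_basis_elt(1) by simp
          note zz = mod_hom_zero[OF F.module_axioms F.module_axioms dh]
            mod_hom_zero[OF F.module_axioms F.module_axioms ext_hom[OF t]]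
          show ?thesis unfolding z using c[OF t]
            by (simp only: zz F.smult_r_null F.M.minus_zero_right F.M.zero_closed)
        next
          case False
          let ?b' = "e x (insert s K)"
          have b': "?b' \<in> carrier (FU E)" using s K(1) by (intro basis_FU) auto
          have sb: "ext s ?b = signed (FU E) (pos K s) ?b'"
            using ext_basis_elt(2)[OF False, of x] b' by (auto simp: signed_def FU_minus)
          have "\<forall>a\<in>insert s K. t < a" using 3 insert.hyps(2) by auto
          from diff_step[OF _ this, of x] s t K(1)
          have st: "d (ext t ?b') = c t \<odot>\<^bsub>FU E\<^esub> ?b' \<ominus>\<^bsub>FU E\<^esub> ext t (d ?b')" by simp
          note ag = F.M.abelian_group_axioms
          note sg = signed_mod_hom[OF F.module_axioms F.module_axioms]
          have "d (ext t (ext s ?b)) = signed (FU E) (pos K s) (d (ext t ?b'))"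
            unfolding sb using sg[OF ext_hom[OF t] b'] sg[OF dh et[OF b']] by simp
          also have "\<dots> = c t \<odot>\<^bsub>FU E\<^esub> signed (FU E) (pos K s) ?b' \<ominus>\<^bsub>FU E\<^esub> signed (FU E) (pos K s) (ext t (d ?b'))"
            unfolding st a_minus_def using c[OF t] b' et[OF dc[OF b']]
            by (subst signed_add[OF ag])
               (auto simp: F.smult_r_minus signed_def simp del: free_module_simps
                 intro!: F.smult_closed)
          also have "signed (FU E) (pos K s) (ext t (d ?b')) = ext t (d (ext s ?b))"
            unfolding sb using sg[OF dh b'] sg[OF ext_hom[OF t] dc[OF b']] by simp
          finally show ?thesis unfolding sb .
        qed
        also have "d (ext s ?b) = c s \<odot>\<^bsub>FU E\<^esub> ?b \<ominus>\<^bsub>FU E\<^esub> ext s ?D" by (rule IH[OF s])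
        also have "ext t \<dots> = ?q \<ominus>\<^bsub>FU E\<^esub> ?r"
          using mod_hom_diff[OF F.module_axioms F.module_axioms ext_hom[OF t] F.smult_closed[OF c[OF s] b] es[OF D]]
            mod_hom_smult[OF ext_hom[OF t] c[OF s] b] by metis
        finally have 4: "d (ext t (ext s ?b)) = ?p \<ominus>\<^bsub>FU E\<^esub> (?q \<ominus>\<^bsub>FU E\<^esub> ?r)" .
        have "ext s (ext t ?b) = \<ominus>\<^bsub>FU E\<^esub> ext t (ext s ?b)"
          using ext_ext(2)[OF b, of s t] 3 et[OF es[OF b]] by (simp add: FU_minus)
        then have 5: "d (ext s (ext t ?b)) = \<ominus>\<^bsub>FU E\<^esub> (?p \<ominus>\<^bsub>FU E\<^esub> (?q \<ominus>\<^bsub>FU E\<^esub> ?r))"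
          using mod_hom_minus[OF F.module_axioms F.module_axioms dh et[OF es[OF b]]] 4 by metis
        have "ext s (ext t ?D) = \<ominus>\<^bsub>FU E\<^esub> ?r"
          using ext_ext(2)[OF D, of s t] 3 rc by (simp add: FU_minus)
        then have 6: "ext s (d (ext t ?b)) = ?p \<ominus>\<^bsub>FU E\<^esub> (\<ominus>\<^bsub>FU E\<^esub> ?r)"
          unfolding dt
          using mod_hom_diff[OF F.module_axioms F.module_axioms ext_hom[OF s] F.smult_closed[OF c[OF t] b] et[OF D]]
            mod_hom_smult[OF ext_hom[OF s] c[OF t] b] by metis
        have "\<ominus>\<^bsub>FU E\<^esub> (?p \<ominus>\<^bsub>FU E\<^esub> (?q \<ominus>\<^bsub>FU E\<^esub> ?r)) \<oplus>\<^bsub>FU E\<^esub> (?p \<ominus>\<^bsub>FU E\<^esub> (\<ominus>\<^bsub>FU E\<^esub> ?r)) =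
            (\<ominus>\<^bsub>FU E\<^esub> ?p \<oplus>\<^bsub>FU E\<^esub> ?p) \<oplus>\<^bsub>FU E\<^esub> (?q \<oplus>\<^bsub>FU E\<^esub> (\<ominus>\<^bsub>FU E\<^esub> ?r \<oplus>\<^bsub>FU E\<^esub> ?r))"
          using pc qc rc
          by (simp only: a_minus_def F.M.minus_add F.M.minus_minus F.M.a_ac F.M.a_inv_closed F.M.a_closed)
        also have "\<dots> = ?q" using pc qc rc by (simp only: F.M.l_neg F.M.l_zero F.M.r_zero)
        finally show ?thesis unfolding 5 6 .
      qed
    qed
  qed
  let ?l = "\<lambda>u. d (ext s u) \<oplus>\<^bsub>FU E\<^esub> ext s (d u)"
  have "?l u = (\<lambda>u :: 'x \<times> nat set \<Rightarrow> 'a. c s \<odot>\<^bsub>FU E\<^esub> u) u"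
  proof (rule free_module_hom_eq[OF F.module_axioms _ _ _ u])
    show "?l \<in> mod_hom R (FU E) (FU E)"
      by (rule mod_hom_sum[OF F.module_axioms mod_hom_comp[OF ext_hom[OF s] dh] mod_hom_comp[OF dh ext_hom[OF s]]])
    show "(\<lambda>u :: 'x \<times> nat set \<Rightarrow> 'a. c s \<odot>\<^bsub>FU E\<^esub> u) \<in> mod_hom R (FU E) (FU E)"
      by (rule mod_hom_scale[OF F.module_axioms mod_hom_id c[OF s]])
    fix b :: "'x \<times> nat set" assume "b \<in> UNIV \<times> Pow E"
    then obtain x J where b: "b = (x, J)" "J \<subseteq> E" by auto
    then show "?l (basis_elt R b) = c s \<odot>\<^bsub>FU E\<^esub> basis_elt R b"
      using basis[of J x] s finite_subset[of J E] E by simp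
  qed
  then show ?thesis .
qed

end

end

section \<open>Semifree resolutions over a Koszul algebra\<close>

text \<open>The pair (x, J) has the degree of x plus the size of J. The degree of x is kept
  implicit: one pair in degree k determines a degree for all pairs with the same x. In particular
  the graded pieces are stable under exterior multiplication.\<close>

definition graded_basis :: "nat set \<Rightarrow> (int \<Rightarrow> ('x \<times> nat set) set) \<Rightarrow> bool" where
  "graded_basis E B \<longleftrightarrow> (\<forall>k<0. B k = {}) \<and> (\<forall>k x J. (x, J) \<in> B k \<longrightarrow> J \<subseteq> E \<and>
     (\<forall>J'\<subseteq>E. (x, J') \<in> B (k - int (card J) + int (card J'))))"

lemma graded_basisD:
  assumes "graded_basis E B"
  shows "k < 0 \<Longrightarrow> B k = {}" "(x, J) \<in> B k \<Longrightarrow> J \<subseteq> E"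
    "(x, J) \<in> B k \<Longrightarrow> J' \<subseteq> E \<Longrightarrow> (x, J') \<in> B (k - int (card J) + int (card J'))"
  using assms by (auto simp: graded_basis_def)

context cring
begin

abbreviation FB :: "('x \<times> nat set) set \<Rightarrow> ('x \<times> nat set \<Rightarrow> 'a) set" where
  "FB X \<equiv> carrier (free_module R X)"

lemma FB_iff:
  assumes "graded_basis E B"
  shows "u \<in> FB (B k) \<longleftrightarrow> u \<in> carrier (FU E) \<and> (\<forall>b. u b \<noteq> \<zero> \<longrightarrow> b \<in> B k)"
proof
  assume u: "u \<in> FB (B k)"
  then have "u b \<in> carrier R" for b by (rule free_module_coeff[OF cring_axioms])
  with u graded_basisD(2)[OF assms] show "u \<in> carrier (FU E) \<and> (\<forall>b. u b \<noteq> \<zero> \<longrightarrow> b \<in> B k)"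
    by (fastforce simp: free_module_carrier)
next
  assume u: "u \<in> carrier (FU E) \<and> (\<forall>b. u b \<noteq> \<zero> \<longrightarrow> b \<in> B k)"
  then have "u b \<in> carrier R" for b by (blast intro: FU_coeff)
  with u show "u \<in> FB (B k)" by (auto simp: free_module_carrier)
qed

lemma FB_submodule:
  assumes "graded_basis E B"
  shows "submodule (FB (B k)) R (FU E)"
proof -
  interpret F: module R "FU E" by (rule FU_module)
  interpret B: module R "free_module R (B k)" by (rule module_free_module[OF cring_axioms])
  show ?thesis
  proof (rule submodule_combine[OF F.module_axioms])
    show "FB (B k) \<subseteq> carrier (FU E)" using FB_iff[OF assms] by blast
    show "\<zero>\<^bsub>FU E\<^esub> \<in> FB (B k)" using B.M.zero_closed by simp
    show "x \<oplus>\<^bsub>FU E\<^esub> y \<in> FB (B k)" if "x \<in> FB (B k)" "y \<in> FB (B k)" for x y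
      using B.M.a_closed[OF that] by simp
    show "s \<odot>\<^bsub>FU E\<^esub> x \<in> FB (B k)" if "s \<in> carrier R" "x \<in> FB (B k)" for s x
      using B.smult_closed[OF that] by simp
  qed
qed

lemma FB_hom:
  assumes "graded_basis E B" "h \<in> mod_hom R (FU E) A"
  shows "h \<in> mod_hom R (free_module R (B k)) A"
  using assms(2) FB_iff[OF assms(1)] by (auto simp: mod_hom_def)

lemma FB_hom_into:
  assumes "graded_basis E B" "h \<in> mod_hom R (FU E) (FU E)"
    and "\<And>x J. (x, J) \<in> B k \<Longrightarrow> h (basis_elt R (x, J)) \<in> FB (B j)" "u \<in> FB (B k)"
  shows "h u \<in> FB (B j)"
proof -
  interpret F: module R "FU E" by (rule FU_module)
  note E = F.submoduleE[OF FB_submodule[OF assms(1), of j]]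
  note hb = FB_hom[OF assms(1,2), of k]
  interpret B: module R "free_module R (B k)" by (rule module_free_module[OF cring_axioms])
  show ?thesis
    using cring_axioms assms(4)
  proof (rule free_module_support_induct)
    show "h (\<lambda>_. \<zero>) \<in> FB (B j)"
      using mod_hom_zero[OF B.module_axioms F.module_axioms hb]
        submodule_zero[OF F.module_axioms FB_submodule[OF assms(1), of j]] by simp
  next
    fix s x v assume s: "s \<in> carrier R" and x: "x \<in> B k" and v: "v \<in> FB (B k)" "h v \<in> FB (B j)"
    have e: "basis_elt R x \<in> FB (B k)" by (rule basis_elt_closed[OF cring_axioms x])
    have "h (basis_elt R x) \<in> FB (B j)" using x assms(3) by (cases x) simp
    then show "h (v \<oplus>\<^bsub>free_module R (B k)\<^esub> s \<odot>\<^bsub>free_module R (B k)\<^esub> basis_elt R x) \<in> FB (B j)"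
      using E(4)[OF s] E(5)[OF v(2)]
      by (simp only: mod_hom_add[OF hb v(1) B.smult_closed[OF s e]] mod_hom_smult[OF hb s e])
  qed
qed

lemma ext_FB:
  assumes B: "graded_basis E B" and E: "finite E" and t: "t \<in> E" and u: "u \<in> FB (B k)"
  shows "ext t u \<in> FB (B (k + 1))"
proof -
  have u': "u \<in> carrier (FU E)" using u FB_iff[OF B] by blast
  have "(x, J) \<in> B (k + 1)" if "ext t u (x, J) \<noteq> \<zero>" for x J
  proof -
    have tJ: "t \<in> J" "u (x, J - {t}) \<noteq> \<zero>" using that by (auto simp: ext_def split: if_splits)
    then have b: "(x, J - {t}) \<in> B k" using u FB_iff[OF B] by blast
    then have J: "J \<subseteq> E" using graded_basisD(2)[OF B] t by blast
    then have "card J = card (J - {t}) + 1"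
      using tJ(1) finite_subset[OF J E] by (metis card.remove Suc_eq_plus1)
    with graded_basisD(3)[OF B b J] show ?thesis by simp
  qed
  then show ?thesis using mod_hom_closed[OF ext_hom[OF t] u'] FB_iff[OF B] by (metis surj_pair)
qed

lemma contr_FB:
  assumes B: "graded_basis E B" and E: "finite E" and u: "u \<in> FB (B k)"
  shows "contr t u \<in> FB (B (k - 1))"
proof -
  have u': "u \<in> carrier (FU E)" using u FB_iff[OF B] by blast
  have "(x, J) \<in> B (k - 1)" if "contr t u (x, J) \<noteq> \<zero>" for x J
  proof -
    have tJ: "t \<notin> J" "u (x, insert t J) \<noteq> \<zero>" using that by (auto simp: contr_def split: if_splits)
    then have b: "(x, insert t J) \<in> B k" using u FB_iff[OF B] by blast
    then have J: "J \<subseteq> E" using graded_basisD(2)[OF B] by blast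
    then have "card (insert t J) = card J + 1"
      using tJ(1) finite_subset[OF J E] by simp
    with graded_basisD(3)[OF B b J] show ?thesis by simp
  qed
  then show ?thesis using mod_hom_closed[OF contr_hom u'] FB_iff[OF B] by (metis surj_pair)
qed

text \<open>The condition \<open>d e\<^sub>t + e\<^sub>t d = c t\<close> makes the resolution a differential graded module over the
  Koszul algebra on \<open>c\<close>.\<close>

definition dg_res ::
  "nat set \<Rightarrow> (int \<Rightarrow> ('x \<times> nat set) set) \<Rightarrow> ('a, 'm) module \<Rightarrow> (('x \<times> nat set \<Rightarrow> 'a) \<Rightarrow> 'm) \<Rightarrow>
     (nat \<Rightarrow> 'a) \<Rightarrow> (('x \<times> nat set \<Rightarrow> 'a) \<Rightarrow> 'x \<times> nat set \<Rightarrow> 'a) \<Rightarrow> bool" where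
  "dg_res E B M aug c d \<longleftrightarrow> graded_basis E B \<and> d \<in> mod_hom R (FU E) (FU E) \<and>
     (\<forall>k. \<forall>u\<in>FB (B k). d u \<in> FB (B (k - 1)) \<and> d (d u) = (\<lambda>_. \<zero>)) \<and>
     (\<forall>t\<in>E. \<forall>u\<in>carrier (FU E). d (ext t u) \<oplus>\<^bsub>FU E\<^esub> ext t (d u) = c t \<odot>\<^bsub>FU E\<^esub> u) \<and>
     (\<forall>k>0. \<forall>u\<in>FB (B k). d u = (\<lambda>_. \<zero>) \<longrightarrow> (\<exists>w\<in>FB (B (k + 1)). d w = u)) \<and>
     aug \<in> mod_hom R (free_module R (B 0)) M \<and> aug ` FB (B 0) = carrier M \<and>
     (\<forall>u\<in>FB (B 0). aug u = \<zero>\<^bsub>M\<^esub> \<longleftrightarrow> (\<exists>w\<in>FB (B 1). d w = u))"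

lemma dg_resD:
  assumes "dg_res E B M aug c d"
  shows "graded_basis E B" "d \<in> mod_hom R (FU E) (FU E)"
    "u \<in> FB (B k) \<Longrightarrow> d u \<in> FB (B (k - 1))" "u \<in> FB (B k) \<Longrightarrow> d (d u) = (\<lambda>_. \<zero>)"
    "t \<in> E \<Longrightarrow> v \<in> carrier (FU E) \<Longrightarrow> d (ext t v) \<oplus>\<^bsub>FU E\<^esub> ext t (d v) = c t \<odot>\<^bsub>FU E\<^esub> v"
    "k > 0 \<Longrightarrow> u \<in> FB (B k) \<Longrightarrow> d u = (\<lambda>_. \<zero>) \<Longrightarrow> \<exists>w\<in>FB (B (k + 1)). d w = u"
    "aug \<in> mod_hom R (free_module R (B 0)) M" "aug ` FB (B 0) = carrier M"
    "u \<in> FB (B 0) \<Longrightarrow> aug u = \<zero>\<^bsub>M\<^esub> \<longleftrightarrow> (\<exists>w\<in>FB (B 1). d w = u)"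
  using assms by (auto simp: dg_res_def)

end

text \<open>As in \<open>res_gen\<close>, a cycle that is to be killed is encoded by the graph of its restriction to
  its support, so that the generators of all degrees fit into one type.\<close>

datatype ('s, 'm) kgen = Gen 'm | Kill "((('s, 'm) kgen \<times> nat set) \<times> 's) fset"

definition kill_code :: "('s, 'z) ring_scheme \<Rightarrow> (('s, 'm) kgen \<times> nat set \<Rightarrow> 's) \<Rightarrow> ('s, 'm) kgen" where
  "kill_code S z = Kill (Abs_fset {(b, z b) | b. z b \<noteq> \<zero>\<^bsub>S\<^esub>})"

lemma kill_code_inj:
  fixes z w :: "('s, 'm) kgen \<times> nat set \<Rightarrow> 's"
  assumes "finite {x. z x \<noteq> \<zero>\<^bsub>S\<^esub>}" "finite {x. w x \<noteq> \<zero>\<^bsub>S\<^esub>}" "kill_code S z = kill_code S w"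
  shows "z = w"
proof
  fix x
  let ?g = "\<lambda>z. (\<lambda>x. (x, z x)) ` {x. z x \<noteq> \<zero>\<^bsub>S\<^esub>}"
  have g: "kill_code S z = Kill (Abs_fset (?g z))" for z :: "('s, 'm) kgen \<times> nat set \<Rightarrow> 's"
    by (simp only: kill_code_def setcompr_eq_image)
  have eq: "?g z = ?g w" using assms by (simp add: g Abs_fset_inject)
  have "fst ` ?g z = fst ` ?g w" by (simp only: eq)
  then have "{x. z x \<noteq> \<zero>\<^bsub>S\<^esub>} = {x. w x \<noteq> \<zero>\<^bsub>S\<^esub>}" by (simp only: image_image fst_conv image_ident)
  then have zw: "z x = \<zero>\<^bsub>S\<^esub> \<longleftrightarrow> w x = \<zero>\<^bsub>S\<^esub>" by blast
  show "z x = w x"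
  proof (cases "z x = \<zero>\<^bsub>S\<^esub>")
    case True
    then show ?thesis using zw by simp
  next
    case False
    then have "(x, z x) \<in> ?g w" unfolding eq[symmetric] by blast
    then show ?thesis by blast
  qed
qed

section \<open>Construction of a semifree resolution by killing cycles\<close>

context cring
begin

text \<open>The prescribed boundary of a generator: a \<open>Kill\<close> generator is decoded to
  the chain it stands for, anything else gets zero. The differential is thus fixed on all
  conceivable generators at once, before \<open>kdeg\<close> selects those of the resolution. This
  avoids a simultaneous recursion over generators and differential.\<close>

definition kill_target :: "nat set \<Rightarrow> ('a, 'm) kgen \<Rightarrow> ('a, 'm) kgen \<times> nat set \<Rightarrow> 'a" where
  "kill_target E x = (if \<exists>z\<in>carrier (FU E). x = kill_code R z
     then SOME z. z \<in> carrier (FU E) \<and> x = kill_code R z else (\<lambda>_. \<zero>))"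

text \<open>The index set is ignored because only the empty one occurs in degree 0, where the
  augmentation matters.\<close>

definition kill_aug ::
  "('a, 'm) module \<Rightarrow> (('a, 'm) kgen \<times> nat set \<Rightarrow> 'a) \<Rightarrow> 'm" where
  "kill_aug M = lin_ext R M (\<lambda>(x, J). case x of Gen m \<Rightarrow> if m \<in> carrier M then m else \<zero>\<^bsub>M\<^esub> | _ \<Rightarrow> \<zero>\<^bsub>M\<^esub>)"

text \<open>Every cycle of degree k, in degree 0 every element of the kernel of the augmentation,
  receives a generator of degree k + 1. No attempt at minimality is made. The generators in the
  support of \<open>z\<close> have degree at most k, so those of higher degree rest on those of
  lower degree.\<close>

inductive kdeg :: "nat set \<Rightarrow> (nat \<Rightarrow> 'a) \<Rightarrow> ('a, 'm) module \<Rightarrow> nat \<Rightarrow> ('a, 'm) kgen \<Rightarrow> bool"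
  for E c and M :: "('a, 'm) module" where
  Gen: "m \<in> carrier M \<Longrightarrow> kdeg E c M 0 (Gen m)"
| Kill: "z \<in> carrier (FU E) \<Longrightarrow>
    \<forall>x J. z (x, J) \<noteq> \<zero> \<longrightarrow> (\<exists>i. kdeg E c M i x \<and> i + card J = k) \<Longrightarrow>
    koszul_diff E c (kill_target E) z = (\<lambda>_. \<zero>) \<Longrightarrow> (k = 0 \<Longrightarrow> kill_aug M z = \<zero>\<^bsub>M\<^esub>) \<Longrightarrow>
    kdeg E c M (Suc k) (kill_code R z)"

lemma kill_target_closed:
  fixes x :: "('a, 'm) kgen"
  shows "kill_target E x \<in> carrier (FU E)"
proof (cases "\<exists>z\<in>carrier (FU E). x = kill_code R z")
  case True
  then have "\<exists>z. z \<in> carrier (FU E) \<and> x = kill_code R z" by blast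
  from someI_ex[OF this] True show ?thesis by (simp add: kill_target_def)
next
  case False
  interpret F: module R "FU E :: ('a, ('a, 'm) kgen \<times> nat set \<Rightarrow> 'a) module" by (rule FU_module)
  from False F.M.zero_closed show ?thesis by (simp add: kill_target_def)
qed

lemma kill_target_code: "z \<in> carrier (FU E) \<Longrightarrow> kill_target E (kill_code R z) = z"
proof -
  assume z: "z \<in> carrier (FU E)"
  let ?w = "SOME w. w \<in> carrier (FU E) \<and> kill_code R z = kill_code R w"
  have w: "?w \<in> carrier (FU E) \<and> kill_code R z = kill_code R ?w"
    by (rule someI[of _ z]) (use z in simp)
  have "finite {b. z b \<noteq> \<zero>}" "finite {b. ?w b \<noteq> \<zero>}" using z w by (simp_all add: free_module_carrier)
  then have "z = ?w" using w by (intro kill_code_inj[of _ R]) blast+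
  then show ?thesis using z by (auto simp: kill_target_def)
qed

lemma kill_target_Gen: "kill_target E (Gen m) = (\<lambda>_. \<zero>)"
  by (auto simp: kill_target_def kill_code_def)

context
  fixes E :: "nat set" and c :: "nat \<Rightarrow> 'a" and M :: "('a, 'm) module"
  assumes E: "finite E" and c: "\<And>t. t \<in> E \<Longrightarrow> c t \<in> carrier R"
    and M: "module R M" and cM: "\<And>t m. t \<in> E \<Longrightarrow> m \<in> carrier M \<Longrightarrow> c t \<odot>\<^bsub>M\<^esub> m = \<zero>\<^bsub>M\<^esub>"
begin

private abbreviation (input) "dr \<equiv> koszul_diff E c (kill_target E) :: (('a, 'm) kgen \<times> nat set \<Rightarrow> 'a) \<Rightarrow> _"
private abbreviation (input) "er x J \<equiv> basis_elt R (x :: ('a, 'm) kgen, J)"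

private definition "B k = {(x, J). J \<subseteq> E \<and> (\<exists>i. kdeg E c M i x \<and> int i + int (card J) = k)}" for k

interpretation M: module R M by (rule M)
interpretation F: module R "FU E :: ('a, ('a, 'm) kgen \<times> nat set \<Rightarrow> 'a) module" by (rule FU_module)

private lemma B: "graded_basis E B"
  unfolding graded_basis_def B_def by auto

private lemmas iff = FB_iff[OF B]
private lemma dhom: "dr \<in> mod_hom R (FU E) (FU E)"
  by (rule koszul_diff_hom[OF E _ kill_target_closed]) (rule c)

private lemma dext:
  "t \<in> E \<Longrightarrow> u \<in> carrier (FU E) \<Longrightarrow> dr (ext t u) \<oplus>\<^bsub>FU E\<^esub> ext t (dr u) = c t \<odot>\<^bsub>FU E\<^esub> u"
  by (rule koszul_diff_ext[OF E _ kill_target_closed]) (rule c)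

private lemma dbasis: "J \<subseteq> E \<Longrightarrow> dr (er x J) = semifree_diff c (kill_target E) x (sorted_list_of_set J)"
  by (rule koszul_diff_basis[OF E _ kill_target_closed]) (rule c)

private lemma dempty: "dr (er x {}) = kill_target E x"
  by (rule koszul_diff_empty[OF E _ kill_target_closed]) (rule c)

private lemma target_FB: "kdeg E c M i x \<Longrightarrow> kill_target E x \<in> FB (B (int i - 1))"
proof (induction rule: kdeg.cases)
  case (Gen m)
  then show ?case using F.M.zero_closed by (simp add: iff kill_target_Gen)
next
  case (Kill z k)
  have "(y, J) \<in> B (int k)" if nz: "z (y, J) \<noteq> \<zero>" for y J
  proof -
    have "J \<subseteq> E" using FU_support[OF Kill(3), of J y] nz by blast
    moreover obtain j where "kdeg E c M j y" "j + card J = k" using Kill(4) nz by blast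
    ultimately show ?thesis by (auto simp: B_def)
  qed
  then have "z \<in> FB (B (int k))" using Kill(3) by (auto simp: iff)
  then show ?case using Kill(1,2) by (simp add: kill_target_code[OF Kill(3)])
qed

private lemma basis_FB: "kdeg E c M i x \<Longrightarrow> J \<subseteq> E \<Longrightarrow> er x J \<in> FB (B (int i + int (card J)))"
  by (rule basis_elt_closed[OF cring_axioms]) (auto simp: B_def)

private lemma semifree_diff_FB:
  "kdeg E c M i x \<Longrightarrow> distinct ts \<Longrightarrow> set ts \<subseteq> E \<Longrightarrow>
    semifree_diff c (kill_target E) x ts \<in> FB (B (int i + int (length ts) - 1))"
proof (induction ts)
  case Nil
  then show ?case using target_FB by simp
next
  case (Cons t ts)
  note sub = F.submoduleE[OF FB_submodule[OF B]]
  let ?w = "semifree_diff c (kill_target E) x ts"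
  have t: "t \<in> E" using Cons.prems by simp
  have v: "ext t ?w \<in> FB (B (int i + int (length ts)))"
    using ext_FB[OF B E t Cons.IH] Cons.prems by simp
  have "er x (set ts) \<in> FB (B (int i + int (length ts)))"
    using basis_FB[OF Cons.prems(1), of "set ts"] Cons.prems by (simp add: distinct_card)
  then have "c t \<odot>\<^bsub>FU E\<^esub> er x (set ts) \<ominus>\<^bsub>FU E\<^esub> ext t ?w \<in> FB (B (int i + int (length ts)))"
    unfolding a_minus_def using v sub(3-5) c[OF t] by blast
  moreover have "ext t ?w \<in> carrier (FU E)" using v by (simp add: iff)
  ultimately show ?case by (simp add: FU_diff)
qed

private lemma d_FB:
  assumes "u \<in> FB (B k)" shows "dr u \<in> FB (B (k - 1))"
proof (rule FB_hom_into[OF B dhom _ assms])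
  fix x J assume "(x, J) \<in> B k"
  then obtain i where J: "J \<subseteq> E" "kdeg E c M i x" "int i + int (card J) = k" by (auto simp: B_def)
  have "finite J" using J(1) E by (rule finite_subset)
  then show "dr (er x J) \<in> FB (B (k - 1))"
    using semifree_diff_FB[OF J(2), of "sorted_list_of_set J"] J
    by (simp add: dbasis[OF J(1)])
qed

private lemma d_kdeg: "kdeg E c M i x \<Longrightarrow> dr (kill_target E x) = (\<lambda>_. \<zero>)"
proof (induction rule: kdeg.cases)
  case (Gen m)
  then show ?case using mod_hom_zero[OF F.module_axioms F.module_axioms dhom]
    by (simp add: kill_target_Gen)
next
  case (Kill z k)
  then show ?case by (simp add: kill_target_code)
qed

text \<open>From d e_t = c_t - e_t d the terms with c_t cancel in d d e_t. Hence the square of the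
  differential commutes with the exterior variables, and it vanishes once it vanishes on
  generators.\<close>

private lemma dd_ext:
  assumes t: "t \<in> E" and v: "v \<in> carrier (FU E)"
  shows "dr (dr (ext t v)) = ext t (dr (dr v))"
proof -
  note dc = mod_hom_closed[OF dhom] and ec = mod_hom_closed[OF ext_hom[OF t]]
  have cv: "c t \<odot>\<^bsub>FU E\<^esub> w \<in> carrier (FU E)" if "w \<in> carrier (FU E)" for w :: "('a, 'm) kgen \<times> nat set \<Rightarrow> 'a"
    by (rule F.smult_closed[OF c[OF t] that])
  have 1: "dr (ext t w) = c t \<odot>\<^bsub>FU E\<^esub> w \<ominus>\<^bsub>FU E\<^esub> ext t (dr w)" if w: "w \<in> carrier (FU E)" for w
    unfolding dext[OF t w, symmetric] a_minus_def using dc[OF ec[OF w]] ec[OF dc[OF w]]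
    by (simp only: F.M.a_assoc F.M.r_neg F.M.r_zero F.M.a_inv_closed)
  have "dr (dr (ext t v)) = dr (c t \<odot>\<^bsub>FU E\<^esub> v) \<ominus>\<^bsub>FU E\<^esub> dr (ext t (dr v))"
    unfolding 1[OF v] by (rule mod_hom_diff[OF F.module_axioms F.module_axioms dhom cv[OF v] ec[OF dc[OF v]]])
  also have "\<dots> = c t \<odot>\<^bsub>FU E\<^esub> dr v \<ominus>\<^bsub>FU E\<^esub> (c t \<odot>\<^bsub>FU E\<^esub> dr v \<ominus>\<^bsub>FU E\<^esub> ext t (dr (dr v)))"
    unfolding 1[OF dc[OF v]] mod_hom_smult[OF dhom c[OF t] v] ..
  also have "\<dots> = ext t (dr (dr v))"
    using cv[OF dc[OF v]] ec[OF dc[OF dc[OF v]]]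
    by (simp only: a_minus_def F.M.minus_add F.M.minus_minus F.M.a_inv_closed F.M.r_neg2)
  finally show ?thesis .
qed

text \<open>On generators it holds because only cycles are killed; e_J x is reached from x by
  exterior multiplications, up to sign.\<close>

private lemma dd:
  assumes "u \<in> FB (B k)" shows "dr (dr u) = (\<lambda>_. \<zero>)"
proof -
  have basis: "dr (dr (er x J)) = (\<lambda>_. \<zero>)" if "finite J" "J \<subseteq> E" "kdeg E c M i x" for x J i
    using that
  proof (induction J)
    case empty
    then show ?case using d_kdeg by (simp add: dempty)
  next
    case (insert t K)
    have t: "t \<in> E" and K: "er x K \<in> carrier (FU E)"
      using insert.prems basis_elt_closed[OF cring_axioms, of "(x, K)" "UNIV \<times> Pow E"] by auto
    have i: "er x (insert t K) \<in> carrier (FU E)" by (rule basis_elt_closed[OF cring_axioms]) (use insert.prems(1) in simp)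
    have "ext t (er x K) = signed (FU E) (pos K t) (er x (insert t K))"
      using ext_basis_elt(2)[OF insert.hyps(2), of x] i by (auto simp: signed_def FU_minus)
    then have "er x (insert t K) = signed (FU E) (pos K t) (ext t (er x K))"
      using i signed_signed[OF F.M.abelian_group_axioms i, of "pos K t" "pos K t"] by (simp add: signed_def)
    then have "dr (dr (er x (insert t K))) = signed (FU E) (pos K t) (dr (dr (ext t (er x K))))"
      using signed_mod_hom[OF F.module_axioms F.module_axioms mod_hom_comp[OF dhom dhom]
          mod_hom_closed[OF ext_hom[OF t] K]] by simp
    also have "dr (dr (ext t (er x K))) = (\<lambda>_. \<zero>)"
      using dd_ext[OF t K] insert mod_hom_zero[OF F.module_axioms F.module_axioms ext_hom[OF t]] by simp
    moreover have "(\<lambda>_. \<zero>) \<in> carrier (FU E :: ('a, ('a, 'm) kgen \<times> nat set \<Rightarrow> 'a) module)"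
      using F.M.zero_closed by simp
    ultimately show ?case by (simp add: signed_def FU_minus)
  qed
  have "(\<lambda>u. dr (dr u)) u = (\<lambda>(u :: ('a, 'm) kgen \<times> nat set \<Rightarrow> 'a) (_ :: ('a, 'm) kgen \<times> nat set). \<zero>) u"
  proof (rule free_module_hom_eq[OF F.module_axioms FB_hom[OF B mod_hom_comp[OF dhom dhom]] _ _ assms])
    show "(\<lambda>(u :: ('a, 'm) kgen \<times> nat set \<Rightarrow> 'a) (_ :: ('a, 'm) kgen \<times> nat set). \<zero>)
        \<in> mod_hom R (free_module R (B k)) (FU E)"
      using mod_hom_zero_map[OF F.module_axioms] by simp
    fix b assume "b \<in> B k"
    then show "dr (dr (basis_elt R b)) = (\<lambda>_. \<zero>)"
      using basis finite_subset[OF _ E] by (auto simp: B_def)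
  qed
  then show ?thesis .
qed

private lemma kill_aug_coeff:
  "(\<lambda>(x, J). case x of Gen m \<Rightarrow> if m \<in> carrier M then m else \<zero>\<^bsub>M\<^esub> | _ \<Rightarrow> \<zero>\<^bsub>M\<^esub>) \<in> X \<rightarrow> carrier M"
  by (auto split: kgen.split)

private lemma aug_hom: "kill_aug M \<in> mod_hom R (FU E) M"
  unfolding kill_aug_def by (rule lin_ext_hom[OF M kill_aug_coeff])

private lemma aug_Gen: "m \<in> carrier M \<Longrightarrow> kill_aug M (er (Gen m) {}) = m"
  unfolding kill_aug_def
  using lin_ext_basis_elt[OF M kill_aug_coeff, of "(Gen m, {})" "UNIV \<times> Pow E"] by simp

text \<open>The generator that encodes \<open>z\<close> has boundary \<open>z\<close>.\<close>

private lemma killed: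
  assumes z: "z \<in> FB (B (int k))" "dr z = (\<lambda>_. \<zero>)" "k = 0 \<Longrightarrow> kill_aug M z = \<zero>\<^bsub>M\<^esub>"
  shows "\<exists>w\<in>FB (B (int k + 1)). dr w = z"
proof
  have zF: "z \<in> carrier (FU E)" using z(1) by (simp add: iff)
  have "\<forall>x J. z (x, J) \<noteq> \<zero> \<longrightarrow> (\<exists>i. kdeg E c M i x \<and> i + card J = k)"
  proof (intro allI impI)
    fix x J assume "z (x, J) \<noteq> \<zero>"
    then have "(x, J) \<in> B (int k)" using z(1) by (simp add: iff)
    then show "\<exists>i. kdeg E c M i x \<and> i + card J = k" by (auto simp: B_def)
  qed
  from kdeg.Kill[OF zF this z(2,3)] have "kdeg E c M (Suc k) (kill_code R z)" .
  from basis_FB[OF this, of "{}"] show "er (kill_code R z) {} \<in> FB (B (int k + 1))" by (simp add: add.commute)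
  show "dr (er (kill_code R z) {}) = z"
    by (simp add: dempty kill_target_code[OF zF])
qed

text \<open>There are two kinds of basis elements of degree 1. One is e_t times a generator of
  degree 0, with boundary c_t times that generator, and here it enters that c_t annihilates
  \<open>M\<close>. The other is a generator that kills an element of the kernel of the
  augmentation.\<close>

private lemma aug_d:
  assumes "w \<in> FB (B 1)"
  shows "kill_aug M (dr w) = \<zero>\<^bsub>M\<^esub>"
proof (rule free_module_hom_eq[OF M FB_hom[OF B mod_hom_comp[OF dhom aug_hom]] mod_hom_zero_map[OF M] _ assms])
  fix b assume "b \<in> B 1"
  then obtain x J i where b: "b = (x, J)" "J \<subseteq> E" "kdeg E c M i x" "int i + int (card J) = 1"
    by (auto simp: B_def)
  have fJ: "finite J" using b(2) E by (rule finite_subset)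
  show "kill_aug M (dr (basis_elt R b)) = \<zero>\<^bsub>M\<^esub>"
  proof (cases i)
    case 0
    then have "card J = 1" using b(4) by simp
    then obtain t where J: "J = {t}" by (auto simp: card_1_singleton_iff)
    have t: "t \<in> E" using b(2) J by simp
    obtain m where m: "x = Gen m" "m \<in> carrier M" using b(3) 0 by (auto elim: kdeg.cases)
    have m0: "er (Gen m) {} \<in> carrier (FU E)" by (rule basis_elt_closed[OF cring_axioms]) simp
    have z: "ext t (\<lambda>_. \<zero>) = (\<lambda>_. \<zero>)" by (auto simp: ext_def)
    have "dr (basis_elt R b) = c t \<odot>\<^bsub>FU E\<^esub> er (Gen m) {}"
      using FU_coeff[OF m0] c[OF t] b(2)
      by (simp add: b(1) J dbasis m(1) kill_target_Gen z a_minus_def)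
    then show ?thesis
      using mod_hom_smult[OF aug_hom c[OF t] m0] aug_Gen[OF m(2)] cM[OF t m(2)] by simp
  next
    case (Suc k)
    then have "k = 0" "card J = 0" using b(4) by simp_all
    then have "k = 0" "J = {}" using fJ by simp_all
    moreover obtain z where "x = kill_code R z" "z \<in> carrier (FU E)" "k = 0 \<Longrightarrow> kill_aug M z = \<zero>\<^bsub>M\<^esub>"
      using b(3) Suc by (auto elim: kdeg.cases)
    ultimately show ?thesis
      by (simp add: b(1) dempty kill_target_code)
  qed
qed

lemma ex_dg_res:
  "\<exists>(B :: int \<Rightarrow> (('a, 'm) kgen \<times> nat set) set) aug d. dg_res E B M aug c d"
proof (intro exI)
  show "dg_res E B M (kill_aug M) c dr"
    unfolding dg_res_def
  proof (intro conjI allI ballI impI)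
    show "graded_basis E B" by (rule B)
    show "dr \<in> mod_hom R (FU E) (FU E)" by (rule dhom)
    show "dr u \<in> FB (B (k - 1))" if "u \<in> FB (B k)" for u k using d_FB[OF that] .
    show "dr (dr u) = (\<lambda>_. \<zero>)" if "u \<in> FB (B k)" for u k using dd[OF that] .
    show "dr (ext t u) \<oplus>\<^bsub>FU E\<^esub> ext t (dr u) = c t \<odot>\<^bsub>FU E\<^esub> u" if "t \<in> E" "u \<in> carrier (FU E)" for t u
      using dext[OF that] .
    show "\<exists>w\<in>FB (B (k + 1)). dr w = u" if "k > 0" "u \<in> FB (B k)" "dr u = (\<lambda>_. \<zero>)" for k u
      using killed[of u "nat k"] that by simp
    show "kill_aug M \<in> mod_hom R (free_module R (B 0)) M" by (rule FB_hom[OF B aug_hom])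
    show "kill_aug M ` FB (B 0) = carrier M"
    proof
      show "kill_aug M ` FB (B 0) \<subseteq> carrier M" using mod_hom_closed[OF aug_hom] by (auto simp: iff)
      have "m \<in> kill_aug M ` FB (B 0)" if m: "m \<in> carrier M" for m
        using aug_Gen[OF m] basis_FB[OF kdeg.Gen[OF m], of "{}"] by (auto intro: rev_image_eqI)
      then show "carrier M \<subseteq> kill_aug M ` FB (B 0)" by blast
    qed
    show "kill_aug M u = \<zero>\<^bsub>M\<^esub> \<longleftrightarrow> (\<exists>w\<in>FB (B 1). dr w = u)" if u: "u \<in> FB (B 0)" for u
    proof
      assume "kill_aug M u = \<zero>\<^bsub>M\<^esub>"
      \<comment> \<open>Degree -1 has no basis elements, so every element of degree 0 is a
        cycle.\<close>
      moreover have "dr u = (\<lambda>_. \<zero>)"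
        using d_FB[OF u] graded_basisD(1)[OF B, of "-1"] by (auto simp: free_module_carrier)
      ultimately show "\<exists>w\<in>FB (B 1). dr w = u" using killed[of u 0] u by simp
    qed (use aug_d in blast)
  qed
qed

end

end

section \<open>Changing the Koszul structure\<close>

text \<open>The differential is conjugated with the automorphism \<open>1 + a e\<^sub>t \<iota>\<^sub>i\<close>, which carries
  multiplication by \<open>e\<^sub>i\<close> to multiplication by \<open>e\<^sub>i + a e\<^sub>t\<close>.\<close>

context cring
begin

lemma dg_res_elementary_change:
  fixes B :: "int \<Rightarrow> ('x \<times> nat set) set"
  assumes res: "dg_res E B M aug c d" and E: "finite E" and M: "module R M"
    and i: "i \<in> E" and t: "t \<in> E" and it: "i \<noteq> t" and a: "a \<in> carrier R"
    and c: "\<And>s. s \<in> E \<Longrightarrow> c s \<in> carrier R"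
  shows "\<exists>d'. dg_res E B M aug (c(i := c i \<oplus> a \<otimes> c t)) d' \<and>
    (\<forall>I. ideal I R \<longrightarrow> a \<in> I \<longrightarrow> (\<forall>u\<in>carrier (FU E). \<forall>b. d' u b \<ominus> d u b \<in> I))"
proof -
  note D = dg_resD[OF res]
  note B = D(1)
  interpret F: module R "FU E :: ('a, 'x \<times> nat set \<Rightarrow> 'a) module" by (rule FU_module)
  let ?F = "FU E :: ('a, 'x \<times> nat set \<Rightarrow> 'a) module"
  note m = F.module_axioms
  note eh = ext_hom and dh = D(2)
  note ec = mod_hom_closed[OF ext_hom] and dc = mod_hom_closed[OF D(2)]
  \<comment> \<open>This operator has square zero because i and t are distinct, which makes 1 + a
    \<epsilon> invertible with inverse 1 - a \<epsilon>. It preserves degrees.\<close>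
  define \<epsilon> where "\<epsilon> u = ext t (contr i u)" for u :: "'x \<times> nat set \<Rightarrow> 'a"
  have \<epsilon>h: "\<epsilon> \<in> mod_hom R ?F ?F"
    unfolding \<epsilon>_def[abs_def] by (rule mod_hom_comp[OF contr_hom ext_hom[OF t]])
  note \<epsilon>c = mod_hom_closed[OF \<epsilon>h]
  have \<epsilon>B: "\<epsilon> u \<in> FB (B k)" if "u \<in> FB (B k)" for u k
    using ext_FB[OF B E t contr_FB[OF B E that]] by (simp add: \<epsilon>_def)
  have FBsub: "FB (B k) \<subseteq> carrier ?F" for k using FB_iff[OF B] by blast
  have zc: "(\<lambda>_. \<zero>) \<in> carrier ?F" using F.M.zero_closed by simp
  have ez: "ext s (\<lambda>_. \<zero>) = (\<lambda>_. \<zero>)" for s by (auto simp: ext_def)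
  have \<epsilon>\<epsilon>: "\<epsilon> (\<epsilon> u) = (\<lambda>_. \<zero>)" if u: "u \<in> carrier ?F" for u
  proof -
    have v: "contr i u \<in> carrier ?F" by (rule mod_hom_closed[OF contr_hom u])
    have "contr i (ext t (contr i u)) = (\<lambda>b. \<ominus> ext t (contr i (contr i u)) b)"
      by (rule ext_contr(2)[OF v it])
    then show ?thesis by (simp add: \<epsilon>_def contr_contr[OF u] ez)
  qed
  \<comment> \<open>Contraction lowers the degree by one, hence kills degree 0. This keeps the
    augmentation unchanged by the conjugation.\<close>
  have \<epsilon>z: "\<epsilon> u = (\<lambda>_. \<zero>)" if u: "u \<in> FB (B 0)" for u
  proof -
    have "contr i u \<in> FB (B (-1))" using contr_FB[OF B E u, of i] by simp
    then have "contr i u = (\<lambda>_. \<zero>)" using graded_basisD(1)[OF B, of "-1"] by (auto simp: free_module_carrier)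
    then show ?thesis by (simp add: \<epsilon>_def ez)
  qed
  define \<Phi> where "\<Phi> u = u \<oplus>\<^bsub>?F\<^esub> a \<odot>\<^bsub>?F\<^esub> \<epsilon> u" for u
  define \<Psi> where "\<Psi> u = u \<ominus>\<^bsub>?F\<^esub> a \<odot>\<^bsub>?F\<^esub> \<epsilon> u" for u
  have \<Phi>h: "\<Phi> \<in> mod_hom R ?F ?F"
    unfolding \<Phi>_def[abs_def] by (rule mod_hom_sum[OF m mod_hom_id mod_hom_scale[OF m \<epsilon>h a]])
  have \<Psi>h: "\<Psi> \<in> mod_hom R ?F ?F"
    unfolding \<Psi>_def[abs_def] by (rule mod_hom_minusf[OF m mod_hom_id mod_hom_scale[OF m \<epsilon>h a]])
  note \<Phi>c = mod_hom_closed[OF \<Phi>h] and \<Psi>c = mod_hom_closed[OF \<Psi>h]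
  have ac: "a \<odot>\<^bsub>?F\<^esub> u \<in> carrier ?F" if "u \<in> carrier ?F" for u by (rule F.smult_closed[OF a that])
  have \<epsilon>a: "\<epsilon> (a \<odot>\<^bsub>?F\<^esub> \<epsilon> u) = \<zero>\<^bsub>?F\<^esub>" if u: "u \<in> carrier ?F" for u
    using mod_hom_smult[OF \<epsilon>h a \<epsilon>c[OF u]] \<epsilon>\<epsilon>[OF u] a by simp
  have \<Phi>\<Psi>: "\<Phi> (\<Psi> u) = u" if u: "u \<in> carrier ?F" for u
  proof -
    have "\<epsilon> (\<Psi> u) = \<epsilon> u"
      unfolding \<Psi>_def mod_hom_diff[OF m m \<epsilon>h u ac[OF \<epsilon>c[OF u]]] \<epsilon>a[OF u]
      by (rule F.M.minus_zero_right[OF \<epsilon>c[OF u]])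
    then show ?thesis using u ac[OF \<epsilon>c[OF u]]
      by (simp only: \<Phi>_def \<Psi>_def a_minus_def F.M.a_assoc F.M.l_neg F.M.r_zero F.M.a_inv_closed)
  qed
  have \<Psi>\<Phi>: "\<Psi> (\<Phi> u) = u" if u: "u \<in> carrier ?F" for u
  proof -
    have "\<epsilon> (\<Phi> u) = \<epsilon> u"
      unfolding \<Phi>_def mod_hom_add[OF \<epsilon>h u ac[OF \<epsilon>c[OF u]]] \<epsilon>a[OF u]
      by (rule F.M.r_zero[OF \<epsilon>c[OF u]])
    then show ?thesis using u ac[OF \<epsilon>c[OF u]]
      by (simp only: \<Phi>_def \<Psi>_def a_minus_def F.M.a_assoc F.M.r_neg F.M.r_zero F.M.a_inv_closed)
  qed
  have \<Phi>B: "\<Phi> u \<in> FB (B k)" and \<Psi>B: "\<Psi> u \<in> FB (B k)" if u: "u \<in> FB (B k)" for u k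
  proof -
    note s = F.submoduleE[OF FB_submodule[OF B, of k]]
    show "\<Phi> u \<in> FB (B k)" unfolding \<Phi>_def by (rule s(5)[OF u s(4)[OF a \<epsilon>B[OF u]]])
    show "\<Psi> u \<in> FB (B k)" unfolding \<Psi>_def a_minus_def by (rule s(5)[OF u s(3)[OF s(4)[OF a \<epsilon>B[OF u]]]])
  qed
  have \<Psi>0: "\<Psi> u = u" if u: "u \<in> FB (B 0)" for u
  proof -
    have 1: "a \<odot>\<^bsub>?F\<^esub> \<epsilon> u = \<zero>\<^bsub>?F\<^esub>" using \<epsilon>z[OF u] a by simp
    have "u \<in> carrier ?F" using u FBsub by blast
    then show ?thesis unfolding \<Psi>_def 1 by (rule F.M.minus_zero_right)
  qed
  \<comment> \<open>Multiplication by e_i + a e_t for s = i and by e_s otherwise: the operator to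
    which \<open>ext s\<close> is conjugate.\<close>
  define e' where "e' s u = ext s u \<oplus>\<^bsub>?F\<^esub> (if s = i then a \<odot>\<^bsub>?F\<^esub> ext t u else \<zero>\<^bsub>?F\<^esub>)" for s u
  have e'c: "e' s u \<in> carrier ?F" if "s \<in> E" "u \<in> carrier ?F" for s u
    unfolding e'_def using ec[OF that] ac[OF ec[OF t that(2)]] F.M.zero_closed
    by (cases "s = i") (simp_all only: if_True if_False F.M.a_closed simp_thms)
  have \<Phi>e: "\<Phi> (ext s u) = e' s (\<Phi> u)" if s: "s \<in> E" and u: "u \<in> carrier ?F" for s u
  proof -
    have w: "contr i u \<in> carrier ?F" by (rule mod_hom_closed[OF contr_hom u])
    have e\<Phi>: "ext s (\<Phi> u) = ext s u \<oplus>\<^bsub>?F\<^esub> a \<odot>\<^bsub>?F\<^esub> ext s (\<epsilon> u)"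
      unfolding \<Phi>_def mod_hom_add[OF eh[OF s] u ac[OF \<epsilon>c[OF u]]] mod_hom_smult[OF eh[OF s] a \<epsilon>c[OF u]] ..
    show ?thesis
    proof (cases "s = i")
      case False
      have "\<epsilon> (ext s u) = ext s (\<epsilon> u)"
      proof -
        have "contr i (ext s u) = (\<lambda>b. \<ominus> ext s (contr i u) b)"
          using ext_contr(2)[OF u] False by metis
        also have "\<dots> = \<ominus>\<^bsub>?F\<^esub> ext s (contr i u)" by (rule FU_minus[OF ec[OF s w], symmetric])
        finally have 1: "\<epsilon> (ext s u) = \<ominus>\<^bsub>?F\<^esub> ext t (ext s (contr i u))"
          unfolding \<epsilon>_def using mod_hom_minus[OF m m eh[OF t] ec[OF s w]] by simp
        show ?thesis
        proof (cases "s = t")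
          case True
          then show ?thesis using ext_ext(1)[OF w] 1 FU_minus[OF zc] by (simp add: \<epsilon>_def)
        next
          case False
          have "ext t (ext s (contr i u)) = \<ominus>\<^bsub>?F\<^esub> ext s (ext t (contr i u))"
            using ext_ext(2)[OF w, of t s] False FU_minus[OF ec[OF s ec[OF t w]]] by metis
          then show ?thesis using ec[OF s ec[OF t w]] unfolding 1 by (simp only: \<epsilon>_def F.M.minus_minus)
        qed
      qed
      then show ?thesis
        unfolding e'_def e\<Phi> using False F.M.r_zero F.M.a_closed[OF ec[OF s u] ac[OF ec[OF s \<epsilon>c[OF u]]]]
        by (simp only: \<Phi>_def if_False)
    next
      case True
      have e\<epsilon>: "ext t (\<epsilon> u) = \<zero>\<^bsub>?F\<^esub>" using ext_ext(1)[OF w] by (simp add: \<epsilon>_def)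
      have et\<Phi>: "ext t (\<Phi> u) = ext t u"
        unfolding \<Phi>_def mod_hom_add[OF eh[OF t] u ac[OF \<epsilon>c[OF u]]] mod_hom_smult[OF eh[OF t] a \<epsilon>c[OF u]] e\<epsilon>
        using ec[OF t u] a by (simp only: F.smult_r_null F.M.r_zero)
      have "contr i (ext i u) = u \<ominus>\<^bsub>?F\<^esub> ext i (contr i u)"
      proof -
        have "ext i (contr i u) \<oplus>\<^bsub>?F\<^esub> contr i (ext i u) = u" using ext_contr(1)[OF u, of i] by simp
        then show ?thesis
          using ec[OF i w] mod_hom_closed[OF contr_hom ec[OF i u], of i]
          by (metis F.M.a_comm F.M.add.inv_solve_right' a_minus_def F.M.a_closed F.M.add.m_assoc F.M.r_neg F.M.r_zero F.M.a_inv_closed)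
      qed
      then have "\<epsilon> (ext i u) = ext t u \<ominus>\<^bsub>?F\<^esub> ext t (ext i (contr i u))"
        unfolding \<epsilon>_def using mod_hom_diff[OF m m eh[OF t] u ec[OF i w]] by simp
      also have "ext t (ext i (contr i u)) = \<ominus>\<^bsub>?F\<^esub> ext i (\<epsilon> u)"
        using ext_ext(2)[OF w, of t i] it FU_minus[OF ec[OF i ec[OF t w]]] unfolding \<epsilon>_def by metis
      also have "ext t u \<ominus>\<^bsub>?F\<^esub> \<ominus>\<^bsub>?F\<^esub> ext i (\<epsilon> u) = ext t u \<oplus>\<^bsub>?F\<^esub> ext i (\<epsilon> u)"
        using ec[OF i \<epsilon>c[OF u]] by (simp only: a_minus_def F.M.minus_minus)
      finally have "\<Phi> (ext i u) = ext i u \<oplus>\<^bsub>?F\<^esub> (a \<odot>\<^bsub>?F\<^esub> ext t u \<oplus>\<^bsub>?F\<^esub> a \<odot>\<^bsub>?F\<^esub> ext i (\<epsilon> u))"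
        unfolding \<Phi>_def using F.smult_r_distr[OF a ec[OF t u] ec[OF i \<epsilon>c[OF u]]] by metis
      also have "\<dots> = (ext i u \<oplus>\<^bsub>?F\<^esub> a \<odot>\<^bsub>?F\<^esub> ext i (\<epsilon> u)) \<oplus>\<^bsub>?F\<^esub> a \<odot>\<^bsub>?F\<^esub> ext t u"
        using ec[OF i u] ac[OF ec[OF t u]] ac[OF ec[OF i \<epsilon>c[OF u]]]
        by (simp only: F.M.a_ac F.M.a_closed)
      finally show ?thesis unfolding e'_def et\<Phi> using True e\<Phi> by (simp only: if_True simp_thms)
    qed
  qed
  have \<Psi>e: "\<Psi> (e' s v) = ext s (\<Psi> v)" if s: "s \<in> E" and v: "v \<in> carrier ?F" for s v
    using \<Phi>e[OF s \<Psi>c[OF v]] \<Psi>\<Phi>[OF ec[OF s \<Psi>c[OF v]]] by (simp only: \<Phi>\<Psi>[OF v])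
  let ?c = "c(i := c i \<oplus> a \<otimes> c t)"
  \<comment> \<open>The relation for the old differential and the new variables; e_i + a e_t has
    boundary c_i + a c_t.\<close>
  have de: "d (e' s v) \<oplus>\<^bsub>?F\<^esub> e' s (d v) = ?c s \<odot>\<^bsub>?F\<^esub> v" if s: "s \<in> E" and v: "v \<in> carrier ?F" for s v
  proof (cases "s = i")
    case False
    then show ?thesis
      using D(5)[OF s v] F.M.r_zero[OF ec[OF s v]] F.M.r_zero[OF ec[OF s dc[OF v]]]
      by (simp only: e'_def if_False fun_upd_other not_False_eq_True)
  next
    case True
    let ?p = "d (ext i v)" and ?q = "ext i (d v)" and ?r = "a \<odot>\<^bsub>?F\<^esub> d (ext t v)" and ?s = "a \<odot>\<^bsub>?F\<^esub> ext t (d v)"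
    have cl: "?p \<in> carrier ?F" "?q \<in> carrier ?F" "?r \<in> carrier ?F" "?s \<in> carrier ?F"
      using dc[OF ec[OF i v]] ec[OF i dc[OF v]] ac[OF dc[OF ec[OF t v]]] ac[OF ec[OF t dc[OF v]]] by simp_all
    have "d (e' i v) = ?p \<oplus>\<^bsub>?F\<^esub> ?r"
      unfolding e'_def using mod_hom_add[OF dh ec[OF i v] ac[OF ec[OF t v]]] mod_hom_smult[OF dh a ec[OF t v]]
      by (simp only: if_True simp_thms)
    then have "d (e' i v) \<oplus>\<^bsub>?F\<^esub> e' i (d v) = (?p \<oplus>\<^bsub>?F\<^esub> ?q) \<oplus>\<^bsub>?F\<^esub> (?r \<oplus>\<^bsub>?F\<^esub> ?s)"
      using cl by (simp only: e'_def if_True simp_thms F.M.a_ac F.M.a_closed)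
    also have "?r \<oplus>\<^bsub>?F\<^esub> ?s = a \<odot>\<^bsub>?F\<^esub> (c t \<odot>\<^bsub>?F\<^esub> v)"
      unfolding D(5)[OF t v, symmetric] by (rule F.smult_r_distr[OF a dc[OF ec[OF t v]] ec[OF t dc[OF v]], symmetric])
    also have "?p \<oplus>\<^bsub>?F\<^esub> ?q = c i \<odot>\<^bsub>?F\<^esub> v" by (rule D(5)[OF i v])
    also have "c i \<odot>\<^bsub>?F\<^esub> v \<oplus>\<^bsub>?F\<^esub> a \<odot>\<^bsub>?F\<^esub> (c t \<odot>\<^bsub>?F\<^esub> v) = (c i \<oplus> a \<otimes> c t) \<odot>\<^bsub>?F\<^esub> v"
      using F.smult_l_distr[OF c[OF i] _ v, of "a \<otimes> c t"] F.smult_assoc1[OF a c[OF t] v] a c[OF t] by (simp only: m_closed)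
    finally show ?thesis using True by (simp only: fun_upd_same)
  qed
  define d' where "d' u = \<Psi> (d (\<Phi> u))" for u
  have d'h: "d' \<in> mod_hom R ?F ?F"
    unfolding d'_def[abs_def] by (rule mod_hom_comp[OF mod_hom_comp[OF \<Phi>h dh] \<Psi>h])
  have d\<Phi>B: "d (\<Phi> u) \<in> FB (B (k - 1))" if "u \<in> FB (B k)" for u k using D(3)[OF \<Phi>B[OF that]] .
  have sub: "u \<in> carrier ?F" if "u \<in> FB (B k)" for u k using that FBsub by blast
  have \<Psi>z: "\<Psi> (\<lambda>_. \<zero>) = (\<lambda>_. \<zero>)" using mod_hom_zero[OF m m \<Psi>h] by simp
  have \<Phi>z: "\<Phi> (\<lambda>_. \<zero>) = (\<lambda>_. \<zero>)" using mod_hom_zero[OF m m \<Phi>h] by simp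
  have "dg_res E B M aug ?c d'"
    unfolding dg_res_def
  proof (intro conjI allI ballI impI)
    show "graded_basis E B" by (rule B)
    show "d' \<in> mod_hom R ?F ?F" by (rule d'h)
    show "d' u \<in> FB (B (k - 1))" if "u \<in> FB (B k)" for u k
      unfolding d'_def by (rule \<Psi>B[OF d\<Phi>B[OF that]])
    show "d' (d' u) = (\<lambda>_. \<zero>)" if u: "u \<in> FB (B k)" for u k
      by (simp only: d'_def \<Phi>\<Psi>[OF sub[OF d\<Phi>B[OF u]]] D(4)[OF \<Phi>B[OF u]] \<Psi>z)
    show "d' (ext s u) \<oplus>\<^bsub>?F\<^esub> ext s (d' u) = ?c s \<odot>\<^bsub>?F\<^esub> u" if s: "s \<in> E" and u: "u \<in> carrier ?F" for s u
    proof -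
      have cs: "?c s \<in> carrier R" using c[OF s] c[OF i] c[OF t] a by simp
      have "d' (ext s u) \<oplus>\<^bsub>?F\<^esub> ext s (d' u) = \<Psi> (d (e' s (\<Phi> u))) \<oplus>\<^bsub>?F\<^esub> \<Psi> (e' s (d (\<Phi> u)))"
        by (simp only: d'_def \<Phi>e[OF s u] \<Psi>e[OF s dc[OF \<Phi>c[OF u]]])
      also have "\<dots> = \<Psi> (?c s \<odot>\<^bsub>?F\<^esub> \<Phi> u)"
        unfolding de[OF s \<Phi>c[OF u], symmetric]
        by (rule mod_hom_add[OF \<Psi>h dc[OF e'c[OF s \<Phi>c[OF u]]] e'c[OF s dc[OF \<Phi>c[OF u]]], symmetric])
      also have "\<dots> = ?c s \<odot>\<^bsub>?F\<^esub> u"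
        unfolding mod_hom_smult[OF \<Psi>h cs \<Phi>c[OF u]] \<Psi>\<Phi>[OF u] ..
      finally show ?thesis .
    qed
    show "\<exists>w\<in>FB (B (k + 1)). d' w = u" if k: "k > 0" and u: "u \<in> FB (B k)" and z: "d' u = (\<lambda>_. \<zero>)" for k u
    proof -
      have "d (\<Phi> u) = \<Phi> (d' u)" by (simp only: d'_def \<Phi>\<Psi>[OF sub[OF d\<Phi>B[OF u]]])
      then have "d (\<Phi> u) = (\<lambda>_. \<zero>)" by (simp only: z \<Phi>z)
      from D(6)[OF k \<Phi>B[OF u] this] obtain w where w: "w \<in> FB (B (k + 1))" "d w = \<Phi> u" by blast
      then have "d' (\<Psi> w) = u" by (simp only: d'_def \<Phi>\<Psi>[OF sub[OF w(1)]] \<Psi>\<Phi>[OF sub[OF u]])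
      then show ?thesis using \<Psi>B[OF w(1)] by blast
    qed
    show "aug \<in> mod_hom R (free_module R (B 0)) M" by (rule D(7))
    show "aug ` FB (B 0) = carrier M" by (rule D(8))
    have d'1: "d' w = d (\<Phi> w)" if w: "w \<in> FB (B 1)" for w
      using \<Psi>0[of "d (\<Phi> w)"] d\<Phi>B[OF w] by (simp add: d'_def)
    show "aug u = \<zero>\<^bsub>M\<^esub> \<longleftrightarrow> (\<exists>w\<in>FB (B 1). d' w = u)" if u: "u \<in> FB (B 0)" for u
      unfolding D(9)[OF u]
    proof
      assume "\<exists>w\<in>FB (B 1). d w = u"
      then obtain w where w: "w \<in> FB (B 1)" "d w = u" by blast
      then have "d' (\<Psi> w) = u" using d'1[OF \<Psi>B[OF w(1)]] by (simp only: \<Phi>\<Psi>[OF sub[OF w(1)]])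
      then show "\<exists>w\<in>FB (B 1). d' w = u" using \<Psi>B[OF w(1)] by blast
    next
      assume "\<exists>w\<in>FB (B 1). d' w = u"
      then show "\<exists>w\<in>FB (B 1). d w = u" using d'1 \<Phi>B by metis
    qed
  qed
  \<comment> \<open>Writing \<Phi> = 1 + a \<epsilon> and expanding gives d' - d = a (d \<epsilon> -
    \<epsilon> d \<Phi>), a multiple of \<open>a\<close>.\<close>
  moreover have "d' u b \<ominus> d u b \<in> I" if I: "ideal I R" "a \<in> I" and u: "u \<in> carrier ?F" for I u b
  proof -
    interpret I: ideal I R by (rule I)
    let ?x = "d (\<epsilon> u) b" and ?y = "\<epsilon> (d (\<Phi> u)) b" and ?z = "d u b"
    have cl: "?x \<in> carrier R" "?y \<in> carrier R" "?z \<in> carrier R"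
      using FU_coeff[OF dc[OF \<epsilon>c[OF u]]] FU_coeff[OF \<epsilon>c[OF dc[OF \<Phi>c[OF u]]]] FU_coeff[OF dc[OF u]] by simp_all
    have "d (\<Phi> u) = d u \<oplus>\<^bsub>?F\<^esub> a \<odot>\<^bsub>?F\<^esub> d (\<epsilon> u)"
      unfolding \<Phi>_def mod_hom_add[OF dh u ac[OF \<epsilon>c[OF u]]] mod_hom_smult[OF dh a \<epsilon>c[OF u]] ..
    then have 1: "d (\<Phi> u) b = ?z \<oplus> a \<otimes> ?x" by simp
    have "d' u b = d (\<Phi> u) b \<ominus> a \<otimes> ?y"
      unfolding d'_def \<Psi>_def FU_diff[OF ac[OF \<epsilon>c[OF dc[OF \<Phi>c[OF u]]]]] by simp
    then have "d' u b \<ominus> ?z = a \<otimes> (?x \<ominus> ?y)"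
      using cl a unfolding 1 a_minus_def by (simp add: r_distr r_minus a_ac r_neg1 r_neg2)
    then show ?thesis using I.I_r_closed[OF I(2), of "?x \<ominus> ?y"] cl by simp
  qed
  ultimately show ?thesis by blast
qed

text \<open>\<open>ideal_prod\<close> consists of the finite sums of products and is taken here with
  a mere set of elements as second factor. Each product a c_t is one elementary change, and a sum is
  handled by successive changes.\<close>

lemma dg_res_ideal_change:
  fixes B :: "int \<Rightarrow> ('x \<times> nat set) set"
  assumes E: "finite E" and M: "module R M" and I: "ideal I R" and i: "i \<in> E" and T: "T \<subseteq> E" "i \<notin> T"
    and x: "x \<in> ideal_prod R I (c ` T)"
    and c: "\<And>s. s \<in> E \<Longrightarrow> c s \<in> carrier R" and res: "dg_res E B M aug c d"
  shows "x \<in> carrier R \<and> (\<exists>d'. dg_res E B M aug (c(i := c i \<oplus> x)) d' \<and>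
    (\<forall>u\<in>carrier (FU E). \<forall>b. d' u b \<ominus> d u b \<in> I))"
proof -
  interpret I: ideal I R by (rule I)
  \<comment> \<open>The family and the differential are generalized, since earlier summands have
    already altered both. Only the values on \<open>T\<close> are kept; they survive because
    \<open>i\<close> is not in \<open>T\<close>.\<close>
  have "x \<in> carrier R \<and> (\<forall>c' d. (\<forall>s\<in>T. c' s = c s) \<longrightarrow> (\<forall>s\<in>E. c' s \<in> carrier R) \<longrightarrow> dg_res E B M aug c' d \<longrightarrow>
      (\<exists>d'. dg_res E B M aug (c'(i := c' i \<oplus> x)) d' \<and>
        (\<forall>u\<in>carrier (FU E). \<forall>b. d' u b \<ominus> d u b \<in> I)))"
    using x
  proof (induction x rule: ideal_prod.induct)
    case (prod a b)
    then obtain t where t: "t \<in> T" "b = c t" by blast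
    have tE: "t \<in> E" "i \<noteq> t" using t T by auto
    have a: "a \<in> carrier R" using prod(1) by (rule I.Icarr)
    show ?case
    proof (intro conjI allI impI)
      show "a \<otimes> b \<in> carrier R" using a c[OF tE(1)] t by simp
      fix c' :: "nat \<Rightarrow> 'a" and d
      assume c': "\<forall>s\<in>T. c' s = c s" "\<forall>s\<in>E. c' s \<in> carrier R" and res: "dg_res E B M aug c' d"
      from dg_res_elementary_change[OF res E M i tE a] c' t prod(1) I
      show "\<exists>d'. dg_res E B M aug (c'(i := c' i \<oplus> a \<otimes> b)) d' \<and>
          (\<forall>u\<in>carrier (FU E). \<forall>b. d' u b \<ominus> d u b \<in> I)" by fastforce
    qed
  next
    case (sum x y)
    show ?case
    proof (intro conjI allI impI)
      show "x \<oplus> y \<in> carrier R" using sum by simp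
      fix c' :: "nat \<Rightarrow> 'a" and d
      assume c': "\<forall>s\<in>T. c' s = c s" "\<forall>s\<in>E. c' s \<in> carrier R" and res: "dg_res E B M aug c' d"
      let ?c1 = "c'(i := c' i \<oplus> x)"
      obtain d1 where d1: "dg_res E B M aug ?c1 d1" "\<forall>u\<in>carrier (FU E). \<forall>b. d1 u b \<ominus> d u b \<in> I"
        using sum.IH(1) c' res by blast
      have c1: "\<forall>s\<in>T. ?c1 s = c s" "\<forall>s\<in>E. ?c1 s \<in> carrier R" using c' T sum.IH(1) i by auto
      obtain d2 where d2: "dg_res E B M aug (?c1(i := ?c1 i \<oplus> y)) d2"
        "\<forall>u\<in>carrier (FU E). \<forall>b. d2 u b \<ominus> d1 u b \<in> I"
        using sum.IH(2) c1 d1(1) by blast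
      have "?c1(i := ?c1 i \<oplus> y) = c'(i := c' i \<oplus> (x \<oplus> y))"
        using c' i sum.IH by (simp add: a_assoc)
      moreover have "d2 u b \<ominus> d u b \<in> I" if u: "u \<in> carrier (FU E)" for u b
      proof -
        have cl: "d u b \<in> carrier R" "d1 u b \<in> carrier R" "d2 u b \<in> carrier R"
          using FU_coeff[OF mod_hom_closed[OF dg_resD(2)[OF res] u]]
            FU_coeff[OF mod_hom_closed[OF dg_resD(2)[OF d1(1)] u]]
            FU_coeff[OF mod_hom_closed[OF dg_resD(2)[OF d2(1)] u]] by simp_all
        have "(d2 u b \<ominus> d1 u b) \<oplus> (d1 u b \<ominus> d u b) \<in> I"
          using d1(2) d2(2) u by (intro I.a_closed) blast+
        also have "(d2 u b \<ominus> d1 u b) \<oplus> (d1 u b \<ominus> d u b) = d2 u b \<ominus> d u b"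
          using cl by (simp add: a_minus_def a_assoc r_neg1)
        finally show ?thesis .
      qed
      ultimately show "\<exists>d'. dg_res E B M aug (c'(i := c' i \<oplus> (x \<oplus> y))) d' \<and>
          (\<forall>u\<in>carrier (FU E). \<forall>b. d' u b \<ominus> d u b \<in> I)" using d2(1) by metis
    qed
  qed
  with c res show ?thesis by blast
qed

text \<open>The indices of \<open>D\<close> are treated one after the other. As \<open>T\<close> is
  disjoint from \<open>D\<close>, none of these changes touches the elements c_t that serve to
  express the x_i.\<close>

lemma dg_res_change:
  fixes B :: "int \<Rightarrow> ('x \<times> nat set) set"
  assumes E: "finite E" and M: "module R M" and I: "ideal I R" and D: "D \<subseteq> E" and T: "T \<subseteq> E" "D \<inter> T = {}"
    and x: "\<And>i. i \<in> D \<Longrightarrow> x i \<in> ideal_prod R I (c ` T)"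
    and c: "\<And>s. s \<in> E \<Longrightarrow> c s \<in> carrier R" and res: "dg_res E B M aug c d"
  shows "\<exists>d'. dg_res E B M aug (\<lambda>i. if i \<in> D then c i \<oplus> x i else c i) d' \<and>
    (\<forall>u\<in>carrier (FU E). \<forall>b. d' u b \<ominus> d u b \<in> I)"
proof -
  interpret I: ideal I R by (rule I)
  let ?c = "\<lambda>D i. if i \<in> D then c i \<oplus> x i else c i"
  have "finite D" using D E by (rule finite_subset)
  then show ?thesis
    using D T(2) x
  proof (induction D)
    case empty
    have "d u b \<ominus> d u b \<in> I" if "u \<in> carrier (FU E)" for u b
      using FU_coeff[OF mod_hom_closed[OF dg_resD(2)[OF res] that], of b] minus_eq_zero_iff[of "d u b" "d u b"]
      by simp
    then show ?case using res by auto
  next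
    case (insert i D)
    obtain d1 where d1: "dg_res E B M aug (?c D) d1" "\<forall>u\<in>carrier (FU E). \<forall>b. d1 u b \<ominus> d u b \<in> I"
      using insert.IH insert.prems by auto
    have i: "i \<in> E" "i \<notin> T" using insert.prems by auto
    have xc: "x j \<in> carrier R" if "j \<in> insert i D" for j
      using dg_res_ideal_change[OF E M I _ T(1) _ _ c res, of j "x j"] insert.prems that by blast
    have im: "?c D ` T = c ` T" using insert.prems by (intro image_cong) auto
    have cc: "?c D s \<in> carrier R" if "s \<in> E" for s using xc c that by auto
    obtain d2 where d2: "dg_res E B M aug ((?c D)(i := ?c D i \<oplus> x i)) d2"
      "\<forall>u\<in>carrier (FU E). \<forall>b. d2 u b \<ominus> d1 u b \<in> I"
      using dg_res_ideal_change[OF E M I i(1) T(1) i(2) _ cc d1(1), of "x i"] insert.prems(3)[of i]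
      unfolding im by blast
    have eq: "(?c D)(i := ?c D i \<oplus> x i) = ?c (insert i D)" using insert.hyps by auto
    have "d2 u b \<ominus> d u b \<in> I" if u: "u \<in> carrier (FU E)" for u b
    proof -
      have cl: "d u b \<in> carrier R" "d1 u b \<in> carrier R" "d2 u b \<in> carrier R"
        using FU_coeff[OF mod_hom_closed[OF dg_resD(2)[OF res] u]]
          FU_coeff[OF mod_hom_closed[OF dg_resD(2)[OF d1(1)] u]]
          FU_coeff[OF mod_hom_closed[OF dg_resD(2)[OF d2(1)] u]] by simp_all
      have "(d2 u b \<ominus> d1 u b) \<oplus> (d1 u b \<ominus> d u b) \<in> I"
        using d1(2) d2(2) u by (intro I.a_closed) blast+
      also have "(d2 u b \<ominus> d1 u b) \<oplus> (d1 u b \<ominus> d u b) = d2 u b \<ominus> d u b"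
        using cl by (simp add: a_minus_def a_assoc r_neg1)
      finally show ?thesis .
    qed
    then show ?case using d2(1) unfolding eq by blast
  qed
qed

end

section \<open>Exactness of the Koszul complex\<close>

text \<open>Translates the vanishing of the homology module, given as a quotient of cycles, into the
  existence of preimages.\<close>

lemma koszul_regular_exact:
  fixes R :: "('a, 'b) ring_scheme" (structure)
  assumes R: "cring R" and reg: "koszul_regular R n f" and j: "j \<noteq> 0"
    and v: "v \<in> carrier (free_module R {J. J \<subseteq> {1..n} \<and> int (card J) = j})"
    and z: "cdiff (koszul_complex R n f) j v = (\<lambda>_. \<zero>\<^bsub>R\<^esub>)"
  shows "\<exists>w\<in>carrier (free_module R {J. J \<subseteq> {1..n} \<and> int (card J) = j + 1}).
    v = cdiff (koszul_complex R n f) (j + 1) w"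
proof -
  let ?K = "koszul_complex R n f"
  interpret cring R by (rule R)
  have K: "cmod ?K k = free_module R {J. J \<subseteq> {1..n} \<and> int (card J) = k}" for k
    by (simp add: koszul_complex_def)
  interpret F: module R "cmod ?K j" unfolding K by (rule module_free_module[OF R])
  have vc: "v \<in> cycles ?K j" using v z by (simp add: cycles_iff K)
  have h: "carrier (homology ?K j) = {\<zero>\<^bsub>homology ?K j\<^esub>}"
    using reg j by (simp add: koszul_regular_def)
  have "boundaries ?K j +>\<^bsub>cmod ?K j\<lparr>carrier := cycles ?K j\<rparr>\<^esub> v \<in> carrier (homology ?K j)"
    unfolding homology_def quot_module_carrier using vc by simp
  then have eq: "boundaries ?K j +>\<^bsub>cmod ?K j\<^esub> v = boundaries ?K j"
    unfolding h by (simp add: homology_def quot_module_zero a_r_coset_def')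
  have "cdiff ?K (j + 1) (\<lambda>_. \<zero>) = (\<lambda>_. \<zero>)"
  proof
    fix J
    have f: "f i \<in> carrier R" if "i \<in> {1..n}" for i using reg that by (auto simp: koszul_regular_def)
    have "(\<Oplus>i\<in>{1..n} - J. signed R (int (card {l \<in> J. l < i})) (f i \<otimes> \<zero>)) = (\<Oplus>i\<in>{1..n} - J. \<zero>)"
      using f by (intro finsum_cong') (auto simp: signed_def)
    then show "cdiff ?K (j + 1) (\<lambda>_. \<zero>) J = \<zero>" by (simp add: koszul_complex_def)
  qed
  moreover have "(\<lambda>_. \<zero>) \<in> carrier (cmod ?K (j + 1))"
    unfolding K by (simp add: free_module_carrier)
  ultimately have "(\<lambda>_. \<zero>) \<in> boundaries ?K j" by (force simp: boundaries_iff)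
  then have "\<zero>\<^bsub>cmod ?K j\<^esub> \<oplus>\<^bsub>cmod ?K j\<^esub> v \<in> boundaries ?K j +>\<^bsub>cmod ?K j\<^esub> v"
    unfolding a_r_coset_def' by (auto simp: K)
  moreover have "v \<in> carrier (cmod ?K j)" using v by (simp add: K)
  ultimately have "v \<in> boundaries ?K j" unfolding eq by simp
  then show ?thesis by (auto simp: boundaries_iff K)
qed

text \<open>The values of the first Koszul differential form an ideal that contains the f_i, hence
  contains the ideal they generate.\<close>

lemma koszul_seq_ideal:
  fixes R :: "('a, 'b) ring_scheme" (structure)
  assumes R: "cring R" and f: "f \<in> {1..n} \<rightarrow> carrier R" and a: "a \<in> seq_ideal R n f"
  shows "\<exists>w\<in>carrier (free_module R {J. J \<subseteq> {1..n} \<and> int (card J) = 1}).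
    a = cdiff (koszul_complex R n f) 1 w {}"
proof -
  interpret cring R by (rule R)
  let ?Y = "{J. J \<subseteq> {1..n} \<and> int (card J) = 1}"
  interpret F: module R "free_module R ?Y" by (rule module_free_module[OF R])
  have cd: "cdiff (koszul_complex R n f) 1 w {} = (\<Oplus>i\<in>{1..n}. f i \<otimes> w {i})" for w
    by (simp add: koszul_complex_def signed_def)
  have fc: "f i \<in> carrier R" if "i \<in> {1..n}" for i using f that by auto
  have wc: "w J \<in> carrier R" if "w \<in> carrier (free_module R ?Y)" for w J
    by (rule free_module_coeff[OF R that])
  define A where "A = (\<lambda>w. \<Oplus>i\<in>{1..n}. f i \<otimes> w {i}) ` carrier (free_module R ?Y)"
  have "ideal A R"
  proof (rule idealI[OF ring_axioms])
    have cl: "(\<Oplus>i\<in>{1..n}. f i \<otimes> w {i}) \<in> carrier R" if "w \<in> carrier (free_module R ?Y)" for w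
      using fc wc[OF that] by (intro finsum_closed) auto
    have sub: "A \<subseteq> carrier R" using cl by (auto simp: A_def)
    have sum: "x \<oplus> y \<in> A" if xy: "x \<in> A" "y \<in> A" for x y
    proof -
      from xy obtain u w where u: "u \<in> carrier (free_module R ?Y)" "x = (\<Oplus>i\<in>{1..n}. f i \<otimes> u {i})"
        and w: "w \<in> carrier (free_module R ?Y)" "y = (\<Oplus>i\<in>{1..n}. f i \<otimes> w {i})" by (auto simp: A_def)
      have "(\<Oplus>i\<in>{1..n}. f i \<otimes> (u {i} \<oplus> w {i})) = (\<Oplus>i\<in>{1..n}. f i \<otimes> u {i} \<oplus> f i \<otimes> w {i})"
        using fc wc[OF u(1)] wc[OF w(1)] by (intro finsum_cong') (auto simp: r_distr)
      also have "\<dots> = x \<oplus> y"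
        unfolding u(2) w(2) using fc wc[OF u(1)] wc[OF w(1)] by (intro finsum_addf) auto
      finally have "x \<oplus> y = (\<Oplus>i\<in>{1..n}. f i \<otimes> (u \<oplus>\<^bsub>free_module R ?Y\<^esub> w) {i})" by simp
      then show ?thesis using F.M.a_closed[OF u(1) w(1)] unfolding A_def by (rule image_eqI)
    qed
    have scale: "s \<otimes> x \<in> A" if s: "s \<in> carrier R" and x: "x \<in> A" for s x
    proof -
      from x obtain u where u: "u \<in> carrier (free_module R ?Y)" "x = (\<Oplus>i\<in>{1..n}. f i \<otimes> u {i})"
        by (auto simp: A_def)
      have "(\<Oplus>i\<in>{1..n}. f i \<otimes> (s \<otimes> u {i})) = (\<Oplus>i\<in>{1..n}. s \<otimes> (f i \<otimes> u {i}))"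
        using fc wc[OF u(1)] s by (intro finsum_cong') (auto simp: m_lcomm)
      also have "\<dots> = s \<otimes> x"
        unfolding u(2) using fc wc[OF u(1)] s by (intro finsum_rdistr[symmetric]) auto
      finally have "s \<otimes> x = (\<Oplus>i\<in>{1..n}. f i \<otimes> (s \<odot>\<^bsub>free_module R ?Y\<^esub> u) {i})" by simp
      then show ?thesis using F.smult_closed[OF s u(1)] unfolding A_def by (rule image_eqI)
    qed
    show "subgroup A (add_monoid R)"
    proof (rule add.subgroupI[OF sub])
      show "A \<noteq> {}" using F.M.zero_closed by (auto simp: A_def)
      show "\<ominus> x \<in> A" if "x \<in> A" for x
        using scale[of "\<ominus> \<one>" x] that sub by (auto simp: l_minus subset_iff)
      show "x \<oplus> y \<in> A" if "x \<in> A" "y \<in> A" for x y using sum[OF that] .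
    qed
    show "x \<otimes> b \<in> A" if "b \<in> A" "x \<in> carrier R" for b x using scale[OF that(2,1)] .
    then show "b \<otimes> x \<in> A" if "b \<in> A" "x \<in> carrier R" for b x
      using scale[OF that(2,1)] that sub m_comm[of b x] by auto
  qed
  moreover have "f ` {1..n} \<subseteq> A"
  proof clarify
    fix i assume i: "i \<in> {1..n}"
    have "(\<Oplus>k\<in>{1..n}. f k \<otimes> basis_elt R {i} {k}) = (\<Oplus>k\<in>{1..n}. if i = k then f k else \<zero>)"
      using fc i by (intro finsum_cong') (auto simp: basis_elt_def)
    also have "\<dots> = f i" using fc i by (intro finsum_singleton) auto
    finally have "f i = (\<Oplus>k\<in>{1..n}. f k \<otimes> basis_elt R {i} {k})" by simp
    moreover have "basis_elt R {i} \<in> carrier (free_module R ?Y)"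
      using i by (intro basis_elt_closed[OF R]) simp
    ultimately show "f i \<in> A" by (auto simp: A_def)
  qed
  ultimately have "seq_ideal R n f \<subseteq> A" unfolding seq_ideal_def by (rule genideal_minimal)
  with a show ?thesis unfolding cd A_def by blast
qed

section \<open>Acyclicity of the kernel of the reduction\<close>

text \<open>The kernel of dividing the coefficients by \<open>A\<close> and setting the exterior
  variables of \<open>D\<close> to zero: only the coefficients without an index from
  \<open>D\<close> survive the division, and they have to lie in \<open>A\<close>.\<close>

definition red_kernel :: "nat set \<Rightarrow> 'a set \<Rightarrow> ('x \<times> nat set \<Rightarrow> 'a) set" where
  "red_kernel D A = {u. \<forall>x J. J \<inter> D = {} \<longrightarrow> u (x, J) \<in> A}"

context cring
begin

text \<open>The operator is the sum of the c_t times the contraction at t, for t in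
  \<open>D\<close>. By the commutation rules it satisfies the relation of the differential with e_s
  for s in \<open>D\<close> and anticommutes with the other e_s.\<close>

lemma ex_contraction_sum:
  fixes c :: "nat \<Rightarrow> 'a"
  assumes "finite D" "D \<subseteq> E" "\<And>t. t \<in> E \<Longrightarrow> c t \<in> carrier R"
  shows "\<exists>K. K \<in> mod_hom R (FU E :: ('a, 'x \<times> nat set \<Rightarrow> 'a) module) (FU E) \<and>
    (\<forall>s\<in>E. \<forall>u\<in>carrier (FU E). K (ext s u) \<oplus>\<^bsub>FU E\<^esub> ext s (K u) =
      (if s \<in> D then c s \<odot>\<^bsub>FU E\<^esub> u else \<zero>\<^bsub>FU E\<^esub>)) \<and>
    (\<forall>u\<in>carrier (FU E). \<forall>b. K u b = (\<Oplus>t\<in>D. c t \<otimes> contr t u b))"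
  using assms(1,2)
proof (induction D)
  let ?F = "FU E :: ('a, 'x \<times> nat set \<Rightarrow> 'a) module"
  interpret F: module R ?F by (rule FU_module)
  {
    case empty
    have "(\<lambda>_. \<zero>\<^bsub>?F\<^esub>) \<in> mod_hom R ?F ?F" by (rule mod_hom_zero_map[OF F.module_axioms])
    moreover have "ext s \<zero>\<^bsub>?F\<^esub> = \<zero>\<^bsub>?F\<^esub>" for s by (auto simp: ext_def)
    moreover have "\<zero>\<^bsub>?F\<^esub> \<oplus>\<^bsub>?F\<^esub> \<zero>\<^bsub>?F\<^esub> = \<zero>\<^bsub>?F\<^esub>" by simp
    ultimately show ?case by (intro exI[of _ "\<lambda>_. \<zero>\<^bsub>?F\<^esub>"]) simp
  next
    case (insert t D)
    then obtain K where K: "K \<in> mod_hom R ?F ?F"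
      "\<And>s u. s \<in> E \<Longrightarrow> u \<in> carrier ?F \<Longrightarrow> K (ext s u) \<oplus>\<^bsub>?F\<^esub> ext s (K u) =
        (if s \<in> D then c s \<odot>\<^bsub>?F\<^esub> u else \<zero>\<^bsub>?F\<^esub>)"
      "\<And>u b. u \<in> carrier ?F \<Longrightarrow> K u b = (\<Oplus>t\<in>D. c t \<otimes> contr t u b)" by auto
    have tE: "t \<in> E" and ct: "c t \<in> carrier R" using insert.prems assms(3) by auto
    let ?L = "\<lambda>u. c t \<odot>\<^bsub>?F\<^esub> contr t u"
    have Lh: "?L \<in> mod_hom R ?F ?F" by (rule mod_hom_scale[OF F.module_axioms contr_hom ct])
    have KL: "(\<lambda>u. K u \<oplus>\<^bsub>?F\<^esub> ?L u) \<in> mod_hom R ?F ?F" by (rule mod_hom_sum[OF F.module_axioms K(1) Lh])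
    have "(K (ext s u) \<oplus>\<^bsub>?F\<^esub> ?L (ext s u)) \<oplus>\<^bsub>?F\<^esub> ext s (K u \<oplus>\<^bsub>?F\<^esub> ?L u) =
        (if s \<in> insert t D then c s \<odot>\<^bsub>?F\<^esub> u else \<zero>\<^bsub>?F\<^esub>)" if s: "s \<in> E" and u: "u \<in> carrier ?F" for s u
    proof -
      note e = mod_hom_closed[OF ext_hom[OF s]] and Kc = mod_hom_closed[OF K(1)]
      have c1: "contr t (ext s u) \<in> carrier ?F" "ext s (contr t u) \<in> carrier ?F" "contr t u \<in> carrier ?F"
        using mod_hom_closed[OF contr_hom e[OF u]] mod_hom_closed[OF contr_hom u] e[OF mod_hom_closed[OF contr_hom u]]
        by blast+
      have L: "?L (ext s u) \<oplus>\<^bsub>?F\<^esub> c t \<odot>\<^bsub>?F\<^esub> ext s (contr t u) = (if s = t then c s \<odot>\<^bsub>?F\<^esub> u else \<zero>\<^bsub>?F\<^esub>)"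
      proof -
        have "?L (ext s u) \<oplus>\<^bsub>?F\<^esub> c t \<odot>\<^bsub>?F\<^esub> ext s (contr t u) =
            c t \<odot>\<^bsub>?F\<^esub> (contr t (ext s u) \<oplus>\<^bsub>?F\<^esub> ext s (contr t u))"
          by (rule F.smult_r_distr[OF ct c1(1,2), symmetric])
        moreover have "contr t (ext s u) \<oplus>\<^bsub>?F\<^esub> ext s (contr t u) = (if s = t then u else \<zero>\<^bsub>?F\<^esub>)"
        proof (cases "s = t")
          case True
          have "ext t (contr t u) \<oplus>\<^bsub>?F\<^esub> contr t (ext t u) = u" using ext_contr(1)[OF u, of t] by simp
          then show ?thesis using True F.M.a_comm[OF c1(1,2)] by simp
        next
          case False
          have "contr t (ext s u) = \<ominus>\<^bsub>?F\<^esub> ext s (contr t u)"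
            using ext_contr(2)[OF u, of t s] False FU_minus[OF c1(2)] by metis
          then show ?thesis using False F.M.l_neg[OF c1(2)] by metis
        qed
        ultimately show ?thesis using ct by (cases "s = t") (simp_all only: if_True if_False simp_thms F.smult_r_null)
      qed
      have ex: "ext s (K u \<oplus>\<^bsub>?F\<^esub> ?L u) = ext s (K u) \<oplus>\<^bsub>?F\<^esub> c t \<odot>\<^bsub>?F\<^esub> ext s (contr t u)"
        unfolding mod_hom_add[OF ext_hom[OF s] Kc[OF u] F.smult_closed[OF ct c1(3)]]
          mod_hom_smult[OF ext_hom[OF s] ct c1(3)] ..
      have "(K (ext s u) \<oplus>\<^bsub>?F\<^esub> ?L (ext s u)) \<oplus>\<^bsub>?F\<^esub> ext s (K u \<oplus>\<^bsub>?F\<^esub> ?L u) =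
          (K (ext s u) \<oplus>\<^bsub>?F\<^esub> ext s (K u)) \<oplus>\<^bsub>?F\<^esub> (?L (ext s u) \<oplus>\<^bsub>?F\<^esub> c t \<odot>\<^bsub>?F\<^esub> ext s (contr t u))"
        unfolding ex using Kc[OF e[OF u]] e[OF Kc[OF u]] F.smult_closed[OF ct c1(1)] F.smult_closed[OF ct c1(2)]
        by (simp only: F.M.a_ac F.M.a_closed)
      also have "\<dots> = (if s \<in> insert t D then c s \<odot>\<^bsub>?F\<^esub> u else \<zero>\<^bsub>?F\<^esub>)"
        unfolding K(2)[OF s u] L using insert.hyps(2) F.smult_closed[OF assms(3)[OF s] u] F.M.zero_closed
        by (cases "s = t"; cases "s \<in> D")
          (simp_all only: if_True if_False simp_thms F.M.r_zero F.M.l_zero insert_iff)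
      finally show ?thesis .
    qed
    moreover have "(K u \<oplus>\<^bsub>?F\<^esub> ?L u) b = (\<Oplus>s\<in>insert t D. c s \<otimes> contr s u b)" if u: "u \<in> carrier ?F" for u b
    proof -
      have "c s \<otimes> contr s u b \<in> carrier R" if "s \<in> insert t D" for s
        using insert.prems that by (intro m_closed assms(3) FU_coeff[OF mod_hom_closed[OF contr_hom u]]) blast
      then show ?thesis
        using insert.hyps by (simp add: K(3)[OF u] finsum_insert Pi_iff a_comm)
    qed
    ultimately show ?case using KL by (intro exI[of _ "\<lambda>u. K u \<oplus>\<^bsub>?F\<^esub> ?L u"]) blast
  }
qed

text \<open>An element with coefficients in \<open>A\<close> is a combination of basis elements with
  scalars in \<open>A\<close>, and a linear map retains these scalars.\<close>

lemma mod_hom_coeff_ideal: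
  assumes A: "ideal A R" and h: "h \<in> mod_hom R (free_module R X) (free_module R Y)"
    and u: "u \<in> carrier (free_module R X)" "\<And>b. u b \<in> A"
  shows "h u b \<in> A"
proof -
  interpret A: ideal A R by (rule A)
  interpret X: module R "free_module R X" by (rule module_free_module[OF cring_axioms])
  interpret Y: module R "free_module R Y" by (rule module_free_module[OF cring_axioms])
  have "(\<forall>b. u b \<in> A) \<longrightarrow> (\<forall>b. h u b \<in> A)" if "finite T" "{b. u b \<noteq> \<zero>} \<subseteq> T" "u \<in> carrier (free_module R X)" for T u
    using that
  proof (induction T arbitrary: u)
    case empty
    then have "u = \<zero>\<^bsub>free_module R X\<^esub>" by auto
    then show ?case using mod_hom_zero[OF X.module_axioms Y.module_axioms h] by simp
  next
    case (insert x T)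
    note c = free_module_coeff[OF cring_axioms insert.prems(2)]
    let ?v = "u(x := \<zero>)"
    have "finite {b. ?v b \<noteq> \<zero>}"
      by (rule finite_subset[of _ "{b. u b \<noteq> \<zero>}"]) (use insert.prems(2) in \<open>auto simp: free_module_carrier\<close>)
    then have v: "?v \<in> carrier (free_module R X)"
      using insert.prems(2) by (auto simp: free_module_carrier)
    show ?case
    proof (intro impI allI)
      fix b assume uA: "\<forall>b. u b \<in> A"
      have "{b. ?v b \<noteq> \<zero>} \<subseteq> T" using insert.prems(1) by auto
      then have "(\<forall>b. ?v b \<in> A) \<longrightarrow> (\<forall>b. h ?v b \<in> A)" by (rule insert.IH[OF _ v])
      then have IH: "h ?v b \<in> A" using uA by simp
      show "h u b \<in> A"
      proof (cases "x \<in> X")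
        case True
        have e: "basis_elt R x \<in> carrier (free_module R X)" by (rule basis_elt_closed[OF cring_axioms True])
        have eq: "u = ?v \<oplus>\<^bsub>free_module R X\<^esub> u x \<odot>\<^bsub>free_module R X\<^esub> basis_elt R x"
          using c by (auto simp: basis_elt_def fun_eq_iff)
        have "h (?v \<oplus>\<^bsub>free_module R X\<^esub> u x \<odot>\<^bsub>free_module R X\<^esub> basis_elt R x) = h ?v \<oplus>\<^bsub>free_module R Y\<^esub> u x \<odot>\<^bsub>free_module R Y\<^esub> h (basis_elt R x)"
          unfolding mod_hom_add[OF h v X.smult_closed[OF c e]] mod_hom_smult[OF h c e] ..
        then have "h u = h ?v \<oplus>\<^bsub>free_module R Y\<^esub> u x \<odot>\<^bsub>free_module R Y\<^esub> h (basis_elt R x)"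
          unfolding eq[symmetric] .
        moreover have "u x \<otimes> h (basis_elt R x) b \<in> A"
          using A.I_r_closed uA free_module_coeff[OF cring_axioms mod_hom_closed[OF h e]] by blast
        ultimately show ?thesis using IH by simp
      next
        case False
        then have "?v = u" using insert.prems(2) by (auto simp: free_module_carrier)
        then show ?thesis using IH by simp
      qed
    qed
  qed
  then show ?thesis using u by (auto simp: free_module_carrier)
qed

section \<open>The filtration by the number of indices from \<open>D\<close>\<close>

context
  fixes E D :: "nat set" and B :: "int \<Rightarrow> ('x \<times> nat set) set" and M :: "('a, 'm) module" and aug c d
  assumes res: "dg_res E B M aug c d" and E: "finite E" and D: "D \<subseteq> E"
    and c: "\<And>t. t \<in> E \<Longrightarrow> c t \<in> carrier R"
begin

private abbreviation (input) "FF \<equiv> FU E :: ('a, 'x \<times> nat set \<Rightarrow> 'a) module"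
text \<open>The functions supported here form the j-th power of the exterior ideal generated by the
  variables of \<open>D\<close>, times the module.\<close>

private definition "X j = {(x :: 'x, J). J \<subseteq> E \<and> j \<le> card (J \<inter> D)}" for j :: nat

interpretation F: module R FF by (rule FU_module)

private lemmas r = dg_resD[OF res]

private lemma finD: "finite D" using D E by (rule finite_subset)

private lemma X_iff: "u \<in> FB (X j) \<longleftrightarrow> u \<in> carrier FF \<and> (\<forall>x J. u (x, J) \<noteq> \<zero> \<longrightarrow> j \<le> card (J \<inter> D))"
proof
  assume u: "u \<in> FB (X j)"
  then have "u b \<in> carrier R" for b by (rule free_module_coeff[OF cring_axioms])
  with u show "u \<in> carrier FF \<and> (\<forall>x J. u (x, J) \<noteq> \<zero> \<longrightarrow> j \<le> card (J \<inter> D))"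
    by (fastforce simp: free_module_carrier X_def)
next
  assume u: "u \<in> carrier FF \<and> (\<forall>x J. u (x, J) \<noteq> \<zero> \<longrightarrow> j \<le> card (J \<inter> D))"
  then have "u b \<in> carrier R" for b by (blast intro: FU_coeff)
  moreover have "u b = \<zero>" if "b \<notin> X j" for b
    using that u FU_support[of u E "snd b" "fst b"] by (cases b) (auto simp: X_def)
  ultimately show "u \<in> FB (X j)" using u by (simp add: free_module_carrier)
qed

private lemma X_submodule: "submodule (FB (X j)) R FF"
proof -
  interpret X: module R "free_module R (X j)" by (rule module_free_module[OF cring_axioms])
  show ?thesis
  proof (rule submodule_combine[OF F.module_axioms])
    show "FB (X j) \<subseteq> carrier FF" using X_iff by blast
    show "\<zero>\<^bsub>FF\<^esub> \<in> FB (X j)" using X.M.zero_closed by simp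
    show "x \<oplus>\<^bsub>FF\<^esub> y \<in> FB (X j)" if "x \<in> FB (X j)" "y \<in> FB (X j)" for x y
      using X.M.a_closed[OF that] by simp
    show "s \<odot>\<^bsub>FF\<^esub> x \<in> FB (X j)" if "s \<in> carrier R" "x \<in> FB (X j)" for s x
      using X.smult_closed[OF that] by simp
  qed
qed

private lemma ext_X:
  assumes t: "t \<in> D" and u: "u \<in> FB (X j)"
  shows "ext t u \<in> FB (X (Suc j))"
proof -
  have u': "u \<in> carrier FF" using u X_iff by blast
  have tE: "t \<in> E" using t D by blast
  have "Suc j \<le> card (J \<inter> D)" if "ext t u (x, J) \<noteq> \<zero>" for x J
  proof -
    have tJ: "t \<in> J" "u (x, J - {t}) \<noteq> \<zero>" using that by (auto simp: ext_def split: if_splits)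
    then have "j \<le> card ((J - {t}) \<inter> D)" using u X_iff by blast
    moreover have "J \<inter> D = insert t ((J - {t}) \<inter> D)" using tJ t by auto
    moreover have "finite ((J - {t}) \<inter> D)" using finD by simp
    ultimately show ?thesis by (metis Diff_iff IntD1 Suc_le_mono card_insert_disjoint singletonI)
  qed
  then show ?thesis using mod_hom_closed[OF ext_hom[OF tE] u'] X_iff by blast
qed

text \<open>Since \<open>d - K\<close> anticommutes with \<open>ext t\<close> for all \<open>t\<close> in \<open>D\<close>, it preserves the filtration
  by the number of indices from \<open>D\<close>, so only the Koszul part \<open>K\<close> acts on its graded pieces.\<close>

private lemma decomposition:
  obtains K where "K \<in> mod_hom R FF FF"
    "\<And>u x J. u \<in> carrier FF \<Longrightarrow> K u (x, J) = (\<Oplus>t\<in>D. c t \<otimes> contr t u (x, J))"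
    "\<And>u j. u \<in> FB (X j) \<Longrightarrow> d u \<ominus>\<^bsub>FF\<^esub> K u \<in> FB (X j)"
proof -
  obtain K where K: "K \<in> mod_hom R FF FF"
    "\<And>s u. s \<in> E \<Longrightarrow> u \<in> carrier FF \<Longrightarrow> K (ext s u) \<oplus>\<^bsub>FF\<^esub> ext s (K u) =
      (if s \<in> D then c s \<odot>\<^bsub>FF\<^esub> u else \<zero>\<^bsub>FF\<^esub>)"
    "\<And>u b. u \<in> carrier FF \<Longrightarrow> K u b = (\<Oplus>t\<in>D. c t \<otimes> contr t u b)"
  proof -
    have "\<exists>K. K \<in> mod_hom R FF FF \<and>
      (\<forall>s\<in>E. \<forall>u\<in>carrier FF. K (ext s u) \<oplus>\<^bsub>FF\<^esub> ext s (K u) =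
        (if s \<in> D then c s \<odot>\<^bsub>FF\<^esub> u else \<zero>\<^bsub>FF\<^esub>)) \<and>
      (\<forall>u\<in>carrier FF. \<forall>b. K u b = (\<Oplus>t\<in>D. c t \<otimes> contr t u b))"
      by (rule ex_contraction_sum[OF finD D]) (rule c)
    then show ?thesis using that by blast
  qed
  let ?\<theta> = "\<lambda>u. d u \<ominus>\<^bsub>FF\<^esub> K u"
  have \<theta>: "?\<theta> \<in> mod_hom R FF FF" by (rule mod_hom_minusf[OF F.module_axioms r(2) K(1)])
  note dc = mod_hom_closed[OF r(2)] and Kc = mod_hom_closed[OF K(1)]
  \<comment> \<open>For \<open>s\<close> in \<open>D\<close>, both \<open>d\<close> and
    \<open>K\<close> satisfy the relation with the same c_s, so it cancels in the
    difference.\<close>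
  have anti: "?\<theta> (ext s u) = \<ominus>\<^bsub>FF\<^esub> ext s (?\<theta> u)" if s: "s \<in> D" and u: "u \<in> carrier FF" for s u
  proof -
    have sE: "s \<in> E" using s D by blast
    note e = mod_hom_closed[OF ext_hom[OF sE]]
    have cl: "d (ext s u) \<in> carrier FF" "ext s (d u) \<in> carrier FF" "K (ext s u) \<in> carrier FF" "ext s (K u) \<in> carrier FF"
      using dc e Kc u by blast+
    have eq: "d (ext s u) \<oplus>\<^bsub>FF\<^esub> ext s (d u) = K (ext s u) \<oplus>\<^bsub>FF\<^esub> ext s (K u)"
      using r(5)[OF sE u] K(2)[OF sE u] s by (simp only: if_True)
    have "ext s (?\<theta> u) = ext s (d u) \<ominus>\<^bsub>FF\<^esub> ext s (K u)"
      by (rule mod_hom_diff[OF F.module_axioms F.module_axioms ext_hom[OF sE] dc[OF u] Kc[OF u]])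
    then have "?\<theta> (ext s u) \<oplus>\<^bsub>FF\<^esub> ext s (?\<theta> u) =
        (d (ext s u) \<oplus>\<^bsub>FF\<^esub> ext s (d u)) \<oplus>\<^bsub>FF\<^esub> \<ominus>\<^bsub>FF\<^esub> (K (ext s u) \<oplus>\<^bsub>FF\<^esub> ext s (K u))"
      using cl by (simp only: a_minus_def F.M.minus_add F.M.a_ac F.M.a_closed F.M.a_inv_closed)
    also have "\<dots> = \<zero>\<^bsub>FF\<^esub>" unfolding eq using cl by (intro F.M.r_neg F.M.a_closed)
    finally show ?thesis
      using mod_hom_closed[OF \<theta> e[OF u]] e[OF mod_hom_closed[OF \<theta> u]] by (metis F.M.minus_equality)
  qed
  \<comment> \<open>Pulling the factors indexed by \<open>L\<close> out of the argument costs only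
    signs; each of them, multiplied back in front, raises the filtration by one.\<close>
  have basis: "?\<theta> (basis_elt R (x, L \<union> J')) \<in> FB (X (card L))"
    if "finite L" "L \<subseteq> D" "J' \<subseteq> E - D" for L J' x
    using that
  proof (induction L)
    case empty
    have "basis_elt R (x, J') \<in> carrier FF" using empty by (intro basis_elt_closed[OF cring_axioms]) auto
    then show ?case using mod_hom_closed[OF \<theta>] X_iff by simp
  next
    case (insert t L)
    let ?b = "basis_elt R (x, L \<union> J')"
    have t: "t \<in> D" "t \<in> E" using insert.prems D by auto
    have tn: "t \<notin> L \<union> J'" using insert by auto
    have b: "?b \<in> carrier FF" using insert.prems D by (intro basis_elt_closed[OF cring_axioms]) auto
    have b': "basis_elt R (x, insert t (L \<union> J')) \<in> carrier FF"
      using insert.prems D by (intro basis_elt_closed[OF cring_axioms]) auto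
    have "?\<theta> (ext t ?b) \<in> FB (X (Suc (card L)))"
      unfolding anti[OF t(1) b] using ext_X[OF t(1)] insert F.submoduleE(3)[OF X_submodule] by simp
    moreover have "ext t ?b = signed FF (pos (L \<union> J') t) (basis_elt R (x, insert t (L \<union> J')))"
      using ext_basis_elt(2)[OF tn, of x] b' by (auto simp: signed_def FU_minus)
    ultimately have s: "signed FF (pos (L \<union> J') t) (?\<theta> (basis_elt R (x, insert t (L \<union> J')))) \<in> FB (X (Suc (card L)))"
      using signed_mod_hom[OF F.module_axioms F.module_axioms \<theta> b'] by simp
    have "signed FF (pos (L \<union> J') t) (signed FF (pos (L \<union> J') t) (?\<theta> (basis_elt R (x, insert t (L \<union> J')))))
        \<in> FB (X (Suc (card L)))"
      unfolding signed_def[of FF "pos (L \<union> J') t" "signed FF (pos (L \<union> J') t) _"]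
      using s F.submoduleE(3)[OF X_submodule s] by simp
    then show ?case
      using insert.hyps mod_hom_closed[OF \<theta> b'] signed_signed[OF F.M.abelian_group_axioms]
      by (simp add: signed_def)
  qed
  show ?thesis
  proof (rule that[OF K(1)])
    show "K u (x, J) = (\<Oplus>t\<in>D. c t \<otimes> contr t u (x, J))" if "u \<in> carrier FF" for u x J
      using K(3)[OF that] .
    fix u j assume u: "u \<in> FB (X j)"
    interpret X: module R "free_module R (X j)" by (rule module_free_module[OF cring_axioms])
    note S = F.submoduleE[OF X_submodule[of j]]
    have \<theta>X: "?\<theta> \<in> mod_hom R (free_module R (X j)) FF"
      using \<theta> X_iff by (auto simp: mod_hom_def)
    show "?\<theta> u \<in> FB (X j)"
      using cring_axioms u
    proof (rule free_module_support_induct)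
      show "?\<theta> (\<lambda>_. \<zero>) \<in> FB (X j)"
        using mod_hom_zero[OF X.module_axioms F.module_axioms \<theta>X] submodule_zero[OF F.module_axioms X_submodule] by simp
    next
      fix s b v assume s: "s \<in> carrier R" and b: "b \<in> X j" and v: "v \<in> FB (X j)" "?\<theta> v \<in> FB (X j)"
      obtain x J where xJ: "b = (x, J)" "J \<subseteq> E" "j \<le> card (J \<inter> D)" using b by (auto simp: X_def)
      have e: "basis_elt R b \<in> FB (X j)" by (rule basis_elt_closed[OF cring_axioms b])
      have "(J \<inter> D) \<union> (J - D) = J" by blast
      then have "?\<theta> (basis_elt R b) \<in> FB (X (card (J \<inter> D)))"
        using basis[of "J \<inter> D" "J - D" x] xJ finD by auto
      then have "?\<theta> (basis_elt R b) \<in> FB (X j)" using xJ(3) unfolding X_iff by fastforce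
      then show "?\<theta> (v \<oplus>\<^bsub>free_module R (X j)\<^esub> s \<odot>\<^bsub>free_module R (X j)\<^esub> basis_elt R b) \<in> FB (X j)"
        using S(4)[OF s] S(5)[OF v(2)]
        by (simp only: mod_hom_add[OF \<theta>X v(1) X.smult_closed[OF s e]] mod_hom_smult[OF \<theta>X s e])
    qed
  qed
qed

private lemma X_red_kernel:
  assumes "ideal A R" "u \<in> FB (X (Suc j))" shows "u \<in> red_kernel D A"
proof -
  interpret A: ideal A R by fact
  have "u (x, J) = \<zero>" if "J \<inter> D = {}" for x J
  proof (rule ccontr)
    assume "u (x, J) \<noteq> \<zero>"
    then have "Suc j \<le> card (J \<inter> D)" using assms(2) X_iff by blast
    with that show False by simp
  qed
  then show ?thesis by (simp add: red_kernel_def)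
qed

text \<open>Split \<open>u\<close> into the part without indices from \<open>D\<close>, whose
  coefficients lie in \<open>A\<close>, and the part with at least one. Linearity handles the
  former. On the latter, \<open>d - K\<close> keeps an index from \<open>D\<close>, and
  \<open>K\<close> only produces coefficients that are combinations of the c_t in
  \<open>A\<close>.\<close>

lemma red_kernel_diff:
  assumes A: "ideal A R" "c ` D \<subseteq> A" and u: "u \<in> carrier (FU E)" "u \<in> red_kernel D A"
  shows "d u \<in> red_kernel D A"
proof -
  interpret A: ideal A R by (rule A)
  obtain K where K: "K \<in> mod_hom R FF FF"
    "\<And>u x J. u \<in> carrier FF \<Longrightarrow> K u (x, J) = (\<Oplus>t\<in>D. c t \<otimes> contr t u (x, J))"
    "\<And>u j. u \<in> FB (X j) \<Longrightarrow> d u \<ominus>\<^bsub>FF\<^esub> K u \<in> FB (X j)" by (rule decomposition) blast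
  define u0 where "u0 = (\<lambda>(x, J). if J \<inter> D = {} then u (x, J) else \<zero>)"
  define u1 where "u1 = (\<lambda>(x, J). if J \<inter> D = {} then \<zero> else u (x, J))"
  have fin: "finite {b. u0 b \<noteq> \<zero>}" "finite {b. u1 b \<noteq> \<zero>}"
  proof -
    have f: "finite {b. u b \<noteq> \<zero>}" using u(1) by (simp add: free_module_carrier)
    show "finite {b. u0 b \<noteq> \<zero>}" "finite {b. u1 b \<noteq> \<zero>}"
      by (rule finite_subset[OF _ f], force simp: u0_def u1_def split: if_splits)+
  qed
  have u0: "u0 \<in> carrier FF" using u(1) fin by (auto simp: u0_def free_module_carrier)
  have u1: "u1 \<in> carrier FF" using u(1) fin by (auto simp: u1_def free_module_carrier)
  have u1X: "u1 \<in> FB (X 1)"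
    unfolding X_iff using u1 finD by (auto simp: u1_def Suc_le_eq card_gt_0_iff split: if_splits)
  have uu: "u = u0 \<oplus>\<^bsub>FF\<^esub> u1" using FU_coeff[OF u(1)] by (auto simp: u0_def u1_def)
  have "u0 b \<in> A" for b using u(2) by (cases b) (auto simp: u0_def red_kernel_def)
  then have d0: "d u0 b \<in> A" for b by (rule mod_hom_coeff_ideal[OF A(1) r(2) u0])
  show ?thesis
    unfolding red_kernel_def
  proof (intro CollectI allI impI)
    fix x J assume J: "J \<inter> D = {}"
    let ?t = "d u1 \<ominus>\<^bsub>FF\<^esub> K u1"
    have t: "?t (x, J) \<in> A" using X_red_kernel[OF A(1), of ?t 0] K(3)[OF u1X] J by (simp add: red_kernel_def)
    have k: "K u1 (x, J) \<in> A"
    proof -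
      have "(\<Oplus>t\<in>D'. c t \<otimes> contr t u1 (x, J)) \<in> A" if "finite D'" "D' \<subseteq> D" for D'
        using that
      proof (induction D')
        case (insert t D')
        have cl: "contr s u1 (x, J) \<in> carrier R" "c s \<in> A" if "s \<in> insert t D'" for s
          using FU_coeff[OF mod_hom_closed[OF contr_hom u1], of s "(x, J)"] A(2) insert.prems that by blast+
        then have "c s \<otimes> contr s u1 (x, J) \<in> A" if "s \<in> insert t D'" for s
          using A.I_r_closed that by blast
        with insert show ?case by (subst finsum_insert) (auto simp: Pi_iff)
      qed simp
      then show ?thesis using finD by (simp add: K(2)[OF u1])
    qed
    have "d u1 (x, J) = ?t (x, J) \<oplus> K u1 (x, J)"
      using FU_coeff[OF mod_hom_closed[OF r(2) u1]] FU_coeff[OF mod_hom_closed[OF K(1) u1]]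
      unfolding FU_diff[OF mod_hom_closed[OF K(1) u1]] by (simp add: a_minus_def a_assoc l_neg)
    then have "d u1 (x, J) \<in> A" using t k by simp
    moreover have "d u (x, J) = d u0 (x, J) \<oplus> d u1 (x, J)"
      unfolding uu mod_hom_add[OF r(2) u0 u1] by simp
    ultimately show "d u (x, J) \<in> A" using d0 by simp
  qed
qed

section \<open>Exactness on the layers of the filtration and on the kernel of the reduction\<close>

context
  fixes n :: nat
  assumes Dn: "D = {1..n}" and lt: "\<And>s t. s \<in> D \<Longrightarrow> t \<in> E - D \<Longrightarrow> s < t" and reg: "koszul_regular R n c"
begin

private abbreviation (input) "kd k \<equiv> cdiff (koszul_complex R n c) k"
private abbreviation (input) "Sl j \<equiv> carrier (free_module R {L. L \<subseteq> {1..n} \<and> int (card L) = int j})"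

private lemma koszul_cdiff: "kd k v L = (\<Oplus>t\<in>D - L. signed R (pos L t) (c t \<otimes> v (insert t L)))"
  by (simp add: koszul_complex_def Dn pos_def)

text \<open>With the generator and the indices outside \<open>D\<close> held fixed, \<open>K\<close>
  is the Koszul differential in the remaining indices, with the same signs.\<close>

private lemma contraction_sum_koszul:
  assumes u: "u \<in> carrier FF" and J: "J \<subseteq> E"
  shows "(\<Oplus>t\<in>D. c t \<otimes> contr t u (x, J)) =
    (\<Oplus>t\<in>D - (J \<inter> D). signed R (pos (J \<inter> D) t) (c t \<otimes> u (x, insert t J)))"
proof -
  have cD: "c t \<in> carrier R" if "t \<in> D" for t using c that D by blast
  have p: "pos J t = pos (J \<inter> D) t" if "t \<in> D" for t
  proof -
    \<comment> \<open>The indices of \<open>D\<close> come before all others, so the indices of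
      \<open>J\<close> outside \<open>D\<close> do not contribute to the sign.\<close>
    have "{i \<in> J. i < t} = {i \<in> J \<inter> D. i < t}"
    proof (intro equalityI subsetI)
      fix i assume i: "i \<in> {i \<in> J. i < t}"
      then have "i \<in> D" using lt[OF that, of i] J by force
      with i show "i \<in> {i \<in> J \<inter> D. i < t}" by simp
    qed simp
    then show ?thesis by (simp add: pos_def)
  qed
  have "(\<Oplus>t\<in>D. c t \<otimes> contr t u (x, J)) = (\<Oplus>t\<in>D - (J \<inter> D). c t \<otimes> contr t u (x, J))"
    using finD cD FU_coeff[OF mod_hom_closed[OF contr_hom u], of _ "(x, J)"]
    by (intro add.finprod_mono_neutral_cong_right) (auto simp: contr_def)
  also have "\<dots> = (\<Oplus>t\<in>D - (J \<inter> D). signed R (pos (J \<inter> D) t) (c t \<otimes> u (x, insert t J)))"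
    using cD FU_coeff[OF u] by (intro finsum_cong') (auto simp: contr_def p signed_mult)
  finally show ?thesis .
qed

text \<open>The coefficients of \<open>z\<close> with exactly j indices from \<open>D\<close>, for
  fixed \<open>x\<close> and \<open>J'\<close>, form a Koszul cycle of degree j, hence a boundary
  for j > 0. For j = 0 the role of exactness is taken by the assumption on \<open>z\<close>: its
  coefficient lies in the ideal, which is the image of the first differential. The clause that a
  zero slice gets the zero preimage will keep the assembled element finitely supported.\<close>

private lemma kill_slice:
  assumes z: "z \<in> FB (X j)" "d z = (\<lambda>_. \<zero>)" and j: "j = 0 \<Longrightarrow> z \<in> red_kernel D (seq_ideal R n c)"
    and J': "J' \<subseteq> E - D"
  shows "\<exists>W\<in>Sl (Suc j). (\<forall>L\<subseteq>D. card L = j \<longrightarrow> z (x, L \<union> J') = kd (int j + 1) W L) \<and>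
    ((\<forall>L\<subseteq>D. card L = j \<longrightarrow> z (x, L \<union> J') = \<zero>) \<longrightarrow> W = (\<lambda>_. \<zero>))"
proof (cases "\<forall>L\<subseteq>D. card L = j \<longrightarrow> z (x, L \<union> J') = \<zero>")
  case True
  have "kd (int j + 1) (\<lambda>_. \<zero>) L = \<zero>" for L
    unfolding koszul_cdiff using c D by (subst finsum_cong'[OF refl, where g = "\<lambda>_. \<zero>"]) auto
  with True show ?thesis by (intro bexI[of _ "\<lambda>_. \<zero>"]) (auto simp: free_module_carrier)
next
  case False
  have zF: "z \<in> carrier FF" using z(1) X_iff by blast
  have zc: "z b \<in> carrier R" for b using FU_coeff[OF zF] .
  show ?thesis
  proof (cases "j = 0")
    case True
    have "z (x, J') \<in> seq_ideal R n c" using j[OF True] J' by (auto simp: red_kernel_def)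
    moreover have "c \<in> {1..n} \<rightarrow> carrier R" using c D Dn by auto
    ultimately obtain W where W: "W \<in> Sl 1" "z (x, J') = kd 1 W {}"
      using koszul_seq_ideal[OF cring_axioms, of c n "z (x, J')"] by auto
    have "z (x, L \<union> J') = kd (int j + 1) W L" if "L \<subseteq> D" "card L = j" for L
    proof -
      have "L = {}" using that True finite_subset[OF that(1) finD] by simp
      with W(2) True show ?thesis by simp
    qed
    with W(1) False True show ?thesis by (intro bexI[of _ W]) auto
  next
    case nz: False
    define v where "v = (\<lambda>L. if L \<subseteq> D \<and> card L = j then z (x, L \<union> J') else \<zero>)"
    have "{L. v L \<noteq> \<zero>} \<subseteq> Pow D" by (auto simp: v_def)
    then have "finite {L. v L \<noteq> \<zero>}" by (rule finite_subset) (simp add: finD)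
    then have v: "v \<in> Sl j" using zc by (auto simp: free_module_carrier v_def Dn)
    obtain K where K: "K \<in> mod_hom R FF FF"
      "\<And>u x J. u \<in> carrier FF \<Longrightarrow> K u (x, J) = (\<Oplus>t\<in>D. c t \<otimes> contr t u (x, J))"
      "\<And>u j. u \<in> FB (X j) \<Longrightarrow> d u \<ominus>\<^bsub>FF\<^esub> K u \<in> FB (X j)" by (rule decomposition) blast
    have "kd (int j) v L = \<zero>" for L
    proof (cases "L \<subseteq> D \<and> Suc (card L) = j")
      case True
      then have L: "L \<subseteq> D" "Suc (card L) = j" "finite L" using finite_subset[OF _ finD] by auto
      have JD: "(L \<union> J') \<inter> D = L" and JE: "L \<union> J' \<subseteq> E" using L J' D by auto
      have "(\<Oplus>t\<in>D - L. signed R (pos L t) (c t \<otimes> v (insert t L))) =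
          (\<Oplus>t\<in>D - ((L \<union> J') \<inter> D). signed R (pos ((L \<union> J') \<inter> D) t) (c t \<otimes> z (x, insert t (L \<union> J'))))"
        unfolding JD using L zc c D by (intro finsum_cong') (auto simp: v_def)
      also have "\<dots> = K z (x, L \<union> J')" unfolding K(2)[OF zF] contraction_sum_koszul[OF zF JE] ..
      \<comment> \<open>\<open>z\<close> is a cycle and \<open>d - K\<close> respects the
        filtration, so \<open>K z\<close> lies in \<open>X j\<close>; the index set in question has
        only j - 1 elements in \<open>D\<close>.\<close>
      also have "\<dots> = \<zero>"
      proof -
        have "(d z \<ominus>\<^bsub>FF\<^esub> K z) (x, L \<union> J') = \<zero>"
          using K(3)[OF z(1)] L(2) JD unfolding X_iff by (metis Suc_n_not_le_n)
        then have "\<zero> \<ominus> K z (x, L \<union> J') = \<zero>"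
          unfolding FU_diff[OF mod_hom_closed[OF K(1) zF]] z(2) by simp
        then show ?thesis
          using FU_coeff[OF mod_hom_closed[OF K(1) zF], of "(x, L \<union> J')"] minus_eq_zero_iff zero_closed by metis
      qed
      finally show ?thesis unfolding koszul_cdiff .
    next
      case False
      have "v (insert t L) = \<zero>" if t: "t \<in> D - L" for t
      proof -
        have "card (insert t L) = Suc (card L)" if "L \<subseteq> D"
          using t finite_subset[OF that finD] by simp
        with False show ?thesis by (auto simp: v_def)
      qed
      then have "(\<Oplus>t\<in>D - L. signed R (pos L t) (c t \<otimes> v (insert t L))) = (\<Oplus>t\<in>D - L. \<zero>)"
        using c D by (intro finsum_cong') auto
      then show ?thesis unfolding koszul_cdiff by simp
    qed
    then have "kd (int j) v = (\<lambda>_. \<zero>)" by auto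
    then obtain W where W: "W \<in> carrier (free_module R {L. L \<subseteq> {1..n} \<and> int (card L) = int j + 1})"
      "v = kd (int j + 1) W"
      using koszul_regular_exact[OF cring_axioms reg, of "int j" v] v nz by auto
    have "z (x, L \<union> J') = kd (int j + 1) W L" if "L \<subseteq> D" "card L = j" for L
      using that unfolding W(2)[symmetric] by (simp add: v_def)
    moreover have "W \<in> Sl (Suc j)" using W(1) by (simp add: add.commute)
    ultimately show ?thesis using False by (intro bexI[of _ W]) auto
  qed
qed

text \<open>The preimages of the slices are assembled to \<open>w\<close>. Then \<open>K w\<close>
  cancels the lowest layer of \<open>z\<close>, and \<open>d w\<close> differs from
  \<open>K w\<close> by an element of the next filtration step, since \<open>w\<close> itself lies
  there.\<close>

private lemma filtration_step:
  assumes zB: "z \<in> FB (B k)" and z: "z \<in> FB (X j)" "d z = (\<lambda>_. \<zero>)"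
    and j: "j = 0 \<Longrightarrow> z \<in> red_kernel D (seq_ideal R n c)"
  shows "\<exists>w\<in>FB (B (k + 1)) \<inter> FB (X (Suc j)). z \<ominus>\<^bsub>FF\<^esub> d w \<in> FB (X (Suc j))"
proof -
  have zF: "z \<in> carrier FF" using z(1) X_iff by blast
  obtain W where W: "\<And>x J'. J' \<subseteq> E - D \<Longrightarrow> W x J' \<in> Sl (Suc j)"
    "\<And>x J' L. J' \<subseteq> E - D \<Longrightarrow> L \<subseteq> D \<Longrightarrow> card L = j \<Longrightarrow> z (x, L \<union> J') = kd (int j + 1) (W x J') L"
    "\<And>x J'. J' \<subseteq> E - D \<Longrightarrow> \<forall>L\<subseteq>D. card L = j \<longrightarrow> z (x, L \<union> J') = \<zero> \<Longrightarrow> W x J' = (\<lambda>_. \<zero>)"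
  proof -
    define P where "P x J' W \<longleftrightarrow> (W \<in> Sl (Suc j) \<and>
        (\<forall>L\<subseteq>D. card L = j \<longrightarrow> z (x, L \<union> J') = kd (int j + 1) W L) \<and>
        ((\<forall>L\<subseteq>D. card L = j \<longrightarrow> z (x, L \<union> J') = \<zero>) \<longrightarrow> W = (\<lambda>_. \<zero>)))" for x J' W
    have ex: "\<exists>W. P x J' W" if "J' \<subseteq> E - D" for x J'
    proof -
      have "\<exists>W\<in>Sl (Suc j). (\<forall>L\<subseteq>D. card L = j \<longrightarrow> z (x, L \<union> J') = kd (int j + 1) W L) \<and>
        ((\<forall>L\<subseteq>D. card L = j \<longrightarrow> z (x, L \<union> J') = \<zero>) \<longrightarrow> W = (\<lambda>_. \<zero>))"
        by (rule kill_slice[OF z _ that]) (rule j)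
      then show ?thesis unfolding P_def Bex_def .
    qed
    have P: "P x J' (SOME W. P x J' W)" if "J' \<subseteq> E - D" for x J'
      by (rule someI_ex[of "P x J'"]) (rule ex[OF that])
    have P1: "(SOME W. P x J' W) \<in> Sl (Suc j)" if "J' \<subseteq> E - D" for x J'
      using P[OF that] unfolding P_def by (rule conjunct1)
    have P2: "z (x, L \<union> J') = kd (int j + 1) (SOME W. P x J' W) L"
      if "J' \<subseteq> E - D" "L \<subseteq> D" "card L = j" for x J' L
      using P[OF that(1), of x] that(2,3) P_def[of x J' "SOME W. P x J' W"] by blast
    show ?thesis
    proof (rule that[of "\<lambda>x J'. SOME W. P x J' W"], fact P1, fact P2)
      fix x J' assume "J' \<subseteq> E - D" "\<forall>L\<subseteq>D. card L = j \<longrightarrow> z (x, L \<union> J') = \<zero>"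
      with P[OF this(1), of x] P_def[of x J' "SOME W. P x J' W"] show "(SOME W. P x J' W) = (\<lambda>_. \<zero>)" by blast
    qed
  qed
  \<comment> \<open>The set \<open>J\<close> is split into its indices outside \<open>D\<close>,
    which select the slice, and those in \<open>D\<close>, at which the chosen preimage is
    evaluated.\<close>
  define w where "w = (\<lambda>(x, J). if J \<subseteq> E then W x (J - D) (J \<inter> D) else \<zero>)"
  have wnz: "J \<subseteq> E \<and> card (J \<inter> D) = Suc j \<and> (\<exists>L\<subseteq>D. card L = j \<and> z (x, L \<union> (J - D)) \<noteq> \<zero>)" if "w (x, J) \<noteq> \<zero>" for x J
  proof -
    have J: "J \<subseteq> E" "W x (J - D) (J \<inter> D) \<noteq> \<zero>" using that by (auto simp: w_def split: if_splits)
    then have J': "J - D \<subseteq> E - D" by blast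
    have "J \<inter> D \<in> {L. L \<subseteq> {1..n} \<and> int (card L) = int (Suc j)}"
      using W(1)[OF J', of x] J(2) unfolding free_module_carrier by blast
    moreover have "\<exists>L\<subseteq>D. card L = j \<and> z (x, L \<union> (J - D)) \<noteq> \<zero>"
    proof (rule ccontr)
      assume "\<not> ?thesis"
      then have "W x (J - D) = (\<lambda>_. \<zero>)" by (intro W(3)[OF J']) blast
      with J(2) show False by simp
    qed
    ultimately show ?thesis using J(1) by simp
  qed
  \<comment> \<open>A nonzero value of \<open>w\<close> at x comes from a nonzero slice of
    \<open>z\<close> at x, so only finitely many x occur, and \<open>E\<close> has finitely many
    subsets.\<close>
  have "{b. w b \<noteq> \<zero>} \<subseteq> fst ` {b. z b \<noteq> \<zero>} \<times> Pow E" using wnz by force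
  moreover have "finite (fst ` {b. z b \<noteq> \<zero>} \<times> Pow E)" using zF E by (simp add: free_module_carrier)
  ultimately have fin: "finite {b. w b \<noteq> \<zero>}" by (rule finite_subset)
  have "w b \<in> carrier R" for b
  proof (cases b)
    case (Pair x J)
    show ?thesis
    proof (cases "J \<subseteq> E")
      case True
      then have "W x (J - D) \<in> Sl (Suc j)" by (intro W(1)) blast
      from free_module_coeff[OF cring_axioms this] True Pair show ?thesis by (simp add: w_def)
    qed (simp add: w_def Pair)
  qed
  then have wF: "w \<in> carrier FF" using fin by (auto simp: free_module_carrier w_def)
  have wX: "w \<in> FB (X (Suc j))" unfolding X_iff using wF wnz by auto
  \<comment> \<open>Compared with a pair in the support of \<open>z\<close>, the j indices in
    \<open>D\<close> have been replaced by j + 1 others; the degree grows by one.\<close>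
  have "(x, J) \<in> B (k + 1)" if "w (x, J) \<noteq> \<zero>" for x J
  proof -
    from wnz[OF that] obtain L where
      L: "J \<subseteq> E" "card (J \<inter> D) = Suc j" "L \<subseteq> D" "card L = j" "z (x, L \<union> (J - D)) \<noteq> \<zero>"
      by blast
    have fin: "finite J" "finite L" using L E finD by (auto intro: finite_subset)
    have b: "(x, L \<union> (J - D)) \<in> B k" using zB L(5) FB_iff[OF r(1)] by blast
    have "card ((J \<inter> D) \<union> (J - D)) = card (J \<inter> D) + card (J - D)"
      using fin by (intro card_Un_disjoint) auto
    moreover have "(J \<inter> D) \<union> (J - D) = J" by blast
    moreover have "card (L \<union> (J - D)) = card L + card (J - D)"
      using fin L(3) by (intro card_Un_disjoint) auto
    ultimately show ?thesis using graded_basisD(3)[OF r(1) b L(1)] L(2,4) by (simp add: add.commute)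
  qed
  then have wB: "w \<in> FB (B (k + 1))" using FB_iff[OF r(1)] wF by (metis surj_pair)
  obtain K where K: "K \<in> mod_hom R FF FF"
    "\<And>u x J. u \<in> carrier FF \<Longrightarrow> K u (x, J) = (\<Oplus>t\<in>D. c t \<otimes> contr t u (x, J))"
    "\<And>u j. u \<in> FB (X j) \<Longrightarrow> d u \<ominus>\<^bsub>FF\<^esub> K u \<in> FB (X j)" by (rule decomposition) blast
  note dw = mod_hom_closed[OF r(2) wF] and Kw = mod_hom_closed[OF K(1) wF]
  \<comment> \<open>With exactly j indices in \<open>D\<close> the two values agree by the choice of
    the preimages. With fewer, both vanish: \<open>z\<close> lies in \<open>X j\<close>, and
    \<open>w\<close> is concentrated on sets with exactly j + 1 indices in \<open>D\<close>.\<close>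
  have "z b \<ominus> K w b = \<zero>" if b: "\<not> Suc j \<le> card (snd b \<inter> D)" for b
  proof -
    obtain x J where xJ: "b = (x, J)" by (cases b)
    have cl: "z b \<in> carrier R" "K w b \<in> carrier R" using FU_coeff[OF zF] FU_coeff[OF Kw] by auto
    have "z b = K w b"
    proof (cases "J \<subseteq> E")
      case False
      then show ?thesis using FU_support[OF zF] FU_support[OF Kw] by (simp add: xJ)
    next
      case True
      let ?L = "J \<inter> D"
      have Kw': "K w b = (\<Oplus>t\<in>D - ?L. signed R (pos ?L t) (c t \<otimes> w (x, insert t J)))"
        unfolding xJ K(2)[OF wF] contraction_sum_koszul[OF wF True] ..
      show ?thesis
      proof (cases "card ?L = j")
        case True
        have ins: "insert t J - D = J - D" "insert t J \<inter> D = insert t ?L" "insert t J \<subseteq> E" if "t \<in> D" for t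
          using that D \<open>J \<subseteq> E\<close> by auto
        have wc: "w b \<in> carrier R" for b using FU_coeff[OF wF] .
        have J': "J - D \<subseteq> E - D" using \<open>J \<subseteq> E\<close> by blast
        have "z (x, ?L \<union> (J - D)) = kd (int j + 1) (W x (J - D)) ?L" using W(2)[OF J' _ True] by simp
        moreover have "?L \<union> (J - D) = J" by blast
        moreover have "kd (int j + 1) (W x (J - D)) ?L = K w b"
          unfolding koszul_cdiff Kw'
        proof (rule finsum_cong'[OF refl])
          show "(\<lambda>t. signed R (pos ?L t) (c t \<otimes> w (x, insert t J))) \<in> D - ?L \<rightarrow> carrier R"
            using wc c D by auto
          show "signed R (pos ?L t) (c t \<otimes> W x (J - D) (insert t ?L)) = signed R (pos ?L t) (c t \<otimes> w (x, insert t J))"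
            if "t \<in> D - ?L" for t
            using that ins[of t] by (simp add: w_def)
        qed
        ultimately show ?thesis by (simp add: xJ)
      next
        case False
        have "w (x, insert t J) = \<zero>" if "t \<in> D - ?L" for t
        proof (rule ccontr)
          assume "w (x, insert t J) \<noteq> \<zero>"
          then have "card (insert t J \<inter> D) = Suc j" using wnz by blast
          moreover have "insert t J \<inter> D = insert t ?L" using that by blast
          moreover have "card (insert t ?L) = Suc (card ?L)" using that finD by (intro card_insert_disjoint) auto
          ultimately show False using False by simp
        qed
        then have "(\<Oplus>t\<in>D - ?L. signed R (pos ?L t) (c t \<otimes> w (x, insert t J))) = (\<Oplus>t\<in>D - ?L. \<zero>)"
          using c D by (intro finsum_cong') auto
        moreover have "z b = \<zero>"
          using z(1) b False unfolding X_iff xJ by (metis le_antisym not_less_eq_eq snd_conv)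
        ultimately show ?thesis unfolding Kw' by simp
      qed
    qed
    then show ?thesis using cl by (simp add: minus_eq_zero_iff)
  qed
  then have zK: "z \<ominus>\<^bsub>FF\<^esub> K w \<in> FB (X (Suc j))"
    using F.M.minus_closed[OF zF Kw] unfolding X_iff FU_diff[OF Kw] by (metis snd_conv)
  have "(z \<ominus>\<^bsub>FF\<^esub> K w) \<ominus>\<^bsub>FF\<^esub> (d w \<ominus>\<^bsub>FF\<^esub> K w) = z \<ominus>\<^bsub>FF\<^esub> d w"
    using zF dw Kw F.M.r_neg1[OF Kw]
    by (simp only: a_minus_def F.M.minus_add F.M.minus_minus F.M.a_ac F.M.a_closed F.M.a_inv_closed)
      (simp only: F.M.a_assoc[symmetric] F.M.a_closed F.M.a_inv_closed F.M.r_neg F.M.l_neg F.M.r_zero F.M.l_zero)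
  then have "z \<ominus>\<^bsub>FF\<^esub> d w \<in> FB (X (Suc j))"
    using submodule_diff[OF F.module_axioms X_submodule zK K(3)[OF wX]] by metis
  with wB wX show ?thesis by blast
qed

text \<open>After subtracting \<open>d w\<close> the cycle lies one step deeper, and the process
  ends because \<open>D\<close> has n elements, so that \<open>X j\<close> carries only zero for j >
  n. The condition for j = 0 concerns the first round only.\<close>

private lemma filtration_exact:
  assumes "z \<in> FB (B k)" "z \<in> FB (X j)" "d z = (\<lambda>_. \<zero>)" "j = 0 \<Longrightarrow> z \<in> red_kernel D (seq_ideal R n c)"
  shows "\<exists>w\<in>FB (B (k + 1)) \<inter> FB (X (Suc j)). d w = z"
  using assms
proof (induction "Suc n - j" arbitrary: z j)
  case 0
  have "z b = \<zero>" for b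
  proof (rule ccontr)
    assume b: "z b \<noteq> \<zero>"
    have "j \<le> card (snd b \<inter> D)" using 0(3) b X_iff by (metis prod.collapse)
    also have "\<dots> \<le> card D" using finD by (intro card_mono) auto
    finally show False using 0(1) Dn by simp
  qed
  then have "z = \<zero>\<^bsub>FF\<^esub>" by auto
  moreover have "\<zero>\<^bsub>FF\<^esub> \<in> FB (B (k + 1)) \<inter> FB (X (Suc j))"
    using submodule_zero[OF F.module_axioms FB_submodule[OF r(1)]] submodule_zero[OF F.module_axioms X_submodule]
    by blast
  ultimately show ?case using mod_hom_zero[OF F.module_axioms F.module_axioms r(2)] by metis
next
  case (Suc m)
  obtain w where w: "w \<in> FB (B (k + 1))" "w \<in> FB (X (Suc j))" "z \<ominus>\<^bsub>FF\<^esub> d w \<in> FB (X (Suc j))"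
  proof -
    have "\<exists>w\<in>FB (B (k + 1)) \<inter> FB (X (Suc j)). z \<ominus>\<^bsub>FF\<^esub> d w \<in> FB (X (Suc j))"
      by (rule filtration_step[OF Suc.prems(1-3)]) (rule Suc.prems(4))
    then show ?thesis using that by blast
  qed
  have wF: "w \<in> carrier FF" "z \<in> carrier FF" using w(2) Suc.prems(2) X_iff by blast+
  note dw = mod_hom_closed[OF r(2) wF(1)]
  have db: "d w \<in> FB (B k)" using r(3)[OF w(1)] by simp
  have zd: "z \<ominus>\<^bsub>FF\<^esub> d w \<in> FB (B k)"
    by (rule submodule_diff[OF F.module_axioms FB_submodule[OF r(1)] Suc.prems(1) db])
  have "d (z \<ominus>\<^bsub>FF\<^esub> d w) = d z \<ominus>\<^bsub>FF\<^esub> d (d w)"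
    by (rule mod_hom_diff[OF F.module_axioms F.module_axioms r(2) wF(2) dw])
  also have "\<dots> = (\<lambda>_. \<zero>)"
    unfolding Suc.prems(3) r(4)[OF w(1)]
    using F.M.minus_zero_right[OF F.M.zero_closed] by simp
  finally have d0: "d (z \<ominus>\<^bsub>FF\<^esub> d w) = (\<lambda>_. \<zero>)" .
  have m: "m = Suc n - Suc j" using Suc.hyps(2) by simp
  obtain w' where w': "w' \<in> FB (B (k + 1))" "w' \<in> FB (X (Suc (Suc j)))" "d w' = z \<ominus>\<^bsub>FF\<^esub> d w"
    using Suc.hyps(1)[OF m zd w(3) d0] by blast
  have w'X: "w' \<in> FB (X (Suc j))" using w'(2) unfolding X_iff by (meson Suc_leD)
  have w'F: "w' \<in> carrier FF" using w'(2) X_iff by blast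
  have "d (w \<oplus>\<^bsub>FF\<^esub> w') = d w \<oplus>\<^bsub>FF\<^esub> (z \<ominus>\<^bsub>FF\<^esub> d w)"
    using mod_hom_add[OF r(2) wF(1) w'F] w'(3) by metis
  also have "\<dots> = z" using dw wF(2) by (simp only: a_minus_def F.M.a_lcomm[OF dw wF(2)] F.M.a_inv_closed F.M.r_neg F.M.r_zero)
  finally show ?case
    using F.submoduleE(5)[OF FB_submodule[OF r(1)] w(1) w'(1)] F.submoduleE(5)[OF X_submodule w(2) w'X] by blast
qed

text \<open>The preimage has at least one index from \<open>D\<close> in every term, hence lies in
  the kernel for whatever ideal.\<close>

lemma red_kernel_exact:
  assumes "z \<in> FB (B k)" "z \<in> red_kernel D (seq_ideal R n c)" "d z = (\<lambda>_. \<zero>)"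
  shows "\<exists>w\<in>FB (B (k + 1)) \<inter> red_kernel D (seq_ideal R n c). d w = z"
proof -
  have z: "z \<in> FB (X 0)" using assms(1) FB_iff[OF r(1)] unfolding X_iff by blast
  have "c ` {1..n} \<subseteq> carrier R" using c D Dn by auto
  then have "ideal (seq_ideal R n c) R" unfolding seq_ideal_def by (rule genideal_ideal)
  moreover have "\<exists>w\<in>FB (B (k + 1)) \<inter> FB (X (Suc 0)). d w = z"
    by (rule filtration_exact[OF assms(1) z assms(3)]) (rule assms(2))
  ultimately show ?thesis using X_red_kernel by blast
qed

end

end

end

section \<open>Reduction of a semifree resolution\<close>

text \<open>The map that sets the exterior variables of \<open>D\<close> to zero and applies
  \<open>p\<close> to the coefficients.\<close>

definition slice_reduce ::
  "nat set \<Rightarrow> ('t, 'y) ring_scheme \<Rightarrow> ('s \<Rightarrow> 't) \<Rightarrow> ('x \<times> nat set \<Rightarrow> 's) \<Rightarrow> 'x \<times> nat set \<Rightarrow> 't" where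
  "slice_reduce D T p u = (\<lambda>(x, J). if J \<inter> D = {} then p (u (x, J)) else \<zero>\<^bsub>T\<^esub>)"

lemma reduce_slice_reduce:
  "q \<zero>\<^bsub>T\<^esub> = \<zero>\<^bsub>T'\<^esub> \<Longrightarrow> reduce q (slice_reduce D T p u) = slice_reduce D T' (\<lambda>x. q (p x)) u"
  by (auto simp: reduce_def slice_reduce_def)

definition slice_basis ::
  "nat set \<Rightarrow> (int \<Rightarrow> ('x \<times> nat set) set) \<Rightarrow> int \<Rightarrow> ('x \<times> nat set) set" where
  "slice_basis D B k = {(x, J) \<in> B k. J \<inter> D = {}}"

context cring
begin

context
  fixes T :: "('t, 'y) ring_scheme" and p :: "'a \<Rightarrow> 't" and D :: "nat set"
    and B :: "int \<Rightarrow> ('x \<times> nat set) set"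
  assumes T: "cring T" and p: "p \<in> ring_hom R T" and p_surj: "p ` carrier R = carrier T"
begin

private lemmas p0 = ring_hom_zero'[OF cring_axioms T p]

lemma slice_reduce_hom:
  "slice_reduce D T p \<in> mod_hom R (free_module R (B k)) (restrict_scalars p (free_module T (slice_basis D B k)))"
proof (rule mod_homI)
  interpret T: cring T by (rule T)
  note c = free_module_coeff[OF cring_axioms]
  fix u assume u: "u \<in> FB (B k)"
  have "{b. slice_reduce D T p u b \<noteq> \<zero>\<^bsub>T\<^esub>} \<subseteq> {b. u b \<noteq> \<zero>}"
    by (auto simp: slice_reduce_def p0 split: if_splits)
  with u have "finite {b. slice_reduce D T p u b \<noteq> \<zero>\<^bsub>T\<^esub>}"
    by (auto simp: free_module_carrier intro: finite_subset)
  moreover have "slice_reduce D T p u b \<in> carrier T" for b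
    using ring_hom_closed[OF p c[OF u]] by (auto simp: slice_reduce_def split: prod.split)
  moreover have "slice_reduce D T p u b = \<zero>\<^bsub>T\<^esub>" if "b \<notin> slice_basis D B k" for b
    using that u p0 by (cases b) (auto simp: slice_reduce_def slice_basis_def free_module_carrier)
  ultimately show "slice_reduce D T p u \<in> carrier (restrict_scalars p (free_module T (slice_basis D B k)))"
    by (simp add: free_module_carrier)
  show "slice_reduce D T p (u \<oplus>\<^bsub>free_module R (B k)\<^esub> v) =
      slice_reduce D T p u \<oplus>\<^bsub>restrict_scalars p (free_module T (slice_basis D B k))\<^esub> slice_reduce D T p v"
    if "v \<in> FB (B k)" for v
    using c[OF u] c[OF that] by (auto simp: slice_reduce_def ring_hom_add[OF p])
  show "slice_reduce D T p (s \<odot>\<^bsub>free_module R (B k)\<^esub> u) =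
      s \<odot>\<^bsub>restrict_scalars p (free_module T (slice_basis D B k))\<^esub> slice_reduce D T p u"
    if "s \<in> carrier R" for s
    using c[OF u] that T.r_null[OF ring_hom_closed[OF p that]]
    by (auto simp: slice_reduce_def ring_hom_mult[OF p])
qed

lemma slice_reduce_surj:
  "slice_reduce D T p ` FB (B k) = carrier (free_module T (slice_basis D B k))"
proof
  show "slice_reduce D T p ` FB (B k) \<subseteq> carrier (free_module T (slice_basis D B k))"
    using mod_hom_closed[OF slice_reduce_hom] by fastforce
  show "carrier (free_module T (slice_basis D B k)) \<subseteq> slice_reduce D T p ` FB (B k)"
  proof
    fix v assume v: "v \<in> carrier (free_module T (slice_basis D B k))"
    then obtain u where u: "u \<in> FB (slice_basis D B k)" "v = reduce p u"
      using reduce_surj[OF cring_axioms T p p_surj] by blast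
    have "u \<in> FB (B k)"
      using u(1) free_module_coeff[OF cring_axioms u(1)] by (auto simp: free_module_carrier slice_basis_def)
    moreover have "slice_reduce D T p u = v"
      using u(1) p0 by (auto simp: u(2) slice_reduce_def reduce_def free_module_carrier slice_basis_def fun_eq_iff)
    ultimately show "v \<in> slice_reduce D T p ` FB (B k)" by blast
  qed
qed

lemma slice_reduce_eq_0:
  assumes u: "u \<in> FB (B k)"
  shows "slice_reduce D T p u = (\<lambda>_. \<zero>\<^bsub>T\<^esub>) \<longleftrightarrow> u \<in> red_kernel D (a_kernel R T p)"
  using free_module_coeff[OF cring_axioms u]
  by (auto simp: slice_reduce_def red_kernel_def a_kernel_def' fun_eq_iff)

end

context
  fixes E D :: "nat set" and B :: "int \<Rightarrow> ('x \<times> nat set) set" and M :: "('a, 'm) module" and aug c d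
    and T :: "('t, 'y) ring_scheme" and p :: "'a \<Rightarrow> 't"
  assumes res: "dg_res E B M aug c d" and E: "finite E" and D: "D \<subseteq> E"
    and c: "\<And>t. t \<in> E \<Longrightarrow> c t \<in> carrier R"
    and T: "cring T" and p: "p \<in> ring_hom R T" and p_surj: "p ` carrier R = carrier T"
    and pc: "\<And>t. t \<in> D \<Longrightarrow> p (c t) = \<zero>\<^bsub>T\<^esub>"
begin

private abbreviation (input) "sr \<equiv> slice_reduce D T p"
private abbreviation (input) "Y \<equiv> slice_basis D B"
private lemmas rr = dg_resD[OF res]
private lemmas sr_hom = slice_reduce_hom[OF T p p_surj]
private lemmas sr_surj = slice_reduce_surj[OF T p p_surj]

private lemma mR: "module R (restrict_scalars p (free_module T X))"
  by (rule restrict_scalars_module[OF cring_axioms p module_free_module[OF T]])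

private lemma sr_factor:
  assumes C: "module R C" and h: "h \<in> mod_hom R (free_module R (B k)) C"
    and 0: "\<And>u. u \<in> FB (B k) \<Longrightarrow> sr u = (\<lambda>_. \<zero>\<^bsub>T\<^esub>) \<Longrightarrow> h u = \<zero>\<^bsub>C\<^esub>"
  obtains g where "g \<in> mod_hom R (restrict_scalars p (free_module T (Y k))) C"
    "\<And>u. u \<in> FB (B k) \<Longrightarrow> g (sr u) = h u"
proof (rule factor_through_surj[OF module_free_module[OF cring_axioms] mR C sr_hom[of D B k] _ h])
  show "sr ` FB (B k) = carrier (restrict_scalars p (free_module T (Y k)))" using sr_surj by simp
  show "h u = \<zero>\<^bsub>C\<^esub>" if "u \<in> FB (B k)" "sr u = \<zero>\<^bsub>restrict_scalars p (free_module T (Y k))\<^esub>" for u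
    using 0 that by simp
qed (rule that)

text \<open>The differential preserves the kernel of the reduction and so descends to the quotient.
  The elements c_t with \<open>t\<close> in \<open>D\<close> must become zero in \<open>T\<close>,
  as the variables with these boundaries are set to zero.\<close>

lemma reduction_complex:
  "\<exists>G. chain_complex T G \<and> (\<forall>k. cmod G k = free_module T (Y k)) \<and>
     (\<forall>k. \<forall>u\<in>FB (B k). cdiff G k (sr u) = sr (d u))"
proof -
  have "ring_hom_ring R T p" using ring_axioms T p by (simp add: cring.axioms ring_hom_ringI2)
  then have A: "ideal (a_kernel R T p) R" by (rule ring_hom_ring.kernel_is_ideal)
  have cA: "c ` D \<subseteq> a_kernel R T p" using c D pc by (auto simp: a_kernel_def')
  have "\<exists>g. g \<in> mod_hom T (free_module T (Y k)) (free_module T (Y (k - 1))) \<and>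
      (\<forall>u\<in>FB (B k). g (sr u) = sr (d u))" for k
  proof -
    have dk: "d \<in> mod_hom R (free_module R (B k)) (free_module R (B (k - 1)))"
      using FB_hom[OF rr(1,2)] rr(3) by (auto simp: mod_hom_def)
    have "sr (d u) = (\<lambda>_. \<zero>\<^bsub>T\<^esub>)" if "u \<in> FB (B k)" "sr u = (\<lambda>_. \<zero>\<^bsub>T\<^esub>)" for u
    proof -
      have "u \<in> red_kernel D (a_kernel R T p)"
        using that slice_reduce_eq_0[OF T p p_surj] by blast
      moreover have "u \<in> carrier (FU E)" using that(1) FB_iff[OF rr(1)] by blast
      ultimately have "d u \<in> red_kernel D (a_kernel R T p)"
        using red_kernel_diff[OF res E D c A cA] by blast
      then show ?thesis using slice_reduce_eq_0[OF T p p_surj, of "d u" B "k - 1" D] rr(3)[OF that(1)] by blast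
    qed
    then obtain g where g: "g \<in> mod_hom R (restrict_scalars p (free_module T (Y k)))
        (restrict_scalars p (free_module T (Y (k - 1))))"
      "\<And>u. u \<in> FB (B k) \<Longrightarrow> g (sr u) = sr (d u)"
      using sr_factor[OF mR mod_hom_comp[OF dk sr_hom[of D B "k - 1"]]] by auto
    show ?thesis using restrict_scalars_hom_surj[OF p_surj g(1)] g(2) by blast
  qed
  then have "\<forall>k. \<exists>g. g \<in> mod_hom T (free_module T (Y k)) (free_module T (Y (k - 1))) \<and>
      (\<forall>u\<in>FB (B k). g (sr u) = sr (d u))" by blast
  from choice[OF this] obtain g where g': "\<forall>k. g k \<in> mod_hom T (free_module T (Y k)) (free_module T (Y (k - 1))) \<and>
      (\<forall>u\<in>FB (B k). g k (sr u) = sr (d u))" ..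
  have g: "g k \<in> mod_hom T (free_module T (Y k)) (free_module T (Y (k - 1)))" for k
    by (rule conjunct1[OF spec[OF g', of k]])
  have gr: "g k (sr u) = sr (d u)" if "u \<in> FB (B k)" for k u
    by (rule bspec[OF conjunct2[OF spec[OF g', of k]] that])
  have "g (k - 1) (g k y) = (\<lambda>_. \<zero>\<^bsub>T\<^esub>)" if y: "y \<in> carrier (free_module T (Y k))" for k y
  proof -
    obtain u where u: "u \<in> FB (B k)" "y = sr u" using y sr_surj[of D B k] by blast
    have "g (k - 1) (g k y) = sr (d (d u))" unfolding u(2) gr[OF u(1)] gr[OF rr(3)[OF u(1)]] ..
    also have "\<dots> = (\<lambda>_. \<zero>\<^bsub>T\<^esub>)"
      using rr(4)[OF u(1)] ring_hom_zero'[OF cring_axioms T p] by (simp add: slice_reduce_def fun_eq_iff)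
    finally show ?thesis .
  qed
  then have "chain_complex T \<lparr>cmod = \<lambda>k. free_module T (Y k), cdiff = g\<rparr>"
    using g by (simp add: chain_complex_def module_free_module[OF T])
  then show ?thesis using gr by (intro exI[of _ "\<lparr>cmod = \<lambda>k. free_module T (Y k), cdiff = g\<rparr>"]) (simp del: free_module_simps)
qed

text \<open>The long exact sequence of homology in elements. A cycle of the quotient is lifted to
  \<open>u\<close>; \<open>d u\<close> is a cycle of the kernel, so equal to \<open>d v\<close> with
  \<open>v\<close> in the kernel; then \<open>u - v\<close> is a cycle of the resolution, hence a
  boundary, and it has the same reduction as \<open>u\<close>.\<close>

lemma reduction_free_res:
  assumes Dn: "D = {1..n}" and lt: "\<And>s t. s \<in> D \<Longrightarrow> t \<in> E - D \<Longrightarrow> s < t" and reg: "koszul_regular R n c"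
    and ker: "a_kernel R T p = seq_ideal R n c" and M': "module T M'" and MM': "M = restrict_scalars p M'"
    and G: "chain_complex T G" "\<And>k. cmod G k = free_module T (Y k)"
      "\<And>k u. u \<in> FB (B k) \<Longrightarrow> cdiff G k (sr u) = sr (d u)"
  shows "\<exists>\<eta>. free_res T M' G Y \<eta>"
proof -
  have M: "module R M" unfolding MM' by (rule restrict_scalars_module[OF cring_axioms p M'])
  interpret F: module R "FU E" by (rule FU_module)
  have exact: "\<exists>w\<in>FB (B (k + 1)) \<inter> red_kernel D (seq_ideal R n c). d w = z"
    if "z \<in> FB (B k)" "z \<in> red_kernel D (seq_ideal R n c)" "d z = (\<lambda>_. \<zero>)" for z k
    by (rule red_kernel_exact[OF res E D c Dn lt reg that])
  have ker_iff: "sr u = (\<lambda>_. \<zero>\<^bsub>T\<^esub>) \<longleftrightarrow> u \<in> red_kernel D (seq_ideal R n c)" if "u \<in> FB (B k)" for u k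
    using slice_reduce_eq_0[OF T p p_surj, of u B k D] that unfolding ker by blast
  have d0: "d u = (\<lambda>_. \<zero>)" if "u \<in> FB (B 0)" for u
    using rr(3)[OF that] graded_basisD(1)[OF rr(1), of "- 1"] by (auto simp: free_module_carrier)
  \<comment> \<open>An element of the kernel in degree 0 is a cycle, hence a boundary, so
    \<open>aug\<close> kills it. This lets \<open>aug\<close> descend.\<close>
  have "aug u = \<zero>\<^bsub>M\<^esub>" if "u \<in> FB (B 0)" "sr u = (\<lambda>_. \<zero>\<^bsub>T\<^esub>)" for u
    using exact[OF that(1) _ d0[OF that(1)]] that ker_iff[OF that(1)] rr(9)[OF that(1)] by auto
  then obtain \<eta> where \<eta>: "\<eta> \<in> mod_hom R (restrict_scalars p (free_module T (Y 0))) M"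
    "\<And>u. u \<in> FB (B 0) \<Longrightarrow> \<eta> (sr u) = aug u"
    using sr_factor[OF M rr(7)] by blast
  have \<eta>T: "\<eta> \<in> mod_hom T (free_module T (Y 0)) M'"
    using restrict_scalars_hom_surj[OF p_surj] \<eta>(1) unfolding MM' by blast
  have "\<eta> ` carrier (free_module T (Y 0)) = aug ` FB (B 0)"
    unfolding sr_surj[of D B 0, symmetric] image_image using \<eta>(2) by simp
  also have "\<dots> = carrier M'" using rr(8) MM' by simp
  finally have surj: "\<eta> ` carrier (free_module T (Y 0)) = carrier M'" .
  have bd: "sr u \<in> boundaries G k \<longleftrightarrow> (\<exists>w\<in>FB (B (k + 1)). sr u = sr (d w))" for u k
    unfolding boundaries_iff G(2) sr_surj[of D B "k + 1", symmetric] using G(3)[of _ "k + 1"] by auto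
  have sr_diff: "sr (u \<ominus>\<^bsub>FU E\<^esub> v) = (\<lambda>_. \<zero>\<^bsub>T\<^esub>) \<longleftrightarrow> sr u = sr v" if "u \<in> FB (B k)" "v \<in> FB (B k)" for u v k
  proof -
    \<comment> \<open>The difference is formed in the ungraded module. The constant family presents
      that module as a graded piece, to which linearity of the reduction applies.\<close>
    let ?U = "\<lambda>_ :: int. UNIV \<times> Pow E :: ('x \<times> nat set) set"
    interpret N: module T "free_module T (slice_basis D ?U 0)" by (rule module_free_module[OF T])
    have uv: "u \<in> carrier (FU E)" "v \<in> carrier (FU E)" using that FB_iff[OF rr(1)] by blast+
    note h = sr_hom[of D ?U 0]
    have c: "sr u \<in> carrier (free_module T (slice_basis D ?U 0))" "sr v \<in> carrier (free_module T (slice_basis D ?U 0))"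
      using mod_hom_closed[OF h] uv by simp_all
    have "sr (u \<ominus>\<^bsub>FU E\<^esub> v) = sr u \<ominus>\<^bsub>free_module T (slice_basis D ?U 0)\<^esub> sr v"
      using mod_hom_diff[OF F.module_axioms mR h uv] by simp
    then show ?thesis using N.M.minus_eq_zero_iff[OF c] by simp
  qed
  have cyc: "x \<in> boundaries G k" if k: "k > 0" and x: "x \<in> cycles G k" for k x
  proof -
    obtain u where u: "u \<in> FB (B k)" "x = sr u"
      using x sr_surj[of D B k, symmetric] unfolding cycles_iff G(2) by auto
    have "sr (d u) = (\<lambda>_. \<zero>\<^bsub>T\<^esub>)" using x u(1) G(3) unfolding cycles_iff G(2) u(2) by simp
    then have "d u \<in> red_kernel D (seq_ideal R n c)" using ker_iff[OF rr(3)[OF u(1)]] by blast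
    then obtain v where v: "v \<in> FB (B k)" "v \<in> red_kernel D (seq_ideal R n c)" "d v = d u"
      using exact[OF rr(3)[OF u(1)] _ rr(4)[OF u(1)]] by auto
    have uv: "u \<in> carrier (FU E)" "v \<in> carrier (FU E)" using u(1) v(1) FB_iff[OF rr(1)] by blast+
    have uvB: "u \<ominus>\<^bsub>FU E\<^esub> v \<in> FB (B k)"
      by (rule submodule_diff[OF F.module_axioms FB_submodule[OF rr(1)] u(1) v(1)])
    have "d (u \<ominus>\<^bsub>FU E\<^esub> v) = d u \<ominus>\<^bsub>FU E\<^esub> d v"
      by (rule mod_hom_diff[OF F.module_axioms F.module_axioms rr(2) uv])
    also have "\<dots> = (\<lambda>_. \<zero>)"
      unfolding v(3) a_minus_def using F.M.r_neg[OF mod_hom_closed[OF rr(2) uv(1)]] by simp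
    finally obtain w where w: "w \<in> FB (B (k + 1))" "d w = u \<ominus>\<^bsub>FU E\<^esub> v"
      using rr(6)[OF k uvB] by blast
    have dw: "d w \<in> FB (B k)" using rr(3)[OF w(1)] by simp
    have "u \<ominus>\<^bsub>FU E\<^esub> d w = v"
      unfolding w(2) using uv F.M.r_neg1[OF uv]
      by (simp only: a_minus_def F.M.minus_add F.M.minus_minus F.M.a_inv_closed F.M.r_neg F.M.l_zero F.M.a_assoc[symmetric])
    then have "sr u = sr (d w)"
      using sr_diff[OF u(1) dw] ker_iff[OF v(1)] v(2) by simp
    then show ?thesis using w(1) bd u(2) by blast
  qed
  have "\<eta> x = \<zero>\<^bsub>M'\<^esub> \<longleftrightarrow> x \<in> boundaries G 0" if x: "x \<in> carrier (free_module T (Y 0))" for x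
  proof -
    obtain u where u: "u \<in> FB (B 0)" "x = sr u" using x sr_surj[of D B 0] by blast
    have "\<eta> x = \<zero>\<^bsub>M'\<^esub> \<longleftrightarrow> aug u = \<zero>\<^bsub>M\<^esub>" using u \<eta>(2) MM' by simp
    also have "\<dots> \<longleftrightarrow> x \<in> boundaries G 0"
    proof
      assume "aug u = \<zero>\<^bsub>M\<^esub>"
      then show "x \<in> boundaries G 0" using rr(9)[OF u(1)] bd[of u 0] u(2) by auto
    next
      assume "x \<in> boundaries G 0"
      then obtain w where w: "w \<in> FB (B 1)" "sr u = sr (d w)" using bd[of u 0] u(2) by auto
      have dw: "d w \<in> FB (B 0)" using rr(3)[OF w(1)] by simp
      have "aug u = \<eta> (sr u)" using \<eta>(2) u(1) by simp
      also have "\<dots> = aug (d w)" using w(2) \<eta>(2) dw by simp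
      also have "\<dots> = \<zero>\<^bsub>M\<^esub>" using rr(9)[OF dw] w(1) by blast
      finally show "aug u = \<zero>\<^bsub>M\<^esub>" .
    qed
    finally show ?thesis .
  qed
  moreover have "\<forall>k<0. Y k = {}" using graded_basisD(1)[OF rr(1)] by (simp add: slice_basis_def)
  ultimately show ?thesis
    unfolding free_res_def using G(1,2) cyc \<eta>T surj by (intro exI[of _ \<eta>]) auto
qed

end

end

section \<open>Quotients of a commutative ring\<close>

text \<open>The folding relation only sees the values on \<open>A\<close>, so the products agree in
  any structure, whether or not the values lie in the carrier. This generality is wanted because the
  Koszul differential is compared as a function on all arguments.\<close>

lemma finprod_cong_any:
  fixes f g :: "'a \<Rightarrow> 'b" and G :: "('b, 'c) monoid_scheme"
  assumes "\<And>a. a \<in> A \<Longrightarrow> f a = g a"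
  shows "finprod G f A = finprod G g A"
proof -
  have *: "(B, x) \<in> foldSetD D h e \<Longrightarrow> (\<And>a. a \<in> B \<Longrightarrow> h a = k a) \<Longrightarrow> (B, x) \<in> foldSetD D k e"
    for B x D e and h k :: "'a \<Rightarrow> 'b \<Rightarrow> 'b"
    by (induction rule: foldSetD.induct) (auto intro!: foldSetD.intros)
  have "(A, x) \<in> foldSetD (carrier G) (mult G \<circ> f) \<one>\<^bsub>G\<^esub> \<longleftrightarrow>
      (A, x) \<in> foldSetD (carrier G) (mult G \<circ> g) \<one>\<^bsub>G\<^esub>" for x
    using *[of A x _ "mult G \<circ> f" _ "mult G \<circ> g"] *[of A x _ "mult G \<circ> g" _ "mult G \<circ> f"] assms by auto
  then show ?thesis by (simp add: finprod_def foldD_def)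
qed

lemma koszul_complex_cong:
  assumes "\<And>i. i \<in> {1..n} \<Longrightarrow> f i = g i"
  shows "koszul_complex Q n f = koszul_complex Q n g"
  unfolding koszul_complex_def finsum_def
  by (intro arg_cong2[of _ _ _ _ cplx.make] cplx.equality) (use assms in \<open>auto intro!: ext finprod_cong_any\<close>)

lemma seq_ideal_cong: "(\<And>i. i \<in> {1..n} \<Longrightarrow> f i = g i) \<Longrightarrow> seq_ideal Q n f = seq_ideal Q n g"
  unfolding seq_ideal_def by (metis image_cong)

text \<open>Only the entries with index 1 to n enter. The families used later carry the annihilating
  elements at larger indices.\<close>

lemma koszul_regular_cong:
  assumes "\<And>i. i \<in> {1..n} \<Longrightarrow> f i = g i" "koszul_regular Q n f"
  shows "koszul_regular Q n g"
proof -
  have "koszul_complex Q n f = koszul_complex Q n g" by (rule koszul_complex_cong) (rule assms(1))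
  moreover have "seq_ideal Q n f = seq_ideal Q n g" by (rule seq_ideal_cong) (rule assms(1))
  ultimately show ?thesis using assms(2) by (simp add: koszul_regular_def Pi_iff assms(1))
qed

lemma ideal_prod_mono: "A \<subseteq> A' \<Longrightarrow> x \<in> ideal_prod Q I A \<Longrightarrow> x \<in> ideal_prod Q I A'"
  by (rotate_tac, induction rule: ideal_prod.induct) (auto intro: ideal_prod.intros)

text \<open>An element is a finite sum of products, so finitely many second factors are enough.
  Hence finitely many exterior variables have to be added.\<close>

lemma ideal_prod_finite:
  assumes "x \<in> ideal_prod Q I A"
  shows "\<exists>F\<subseteq>A. finite F \<and> x \<in> ideal_prod Q I F"
  using assms
proof (induction rule: ideal_prod.induct)
  case (prod i j)
  then show ?case by (intro exI[of _ "{j}"]) (auto intro: ideal_prod.prod)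
next
  case (sum x y)
  then obtain F F' where "F \<subseteq> A" "finite F" "x \<in> ideal_prod Q I F" "F' \<subseteq> A" "finite F'" "y \<in> ideal_prod Q I F'"
    by blast
  then show ?case
    using ideal_prod_mono[of F "F \<union> F'" x Q I] ideal_prod_mono[of F' "F \<union> F'" y Q I]
    by (intro exI[of _ "F \<union> F'"]) (auto intro: ideal_prod.sum)
qed

lemma quot_map_hom:
  assumes "cring Q" "ideal J Q"
  shows "quot_map Q J \<in> ring_hom Q (Q Quot J)" "quot_map Q J ` carrier Q = carrier (Q Quot J)"
    "q \<in> carrier Q \<Longrightarrow> quot_map Q J q = \<zero>\<^bsub>Q Quot J\<^esub> \<longleftrightarrow> q \<in> J"
proof -
  interpret ideal J Q by fact
  show "quot_map Q J \<in> ring_hom Q (Q Quot J)" unfolding quot_map_def by (rule rcos_ring_hom)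
  show "quot_map Q J ` carrier Q = carrier (Q Quot J)"
    by (auto simp: quot_map_def FactRing_def A_RCOSETS_def')
  show "q \<in> carrier Q \<Longrightarrow> quot_map Q J q = \<zero>\<^bsub>Q Quot J\<^esub> \<longleftrightarrow> q \<in> J"
    using a_rcos_self[of q] a_rcos_const[of q] by (auto simp: quot_map_def FactRing_def)
qed

text \<open>I + (J + q) = I + q, since \<open>J\<close> is contained in \<open>I\<close> and
  contains zero.\<close>

lemma quot_quot_map_apply:
  assumes "cring Q" "ideal J Q" "ideal I Q" "J \<subseteq> I" "q \<in> carrier Q"
  shows "quot_quot_map Q I (quot_map Q J q) = quot_map Q I q"
proof -
  interpret cring Q by fact
  interpret J: ideal J Q by fact
  interpret I: ideal I Q by fact
  show ?thesis
  proof (intro equalityI subsetI)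
    fix x assume "x \<in> quot_quot_map Q I (quot_map Q J q)"
    then have "\<exists>i\<in>I. \<exists>j\<in>J. x = i \<oplus>\<^bsub>Q\<^esub> (j \<oplus>\<^bsub>Q\<^esub> q)"
      unfolding quot_quot_map_def quot_map_def set_add_def' a_r_coset_def' by blast
    then obtain i j where ij: "i \<in> I" "j \<in> J" "x = i \<oplus>\<^bsub>Q\<^esub> (j \<oplus>\<^bsub>Q\<^esub> q)" by blast
    have "x = (i \<oplus>\<^bsub>Q\<^esub> j) \<oplus>\<^bsub>Q\<^esub> q"
      unfolding ij(3) using a_assoc[OF I.Icarr[OF ij(1)] J.Icarr[OF ij(2)] assms(5)] ..
    moreover have "i \<oplus>\<^bsub>Q\<^esub> j \<in> I" using ij assms(4) by (intro I.a_closed) blast+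
    ultimately show "x \<in> quot_map Q I q" unfolding quot_map_def a_r_coset_def' by blast
  next
    fix x assume "x \<in> quot_map Q I q"
    then obtain i where i: "i \<in> I" "x = i \<oplus>\<^bsub>Q\<^esub> q" unfolding quot_map_def a_r_coset_def' by blast
    have "x = i \<oplus>\<^bsub>Q\<^esub> (\<zero>\<^bsub>Q\<^esub> \<oplus>\<^bsub>Q\<^esub> q)" unfolding i(2) l_zero[OF assms(5)] ..
    moreover have "\<zero>\<^bsub>Q\<^esub> \<oplus>\<^bsub>Q\<^esub> q \<in> quot_map Q J q"
      using J.zero_closed unfolding quot_map_def a_r_coset_def' by blast
    ultimately show "x \<in> quot_quot_map Q I (quot_map Q J q)"
      using i(1) unfolding quot_quot_map_def set_add_def' by blast
  qed
qed

lemma quot_quot_map_hom: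
  assumes "cring Q" "ideal J Q" "ideal I Q" "J \<subseteq> I"
  shows "quot_quot_map Q I \<in> ring_hom (Q Quot J) (Q Quot I)"
    "quot_quot_map Q I ` carrier (Q Quot J) = carrier (Q Quot I)"
proof -
  interpret cring Q by fact
  note J = quot_map_hom[OF assms(1,2)] and I = quot_map_hom[OF assms(1,3)]
  note q = quot_quot_map_apply[OF assms]
  show "quot_quot_map Q I \<in> ring_hom (Q Quot J) (Q Quot I)"
  proof (rule ring_hom_memI)
    fix x assume "x \<in> carrier (Q Quot J)"
    then obtain a where a: "a \<in> carrier Q" "x = quot_map Q J a" unfolding J(2)[symmetric] by blast
    show "quot_quot_map Q I x \<in> carrier (Q Quot I)" unfolding a(2) q[OF a(1)] I(2)[symmetric] using a(1) by blast
    fix y assume "y \<in> carrier (Q Quot J)"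
    then obtain b where b: "b \<in> carrier Q" "y = quot_map Q J b" unfolding J(2)[symmetric] by blast
    show "quot_quot_map Q I (x \<otimes>\<^bsub>Q Quot J\<^esub> y) = quot_quot_map Q I x \<otimes>\<^bsub>Q Quot I\<^esub> quot_quot_map Q I y"
      using a b q ring_hom_mult[OF J(1), of a b, symmetric] ring_hom_mult[OF I(1), of a b] by simp
    show "quot_quot_map Q I (x \<oplus>\<^bsub>Q Quot J\<^esub> y) = quot_quot_map Q I x \<oplus>\<^bsub>Q Quot I\<^esub> quot_quot_map Q I y"
      using a b q ring_hom_add[OF J(1), of a b, symmetric] ring_hom_add[OF I(1), of a b] by simp
  next
    show "quot_quot_map Q I \<one>\<^bsub>Q Quot J\<^esub> = \<one>\<^bsub>Q Quot I\<^esub>"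
      using q[OF one_closed] ring_hom_one[OF J(1)] ring_hom_one[OF I(1)] by simp
  qed
  show "quot_quot_map Q I ` carrier (Q Quot J) = carrier (Q Quot I)"
    unfolding J(2)[symmetric] I(2)[symmetric] image_image using q by simp
qed

section \<open>Ext and Tor over the quotient by a Koszul-regular sequence\<close>

text \<open>Over Q/(c) the canonical resolution is exchanged for the reduction of the semifree one,
  and then base change leads to \<open>Q Quot I\<close>. The reduced complex \<open>G'\<close> over
  \<open>Q Quot I\<close> is a parameter, so that the same complex can be supplied for both
  sequences.\<close>

lemma Ext_Tor_reduction:
  fixes Q :: "'q ring" and B :: "int \<Rightarrow> ('x \<times> nat set) set"
    and M :: "('q set, 'm) module" and N :: "('q set, 'n) cplx"
    and I :: "'q set" and n :: nat and c :: "nat \<Rightarrow> 'q"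
  defines "S \<equiv> Q Quot seq_ideal Q n c" and "q \<equiv> quot_quot_map Q I"
  assumes Q: "cring Q" and reg: "koszul_regular Q n c" and I: "ideal I Q" and cI: "c ` {1..n} \<subseteq> I"
    and M: "module (Q Quot I) M" and N: "chain_complex (Q Quot I) N"
    and res: "cring.dg_res Q E B (restrict_scalars (quot_map Q I) M) aug c d"
    and E: "finite E" and D: "D \<subseteq> E" and Dn: "D = {1..n}"
    and lt: "\<And>s t. s \<in> D \<Longrightarrow> t \<in> E - D \<Longrightarrow> s < t" and c: "\<And>t. t \<in> E \<Longrightarrow> c t \<in> carrier Q"
    and G': "chain_complex (Q Quot I) G'" "\<And>k. cmod G' k = free_module (Q Quot I) (slice_basis D B k)"
      "\<And>k u. u \<in> carrier (free_module Q (B k)) \<Longrightarrow> cdiff G' k (slice_reduce D (Q Quot I) (quot_map Q I) u) =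
        slice_reduce D (Q Quot I) (quot_map Q I) (d u)"
  shows "min_gens S (Ext_module S (restrict_scalars q M) (restrict_scalars_cplx q N) i) =
      min_gens (Q Quot I) (homology (hom_complex (Q Quot I) G' N) (- i))" (is ?Ext)
    and "min_gens S (Tor_module S (restrict_scalars q M) (restrict_scalars_cplx q N) i) =
      min_gens (Q Quot I) (homology (tensor_complex (Q Quot I) G' N) i)" (is ?Tor)
proof -
  interpret cring Q by (rule Q)
  interpret I: ideal I Q by (rule I)
  let ?J = "seq_ideal Q n c" and ?R = "Q Quot I"
  let ?p = "quot_map Q ?J" and ?pI = "quot_map Q I"
  have J: "ideal ?J Q" unfolding seq_ideal_def using cI I.Icarr by (intro genideal_ideal) blast
  interpret J: ideal ?J Q by (rule J)
  have JI: "?J \<subseteq> I" unfolding seq_ideal_def by (rule genideal_minimal[OF I cI])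
  have S: "cring S" unfolding S_def by (rule J.quotient_is_cring[OF Q])
  have R: "cring ?R" by (rule I.quotient_is_cring[OF Q])
  note p = quot_map_hom[OF Q J, folded S_def] and pI = quot_map_hom[OF Q I]
  note q = quot_quot_map_hom[OF Q J I JI, folded S_def q_def]
  have qp: "q (?p x) = ?pI x" if "x \<in> carrier Q" for x
    unfolding q_def by (rule quot_quot_map_apply[OF Q J I JI that])
  define M' where "M' = restrict_scalars q M"
  have M': "module S M'" unfolding M'_def by (rule restrict_scalars_module[OF S q(1) M])
  have N': "chain_complex S (restrict_scalars_cplx q N)"
    by (rule restrict_scalars_cplx_complex[OF S q(1) N])
  \<comment> \<open>The action of \<open>Q\<close> on \<open>M\<close> through the intermediate
    quotient agrees with the direct one only on the carrier of \<open>Q\<close>, so the two modules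
    are not equal as records and linearity of \<open>aug\<close> is checked again.\<close>
  have res': "dg_res E B (restrict_scalars ?p M') aug c d"
  proof -
    have "aug \<in> mod_hom Q (free_module Q (B 0)) (restrict_scalars ?p M')"
      using dg_resD(7)[OF res] by (auto simp: mod_hom_def M'_def qp)
    then show ?thesis using res unfolding dg_res_def by (simp add: M'_def)
  qed
  have ker: "a_kernel Q S ?p = ?J" using p(3) J.Icarr unfolding a_kernel_def' by blast
  have pc: "?p (c t) = \<zero>\<^bsub>S\<^esub>" if "t \<in> D" for t
    using p(3)[of "c t"] c D that genideal_self[of "c ` {1..n}"] cI I.Icarr Dn
    unfolding seq_ideal_def by blast
  have "\<exists>G. chain_complex S G \<and> (\<forall>k. cmod G k = free_module S (slice_basis D B k)) \<and>
     (\<forall>k. \<forall>u\<in>carrier (free_module Q (B k)). cdiff G k (slice_reduce D S ?p u) = slice_reduce D S ?p (d u))"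
    by (rule reduction_complex[OF res' E D _ S p(1,2)]) (fact c, fact pc)
  then obtain G where G: "chain_complex S G" "\<And>k. cmod G k = free_module S (slice_basis D B k)"
    "\<And>k u. u \<in> carrier (free_module Q (B k)) \<Longrightarrow> cdiff G k (slice_reduce D S ?p u) = slice_reduce D S ?p (d u)"
    by blast
  have "\<exists>\<eta>. free_res S M' G (slice_basis D B) \<eta>"
    by (rule reduction_free_res[OF res' E D _ S p(1,2) _ Dn _ reg ker M' refl G(1,2)]) (fact c, fact pc, fact lt, fact G(3))
  then obtain \<eta> where \<eta>: "free_res S M' G (slice_basis D B) \<eta>" ..
  \<comment> \<open>Reducing first to \<open>S\<close> and then to \<open>Q Quot I\<close> is the
    direct reduction; each element of \<open>G\<close> is lifted to \<open>Q\<close> to see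
    this.\<close>
  have G'G: "cdiff G' k (reduce q v) = reduce q (cdiff G k v)" if v: "v \<in> carrier (cmod G k)" for k v
  proof -
    have q0: "q \<zero>\<^bsub>S\<^esub> = \<zero>\<^bsub>?R\<^esub>" by (rule ring_hom_zero'[OF S R q(1)])
    have red: "reduce q (slice_reduce D S ?p w) = slice_reduce D ?R ?pI w"
      if "w \<in> carrier (free_module Q (B k))" for w k
      unfolding reduce_slice_reduce[of q, OF q0]
      using qp free_module_coeff[OF Q that] by (auto simp: slice_reduce_def fun_eq_iff)
    obtain u where u: "u \<in> carrier (free_module Q (B k))" "v = slice_reduce D S ?p u"
      using v slice_reduce_surj[OF S p(1,2), of D B k] unfolding G(2) by blast
    have "cdiff G' k (reduce q v) = slice_reduce D ?R ?pI (d u)"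
      unfolding u(2) red[OF u(1)] by (rule G'(3)[OF u(1)])
    also have "\<dots> = reduce q (cdiff G k v)"
      unfolding u(2) G(3)[OF u(1)] by (rule red[OF dg_resD(3)[OF res u(1)], symmetric])
    finally show ?thesis .
  qed
  note fr = free_resolution_free_res[OF M']
  note bc = S R q G(1,2) G'(1,2) G'G N
  show ?Ext
    unfolding Ext_module_def M'_def[symmetric] min_gens_Ext_eq[OF fr \<eta> M' N']
    by (rule min_gens_hom_base_change[symmetric, OF bc])
  show ?Tor
    unfolding Tor_module_def M'_def[symmetric] min_gens_Tor_eq[OF fr \<eta> M' N']
    by (rule min_gens_tensor_base_change[OF bc])
qed

theorem corollary5p9:
  fixes Q :: "'q ring" and n :: nat and f f' :: "nat \<Rightarrow> 'q" and I :: "'q set"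
    and M :: "('q set, 'm) module" and N :: "('q set, 'n) cplx"
  assumes "local_ring Q"
    and "koszul_regular Q n f" and "koszul_regular Q n f'"
    and "ideal I Q"
    and "\<forall>i\<in>{1..n}. f i \<in> I" and "\<forall>i\<in>{1..n}. f' i \<in> I"
    and "module (Q Quot I) M"
    and "\<forall>i\<in>{1..n}. f i \<ominus>\<^bsub>Q\<^esub> f' i \<in>
           ideal_prod Q I (annihilator Q (restrict_scalars (quot_map Q I) M))"
    and "chain_complex (Q Quot I) N"
  shows "bass_series (Q Quot seq_ideal Q n f)
           (restrict_scalars (quot_quot_map Q I) M)
           (restrict_scalars_cplx (quot_quot_map Q I) N) =
         bass_series (Q Quot seq_ideal Q n f')
           (restrict_scalars (quot_quot_map Q I) M)
           (restrict_scalars_cplx (quot_quot_map Q I) N) \<and>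
         poincare_series (Q Quot seq_ideal Q n f)
           (restrict_scalars (quot_quot_map Q I) M)
           (restrict_scalars_cplx (quot_quot_map Q I) N) =
         poincare_series (Q Quot seq_ideal Q n f')
           (restrict_scalars (quot_quot_map Q I) M)
           (restrict_scalars_cplx (quot_quot_map Q I) N)"
proof -
  have Q: "cring Q" using assms(1) by (simp add: local_ring_def)
  interpret cring Q by (rule Q)
  interpret I: ideal I Q by (rule assms(4))
  let ?R = "Q Quot I" and ?p = "quot_map Q I"
  let ?M = "restrict_scalars ?p M"
  have R: "cring ?R" by (rule I.quotient_is_cring[OF Q])
  note p = quot_map_hom[OF Q assms(4)]
  interpret M: module ?R M by (rule assms(7))
  have M: "module Q ?M" by (rule restrict_scalars_module[OF Q p(1) assms(7)])
  define D where "D = {1..n}"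
  have "\<exists>F. F \<subseteq> annihilator Q ?M \<and> finite F \<and> f i \<ominus>\<^bsub>Q\<^esub> f' i \<in> ideal_prod Q I F" if "i \<in> D" for i
    by (rule ideal_prod_finite) (use assms(8) that in \<open>simp add: D_def\<close>)
  then have "\<forall>i\<in>D. \<exists>F. F \<subseteq> annihilator Q ?M \<and> finite F \<and> f i \<ominus>\<^bsub>Q\<^esub> f' i \<in> ideal_prod Q I F" by blast
  from bchoice[OF this] obtain F where
    F': "\<forall>i\<in>D. F i \<subseteq> annihilator Q ?M \<and> finite (F i) \<and> f i \<ominus>\<^bsub>Q\<^esub> f' i \<in> ideal_prod Q I (F i)" ..
  have F: "F i \<subseteq> annihilator Q ?M" "finite (F i)" "f i \<ominus>\<^bsub>Q\<^esub> f' i \<in> ideal_prod Q I (F i)" if "i \<in> D" for i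
    using bspec[OF F' that] by simp_all
  let ?F = "\<Union>i\<in>D. F i"
  have "finite ?F" using F(2) by (simp add: D_def)
  then obtain h where h: "bij_betw h {0..<card ?F} ?F" using ex_bij_betw_nat_finite by blast
  define E where "E = {1..n + card ?F}"
  \<comment> \<open>The indices 1 to n carry f'. The next ones run through the chosen elements of
    the annihilator, which \<open>h\<close> enumerates from 0; hence the shift by
    \<open>Suc n\<close>. Placing them last gives the order that makes the Koszul signs
    agree.\<close>
  define c where "c t = (if t \<in> D then f' t else h (t - Suc n))" for t
  have DE: "D \<subseteq> E" by (auto simp: D_def E_def)
  have ED: "E - D = {Suc n..n + card ?F}" by (auto simp: D_def E_def)
  have lt: "s < t" if "s \<in> D" "t \<in> E - D" for s t using that(1) that(2)[unfolded ED] by (simp add: D_def)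
  have cT: "c ` (E - D) = ?F"
  proof -
    have "(\<lambda>t. t - Suc n) ` (E - D) = {0..<card ?F}"
      unfolding ED by (auto simp: image_iff intro!: bexI[of _ "_ + Suc n"])
    then have "h ` (\<lambda>t. t - Suc n) ` (E - D) = ?F" using h by (simp add: bij_betw_def)
    then show ?thesis unfolding image_image c_def by simp
  qed
  have E: "finite E" by (simp add: E_def)
  have fI: "f i \<in> I" "f' i \<in> I" if "i \<in> D" for i using assms(5,6) that by (auto simp: D_def)
  \<comment> \<open>The f'_i annihilate \<open>M\<close> because they lie in \<open>I\<close>, the
    other elements by their choice.\<close>
  have ann: "c t \<in> carrier Q \<and> (\<forall>m\<in>carrier M. ?p (c t) \<odot>\<^bsub>M\<^esub> m = \<zero>\<^bsub>M\<^esub>)" if t: "t \<in> E" for t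
  proof (cases "t \<in> D")
    case True
    then have "c t \<in> I" using fI by (simp add: c_def)
    then show ?thesis using p(3)[of "c t"] I.Icarr by simp
  next
    case False
    then have "c t \<in> ?F" using cT t by blast
    then show ?thesis using F(1) by (auto simp: annihilator_def)
  qed
  then have c: "c t \<in> carrier Q" if "t \<in> E" for t using that by blast
  have "\<exists>(B :: int \<Rightarrow> (('q, 'm) kgen \<times> nat set) set) aug d. dg_res E B ?M aug c d"
    by (rule ex_dg_res[OF E _ M]) (use ann in auto)
  then obtain B :: "int \<Rightarrow> (('q, 'm) kgen \<times> nat set) set" and aug d where res: "dg_res E B ?M aug c d" by blast
  define x where "x i = f i \<ominus>\<^bsub>Q\<^esub> f' i" for i
  define g where "g i = (if i \<in> D then c i \<oplus>\<^bsub>Q\<^esub> x i else c i)" for i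
  have xT: "x i \<in> ideal_prod Q I (c ` (E - D))" if "i \<in> D" for i
    unfolding cT x_def by (rule ideal_prod_mono[OF _ F(3)[OF that]]) (use that in blast)
  have "\<exists>d'. dg_res E B ?M aug (\<lambda>i. if i \<in> D then c i \<oplus>\<^bsub>Q\<^esub> x i else c i) d' \<and>
      (\<forall>u\<in>carrier (FU E). \<forall>b. d' u b \<ominus>\<^bsub>Q\<^esub> d u b \<in> I)"
    by (rule dg_res_change[OF E M assms(4) DE _ _ _ _ res, of "E - D" x]) (use xT c in auto)
  then obtain d' where d': "dg_res E B ?M aug g d'"
    "\<And>u b. u \<in> carrier (FU E) \<Longrightarrow> d' u b \<ominus>\<^bsub>Q\<^esub> d u b \<in> I" unfolding g_def[abs_def] by blast
  \<comment> \<open>On \<open>D\<close> the new family is f'_i + (f_i - f'_i).\<close>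
  have gf: "g i = f i" if "i \<in> {1..n}" for i
    using that fI[of i] I.Icarr unfolding g_def c_def x_def D_def[symmetric]
    by (simp add: minus_eq a_lcomm r_neg)
  have cf: "c i = f' i" if "i \<in> {1..n}" for i using that by (simp add: c_def D_def)
  have gc: "g t \<in> carrier Q" if t: "t \<in> E" for t
    using gf[of t] fI(1)[of t] I.Icarr c[OF t] unfolding D_def[symmetric] by (cases "t \<in> D") (auto simp: g_def)
  have pc: "?p (c t) = \<zero>\<^bsub>?R\<^esub>" if "t \<in> D" for t
    using that fI p(3)[of "c t"] I.Icarr by (simp add: c_def)
  have "\<exists>G. chain_complex ?R G \<and> (\<forall>k. cmod G k = free_module ?R (slice_basis D B k)) \<and>
     (\<forall>k. \<forall>u\<in>carrier (free_module Q (B k)). cdiff G k (slice_reduce D ?R ?p u) = slice_reduce D ?R ?p (d u))"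
    by (rule reduction_complex[OF res E DE _ R p(1,2)]) (fact c, fact pc)
  then obtain G where G: "chain_complex ?R G" "\<And>k. cmod G k = free_module ?R (slice_basis D B k)"
    "\<And>k u. u \<in> carrier (free_module Q (B k)) \<Longrightarrow> cdiff G k (slice_reduce D ?R ?p u) = slice_reduce D ?R ?p (d u)"
    by blast
  \<comment> \<open>\<open>d'\<close> and \<open>d\<close> agree modulo \<open>I\<close>, so the
    complex obtained from \<open>d\<close> is also the reduction of \<open>d'\<close>. This one
    complex over \<open>Q Quot I\<close> links the two sequences.\<close>
  have G': "cdiff G k (slice_reduce D ?R ?p u) = slice_reduce D ?R ?p (d' u)"
    if u: "u \<in> carrier (free_module Q (B k))" for k u
  proof -
    have uF: "u \<in> carrier (FU E)" using u FB_iff[OF dg_resD(1)[OF res]] by blast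
    have "?p (d' u b) = ?p (d u b)" for b
    proof -
      have cl: "d u b \<in> carrier Q" "d' u b \<in> carrier Q"
        using FU_coeff[OF mod_hom_closed[OF dg_resD(2)[OF res] uF]]
          FU_coeff[OF mod_hom_closed[OF dg_resD(2)[OF d'(1)] uF]] by auto
      have "?p (d' u b) = ?p (d' u b \<ominus>\<^bsub>Q\<^esub> d u b \<oplus>\<^bsub>Q\<^esub> d u b)" using cl by (simp add: minus_eq a_assoc l_neg)
      also have "\<dots> = ?p (d' u b \<ominus>\<^bsub>Q\<^esub> d u b) \<oplus>\<^bsub>?R\<^esub> ?p (d u b)"
        using ring_hom_add[OF p(1)] cl by simp
      also have "\<dots> = ?p (d u b)"
        using p(3)[of "d' u b \<ominus>\<^bsub>Q\<^esub> d u b"] d'(2)[OF uF] cl ring_hom_closed[OF p(1) cl(1)]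
        by (simp add: cring.cring_simprules[OF R])
      finally show ?thesis .
    qed
    then show ?thesis unfolding G(3)[OF u] by (auto simp: slice_reduce_def fun_eq_iff)
  qed
  have r1: "koszul_regular Q n g" by (rule koszul_regular_cong[OF _ assms(2)]) (simp add: gf)
  have r2: "koszul_regular Q n c" by (rule koszul_regular_cong[OF _ assms(3)]) (simp add: cf)
  have i1: "g ` {1..n} \<subseteq> I" using gf assms(5) by auto
  have i2: "c ` {1..n} \<subseteq> I" using cf assms(6) by auto
  have s: "seq_ideal Q n g = seq_ideal Q n f" "seq_ideal Q n c = seq_ideal Q n f'"
    by (rule seq_ideal_cong, fact gf, rule seq_ideal_cong, fact cf)
  note e1 = Ext_Tor_reduction[OF Q r1 assms(4) i1 assms(7,9) d'(1) E DE D_def lt gc G(1,2) G', unfolded s]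
  note e2 = Ext_Tor_reduction[OF Q r2 assms(4) i2 assms(7,9) res E DE D_def lt c G, unfolded s]
  show ?thesis
    \<comment> \<open>Coefficientwise, both sides equal the number of generators of the same
      homology module over \<open>Q Quot I\<close>.\<close>
    unfolding bass_series_def poincare_series_def
    by (intro conjI arg_cong[of _ _ Abs_fps] HOL.ext) (simp_all only: e1 e2)
qed

end
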